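(* Let $\mathcal A$ be a unital C*-algebra containing unitaries $u_1,\dots,u_n$ such that $w_{cb}(u_1,\dots,u_n)<n$, and let $\mathcal S=\operatorname{span}\{1,u_1,\dots,u_n,u_1^*,\dots,u_n^*\}\subseteq\mathcal A$. If $\mathcal S$ has the lifting property (LP), then $\mathcal A$ cannot be embedded into $\mathcal R^\omega$, and $\mathcal A$ cannot be embedded into $\dfrac{\prod_{m\in\mathbb N}M_m(\mathbb C)}{\bigoplus_{m\in\mathbb N}M_m(\mathbb C)}$.
   Context: "Embedded" means via a unital injective (isometric) *-homomorphism. For $a$ in a unital C*-algebra, $w(a)=\sup\{|s(a)|:s\text{ a state}\}$ is the numerical radius. For elements $a_1,\dots,a_n$ of a C*-algebra, $w_k(a_1,\dots,a_n)=\sup\{w(U_1\otimes a_1+\cdots+U_n\otimes a_n):U_i\in M_k,\ \|U_i\|\le1\}$ and $w_{cb}(a_1,\dots,a_n)=\sup_{k\in\mathbb N}w_k(a_1,\dots,a_n)$. UCP means unital completely positive. An operator system $\mathcal S$ has the LP if for every unital C*-algebra $\mathcal B$, closed two-sided ideal $J\subseteq\mathcal B$ and UCP map $\phi:\mathcal S\to\mathcal B/J$ there is a UCP map $\psi:\mathcal S\to\mathcal B$ with $\pi\circ\psi=\phi$, where $\pi:\mathcal B\to\mathcal B/J$ is the quotient map. $\mathcal R$ is the hyperfinite $II_1$-factor with trace $\tau$, $\omega$ is a free ultrafilter on $\mathbb N$, and $\mathcal R^\omega=\ell^\infty(\mathbb N,\mathcal R)/\{(x_m):\lim_{m\to\omega}\tau(x_m^*x_m)=0\}$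 is its tracial ultrapower. $\prod_m M_m(\mathbb C)$ is the C*-algebra of bounded sequences and $\bigoplus_m M_m(\mathbb C)$ is the ideal of sequences converging to $0$ in norm. *)

theory Defs
  imports
    "HOL-Library.Extended_Real"
    "HOL-Library.FuncSet"
    "HOL-Library.Nonpos_Ints"
    "HOL-Algebra.Module"
    "HOL-Algebra.QuotRing"
    "HOL-Algebra.Subrings"
    "Jordan_Normal_Form.Schur_Decomposition"
begin

section \<open>Unital C*-algebras\<close>

text \<open>
  Algebras are carrier-based, extending the records of HOL-Algebra, because the argument needs
  algebras whose underlying sets are proper subsets of types (von Neumann algebras, quotients,
  bounded sequences).
\<close>

record 'a star_alg = "(complex, 'a) module" +
  adj :: "'a \<Rightarrow> 'a"

record 'a cstar = "'a star_alg" +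
  cnorm :: "'a \<Rightarrow> real"

definition complex_field :: "complex ring" where
  "complex_field = \<lparr>carrier = UNIV, monoid.mult = (*), one = 1, zero = 0, add = (+)\<rparr>"

locale unital_cstar_algebra = ring A + module complex_field A
  for A :: "('a, 'm) cstar_scheme" (structure) +
  assumes smult_mult_left:
      "\<lbrakk>x \<in> carrier A; y \<in> carrier A\<rbrakk> \<Longrightarrow> (c \<odot> x) \<otimes> y = c \<odot> (x \<otimes> y)"
    and smult_mult_right:
      "\<lbrakk>x \<in> carrier A; y \<in> carrier A\<rbrakk> \<Longrightarrow> x \<otimes> (c \<odot> y) = c \<odot> (x \<otimes> y)"
    and adj_closed: "x \<in> carrier A \<Longrightarrow> adj A x \<in> carrier A"
    and adj_adj: "x \<in> carrier A \<Longrightarrow> adj A (adj A x) = x"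
    and adj_add:
      "\<lbrakk>x \<in> carrier A; y \<in> carrier A\<rbrakk> \<Longrightarrow> adj A (x \<oplus> y) = adj A x \<oplus> adj A y"
    and adj_smult: "x \<in> carrier A \<Longrightarrow> adj A (c \<odot> x) = cnj c \<odot> adj A x"
    and adj_mult:
      "\<lbrakk>x \<in> carrier A; y \<in> carrier A\<rbrakk> \<Longrightarrow> adj A (x \<otimes> y) = adj A y \<otimes> adj A x"
    and cnorm_nonneg: "x \<in> carrier A \<Longrightarrow> 0 \<le> cnorm A x"
    and cnorm_eq_0_iff: "x \<in> carrier A \<Longrightarrow> cnorm A x = 0 \<longleftrightarrow> x = \<zero>"
    and cnorm_triangle:
      "\<lbrakk>x \<in> carrier A; y \<in> carrier A\<rbrakk> \<Longrightarrow> cnorm A (x \<oplus> y) \<le> cnorm A x + cnorm A y"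
    and cnorm_smult: "x \<in> carrier A \<Longrightarrow> cnorm A (c \<odot> x) = cmod c * cnorm A x"
    and cnorm_mult:
      "\<lbrakk>x \<in> carrier A; y \<in> carrier A\<rbrakk> \<Longrightarrow> cnorm A (x \<otimes> y) \<le> cnorm A x * cnorm A y"
    and cnorm_cstar: "x \<in> carrier A \<Longrightarrow> cnorm A (adj A x \<otimes> x) = (cnorm A x)\<^sup>2"
    and complete:
      "\<lbrakk>\<forall>i. f i \<in> carrier A;
        \<forall>e>0. \<exists>N. \<forall>i\<ge>N. \<forall>j\<ge>N. cnorm A (f i \<ominus> f j) < e\<rbrakk>
       \<Longrightarrow> \<exists>x\<in>carrier A. (\<lambda>i. cnorm A (f i \<ominus> x)) \<longlonglongrightarrow> 0"

definition unitaries :: "('a, 'm) star_alg_scheme \<Rightarrow> 'a set" where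
  "unitaries A = {u \<in> carrier A.
     adj A u \<otimes>\<^bsub>A\<^esub> u = \<one>\<^bsub>A\<^esub> \<and> u \<otimes>\<^bsub>A\<^esub> adj A u = \<one>\<^bsub>A\<^esub>}"

definition lin_span :: "('a, 'm) star_alg_scheme \<Rightarrow> 'a set \<Rightarrow> 'a set" where
  "lin_span A X = \<Inter> {W. Module.submodule W complex_field A \<and> X \<subseteq> W}"

definition linear_on ::
    "('a, 'm) star_alg_scheme \<Rightarrow> 'a set \<Rightarrow> ('b, 'n) star_alg_scheme \<Rightarrow> ('a \<Rightarrow> 'b) \<Rightarrow> bool" where
  "linear_on A S B f \<longleftrightarrow>
     (\<forall>x\<in>S. \<forall>y\<in>S. f (x \<oplus>\<^bsub>A\<^esub> y) = f x \<oplus>\<^bsub>B\<^esub> f y) \<and>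
     (\<forall>c. \<forall>x\<in>S. f (c \<odot>\<^bsub>A\<^esub> x) = c \<odot>\<^bsub>B\<^esub> f x)"

definition embeds :: "('a, 'm) star_alg_scheme \<Rightarrow> ('b, 'n) star_alg_scheme \<Rightarrow> bool" where
  "embeds A B \<longleftrightarrow> (\<exists>f \<in> Ring.ring_hom A B.
     (\<forall>c. \<forall>x\<in>carrier A. f (c \<odot>\<^bsub>A\<^esub> x) = c \<odot>\<^bsub>B\<^esub> f x) \<and>
     (\<forall>x\<in>carrier A. f (adj A x) = adj B (f x)) \<and>
     inj_on f (carrier A))"


section \<open>States, matrix amplifications and numerical radii\<close>

definition pos_cone :: "('a, 'm) star_alg_scheme \<Rightarrow> 'a set" where
  "pos_cone A = {adj A x \<otimes>\<^bsub>A\<^esub> x | x. x \<in> carrier A}"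

definition states :: "('a, 'm) star_alg_scheme \<Rightarrow> ('a \<Rightarrow> complex) set" where
  "states A = {s.
     (\<forall>x\<in>carrier A. \<forall>y\<in>carrier A. s (x \<oplus>\<^bsub>A\<^esub> y) = s x + s y) \<and>
     (\<forall>c. \<forall>x\<in>carrier A. s (c \<odot>\<^bsub>A\<^esub> x) = c * s x) \<and>
     s \<one>\<^bsub>A\<^esub> = 1 \<and> (\<forall>p\<in>pos_cone A. s p \<in> \<real>\<^sub>\<ge>\<^sub>0)}"

text \<open>
  The *-algebra \<open>M\<^sub>k(A)\<close>, identified with the tensor product of \<open>M\<^sub>k\<close> and \<open>A\<close>. Its C*-norm is
  omitted: it plays no role for positivity or for states.
\<close>

definition mat_alg :: "nat \<Rightarrow> ('a, 'm) star_alg_scheme \<Rightarrow> 'a mat star_alg" where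
  "mat_alg k A =
    \<lparr>carrier = {X \<in> carrier_mat k k. \<forall>i<k. \<forall>j<k. X $$ (i, j) \<in> carrier A},
     monoid.mult = (\<lambda>X Y. mat k k (\<lambda>(i, j). \<Oplus>\<^bsub>A\<^esub>l\<in>{..<k}. X $$ (i, l) \<otimes>\<^bsub>A\<^esub> Y $$ (l, j))),
     one = mat k k (\<lambda>(i, j). if i = j then \<one>\<^bsub>A\<^esub> else \<zero>\<^bsub>A\<^esub>),
     zero = mat k k (\<lambda>_. \<zero>\<^bsub>A\<^esub>),
     add = (\<lambda>X Y. mat k k (\<lambda>(i, j). X $$ (i, j) \<oplus>\<^bsub>A\<^esub> Y $$ (i, j))),
     module.smult = (\<lambda>c X. mat k k (\<lambda>(i, j). c \<odot>\<^bsub>A\<^esub> X $$ (i, j))),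
     adj = (\<lambda>X. mat k k (\<lambda>(i, j). adj A (X $$ (j, i))))\<rparr>"

definition elem_tensor :: "('a, 'm) star_alg_scheme \<Rightarrow> complex mat \<Rightarrow> 'a \<Rightarrow> 'a mat" where
  "elem_tensor A U a = map_mat (\<lambda>c. c \<odot>\<^bsub>A\<^esub> a) U"

definition euclid_norm :: "complex vec \<Rightarrow> real" where
  "euclid_norm v = sqrt (\<Sum>i<dim_vec v. (cmod (v $ i))\<^sup>2)"

definition op_norm :: "complex mat \<Rightarrow> real" where
  "op_norm U = (SUP v \<in> {v \<in> carrier_vec (dim_col U). euclid_norm v \<le> 1}. euclid_norm (U *\<^sub>v v))"

text \<open>Suprema are taken in \<^typ>\<open>ereal\<close>, where they are unconditionally meaningful.\<close>

definition num_radius :: "('a, 'm) star_alg_scheme \<Rightarrow> 'a \<Rightarrow> ereal" where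
  "num_radius A a = (SUP s \<in> states A. ereal (cmod (s a)))"

definition w_mat :: "('a, 'm) star_alg_scheme \<Rightarrow> nat \<Rightarrow> nat \<Rightarrow> (nat \<Rightarrow> 'a) \<Rightarrow> ereal" where
  "w_mat A k n a =
     (SUP U \<in> {U :: nat \<Rightarrow> complex mat. \<forall>i<n. U i \<in> carrier_mat k k \<and> op_norm (U i) \<le> 1}.
        num_radius (mat_alg k A) (\<Oplus>\<^bsub>mat_alg k A\<^esub>i\<in>{..<n}. elem_tensor A (U i) (a i)))"

definition w_cb :: "('a, 'm) star_alg_scheme \<Rightarrow> nat \<Rightarrow> (nat \<Rightarrow> 'a) \<Rightarrow> ereal" where
  "w_cb A n a = (SUP k \<in> {1..}. w_mat A k n a)"


section \<open>Quotients, UCP maps and the lifting property\<close>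

definition closed_ideal :: "'b set \<Rightarrow> ('b, 'm) cstar_scheme \<Rightarrow> bool" where
  "closed_ideal J B \<longleftrightarrow> ideal J B \<and>
     (\<forall>f. \<forall>x\<in>carrier B. (\<forall>i. f i \<in> J) \<and> (\<lambda>i. cnorm B (f i \<ominus>\<^bsub>B\<^esub> x)) \<longlonglongrightarrow> 0 \<longrightarrow> x \<in> J)"

definition cstar_quot :: "('b, 'm) cstar_scheme \<Rightarrow> 'b set \<Rightarrow> 'b set cstar" where
  "cstar_quot B J =
    \<lparr>carrier = carrier (B Quot J), monoid.mult = monoid.mult (B Quot J), one = one (B Quot J),
     zero = zero (B Quot J), add = add (B Quot J),
     module.smult = (\<lambda>c X. \<Union>x\<in>X. J +>\<^bsub>B\<^esub> (c \<odot>\<^bsub>B\<^esub> x)),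
     adj = (\<lambda>X. \<Union>x\<in>X. J +>\<^bsub>B\<^esub> adj B x),
     cnorm = (\<lambda>X. INF x\<in>X. cnorm B x)\<rparr>"

text \<open>UCP maps from the operator system \<open>S \<subseteq> A\<close>; \<open>M\<^sub>k(S)\<close> carries the order of \<open>M\<^sub>k(A)\<close>.\<close>

definition ucp ::
    "('a, 'm) star_alg_scheme \<Rightarrow> 'a set \<Rightarrow> ('b, 'n) star_alg_scheme \<Rightarrow> ('a \<Rightarrow> 'b) \<Rightarrow> bool" where
  "ucp A S B \<phi> \<longleftrightarrow>
     \<phi> \<in> S \<rightarrow> carrier B \<and> linear_on A S B \<phi> \<and> \<phi> \<one>\<^bsub>A\<^esub> = \<one>\<^bsub>B\<^esub> \<and>
     (\<forall>k\<ge>1. \<forall>X \<in> pos_cone (mat_alg k A).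
        (\<forall>i<k. \<forall>j<k. X $$ (i, j) \<in> S) \<longrightarrow> map_mat \<phi> X \<in> pos_cone (mat_alg k B))"

text \<open>
  HOL cannot quantify over all types inside a formula, so the C*-algebras \<open>B\<close> of the lifting
  property range over those whose carrier is a subset of a given type \<open>'b\<close>. For a type of
  cardinality continuum nothing is lost for the separable \<open>S\<close> considered here: the image of a UCP
  map from \<open>S\<close> into \<open>B / J\<close> lies in the image of a separable unital C*-subalgebra of \<open>B\<close>.
\<close>

definition lifting_property :: "'b itself \<Rightarrow> ('a, 'm) star_alg_scheme \<Rightarrow> 'a set \<Rightarrow> bool" where
  "lifting_property _ A S \<longleftrightarrow>
     (\<forall>(B :: 'b cstar) J \<phi>.
        unital_cstar_algebra B \<and> closed_ideal J B \<and> ucp A S (cstar_quot B J) \<phi> \<longrightarrow>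
        (\<exists>\<psi>. ucp A S B \<psi> \<and> (\<forall>x\<in>S. J +>\<^bsub>B\<^esub> \<psi> x = \<phi> x)))"


section \<open>Bounded sequences and matrix algebras\<close>

definition linf_prod :: "(nat \<Rightarrow> 'a cstar) \<Rightarrow> (nat \<Rightarrow> 'a) cstar" where
  "linf_prod A =
    \<lparr>carrier = {x. (\<forall>m. x m \<in> carrier (A m)) \<and> (\<exists>C. \<forall>m. cnorm (A m) (x m) \<le> C)},
     monoid.mult = (\<lambda>x y m. x m \<otimes>\<^bsub>A m\<^esub> y m), one = (\<lambda>m. \<one>\<^bsub>A m\<^esub>),
     zero = (\<lambda>m. \<zero>\<^bsub>A m\<^esub>), add = (\<lambda>x y m. x m \<oplus>\<^bsub>A m\<^esub> y m),
     module.smult = (\<lambda>c x m. c \<odot>\<^bsub>A m\<^esub> x m), adj = (\<lambda>x m. adj (A m) (x m)),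
     cnorm = (\<lambda>x. SUP m. cnorm (A m) (x m))\<rparr>"

definition c0_ideal :: "(nat \<Rightarrow> 'a cstar) \<Rightarrow> (nat \<Rightarrow> 'a) set" where
  "c0_ideal A = {x \<in> carrier (linf_prod A). (\<lambda>m. cnorm (A m) (x m)) \<longlonglongrightarrow> 0}"

definition complex_mat_alg :: "nat \<Rightarrow> complex mat cstar" where
  "complex_mat_alg m =
    \<lparr>carrier = carrier_mat m m, monoid.mult = (*), one = 1\<^sub>m m, zero = 0\<^sub>m m m, add = (+),
     module.smult = (\<cdot>\<^sub>m), adj = mat_adjoint, cnorm = op_norm\<rparr>"

text \<open>The matrix sizes run over \<open>m \<ge> 1\<close>, hence the successor.\<close>

definition matrix_corona :: "(nat \<Rightarrow> complex mat) set cstar" where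
  "matrix_corona =
     cstar_quot (linf_prod (\<lambda>m. complex_mat_alg (Suc m))) (c0_ideal (\<lambda>m. complex_mat_alg (Suc m)))"


section \<open>The hyperfinite \<open>II\<^sub>1\<close> factor and its tracial ultrapower\<close>

text \<open>
  Von Neumann algebras are taken on the separable Hilbert space of square-summable sequences;
  the hyperfinite \<open>II\<^sub>1\<close> factor has separable predual, so it is represented there.
  Operators are extensional functions on that set. Inner products are linear in the second
  argument.
\<close>

definition ell2 :: "(nat \<Rightarrow> complex) set" where
  "ell2 = {x. summable (\<lambda>i. (cmod (x i))\<^sup>2)}"

definition ell2_inner :: "(nat \<Rightarrow> complex) \<Rightarrow> (nat \<Rightarrow> complex) \<Rightarrow> complex" where
  "ell2_inner x y = (\<Sum>i. cnj (x i) * y i)"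

definition ell2_norm :: "(nat \<Rightarrow> complex) \<Rightarrow> real" where
  "ell2_norm x = sqrt (\<Sum>i. (cmod (x i))\<^sup>2)"

type_synonym ell2_op = "(nat \<Rightarrow> complex) \<Rightarrow> (nat \<Rightarrow> complex)"

definition bounded_ops :: "ell2_op set" where
  "bounded_ops = {T \<in> ell2 \<rightarrow>\<^sub>E ell2.
     (\<forall>x\<in>ell2. \<forall>y\<in>ell2. T (\<lambda>i. x i + y i) = (\<lambda>i. T x i + T y i)) \<and>
     (\<forall>c. \<forall>x\<in>ell2. T (\<lambda>i. c * x i) = (\<lambda>i. c * T x i)) \<and>
     (\<exists>C. \<forall>x\<in>ell2. ell2_norm (T x) \<le> C * ell2_norm x)}"

definition B_ell2 :: "ell2_op cstar" where
  "B_ell2 =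
    \<lparr>carrier = bounded_ops, monoid.mult = compose ell2, one = (\<lambda>x\<in>ell2. x),
     zero = (\<lambda>x\<in>ell2. (\<lambda>i. 0)), add = (\<lambda>S T. \<lambda>x\<in>ell2. (\<lambda>i. S x i + T x i)),
     module.smult = (\<lambda>c T. \<lambda>x\<in>ell2. (\<lambda>i. c * T x i)),
     adj = (\<lambda>T. THE T'. T' \<in> bounded_ops \<and>
              (\<forall>x\<in>ell2. \<forall>y\<in>ell2. ell2_inner (T' x) y = ell2_inner x (T y))),
     cnorm = (\<lambda>T. SUP x\<in>{x \<in> ell2. ell2_norm x \<le> 1}. ell2_norm (T x))\<rparr>"

definition commutant :: "ell2_op set \<Rightarrow> ell2_op set" where
  "commutant M = {T \<in> bounded_ops. \<forall>S\<in>M. T \<otimes>\<^bsub>B_ell2\<^esub> S = S \<otimes>\<^bsub>B_ell2\<^esub> T}"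

definition von_neumann_algebra :: "ell2_op set \<Rightarrow> bool" where
  "von_neumann_algebra M \<longleftrightarrow>
     M \<subseteq> bounded_ops \<and> (\<forall>T\<in>M. adj B_ell2 T \<in> M) \<and> commutant (commutant M) = M"

definition vn_alg :: "ell2_op set \<Rightarrow> ell2_op cstar" where
  "vn_alg M = B_ell2\<lparr>carrier := M\<rparr>"

definition finite_dim :: "('a, 'm) star_alg_scheme \<Rightarrow> 'a set \<Rightarrow> bool" where
  "finite_dim A V \<longleftrightarrow> (\<exists>F. finite F \<and> F \<subseteq> V \<and> V \<subseteq> lin_span A F)"

definition star_subalgebra :: "('a, 'm) star_alg_scheme \<Rightarrow> 'a set \<Rightarrow> bool" where
  "star_subalgebra A N \<longleftrightarrow>
     subring N A \<and> Module.submodule N complex_field A \<and> (\<forall>x\<in>N. adj A x \<in> N)"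

definition is_factor :: "ell2_op set \<Rightarrow> bool" where
  "is_factor M \<longleftrightarrow> von_neumann_algebra M \<and>
     M \<inter> commutant M = {c \<odot>\<^bsub>B_ell2\<^esub> \<one>\<^bsub>B_ell2\<^esub> | c. True}"

text \<open>Normality is ultraweak continuity, i.e. being given by square-summable vector sequences.\<close>

definition normal_functional :: "ell2_op set \<Rightarrow> (ell2_op \<Rightarrow> complex) \<Rightarrow> bool" where
  "normal_functional M \<tau> \<longleftrightarrow> (\<exists>\<xi> \<eta>. (\<forall>i::nat. \<xi> i \<in> ell2 \<and> \<eta> i \<in> ell2) \<and>
     summable (\<lambda>i. (ell2_norm (\<xi> i))\<^sup>2) \<and> summable (\<lambda>i. (ell2_norm (\<eta> i))\<^sup>2) \<and>
     (\<forall>T\<in>M. \<tau> T = (\<Sum>i. ell2_inner (\<eta> i) (T (\<xi> i)))))"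

definition faithful_normal_trace :: "ell2_op set \<Rightarrow> (ell2_op \<Rightarrow> complex) \<Rightarrow> bool" where
  "faithful_normal_trace M \<tau> \<longleftrightarrow>
     \<tau> \<in> states (vn_alg M) \<and> normal_functional M \<tau> \<and>
     (\<forall>S\<in>M. \<forall>T\<in>M. \<tau> (S \<otimes>\<^bsub>B_ell2\<^esub> T) = \<tau> (T \<otimes>\<^bsub>B_ell2\<^esub> S)) \<and>
     (\<forall>T\<in>M. \<tau> (adj B_ell2 T \<otimes>\<^bsub>B_ell2\<^esub> T) = 0 \<longrightarrow> T = \<zero>\<^bsub>B_ell2\<^esub>)"

text \<open>\<open>\<tau>\<close> is determined by \<open>M\<close>, and \<open>M\<close> is unique up to isomorphism.\<close>

definition hyperfinite_II1_factor :: "ell2_op set \<Rightarrow> (ell2_op \<Rightarrow> complex) \<Rightarrow> bool" where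
  "hyperfinite_II1_factor M \<tau> \<longleftrightarrow>
     is_factor M \<and> \<not> finite_dim B_ell2 M \<and> faithful_normal_trace M \<tau> \<and>
     (\<exists>N :: nat \<Rightarrow> ell2_op set. incseq N \<and>
        (\<forall>i. star_subalgebra B_ell2 (N i) \<and> finite_dim B_ell2 (N i)) \<and>
        M = commutant (commutant (\<Union>i. N i)))"

definition free_ultrafilter :: "nat filter \<Rightarrow> bool" where
  "free_ultrafilter \<omega> \<longleftrightarrow> \<omega> \<noteq> bot \<and>
     (\<forall>P. eventually P \<omega> \<or> eventually (\<lambda>m. \<not> P m) \<omega>) \<and>
     (\<forall>k. eventually (\<lambda>m. m \<noteq> k) \<omega>)"

definition trace_ideal ::
    "ell2_op set \<Rightarrow> (ell2_op \<Rightarrow> complex) \<Rightarrow> nat filter \<Rightarrow> (nat \<Rightarrow> ell2_op) set" where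
  "trace_ideal M \<tau> \<omega> = {x \<in> carrier (linf_prod (\<lambda>_. vn_alg M)).
     ((\<lambda>m. \<tau> (adj B_ell2 (x m) \<otimes>\<^bsub>B_ell2\<^esub> x m)) \<longlongrightarrow> 0) \<omega>}"

definition tracial_ultrapower ::
    "ell2_op set \<Rightarrow> (ell2_op \<Rightarrow> complex) \<Rightarrow> nat filter \<Rightarrow> (nat \<Rightarrow> ell2_op) set cstar" where
  "tracial_ultrapower M \<tau> \<omega> = cstar_quot (linf_prod (\<lambda>_. vn_alg M)) (trace_ideal M \<tau> \<omega>)"

end

theory Submission imports Defs "HOL-Library.Nat_Bijection" begin

text \<open>
  Suppose that \<open>f\<close> is a unital *-homomorphism from \<open>A\<close> into \<open>P / J\<close>, where \<open>P\<close> consists of the bounded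
  sequences in algebras \<open>B m\<close> with tracial states \<open>\<tau> m\<close>, and \<open>\<tau> m (x\<^sub>m* x\<^sub>m)\<close> tends to \<open>0\<close> for every
  \<open>x\<close> in the ideal \<open>J\<close>. The lifting property turns \<open>f\<close> on \<open>S\<close> into a UCP map \<open>\<psi>\<close> into \<open>P\<close>. Since each
  \<open>u\<^sub>i\<close> is unitary, \<open>\<psi> (u\<^sub>i)* \<psi> (u\<^sub>i) - 1\<close> lies in \<open>J\<close>, so at some coordinate \<open>m\<close> all the numbers
  \<open>\<tau> m (\<psi>\<^sub>m (u\<^sub>i)* \<psi>\<^sub>m (u\<^sub>i))\<close> are close to \<open>1\<close>. Their sum is then close to \<open>n\<close>, and the contradiction
  comes from the inequality

    \<open>\<Sum>\<^sub>i \<tau> (\<psi> (u\<^sub>i)* \<psi> (u\<^sub>i)) \<le> w_cb (u\<^sub>1, \<dots>, u\<^sub>n)\<close>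

  for UCP maps \<open>\<psi>\<close> into a tracial algebra with sufficiently many finite-dimensional subalgebras. For the
  target \<open>M\<^sub>k\<close> this is the classical pairing of an operator with its conjugate: the entries of
  \<open>\<psi> (u\<^sub>i)\<close> are conjugated to give contractions \<open>U\<^sub>i\<close>, and the maximally entangled vector state \<open>s\<close> of
  \<open>M\<^sub>k \<otimes> M\<^sub>k\<close> satisfies \<open>s (\<Sum>\<^sub>i U\<^sub>i \<otimes> \<psi> (u\<^sub>i)) = \<Sum>\<^sub>i \<tau> (\<psi> (u\<^sub>i)* \<psi> (u\<^sub>i))\<close>. For a general finite-dimensional
  *-subalgebra \<open>N\<close> with an orthonormal basis \<open>e\<close>, the role of that state is played by the functionals
  \<open>\<tau> (e\<^sub>i* x e\<^sub>j g)\<close>, where \<open>g\<close> is the inverse of the central element \<open>\<Sum>\<^sub>i e\<^sub>i e\<^sub>i*\<close>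
  (\<open>tracial_witness\<close>); paired with the conjugated compression of \<open>x\<close> to \<open>N\<close> they yield the squared
  length of the projection of \<open>x\<close> onto \<open>N\<close>.

  Composed with \<open>\<psi>\<close>, these functionals are positive on \<open>M\<^sub>k(S)\<close>, whereas the numerical radius refers to
  states of \<open>M\<^sub>k(A)\<close>. Krein's extension theorem closes this gap (\<open>krein_extension\<close>). It is applied to the
  cone of sums of Gram matrices \<open>y\<^sub>i* y\<^sub>j\<close> over \<open>A\<close>; that the identity is an order unit for this cone
  (\<open>dominated_all\<close>) follows from square roots of the elements \<open>1 - h\<close> of \<open>A\<close> with \<open>h\<close> small and
  self-adjoint.

  This argument is carried out once, in \<open>no_unital_star_hom_into_tracial_quotient\<close>. For the matrix
  corona the subalgebra \<open>N\<close> is the whole matrix algebra. For the ultrapower of the hyperfinite factor,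
  an increasing sequence of finite-dimensional subalgebras is dense in the trace norm by von Neumann's
  bicommutant argument (\<open>bicommutant_density\<close>), so \<open>N\<close> can be chosen such that the projections onto
  \<open>N\<close> lose arbitrarily little. In both cases the sequences are determined by countably many complex numbers, and
  an isomorphic copy of \<open>P\<close> on functions from the naturals to the complex numbers is used when the
  lifting property is invoked (\<open>lifting_transport\<close>).
\<close>

section \<open>Star-algebras and cones of Gram matrices\<close>

lemma complex_field_simps [simp]:
  "carrier complex_field = UNIV" "x \<otimes>\<^bsub>complex_field\<^esub> y = x * y" "\<one>\<^bsub>complex_field\<^esub> = 1"
  "\<zero>\<^bsub>complex_field\<^esub> = 0" "x \<oplus>\<^bsub>complex_field\<^esub> y = x + y"
  by (simp_all add: complex_field_def)

lemma cring_complex_field: "cring complex_field"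
proof (rule cringI)
  show "abelian_group complex_field"
    by (rule abelian_groupI) (auto simp: algebra_simps intro: exI[of _ "- x" for x] left_minus)
  show "comm_monoid complex_field"
    by (rule comm_monoidI) (auto simp: algebra_simps)
qed (auto simp: algebra_simps)

text \<open>
  The matrix algebra \<open>M\<^sub>k(A)\<close> enters the extension of functionals only as a vector space with an
  involution and a cone, so the linear structure is kept apart from the product.
\<close>

locale star_space = abelian_group A + vs: module complex_field A
  for A :: "('a, 'm) star_alg_scheme" (structure) +
  assumes adj_closed [simp, intro]: "x \<in> carrier A \<Longrightarrow> adj A x \<in> carrier A"
    and adj_adj [simp]: "x \<in> carrier A \<Longrightarrow> adj A (adj A x) = x"
    and adj_add:
      "\<lbrakk>x \<in> carrier A; y \<in> carrier A\<rbrakk> \<Longrightarrow> adj A (x \<oplus> y) = adj A x \<oplus> adj A y"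
    and adj_smult: "x \<in> carrier A \<Longrightarrow> adj A (c \<odot> x) = cnj c \<odot> adj A x"

locale star_algebra = star_space A + ring A for A :: "('a, 'm) star_alg_scheme" (structure) +
  assumes smult_mult_left:
      "\<lbrakk>x \<in> carrier A; y \<in> carrier A\<rbrakk> \<Longrightarrow> (c \<odot> x) \<otimes> y = c \<odot> (x \<otimes> y)"
    and smult_mult_right:
      "\<lbrakk>x \<in> carrier A; y \<in> carrier A\<rbrakk> \<Longrightarrow> x \<otimes> (c \<odot> y) = c \<odot> (x \<otimes> y)"
    and adj_mult:
      "\<lbrakk>x \<in> carrier A; y \<in> carrier A\<rbrakk> \<Longrightarrow> adj A (x \<otimes> y) = adj A y \<otimes> adj A x"

sublocale unital_cstar_algebra \<subseteq> star_algebra A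
  by unfold_locales (fact smult_mult_left smult_mult_right adj_closed adj_adj adj_add adj_smult adj_mult)+

locale cstar_algebra = star_algebra A for A :: "('a, 'm) cstar_scheme" (structure) +
  assumes cnorm_nonneg: "x \<in> carrier A \<Longrightarrow> 0 \<le> cnorm A x"
    and cnorm_eq_0_iff: "x \<in> carrier A \<Longrightarrow> cnorm A x = 0 \<longleftrightarrow> x = \<zero>"
    and cnorm_triangle:
      "\<lbrakk>x \<in> carrier A; y \<in> carrier A\<rbrakk> \<Longrightarrow> cnorm A (x \<oplus> y) \<le> cnorm A x + cnorm A y"
    and cnorm_smult: "x \<in> carrier A \<Longrightarrow> cnorm A (c \<odot> x) = cmod c * cnorm A x"
    and cnorm_mult:
      "\<lbrakk>x \<in> carrier A; y \<in> carrier A\<rbrakk> \<Longrightarrow> cnorm A (x \<otimes> y) \<le> cnorm A x * cnorm A y"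
    and cnorm_cstar: "x \<in> carrier A \<Longrightarrow> cnorm A (adj A x \<otimes> x) = (cnorm A x)\<^sup>2"
    and complete:
      "\<lbrakk>\<forall>i. f i \<in> carrier A;
        \<forall>e>0. \<exists>N. \<forall>i\<ge>N. \<forall>j\<ge>N. cnorm A (f i \<ominus> f j) < e\<rbrakk>
       \<Longrightarrow> \<exists>x\<in>carrier A. (\<lambda>i. cnorm A (f i \<ominus> x)) \<longlonglongrightarrow> 0"

lemma unital_cstar_algebra_iff: "unital_cstar_algebra A \<longleftrightarrow> cstar_algebra A"
proof
  assume "unital_cstar_algebra A"
  then interpret unital_cstar_algebra A .
  show "cstar_algebra A"
    by unfold_locales (fact cnorm_nonneg cnorm_eq_0_iff cnorm_triangle cnorm_smult cnorm_mult cnorm_cstar | erule (1) complete)+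
next
  assume "cstar_algebra A"
  then interpret cstar_algebra A .
  show "unital_cstar_algebra A"
    by unfold_locales (fact smult_mult_left smult_mult_right adj_closed adj_adj adj_add adj_smult adj_mult cnorm_nonneg cnorm_eq_0_iff cnorm_triangle cnorm_smult cnorm_mult cnorm_cstar | erule (1) complete)+
qed

definition star_hom :: "('a, 'm) star_alg_scheme \<Rightarrow> ('b, 'n) star_alg_scheme \<Rightarrow> ('a \<Rightarrow> 'b) \<Rightarrow> bool" where
  "star_hom A B f \<longleftrightarrow> f \<in> Ring.ring_hom A B \<and>
     (\<forall>c. \<forall>x\<in>carrier A. f (c \<odot>\<^bsub>A\<^esub> x) = c \<odot>\<^bsub>B\<^esub> f x) \<and>
     (\<forall>x\<in>carrier A. f (adj A x) = adj B (f x))"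

definition lin_fun :: "('a, 'm) star_alg_scheme \<Rightarrow> 'a set \<Rightarrow> ('a \<Rightarrow> complex) \<Rightarrow> bool" where
  "lin_fun A S \<theta> \<longleftrightarrow> (\<forall>x\<in>S. \<forall>y\<in>S. \<theta> (x \<oplus>\<^bsub>A\<^esub> y) = \<theta> x + \<theta> y) \<and>
     (\<forall>c. \<forall>x\<in>S. \<theta> (c \<odot>\<^bsub>A\<^esub> x) = c * \<theta> x)"

text \<open>
  The entries of a sum of \<open>p\<close> matrices \<open>y\<^sub>i* y\<^sub>j\<close>, i.e. of \<open>Y* Y\<close> for a rectangular matrix \<open>Y\<close> over
  \<open>A\<close>. Since \<open>p\<close> is arbitrary, these matrices form a convex cone for elementary reasons, and
  *-homomorphisms preserve it. The set \<open>pos_cone (mat_alg k A)\<close> has square factors only.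
\<close>

definition gram :: "('a, 'm) star_alg_scheme \<Rightarrow> nat \<Rightarrow> (nat \<Rightarrow> nat \<Rightarrow> 'a) \<Rightarrow> bool" where
  "gram A k X \<longleftrightarrow> (\<exists>p Y. (\<forall>l<p. \<forall>i<k. Y l i \<in> carrier A) \<and>
     (\<forall>i<k. \<forall>j<k. X i j = (\<Oplus>\<^bsub>A\<^esub>l\<in>{..<p::nat}. adj A (Y l i) \<otimes>\<^bsub>A\<^esub> Y l j)))"

lemma mat_alg_carrier_iff:
  "X \<in> carrier (mat_alg k A) \<longleftrightarrow> X \<in> carrier_mat k k \<and> (\<forall>i<k. \<forall>j<k. X $$ (i, j) \<in> carrier A)"
  by (simp add: mat_alg_def)

lemma mat_alg_mult:
  "X \<otimes>\<^bsub>mat_alg k A\<^esub> Y = mat k k (\<lambda>(i, j). \<Oplus>\<^bsub>A\<^esub>l\<in>{..<k}. X $$ (i, l) \<otimes>\<^bsub>A\<^esub> Y $$ (l, j))"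
  by (simp add: mat_alg_def)

lemma mat_alg_ops:
  "\<one>\<^bsub>mat_alg k A\<^esub> = mat k k (\<lambda>(i, j). if i = j then \<one>\<^bsub>A\<^esub> else \<zero>\<^bsub>A\<^esub>)"
  "\<zero>\<^bsub>mat_alg k A\<^esub> = mat k k (\<lambda>_. \<zero>\<^bsub>A\<^esub>)"
  "X \<oplus>\<^bsub>mat_alg k A\<^esub> Y = mat k k (\<lambda>(i, j). X $$ (i, j) \<oplus>\<^bsub>A\<^esub> Y $$ (i, j))"
  "c \<odot>\<^bsub>mat_alg k A\<^esub> X = mat k k (\<lambda>(i, j). c \<odot>\<^bsub>A\<^esub> X $$ (i, j))"
  "adj (mat_alg k A) X = mat k k (\<lambda>(i, j). adj A (X $$ (j, i)))"
  by (simp_all add: mat_alg_def)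

context module
begin

lemma finsum_smult_r:
  assumes "finite I" "a \<in> carrier R" "f \<in> I \<rightarrow> carrier M"
  shows "a \<odot>\<^bsub>M\<^esub> (\<Oplus>\<^bsub>M\<^esub>i\<in>I. f i) = (\<Oplus>\<^bsub>M\<^esub>i\<in>I. a \<odot>\<^bsub>M\<^esub> f i)"
  using assms(1,3)
proof (induction I rule: finite_induct)
  case (insert x F)
  then show ?case using assms(2)
    by (simp add: Pi_def smult_r_distr)
qed (use assms in auto)

end

context star_space
begin

lemma smult_closed' [simp, intro]: "x \<in> carrier A \<Longrightarrow> c \<odot> x \<in> carrier A"
  by simp

lemma smult_add_left: "x \<in> carrier A \<Longrightarrow> (a + b) \<odot> x = a \<odot> x \<oplus> b \<odot> x"
  using vs.smult_l_distr[of a b x] by simp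

lemma smult_add_right: "x \<in> carrier A \<Longrightarrow> y \<in> carrier A \<Longrightarrow> a \<odot> (x \<oplus> y) = a \<odot> x \<oplus> a \<odot> y"
  using vs.smult_r_distr[of a x y] by simp

lemma smult_smult: "x \<in> carrier A \<Longrightarrow> a \<odot> (b \<odot> x) = (a * b) \<odot> x"
  using vs.smult_assoc1[of a b x] by simp

lemma smult_1 [simp]: "x \<in> carrier A \<Longrightarrow> 1 \<odot> x = x"
  using vs.smult_one[of x] by simp

lemma smult_0_left [simp]: "x \<in> carrier A \<Longrightarrow> 0 \<odot> x = \<zero>"
  using vs.smult_l_null[of x] by simp

lemma smult_0_right [simp]: "a \<odot> \<zero> = \<zero>"
  using vs.smult_r_null[of a] by simp

lemma minus_conv_smult: "x \<in> carrier A \<Longrightarrow> \<ominus> x = (-1) \<odot> x"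
proof -
  assume x: "x \<in> carrier A"
  have "(-1) \<odot> x \<oplus> x = (-1 + 1) \<odot> x" using x smult_add_left[of x "-1" 1] by simp
  then have "(-1) \<odot> x \<oplus> x = \<zero>" using x by simp
  then show ?thesis using x using minus_equality[of "(-1) \<odot> x" x] by simp
qed

lemma diff_conv_smult: "x \<in> carrier A \<Longrightarrow> y \<in> carrier A \<Longrightarrow> x \<ominus> y = x \<oplus> (-1) \<odot> y"
  by (simp add: a_minus_def minus_conv_smult)

lemma adj_zero [simp]: "adj A \<zero> = \<zero>"
  using adj_smult[of \<zero> 0] by simp

lemma adj_diff: "x \<in> carrier A \<Longrightarrow> y \<in> carrier A \<Longrightarrow> adj A (x \<ominus> y) = adj A x \<ominus> adj A y"
  by (simp add: diff_conv_smult adj_add adj_smult)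

lemma adj_finsum:
  assumes "finite I" "f \<in> I \<rightarrow> carrier A"
  shows "adj A (\<Oplus>i\<in>I. f i) = (\<Oplus>i\<in>I. adj A (f i))"
  using assms
proof (induction I rule: finite_induct)
  case (insert x F)
  then show ?case by (simp add: Pi_def adj_add)
qed auto

lemma smult_finsum:
  assumes "finite I" "f \<in> I \<rightarrow> carrier A"
  shows "c \<odot> (\<Oplus>i\<in>I. f i) = (\<Oplus>i\<in>I. c \<odot> f i)"
  using vs.finsum_smult_r[of I c f] assms by simp

lemma finsum_in_submodule:
  assumes "Module.submodule S complex_field A" "finite I" "\<And>i. i \<in> I \<Longrightarrow> f i \<in> S"
  shows "(\<Oplus>i\<in>I. f i) \<in> S"
  using assms(2,3)
proof (induction I rule: finite_induct)
  case empty
  then show ?case using subgroup.one_closed[OF Module.submodule.axioms(1)[OF assms(1)]] by simp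
next
  case (insert x F)
  have "S \<subseteq> carrier A" using assms(1) vs.submoduleE(1) by blast
  with insert show ?case using vs.submoduleE(5)[OF assms(1)]
    by (subst finsum_insert) (auto simp: Pi_def)
qed

lemma lin_fun_zero: "lin_fun A S \<theta> \<Longrightarrow> x \<in> S \<Longrightarrow> x \<in> carrier A \<Longrightarrow> \<theta> \<zero> = 0"
  unfolding lin_fun_def by (metis mult_zero_left smult_0_left)

lemma lin_fun_finsum:
  assumes "lin_fun A S \<theta>" "Module.submodule S complex_field A" "finite I" "\<And>i. i \<in> I \<Longrightarrow> f i \<in> S"
  shows "\<theta> (\<Oplus>i\<in>I. f i) = (\<Sum>i\<in>I. \<theta> (f i))"
  using assms(3,4)
proof (induction I rule: finite_induct)
  case empty
  have "\<zero> \<in> S" using subgroup.one_closed[OF Module.submodule.axioms(1)[OF assms(2)]] by simp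
  then show ?case using lin_fun_zero[OF assms(1)] by simp
next
  case (insert x F)
  have S: "S \<subseteq> carrier A" using assms(2) vs.submoduleE(1) by blast
  have "(\<Oplus>i\<in>F. f i) \<in> S" using finsum_in_submodule[OF assms(2)] insert by auto
  then have "\<theta> (f x \<oplus> (\<Oplus>i\<in>F. f i)) = \<theta> (f x) + \<theta> (\<Oplus>i\<in>F. f i)"
    using assms(1) insert unfolding lin_fun_def by auto
  moreover have "(\<Oplus>i\<in>insert x F. f i) = f x \<oplus> (\<Oplus>i\<in>F. f i)"
    using insert S by (subst finsum_insert) (auto simp: Pi_def)
  ultimately show ?case using insert by simp
qed

lemma finsum_lessThan_Suc:
  "(\<And>i. i \<le> n \<Longrightarrow> f i \<in> carrier A) \<Longrightarrow> (\<Oplus>i\<in>{..<Suc n}. f i) = (\<Oplus>i\<in>{..<n}. f i) \<oplus> f n"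
  by (subst lessThan_Suc, subst finsum_insert) (auto simp: Pi_def intro!: a_comm)

lemma finsum_lessThan_add:
  fixes m n :: nat
  shows "(\<And>i. i < m + n \<Longrightarrow> f i \<in> carrier A) \<Longrightarrow>
    (\<Oplus>i\<in>{..<m+n}. f i) = (\<Oplus>i\<in>{..<m}. f i) \<oplus> (\<Oplus>i\<in>{..<n}. f (m + i))"
proof (induct n)
  case 0
  then show ?case by (auto simp: Pi_def)
next
  case (Suc n)
  then have "(\<Oplus>i\<in>{..<m+Suc n}. f i) = (\<Oplus>i\<in>{..<m}. f i) \<oplus> (\<Oplus>i\<in>{..<n}. f (m + i)) \<oplus> f (m + n)"
    by (simp add: finsum_lessThan_Suc)
  also have "\<dots> = (\<Oplus>i\<in>{..<m}. f i) \<oplus> ((\<Oplus>i\<in>{..<n}. f (m + i)) \<oplus> f (m + n))"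
    using Suc by (intro a_assoc) (auto simp: Pi_def)
  finally show ?case using Suc by (subst finsum_lessThan_Suc[of n]) auto
qed

end

context star_algebra
begin

lemma adj_one [simp]: "adj A \<one> = \<one>"
  using adj_mult[of "adj A \<one>" \<one>] by simp

lemma gram_zero: "gram A k (\<lambda>i j. \<zero>)"
  unfolding gram_def by (rule exI[of _ 0]) auto

lemma gram_cong: "gram A k X \<Longrightarrow> (\<And>i j. i < k \<Longrightarrow> j < k \<Longrightarrow> X i j = X' i j) \<Longrightarrow> gram A k X'"
  unfolding gram_def by simp

lemma gram_single: "(\<And>i. i < k \<Longrightarrow> y i \<in> carrier A) \<Longrightarrow> gram A k (\<lambda>i j. adj A (y i) \<otimes> y j)"
  unfolding gram_def by (rule exI[of _ 1], rule exI[of _ "\<lambda>_. y"]) (auto simp: finsum_lessThan_Suc)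

lemma gram_add:
  assumes "gram A k X" "gram A k X'"
  shows "gram A k (\<lambda>i j. X i j \<oplus> X' i j)"
proof -
  obtain p :: nat and Y where Y: "\<And>l i. l < p \<Longrightarrow> i < k \<Longrightarrow> Y l i \<in> carrier A"
    "\<And>i j. i < k \<Longrightarrow> j < k \<Longrightarrow> X i j = (\<Oplus>l\<in>{..<p}. adj A (Y l i) \<otimes> Y l j)"
    using assms(1) unfolding gram_def by blast
  obtain p' :: nat and Y' where Y': "\<And>l i. l < p' \<Longrightarrow> i < k \<Longrightarrow> Y' l i \<in> carrier A"
    "\<And>i j. i < k \<Longrightarrow> j < k \<Longrightarrow> X' i j = (\<Oplus>l\<in>{..<p'}. adj A (Y' l i) \<otimes> Y' l j)"
    using assms(2) unfolding gram_def by blast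
  define Z where "Z l = (if l < p then Y l else Y' (l - p))" for l
  have Z: "Z l i \<in> carrier A" if "l < p + p'" "i < k" for l i
    using that Y(1) Y'(1) by (auto simp: Z_def)
  have "X i j \<oplus> X' i j = (\<Oplus>l\<in>{..<p+p'}. adj A (Z l i) \<otimes> Z l j)" if "i < k" "j < k" for i j
  proof -
    have "(\<Oplus>l\<in>{..<p+p'}. adj A (Z l i) \<otimes> Z l j) =
      (\<Oplus>l\<in>{..<p}. adj A (Z l i) \<otimes> Z l j) \<oplus> (\<Oplus>l\<in>{..<p'}. adj A (Z (p + l) i) \<otimes> Z (p + l) j)"
      using Z that by (intro finsum_lessThan_add) auto
    also have "(\<Oplus>l\<in>{..<p}. adj A (Z l i) \<otimes> Z l j) = X i j"
      unfolding Y(2)[OF that] using Y(1) that by (intro finsum_cong') (auto simp: Z_def)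
    also have "(\<Oplus>l\<in>{..<p'}. adj A (Z (p + l) i) \<otimes> Z (p + l) j) = X' i j"
      unfolding Y'(2)[OF that] using Y'(1) that by (intro finsum_cong') (auto simp: Z_def)
    finally show ?thesis by simp
  qed
  with Z show ?thesis unfolding gram_def by (intro exI[of _ "p + p'"] exI[of _ Z]) auto
qed

lemma gram_closed: "gram A k X \<Longrightarrow> i < k \<Longrightarrow> j < k \<Longrightarrow> X i j \<in> carrier A"
  unfolding gram_def by (auto intro!: finsum_closed)

lemma gram_adj:
  assumes "gram A k X" "i < k" "j < k" shows "adj A (X i j) = X j i"
proof -
  obtain p :: nat and Y where Y: "\<And>l i. l < p \<Longrightarrow> i < k \<Longrightarrow> Y l i \<in> carrier A"
    "\<And>i j. i < k \<Longrightarrow> j < k \<Longrightarrow> X i j = (\<Oplus>l\<in>{..<p}. adj A (Y l i) \<otimes> Y l j)"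
    using assms(1) unfolding gram_def by blast
  show ?thesis using assms(2,3) Y(1)
    by (subst (1 2) Y(2)) (auto simp: adj_finsum Pi_def adj_mult intro!: finsum_cong')
qed

lemma gram_scale:
  assumes "gram A k X" "r \<ge> 0"
  shows "gram A k (\<lambda>i j. complex_of_real r \<odot> X i j)"
proof -
  obtain p :: nat and Y where Y: "\<And>l i. l < p \<Longrightarrow> i < k \<Longrightarrow> Y l i \<in> carrier A"
    "\<And>i j. i < k \<Longrightarrow> j < k \<Longrightarrow> X i j = (\<Oplus>l\<in>{..<p}. adj A (Y l i) \<otimes> Y l j)"
    using assms(1) unfolding gram_def by blast
  have r: "complex_of_real (sqrt r) * complex_of_real (sqrt r) = complex_of_real r"
    using assms(2) by (metis of_real_mult real_sqrt_mult_self abs_of_nonneg)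
  show ?thesis unfolding gram_def
  proof (intro exI[of _ p] exI[of _ "\<lambda>l i. complex_of_real (sqrt r) \<odot> Y l i"] conjI allI impI)
    fix i j assume ij: "i < k" "j < k"
    have "complex_of_real r \<odot> X i j = (\<Oplus>l\<in>{..<p}. complex_of_real r \<odot> (adj A (Y l i) \<otimes> Y l j))"
      using ij Y(1) by (subst Y(2)[OF ij], subst smult_finsum) (auto simp: Pi_def)
    also have "\<dots> = (\<Oplus>l\<in>{..<p}. adj A (complex_of_real (sqrt r) \<odot> Y l i) \<otimes> (complex_of_real (sqrt r) \<odot> Y l j))"
      using ij Y(1) by (intro finsum_cong')
        (auto simp: adj_smult smult_mult_left smult_mult_right smult_smult r)
    finally show "complex_of_real r \<odot> X i j = \<dots>" .
  qed (use Y in auto)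
qed

lemma gram_mono_size: "gram A q X \<Longrightarrow> k \<le> q \<Longrightarrow> gram A k X"
proof -
  assume "gram A q X" and k: "k \<le> q"
  then obtain p :: nat and Y where "\<And>l i. l < p \<Longrightarrow> i < q \<Longrightarrow> Y l i \<in> carrier A"
    "\<And>i j. i < q \<Longrightarrow> j < q \<Longrightarrow> X i j = (\<Oplus>l\<in>{..<p}. adj A (Y l i) \<otimes> Y l j)"
    unfolding gram_def by blast
  with k show "gram A k X" unfolding gram_def by (intro exI[of _ p] exI[of _ Y]) auto
qed

lemma pos_cone_mat_alg_gram:
  assumes "X \<in> pos_cone (mat_alg k A)" shows "gram A k (\<lambda>i j. X $$ (i, j))"
proof -
  obtain Y where Y: "Y \<in> carrier (mat_alg k A)" "X = adj (mat_alg k A) Y \<otimes>\<^bsub>mat_alg k A\<^esub> Y"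
    using assms unfolding pos_cone_def by blast
  have Yc: "l < k \<Longrightarrow> i < k \<Longrightarrow> Y $$ (l, i) \<in> carrier A" for l i
    using Y(1) by (simp add: mat_alg_carrier_iff)
  have "X $$ (i, j) = (\<Oplus>l\<in>{..<k}. adj A (Y $$ (l, i)) \<otimes> Y $$ (l, j))" if "i < k" "j < k" for i j
  proof -
    have "X $$ (i, j) = (\<Oplus>l\<in>{..<k}. adj (mat_alg k A) Y $$ (i, l) \<otimes> Y $$ (l, j))"
      using that by (simp add: Y(2) mat_alg_mult)
    also have "\<dots> = (\<Oplus>l\<in>{..<k}. adj A (Y $$ (l, i)) \<otimes> Y $$ (l, j))"
      using that Yc by (intro finsum_cong') (auto simp: mat_alg_ops)
    finally show ?thesis .
  qed
  with Yc show ?thesis unfolding gram_def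
    by (intro exI[of _ k] exI[of _ "\<lambda>l i. Y $$ (l, i)"] conjI allI impI)
qed

text \<open>
  Padding a rectangular factor \<open>Y\<close> with zero rows and columns makes it square, at the price of a larger
  matrix. Thus a sum of several squares becomes a single one, and the definition of complete
  positivity, which mentions single squares of all sizes, applies to Gram matrices.
\<close>

lemma gram_pos_cone_padded:
  assumes "gram A k X" "k \<ge> 1"
  shows "\<exists>q\<ge>k. mat q q (\<lambda>(i, j). if i < k \<and> j < k then X i j else \<zero>) \<in> pos_cone (mat_alg q A)"
proof -
  obtain p :: nat and Y where Y: "\<And>l i. l < p \<Longrightarrow> i < k \<Longrightarrow> Y l i \<in> carrier A"
    "\<And>i j. i < k \<Longrightarrow> j < k \<Longrightarrow> X i j = (\<Oplus>l\<in>{..<p}. adj A (Y l i) \<otimes> Y l j)"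
    using assms(1) unfolding gram_def by blast
  define q where "q = k + p"
  define Z where "Z = mat q q (\<lambda>(l, i). if l < p \<and> i < k then Y l i else \<zero>)"
  have Z: "Z \<in> carrier (mat_alg q A)" using Y(1) by (auto simp: Z_def mat_alg_def)
  have Zc: "l < q \<Longrightarrow> i < q \<Longrightarrow> Z $$ (l,i) = (if l < p \<and> i < k then Y l i else \<zero>)" for l i
    by (simp add: Z_def)
  have "(\<Oplus>l\<in>{..<q}. adj A (Z $$ (l, i)) \<otimes> Z $$ (l, j)) = (if i < k \<and> j < k then X i j else \<zero>)"
    if "i < q" "j < q" for i j
  proof (cases "i < k \<and> j < k")
    case True
    have "(\<Oplus>l\<in>{..<q}. adj A (Z $$ (l, i)) \<otimes> Z $$ (l, j)) = (\<Oplus>l\<in>{..<p + k}. adj A (Z $$ (l, i)) \<otimes> Z $$ (l, j))"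
      by (simp add: q_def add.commute)
    also have "\<dots> = (\<Oplus>l\<in>{..<p}. adj A (Z $$ (l, i)) \<otimes> Z $$ (l, j)) \<oplus>
      (\<Oplus>l\<in>{..<k}. adj A (Z $$ (p+l, i)) \<otimes> Z $$ (p+l, j))"
      using Y(1) that by (intro finsum_lessThan_add) (auto simp: Zc q_def)
    also have "(\<Oplus>l\<in>{..<p}. adj A (Z $$ (l, i)) \<otimes> Z $$ (l, j)) = X i j"
      using True Y(1) that by (subst Y(2)) (auto intro!: finsum_cong' simp: Zc q_def)
    also have "(\<Oplus>l\<in>{..<k}. adj A (Z $$ (p+l, i)) \<otimes> Z $$ (p+l, j)) = (\<Oplus>l\<in>{..<k}. \<zero>)"
      using that by (intro finsum_cong') (auto simp: Zc q_def)
    finally show ?thesis using True gram_closed[OF assms(1)] by simp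
  next
    case False
    have "(\<Oplus>l\<in>{..<q}. adj A (Z $$ (l, i)) \<otimes> Z $$ (l, j)) = (\<Oplus>l\<in>{..<q}. \<zero>)"
      using that False Y(1) by (intro finsum_cong') (auto simp: Zc)
    with False show ?thesis by (simp only: if_False finsum_zero finite_lessThan)
  qed
  moreover have "(adj (mat_alg q A) Z \<otimes>\<^bsub>mat_alg q A\<^esub> Z) $$ (i, j) =
      (\<Oplus>l\<in>{..<q}. adj A (Z $$ (l, i)) \<otimes> Z $$ (l, j))" if "i < q" "j < q" for i j
  proof -
    have "(adj (mat_alg q A) Z \<otimes>\<^bsub>mat_alg q A\<^esub> Z) $$ (i, j) =
        (\<Oplus>l\<in>{..<q}. adj (mat_alg q A) Z $$ (i, l) \<otimes> Z $$ (l, j))"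
      using that by (simp add: mat_alg_mult)
    also have "\<dots> = (\<Oplus>l\<in>{..<q}. adj A (Z $$ (l, i)) \<otimes> Z $$ (l, j))"
      using that Z by (intro finsum_cong') (auto simp: mat_alg_ops mat_alg_carrier_iff)
    finally show ?thesis .
  qed
  ultimately have "adj (mat_alg q A) Z \<otimes>\<^bsub>mat_alg q A\<^esub> Z = mat q q (\<lambda>(i, j). if i < k \<and> j < k then X i j else \<zero>)"
    by (intro eq_matI) (simp_all add: mat_alg_mult)
  then have "mat q q (\<lambda>(i, j). if i < k \<and> j < k then X i j else \<zero>) \<in> pos_cone (mat_alg q A)"
    unfolding pos_cone_def using Z by (intro CollectI exI[of _ Z]) simp
  then show ?thesis by (intro exI[of _ q]) (simp add: q_def)
qed

end

text \<open>
  The zero of \<open>A\<close> has to lie in \<open>S\<close> because padding introduces zero entries.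
\<close>

lemma ucp_gram:
  assumes A: "star_algebra A" and B: "star_algebra B" and u: "ucp A S B \<psi>" and g: "gram A k X"
    and S: "\<And>i j. i < k \<Longrightarrow> j < k \<Longrightarrow> X i j \<in> S" "\<zero>\<^bsub>A\<^esub> \<in> S" and k: "k \<ge> 1"
  shows "gram B k (\<lambda>i j. \<psi> (X i j))"
proof -
  obtain q where q: "q \<ge> k" "mat q q (\<lambda>(i, j). if i < k \<and> j < k then X i j else \<zero>\<^bsub>A\<^esub>) \<in> pos_cone (mat_alg q A)"
    (is "?X \<in> _")
    using star_algebra.gram_pos_cone_padded[OF A g k] by blast
  have "\<forall>X \<in> pos_cone (mat_alg q A). (\<forall>i<q. \<forall>j<q. X $$ (i, j) \<in> S) \<longrightarrow> map_mat \<psi> X \<in> pos_cone (mat_alg q B)"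
    using u q(1) k unfolding ucp_def by simp
  moreover have "\<forall>i<q. \<forall>j<q. ?X $$ (i,j) \<in> S" using S by auto
  ultimately have "map_mat \<psi> ?X \<in> pos_cone (mat_alg q B)" using q(2) by blast
  then have "gram B q (\<lambda>i j. map_mat \<psi> ?X $$ (i, j))"
    by (rule star_algebra.pos_cone_mat_alg_gram[OF B])
  then have "gram B k (\<lambda>i j. map_mat \<psi> ?X $$ (i, j))"
    by (rule star_algebra.gram_mono_size[OF B _ q(1)])
  then show ?thesis
    by (rule star_algebra.gram_cong[OF B]) (use q(1) in auto)
qed

section \<open>Square roots and the order unit\<close>

context star_space
begin

lemma smult_minus_one_cancel: "x \<in> carrier A \<Longrightarrow> x \<oplus> (-1) \<odot> x = \<zero>"
  using smult_add_left[of x 1 "-1"] by simp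

lemma diff_zero [simp]: "x \<in> carrier A \<Longrightarrow> x \<ominus> \<zero> = x"
  by (simp add: a_minus_def)

lemma diff_self [simp]: "x \<in> carrier A \<Longrightarrow> x \<ominus> x = \<zero>"
  by (simp add: a_minus_def r_neg)

lemma smult_diff:
  "x \<in> carrier A \<Longrightarrow> y \<in> carrier A \<Longrightarrow> c \<odot> (x \<ominus> y) = c \<odot> x \<ominus> c \<odot> y"
  by (simp add: diff_conv_smult smult_add_right smult_smult mult.commute)

lemma add_diff:
  "\<lbrakk>x \<in> carrier A; y \<in> carrier A; z \<in> carrier A\<rbrakk> \<Longrightarrow> x \<oplus> (y \<ominus> z) = (x \<oplus> y) \<ominus> z"
  by (simp add: a_minus_def a_assoc)

lemma diff_add:
  "\<lbrakk>x \<in> carrier A; y \<in> carrier A; z \<in> carrier A\<rbrakk> \<Longrightarrow> (x \<ominus> y) \<oplus> z = (x \<oplus> z) \<ominus> y"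
  by (simp add: a_minus_def a_ac)

lemma diff_diff_left:
  "\<lbrakk>x \<in> carrier A; y \<in> carrier A; z \<in> carrier A\<rbrakk> \<Longrightarrow> (x \<ominus> y) \<ominus> z = x \<ominus> (y \<oplus> z)"
  by (simp add: a_minus_def minus_add a_assoc)

lemma diff_diff_right:
  "\<lbrakk>x \<in> carrier A; y \<in> carrier A; z \<in> carrier A\<rbrakk> \<Longrightarrow> x \<ominus> (y \<ominus> z) = (x \<oplus> z) \<ominus> y"
  by (simp add: a_minus_def minus_add a_ac)

lemma eq_diff_iff:
  "\<lbrakk>x \<in> carrier A; y \<in> carrier A; z \<in> carrier A\<rbrakk> \<Longrightarrow> z = x \<ominus> y \<longleftrightarrow> z \<oplus> y = x"
  by (auto simp: a_minus_def a_assoc l_neg r_neg)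

lemma diff_eq_iff:
  "\<lbrakk>x \<in> carrier A; y \<in> carrier A; z \<in> carrier A\<rbrakk> \<Longrightarrow> x \<ominus> y = z \<longleftrightarrow> x = z \<oplus> y"
  by (auto simp: a_minus_def a_assoc l_neg r_neg)

lemmas group_simps = add_diff diff_add diff_diff_left diff_diff_right eq_diff_iff diff_eq_iff a_ac

end

context star_algebra
begin

lemma diff_mult:
  "\<lbrakk>x \<in> carrier A; y \<in> carrier A; z \<in> carrier A\<rbrakk> \<Longrightarrow> (x \<ominus> y) \<otimes> z = x \<otimes> z \<ominus> y \<otimes> z"
  by (simp add: a_minus_def l_distr l_minus)

lemma mult_diff:
  "\<lbrakk>x \<in> carrier A; y \<in> carrier A; z \<in> carrier A\<rbrakk> \<Longrightarrow> z \<otimes> (x \<ominus> y) = z \<otimes> x \<ominus> z \<otimes> y"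
  by (simp add: a_minus_def r_distr r_minus)

lemmas group_ring_simps = group_simps l_distr r_distr diff_mult mult_diff m_assoc

end

context cstar_algebra
begin

lemma cnorm_minus: "x \<in> carrier A \<Longrightarrow> y \<in> carrier A \<Longrightarrow> cnorm A (x \<ominus> y) = cnorm A (y \<ominus> x)"
proof -
  assume xy: "x \<in> carrier A" "y \<in> carrier A"
  have "x \<ominus> y = (-1) \<odot> (y \<ominus> x)"
    using xy by (simp add: diff_conv_smult smult_add_right smult_smult a_ac)
  then show ?thesis using xy by (simp add: cnorm_smult)
qed

lemma cnorm_zero [simp]: "cnorm A \<zero> = 0"
  by (simp add: cnorm_eq_0_iff)

lemma diff_triangle:
  assumes "x \<in> carrier A" "y \<in> carrier A" "z \<in> carrier A"
  shows "cnorm A (x \<ominus> z) \<le> cnorm A (x \<ominus> y) + cnorm A (y \<ominus> z)"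
proof -
  have "x \<ominus> z = (x \<ominus> y) \<oplus> (y \<ominus> z)" using assms by algebra
  then show ?thesis using cnorm_triangle[of "x \<ominus> y" "y \<ominus> z"] assms by simp
qed

lemma cnorm_adj: "x \<in> carrier A \<Longrightarrow> cnorm A (adj A x) = cnorm A x"
proof -
  have le: "cnorm A y \<le> cnorm A (adj A y)" if y: "y \<in> carrier A" for y
  proof (cases "cnorm A y = 0")
    case True
    then show ?thesis using y cnorm_nonneg by simp
  next
    case False
    have "cnorm A y * cnorm A y \<le> cnorm A (adj A y) * cnorm A y"
      using cnorm_cstar[OF y] cnorm_mult[of "adj A y" y] y by (simp add: power2_eq_square)
    then show ?thesis using False cnorm_nonneg[OF y] by (simp add: mult_le_cancel_right)
  qed
  assume "x \<in> carrier A"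
  then show ?thesis using le[of x] le[of "adj A x"] by simp
qed

lemma geometric_convergence:
  assumes f: "\<And>i. f i \<in> carrier A" and d: "\<And>i. cnorm A (f (Suc i) \<ominus> f i) \<le> (1/2) ^ i"
  shows "\<exists>x\<in>carrier A. (\<lambda>i. cnorm A (f i \<ominus> x)) \<longlonglongrightarrow> 0"
proof (rule complete)
  have step: "cnorm A (f (i + j) \<ominus> f i) \<le> 2 * (1/2) ^ i - 2 * (1/2) ^ (i + j)" for i j
  proof (induction j)
    case 0
    then show ?case using f by (simp add: a_minus_def r_neg)
  next
    case (Suc j)
    have "cnorm A (f (i + Suc j) \<ominus> f i) \<le> cnorm A (f (Suc (i + j)) \<ominus> f (i + j)) + cnorm A (f (i + j) \<ominus> f i)"
      using diff_triangle f by simp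
    with Suc d[of "i + j"] show ?case by simp
  qed
  have step2: "cnorm A (f i \<ominus> f j) \<le> 2 * (1/2) ^ N" if "i \<ge> N" "j \<ge> N" for i j N
  proof -
    have *: "cnorm A (f i \<ominus> f j) \<le> 2 * (1/2) ^ N" if ij: "i \<ge> j" "j \<ge> N" for i j
    proof -
      have "cnorm A (f i \<ominus> f j) \<le> 2 * (1/2) ^ j" using step[of j "i - j"] ij
        by (smt (verit) le_add_diff_inverse zero_less_power half_gt_zero_iff)
      also have "\<dots> \<le> 2 * (1/2) ^ N" using ij by (simp add: power_decreasing)
      finally show ?thesis .
    qed
    show ?thesis using *[of i j] *[of j i] that cnorm_minus[OF f f, of i j] by (cases "i \<ge> j") auto
  qed
  show "\<forall>e>0. \<exists>N. \<forall>i\<ge>N. \<forall>j\<ge>N. cnorm A (f i \<ominus> f j) < e"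
  proof (intro allI impI)
    fix e :: real assume e: "e > 0"
    obtain N where "(1/2) ^ N < e / 2" using real_arch_pow_inv[of "e/2" "1/2"] e by auto
    then show "\<exists>N. \<forall>i\<ge>N. \<forall>j\<ge>N. cnorm A (f i \<ominus> f j) < e"
      using step2[of N] by (intro exI[of _ N]) (smt (verit) field_sum_of_halves)
  qed
qed (use f in auto)

lemma limit_unique:
  assumes f: "\<And>i. f i \<in> carrier A" and x: "x \<in> carrier A" and y: "y \<in> carrier A"
    and "(\<lambda>i. cnorm A (f i \<ominus> x)) \<longlonglongrightarrow> 0" "(\<lambda>i. cnorm A (f i \<ominus> y)) \<longlonglongrightarrow> 0"
  shows "x = y"
proof -
  have "cnorm A (x \<ominus> y) \<le> cnorm A (f i \<ominus> x) + cnorm A (f i \<ominus> y)" for i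
    using diff_triangle[OF x f y, of i] cnorm_minus[OF x f] by simp
  moreover have "(\<lambda>i. cnorm A (f i \<ominus> x) + cnorm A (f i \<ominus> y)) \<longlonglongrightarrow> 0 + 0"
    by (intro tendsto_add assms)
  ultimately have "cnorm A (x \<ominus> y) \<le> 0"
    using LIMSEQ_le_const by (metis (no_types, lifting) add.right_neutral)
  then have "x \<ominus> y = \<zero>" using x y cnorm_nonneg[of "x \<ominus> y"] cnorm_eq_0_iff[of "x \<ominus> y"] by simp
  then show ?thesis using x y by simp
qed

text \<open>
  A fixed point \<open>x\<close> of \<open>x \<mapsto> (h + x\<^sup>2) / 2\<close> satisfies \<open>(1 - x)\<^sup>2 = 1 - h\<close>. The iteration started at zero stays in
  the ball of radius \<open>1/2\<close>, where \<open>F x - F y = (x (x - y) + (x - y) y) / 2\<close> shows that \<open>F\<close> contracts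
  distances by \<open>1/2\<close>.
\<close>

lemma sqrt_one_minus:
  assumes h: "h \<in> carrier A" "adj A h = h" "cnorm A h \<le> 1/2"
  shows "\<exists>c\<in>carrier A. adj A c = c \<and> c \<otimes> c = \<one> \<ominus> h"
proof -
  define F where "F x = (1/2) \<odot> (h \<oplus> x \<otimes> x)" for x
  define g where "g n = (F ^^ n) \<zero>" for n
  have Fc [simp]: "x \<in> carrier A \<Longrightarrow> F x \<in> carrier A" for x using h by (simp add: F_def)
  have gS: "g (Suc n) = F (g n)" for n by (simp add: g_def)
  have gc [simp]: "g n \<in> carrier A" for n by (induction n) (simp_all add: g_def)
  have gn: "cnorm A (g n) \<le> 1/2" for n
  proof (induction n)
    case 0
    then show ?case by (simp add: g_def)
  next
    case (Suc n)
    have "cnorm A (g n \<otimes> g n) \<le> (1/2) * (1/2)"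
      using cnorm_mult[OF gc[of n] gc[of n]] mult_mono[OF Suc Suc] cnorm_nonneg[OF gc] by force
    then have "cnorm A (h \<oplus> g n \<otimes> g n) \<le> 1"
      using cnorm_triangle[OF h(1), of "g n \<otimes> g n"] h(3) by simp
    then show ?case using h(1) by (simp add: gS F_def cnorm_smult)
  qed
  have gadj: "adj A (g n) = g n" for n
    by (induction n) (use h in \<open>simp_all add: g_def F_def adj_smult adj_add adj_mult flip: funpow.simps\<close>,
      simp add: F_def adj_smult adj_add adj_mult h flip: g_def)
  have Fdiff: "cnorm A (F x \<ominus> F y) \<le> (1/2) * (cnorm A x + cnorm A y) * cnorm A (x \<ominus> y)"
    if xy [simp]: "x \<in> carrier A" "y \<in> carrier A" for x y
  proof -
    have "F x \<ominus> F y = (1/2) \<odot> (x \<otimes> x \<ominus> y \<otimes> y)"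
    proof -
      have "F x \<ominus> F y = (1/2) \<odot> (x \<otimes> x) \<oplus> (-1/2) \<odot> (y \<otimes> y) \<oplus> ((1/2) \<odot> h \<oplus> (-1) \<odot> ((1/2) \<odot> h))"
        using h(1) by (simp add: F_def diff_conv_smult smult_add_right smult_smult a_ac)
      also have "\<dots> = (1/2) \<odot> (x \<otimes> x) \<oplus> (-1/2) \<odot> (y \<otimes> y)"
        using h(1) by (simp only: smult_minus_one_cancel smult_closed' m_closed xy a_closed r_zero)
      finally show ?thesis by (simp add: diff_conv_smult smult_add_right smult_smult)
    qed
    moreover have "x \<otimes> x \<ominus> y \<otimes> y = x \<otimes> (x \<ominus> y) \<oplus> (x \<ominus> y) \<otimes> y" using xy by algebra
    ultimately have "cnorm A (F x \<ominus> F y) = 1/2 * cnorm A (x \<otimes> (x \<ominus> y) \<oplus> (x \<ominus> y) \<otimes> y)"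
      by (simp add: cnorm_smult)
    also have "\<dots> \<le> 1/2 * (cnorm A (x \<otimes> (x \<ominus> y)) + cnorm A ((x \<ominus> y) \<otimes> y))"
      using cnorm_triangle[of "x \<otimes> (x \<ominus> y)" "(x \<ominus> y) \<otimes> y"] by simp
    also have "\<dots> \<le> 1/2 * (cnorm A x * cnorm A (x \<ominus> y) + cnorm A (x \<ominus> y) * cnorm A y)"
      using cnorm_mult[of x "x \<ominus> y"] cnorm_mult[of "x \<ominus> y" y] by simp
    finally show ?thesis by (simp add: algebra_simps)
  qed
  have "cnorm A (g (Suc n) \<ominus> g n) \<le> (1/2) ^ n" for n
  proof (induction n)
    case 0
    have "cnorm A (g (Suc 0) \<ominus> \<zero>) \<le> 1" using gn[of "Suc 0"] by (simp add: a_minus_def)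
    then show ?case by (simp add: g_def)
  next
    case (Suc n)
    have "cnorm A (g (Suc (Suc n)) \<ominus> g (Suc n)) \<le> (1/2) * (cnorm A (g (Suc n)) + cnorm A (g n)) * cnorm A (g (Suc n) \<ominus> g n)"
      using Fdiff[OF gc gc, of "Suc n" n] by (simp add: gS)
    also have "\<dots> \<le> (1/2) * 1 * (1/2)^n"
      using gn[of n] gn[of "Suc n"] cnorm_nonneg[OF gc] Suc cnorm_nonneg[of "g (Suc n) \<ominus> g n"]
      by (intro mult_mono) (auto simp: add_increasing)
    finally show ?case by simp
  qed
  then obtain x where x: "x \<in> carrier A" "(\<lambda>i. cnorm A (g i \<ominus> x)) \<longlonglongrightarrow> 0"
    using geometric_convergence[of g] by auto
  have "(\<lambda>i. cnorm A (F (g i) \<ominus> F x)) \<longlonglongrightarrow> 0"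
  proof (rule tendsto_sandwich[OF _ _ tendsto_const])
    show "\<forall>\<^sub>F i in sequentially. cnorm A (F (g i) \<ominus> F x) \<le> (1/2) * (1/2 + cnorm A x) * cnorm A (g i \<ominus> x)"
    proof (rule always_eventually, rule allI)
      fix i
      have "cnorm A (F (g i) \<ominus> F x) \<le> (1/2) * (cnorm A (g i) + cnorm A x) * cnorm A (g i \<ominus> x)"
        using Fdiff x by simp
      also have "\<dots> \<le> (1/2) * (1/2 + cnorm A x) * cnorm A (g i \<ominus> x)"
        using gn[of i] x cnorm_nonneg[of "g i \<ominus> x"] by (intro mult_right_mono) auto
      finally show "cnorm A (F (g i) \<ominus> F x) \<le> (1/2) * (1/2 + cnorm A x) * cnorm A (g i \<ominus> x)" .
    qed
    show "(\<lambda>i. (1/2) * (1/2 + cnorm A x) * cnorm A (g i \<ominus> x)) \<longlonglongrightarrow> 0"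
      using tendsto_mult_right_zero[OF x(2)] by simp
  qed (use cnorm_nonneg x in auto)
  then have "(\<lambda>i. cnorm A (g (Suc i) \<ominus> F x)) \<longlonglongrightarrow> 0" by (simp add: gS)
  moreover have "(\<lambda>i. cnorm A (g (Suc i) \<ominus> x)) \<longlonglongrightarrow> 0" using x(2) LIMSEQ_Suc by blast
  ultimately have xF: "F x = x" using limit_unique[of "\<lambda>i. g (Suc i)"] x by simp
  have "adj A (g i) \<ominus> adj A x = adj A (g i \<ominus> x)" for i using x by (simp add: adj_diff)
  then have "cnorm A (g i \<ominus> adj A x) = cnorm A (g i \<ominus> x)" for i
    using x by (simp add: gadj cnorm_adj)
  then have xadj: "adj A x = x" using limit_unique[of g "adj A x" x] x by simp
  have "(\<one> \<ominus> x) \<otimes> (\<one> \<ominus> x) = \<one> \<ominus> h"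
  proof -
    have x2: "(2::complex) \<odot> F x = h \<oplus> x \<otimes> x" using h(1) x(1) by (simp add: F_def smult_smult)
    have "2 \<odot> x = x \<oplus> x" using smult_add_left[of x 1 1] x(1) by simp
    then have xx: "x \<oplus> x = h \<oplus> x \<otimes> x" using x2 xF by simp
    have "(\<one> \<ominus> x) \<otimes> (\<one> \<ominus> x) = \<one> \<ominus> (x \<oplus> x) \<oplus> x \<otimes> x"
      using x(1) by (simp add: a_minus_def l_distr r_distr minus_add l_minus r_minus a_ac)
    also have "\<dots> = \<one> \<ominus> h" unfolding xx using x(1) h(1) by algebra
    finally show ?thesis .
  qed
  moreover have "adj A (\<one> \<ominus> x) = \<one> \<ominus> x" using x(1) by (simp add: adj_diff xadj)
  ultimately show ?thesis using x(1) by (intro bexI[of _ "\<one> \<ominus> x"]) auto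
qed

text \<open>
  The factor \<open>2\<close> brings \<open>a* a / (2 t)\<close> into the ball of radius \<open>1/2\<close> on which square roots of \<open>1 - h\<close>
  are available.
\<close>

lemma norm_bound_square:
  assumes a: "a \<in> carrier A" and t: "t > 0" "(cnorm A a)\<^sup>2 \<le> t"
  shows "\<exists>c\<in>carrier A. adj A c \<otimes> c = complex_of_real (2 * t) \<odot> \<one> \<ominus> adj A a \<otimes> a"
proof -
  define h where "h = complex_of_real (1 / (2 * t)) \<odot> (adj A a \<otimes> a)"
  have "cnorm A h = (1 / (2 * t)) * (cnorm A a)\<^sup>2"
    using a t by (simp add: h_def cnorm_smult cnorm_cstar norm_divide)
  also have "\<dots> \<le> (1 / (2 * t)) * t" using t by (intro mult_left_mono) auto
  finally have "cnorm A h \<le> 1/2" using t by simp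
  moreover have "adj A h = h" using a by (simp add: h_def adj_smult adj_mult)
  ultimately obtain c where c: "c \<in> carrier A" "adj A c = c" "c \<otimes> c = \<one> \<ominus> h"
    using sqrt_one_minus[of h] a by (auto simp: h_def)
  let ?r = "complex_of_real (sqrt (2 * t))"
  have r: "?r * ?r = complex_of_real (2 * t)" using t
    by (metis of_real_mult real_sqrt_mult_self abs_of_pos zero_less_mult_iff zero_less_numeral)
  have "adj A (?r \<odot> c) \<otimes> (?r \<odot> c) = (?r * ?r) \<odot> (c \<otimes> c)"
    using c(1,2) by (simp add: adj_smult smult_mult_left smult_mult_right smult_smult)
  also have "\<dots> = complex_of_real (2 * t) \<odot> (\<one> \<ominus> h)" by (simp only: r c)
  also have "\<dots> = complex_of_real (2 * t) \<odot> \<one> \<oplus> (-1) \<odot> (complex_of_real (2 * t) \<odot> h)"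
    using a by (simp add: diff_conv_smult smult_add_right smult_smult h_def)
  also have "complex_of_real (2 * t) \<odot> h = adj A a \<otimes> a"
    using a t by (simp add: h_def smult_smult)
  also have "complex_of_real (2 * t) \<odot> \<one> \<oplus> (-1) \<odot> (adj A a \<otimes> a) = complex_of_real (2 * t) \<odot> \<one> \<ominus> adj A a \<otimes> a"
    using a by (simp add: diff_conv_smult)
  finally show ?thesis using c by (intro bexI[of _ "?r \<odot> c"]) auto
qed

end

context star_algebra
begin

lemma gram_diag:
  assumes "\<And>i. i < k \<Longrightarrow> d i \<ge> 0"
  shows "gram A k (\<lambda>i j. if i = j then complex_of_real (d i) \<odot> \<one> else \<zero>)"
  unfolding gram_def
proof (intro exI[of _ k] exI[of _ "\<lambda>l i. if i = l then complex_of_real (sqrt (d l)) \<odot> \<one> else \<zero>"] conjI allI impI)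
  fix i j assume ij: "i < k" "j < k"
  let ?Y = "\<lambda>l i. if i = l then complex_of_real (sqrt (d l)) \<odot> \<one> else \<zero>"
  have r: "complex_of_real (sqrt (d i)) * complex_of_real (sqrt (d i)) = complex_of_real (d i)"
    using assms[OF ij(1)] by (metis of_real_mult real_sqrt_mult_self abs_of_nonneg)
  have "(\<Oplus>l\<in>{..<k}. adj A (?Y l i) \<otimes> ?Y l j) =
    (\<Oplus>l\<in>{..<k}. if i = l then (if i = j then complex_of_real (d l) \<odot> \<one> else \<zero>) else \<zero>)"
    using r by (intro finsum_cong') (auto simp: adj_smult smult_mult_left smult_mult_right smult_smult)
  also have "\<dots> = (if i = j then complex_of_real (d i) \<odot> \<one> else \<zero>)"
    using ij by (subst finsum_singleton) auto
  finally show "(if i = j then complex_of_real (d i) \<odot> \<one> else \<zero>) = (\<Oplus>l\<in>{..<k}. adj A (?Y l i) \<otimes> ?Y l j)"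
    by (rule sym)
qed auto

end

context cstar_algebra
begin

text \<open>
  The self-adjoint matrix \<open>X + X*\<close> lies below a multiple of the identity in the order given by the cone
  of Gram matrices. That this holds for all \<open>X\<close> says that the identity is an order unit.
\<close>

definition dominated :: "nat \<Rightarrow> (nat \<Rightarrow> nat \<Rightarrow> 'a) \<Rightarrow> bool" where
  "dominated k X \<longleftrightarrow> (\<exists>r::real. gram A k (\<lambda>i j. (if i = j then complex_of_real r \<odot> \<one> else \<zero>) \<ominus> (X i j \<oplus> adj A (X j i))))"

lemma dominated_cong:
  assumes "dominated k X" "\<And>i j. i < k \<Longrightarrow> j < k \<Longrightarrow> X i j = X' i j"
  shows "dominated k X'"
proof -
  obtain r :: real where
    "gram A k (\<lambda>i j. (if i = j then complex_of_real r \<odot> \<one> else \<zero>) \<ominus> (X i j \<oplus> adj A (X j i)))"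
    using assms(1) unfolding dominated_def by blast
  then have "gram A k (\<lambda>i j. (if i = j then complex_of_real r \<odot> \<one> else \<zero>) \<ominus> (X' i j \<oplus> adj A (X' j i)))"
    by (rule gram_cong) (simp add: assms(2))
  then show ?thesis unfolding dominated_def by blast
qed

lemma dominated_add:
  assumes "dominated k X" "dominated k Y"
    and X: "\<And>i j. i < k \<Longrightarrow> j < k \<Longrightarrow> X i j \<in> carrier A" and Y: "\<And>i j. i < k \<Longrightarrow> j < k \<Longrightarrow> Y i j \<in> carrier A"
  shows "dominated k (\<lambda>i j. X i j \<oplus> Y i j)"
proof -
  obtain r s :: real where
    "gram A k (\<lambda>i j. (if i = j then complex_of_real r \<odot> \<one> else \<zero>) \<ominus> (X i j \<oplus> adj A (X j i)))"
    "gram A k (\<lambda>i j. (if i = j then complex_of_real s \<odot> \<one> else \<zero>) \<ominus> (Y i j \<oplus> adj A (Y j i)))"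
    using assms(1,2) unfolding dominated_def by blast
  from gram_add[OF this] have "gram A k (\<lambda>i j. (if i = j then complex_of_real (r + s) \<odot> \<one> else \<zero>) \<ominus>
      (X i j \<oplus> Y i j \<oplus> adj A (X j i \<oplus> Y j i)))"
    by (rule gram_cong) (auto simp: X Y diff_conv_smult adj_add smult_add_left smult_add_right a_ac)
  then show ?thesis unfolding dominated_def by blast
qed

text \<open>
  If \<open>a\<close> and \<open>b\<close> differ, the vector \<open>y\<close> with \<open>x*\<close> at position \<open>a\<close> and \<open>-1\<close> at position \<open>b\<close> has a Gram matrix with \<open>-x\<close> and
  \<open>-x*\<close> off the diagonal, as required, and \<open>x x*\<close> and \<open>1\<close> on the diagonal. Adding the square
  \<open>2 t - x x*\<close> at position \<open>a\<close> and a non-negative scalar diagonal makes the diagonal constant. The same choice of \<open>y\<close> works for \<open>a = b\<close>, where everything takes place in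
  one entry.
\<close>

lemma dominated_single:
  assumes x: "x \<in> carrier A" and a: "a < k" and b: "b < k"
  shows "dominated k (\<lambda>i j. if i = a \<and> j = b then x else \<zero>)"
proof -
  define t where "t = (cnorm A x)\<^sup>2 + 1"
  have t: "t > 0" "(cnorm A (adj A x))\<^sup>2 \<le> t" using x by (auto simp: t_def cnorm_adj add_nonneg_pos)
  obtain c where c: "c \<in> carrier A" "adj A c \<otimes> c = complex_of_real (2 * t) \<odot> \<one> \<ominus> x \<otimes> adj A x"
    using norm_bound_square[OF _ t] x by auto
  define y where "y m = (if m = a then adj A x else \<zero>) \<ominus> (if m = b then \<one> else \<zero>)" for m
  define z where "z m = (if m = a then c else \<zero>)" for m
  define d where "d m = (2 * t + 1) - (if m = a then 2 * t else 0) - (if m = b then 1 else 0)" for m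
  have yc: "y m \<in> carrier A" and zc: "z m \<in> carrier A" for m using x c by (auto simp: y_def z_def)
  have d: "d m \<ge> 0" for m using t by (auto simp: d_def)
  have "gram A k (\<lambda>i j. (adj A (y i) \<otimes> y j \<oplus> adj A (z i) \<otimes> z j) \<oplus> (if i = j then complex_of_real (d i) \<odot> \<one> else \<zero>))"
    using gram_add[OF gram_add[OF gram_single gram_single] gram_diag] yc zc d by simp
  then have "gram A k (\<lambda>i j. (if i = j then complex_of_real (2 * t + 1) \<odot> \<one> else \<zero>) \<ominus>
     ((if i = a \<and> j = b then x else \<zero>) \<oplus> adj A (if j = a \<and> i = b then x else \<zero>)))"
  proof (rule gram_cong)
    fix i j assume "i < k" "j < k"
    define T where "T = complex_of_real (2 * t) \<odot> \<one>"
    have [simp]: "T \<in> carrier A" by (simp add: T_def)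
    have T1: "complex_of_real (2 * t + 1) \<odot> \<one> = T \<oplus> \<one>"
      using smult_add_left[of \<one> "complex_of_real (2 * t)" 1] by (simp add: T_def)
    have Tm: "complex_of_real (- (2 * t)) \<odot> \<one> = \<ominus> T"
      by (simp add: T_def minus_conv_smult smult_smult)
    have dd: "complex_of_real (d i) \<odot> \<one> =
       T \<oplus> \<one> \<ominus> (if i = a then T else \<zero>) \<ominus> (if i = b then \<one> else \<zero>)"
    proof (cases "i = a"; cases "i = b")
      assume "i = a" "i = b"
      then have "d i = 0" by (simp add: d_def)
      then have "complex_of_real (d i) \<odot> \<one> = \<zero>" by simp
      also have "\<zero> = T \<oplus> \<one> \<ominus> T \<ominus> \<one>" by (simp add: group_simps)
      finally show ?thesis using \<open>i = a\<close> \<open>i = b\<close> by simp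
    next
      assume "i = a" "i \<noteq> b"
      then have "d i = 1" by (simp add: d_def)
      then have "complex_of_real (d i) \<odot> \<one> = \<one>" by simp
      also have "\<one> = T \<oplus> \<one> \<ominus> T \<ominus> \<zero>" by (simp add: group_simps)
      finally show ?thesis using \<open>i = a\<close> \<open>i \<noteq> b\<close> by simp
    next
      assume "i \<noteq> a" "i = b"
      then have "d i = 2 * t" by (simp add: d_def)
      then have "complex_of_real (d i) \<odot> \<one> = T" by (simp add: T_def)
      also have "T = T \<oplus> \<one> \<ominus> \<zero> \<ominus> \<one>" by (simp add: group_simps)
      finally show ?thesis using \<open>i \<noteq> a\<close> \<open>i = b\<close> by simp
    next
      assume "i \<noteq> a" "i \<noteq> b"
      then have "d i = 2 * t + 1" by (simp add: d_def)
      then have "complex_of_real (d i) \<odot> \<one> = T \<oplus> \<one>" by (simp only: T1)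
      also have "\<dots> = T \<oplus> \<one> \<ominus> \<zero> \<ominus> \<zero>" by (simp add: group_simps)
      finally show ?thesis using \<open>i \<noteq> a\<close> \<open>i \<noteq> b\<close> by simp
    qed
    have cc: "adj A (z i) \<otimes> z j = (if i = a \<and> j = a then T \<ominus> x \<otimes> adj A x else \<zero>)"
      using c x by (auto simp: z_def T_def)
    define x' where "x' = adj A x"
    have [simp]: "x' \<in> carrier A" using x by (simp add: x'_def)
    have yy: "adj A (y i) \<otimes> y j = ((if i = a then x else \<zero>) \<ominus> (if i = b then \<one> else \<zero>)) \<otimes>
        ((if j = a then x' else \<zero>) \<ominus> (if j = b then \<one> else \<zero>))"
      using x by (auto simp: y_def adj_diff x'_def)
    show "(adj A (y i) \<otimes> y j \<oplus> adj A (z i) \<otimes> z j) \<oplus> (if i = j then complex_of_real (d i) \<odot> \<one> else \<zero>) =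
      (if i = j then complex_of_real (2 * t + 1) \<odot> \<one> else \<zero>) \<ominus>
        ((if i = a \<and> j = b then x else \<zero>) \<oplus> adj A (if j = a \<and> i = b then x else \<zero>))"
      using x unfolding yy cc dd T1 x'_def[symmetric] if_distrib[of "adj A"] adj_zero
      by (cases "i = a"; cases "i = b"; cases "j = a"; cases "j = b"; cases "i = j"; simp add: group_ring_simps)
  qed
  then show ?thesis unfolding dominated_def by blast
qed

end

section \<open>Extension of positive functionals\<close>

context cstar_algebra
begin

lemma dominated_all:
  assumes X: "\<And>i j. i < k \<Longrightarrow> j < k \<Longrightarrow> X i j \<in> carrier A"
  shows "dominated k X"
proof -
  have "dominated k (\<lambda>i j. if (i, j) \<in> I then X i j else \<zero>)" if "finite I" "I \<subseteq> {..<k} \<times> {..<k}" for I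
    using that
  proof (induction I rule: finite_induct)
    case empty
    have "gram A k (\<lambda>i j. (if i = j then complex_of_real 0 \<odot> \<one> else \<zero>) \<ominus> (\<zero> \<oplus> adj A \<zero>))"
      by (rule gram_cong[OF gram_zero]) simp
    then show ?case unfolding dominated_def by auto
  next
    case (insert p I)
    obtain a b where p: "p = (a, b)" by (cases p)
    have ab: "a < k" "b < k" using insert p by auto
    have "dominated k (\<lambda>i j. (if (i, j) \<in> I then X i j else \<zero>) \<oplus> (if i = a \<and> j = b then X a b else \<zero>))"
      using insert X ab by (intro dominated_add dominated_single) auto
    then show ?case
      by (rule dominated_cong) (use insert p X in auto)
  qed
  from this[of "{..<k} \<times> {..<k}"] show ?thesis
    by (auto intro: dominated_cong)
qed

end

context star_space
begin

lemma smult_left_cancel_zero: "x \<in> carrier A \<Longrightarrow> a + b = 0 \<Longrightarrow> a \<odot> x \<oplus> b \<odot> x = \<zero>"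
  using smult_add_left[of x a b] by simp

text \<open>
  The extension theorem of M. Riesz, stated for graphs: \<open>G0\<close> is the graph of a real-linear functional on
  a subspace that contains the order unit \<open>e\<close>, non-negative on the cone \<open>K\<close>. Unions of chains of graphs are
  graphs, so Zorn's lemma provides a maximal one. It is defined everywhere because a value \<open>a\<close> at a new
  vector \<open>v\<close> is admissible as soon as it separates the sets \<open>L\<close> and \<open>U\<close>, and both of these are
  non-empty by the order unit property.
\<close>

lemma riesz_extension:
  fixes G0 :: "('a \<times> real) set"
  assumes K: "K \<subseteq> carrier A" "\<And>x y. x \<in> K \<Longrightarrow> y \<in> K \<Longrightarrow> x \<oplus> y \<in> K"
      "\<And>r x. r \<ge> 0 \<Longrightarrow> x \<in> K \<Longrightarrow> complex_of_real r \<odot> x \<in> K"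
    and e: "e \<in> carrier A" "\<And>x. x \<in> carrier A \<Longrightarrow> \<exists>r. complex_of_real r \<odot> e \<ominus> x \<in> K"
    and G0: "G0 \<subseteq> carrier A \<times> UNIV" "(e, t0) \<in> G0"
      "\<And>x y s t. (x, s) \<in> G0 \<Longrightarrow> (y, t) \<in> G0 \<Longrightarrow> (x \<oplus> y, s + t) \<in> G0"
      "\<And>r x s. (x, s) \<in> G0 \<Longrightarrow> (complex_of_real r \<odot> x, r * s) \<in> G0"
      "\<And>x s. (x, s) \<in> G0 \<Longrightarrow> x \<in> K \<Longrightarrow> s \<ge> 0"
  obtains g where "\<And>x y. x \<in> carrier A \<Longrightarrow> y \<in> carrier A \<Longrightarrow> g (x \<oplus> y) = g x + g y"
    "\<And>r x. x \<in> carrier A \<Longrightarrow> g (complex_of_real r \<odot> x) = r * g x"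
    "\<And>x. x \<in> K \<Longrightarrow> g x \<ge> 0" "\<And>x s. (x, s) \<in> G0 \<Longrightarrow> g x = s"
proof -
  define good where "good = {G :: ('a \<times> real) set. G \<subseteq> carrier A \<times> UNIV \<and> G0 \<subseteq> G \<and>
     (\<forall>x y s t. (x, s) \<in> G \<longrightarrow> (y, t) \<in> G \<longrightarrow> (x \<oplus> y, s + t) \<in> G) \<and>
     (\<forall>r x s. (x, s) \<in> G \<longrightarrow> (complex_of_real r \<odot> x, r * s) \<in> G) \<and>
     (\<forall>x s. (x, s) \<in> G \<longrightarrow> x \<in> K \<longrightarrow> s \<ge> 0)}"
  have "G0 \<in> good" using G0 unfolding good_def by blast
  moreover have "\<Union> \<C> \<in> good" if ne: "\<C> \<noteq> {}" and ch: "subset.chain good \<C>" for \<C>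
  proof -
    have sub: "\<And>G. G \<in> \<C> \<Longrightarrow> G \<in> good" and tot: "\<And>G H. G \<in> \<C> \<Longrightarrow> H \<in> \<C> \<Longrightarrow> G \<subseteq> H \<or> H \<subseteq> G"
      using ch unfolding subset_chain_def by auto
    have "(x \<oplus> y, s + t) \<in> \<Union> \<C>" if xs: "(x, s) \<in> \<Union> \<C>" and yt: "(y, t) \<in> \<Union> \<C>" for x y s t
    proof -
      obtain G H where GH: "G \<in> \<C>" "(x, s) \<in> G" "H \<in> \<C>" "(y, t) \<in> H" using xs yt by blast
      obtain M where M: "M \<in> \<C>" "(x, s) \<in> M" "(y, t) \<in> M" using tot[OF GH(1,3)] GH by blast
      then have "(x \<oplus> y, s + t) \<in> M" using sub[OF M(1)] unfolding good_def by blast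
      then show ?thesis using M(1) by blast
    qed
    moreover have "\<Union> \<C> \<subseteq> carrier A \<times> UNIV" using sub unfolding good_def by blast
    moreover have "G0 \<subseteq> \<Union> \<C>" using sub ne unfolding good_def by blast
    moreover have "(complex_of_real r \<odot> x, r * s) \<in> \<Union> \<C>" if "(x, s) \<in> \<Union> \<C>" for r x s
      using sub that unfolding good_def by blast
    moreover have "s \<ge> 0" if "(x, s) \<in> \<Union> \<C>" "x \<in> K" for x s
      using sub that unfolding good_def by blast
    ultimately show ?thesis unfolding good_def by blast
  qed
  ultimately obtain G where G: "G \<in> good" and max: "\<And>H. H \<in> good \<Longrightarrow> G \<subseteq> H \<Longrightarrow> H = G"
    using subset_Zorn_nonempty[of good] by blast
  have Gc: "x \<in> carrier A" if "(x, s) \<in> G" for x s using G that unfolding good_def by blast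
  have Gadd: "(x \<oplus> y, s + t) \<in> G" if "(x, s) \<in> G" "(y, t) \<in> G" for x y s t
    using G that unfolding good_def by blast
  have Gsc: "(complex_of_real r \<odot> x, r * s) \<in> G" if "(x, s) \<in> G" for r x s
    using G that unfolding good_def by blast
  have Gpos: "s \<ge> 0" if "(x, s) \<in> G" "x \<in> K" for x s
    using G that unfolding good_def by blast
  have GG0: "G0 \<subseteq> G" using G unfolding good_def by blast
  have Gneg: "(\<ominus> x, - s) \<in> G" if "(x, s) \<in> G" for x s
    using Gsc[OF that, of "-1"] Gc[OF that] by (simp add: minus_conv_smult)
  have Gdiff: "(x \<ominus> y, s - t) \<in> G" if "(x, s) \<in> G" "(y, t) \<in> G" for x y s t
    using Gadd[OF that(1) Gneg[OF that(2)]] by (simp add: a_minus_def)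
  have K0: "\<zero> \<in> K"
  proof -
    obtain r where "complex_of_real r \<odot> e \<ominus> \<zero> \<in> K" using e(2)[of \<zero>] by auto
    from K(3)[OF order_refl this] e(1) show ?thesis by simp
  qed
  have single: "s = t" if "(x, s) \<in> G" "(x, t) \<in> G" for x s t
    using Gpos[OF Gdiff[OF that]] Gpos[OF Gdiff[OF that(2,1)]] Gc[OF that(1)] K0 by simp
  have dom: "\<exists>s. (v, s) \<in> G" if v: "v \<in> carrier A" for v
  proof -
    define L where "L = {t. \<exists>x. (x, t) \<in> G \<and> v \<ominus> x \<in> K}"
    define U where "U = {t. \<exists>x. (x, t) \<in> G \<and> x \<ominus> v \<in> K}"
    have eG: "(e, t0) \<in> G" using GG0 G0(2) by blast
    have "L \<noteq> {}"
    proof -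
      obtain r where r: "complex_of_real r \<odot> e \<ominus> (\<ominus> v) \<in> K" using e(2)[of "\<ominus> v"] v by auto
      have "complex_of_real r \<odot> e \<ominus> (\<ominus> v) = v \<ominus> complex_of_real (- r) \<odot> e"
        using v e(1) by (simp add: diff_conv_smult minus_conv_smult smult_smult a_ac)
      then show ?thesis using r Gsc[OF eG, of "- r"] unfolding L_def by auto
    qed
    have "U \<noteq> {}"
    proof -
      obtain r where r: "complex_of_real r \<odot> e \<ominus> v \<in> K" using e(2)[of v] v by auto
      then show ?thesis using r Gsc[OF eG, of r] unfolding U_def by auto
    qed
    have LU: "l \<le> u" if lu: "l \<in> L" "u \<in> U" for l u
    proof -
      obtain x y where xy: "(x, l) \<in> G" "v \<ominus> x \<in> K" "(y, u) \<in> G" "y \<ominus> v \<in> K"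
        using lu unfolding L_def U_def by blast
      have "(y \<ominus> v) \<oplus> (v \<ominus> x) = y \<ominus> x"
        using Gc[OF xy(1)] Gc[OF xy(3)] v by (simp add: group_simps)
      then have "y \<ominus> x \<in> K" using K(2)[OF xy(4,2)] by simp
      then show ?thesis using Gpos[OF Gdiff[OF xy(3,1)]] by simp
    qed
    define a where "a = Sup L"
    have bdd: "bdd_above L" using LU \<open>U \<noteq> {}\<close> unfolding bdd_above_def by blast
    have aL: "l \<le> a" if "l \<in> L" for l unfolding a_def using bdd that by (rule cSup_upper[rotated])
    have aU: "a \<le> u" if "u \<in> U" for u unfolding a_def using \<open>L \<noteq> {}\<close> LU that by (intro cSup_least) auto
    define H where "H = {(x \<oplus> complex_of_real c \<odot> v, t + c * a) | x t c. (x, t) \<in> G}"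
    have GH: "G \<subseteq> H"
    proof
      fix z assume z: "z \<in> G"
      obtain x t where "z = (x, t)" by (cases z)
      then show "z \<in> H" using z Gc[of x t] v unfolding H_def by (intro CollectI exI[of _ x] exI[of _ t] exI[of _ 0]) simp
    qed
    have "H \<in> good"
    proof -
      have h1: "H \<subseteq> carrier A \<times> UNIV" using Gc v unfolding H_def by auto
      have h2: "G0 \<subseteq> H" using GG0 GH by blast
      have h3: "(x \<oplus> y, s + t) \<in> H" if xH: "(x, s) \<in> H" "(y, t) \<in> H" for x y s t
      proof -
        obtain x' y' and s' c t' d :: real where *: "x = x' \<oplus> complex_of_real c \<odot> v" "s = s' + c * a" "(x', s') \<in> G"
          "y = y' \<oplus> complex_of_real d \<odot> v" "t = t' + d * a" "(y', t') \<in> G"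
          using xH unfolding H_def by blast
        have "x \<oplus> y = (x' \<oplus> y') \<oplus> complex_of_real (c + d) \<odot> v"
          using * Gc[OF *(3)] Gc[OF *(6)] v by (simp add: smult_add_left a_ac)
        moreover have "s + t = (s' + t') + (c + d) * a" using * by (simp add: algebra_simps)
        ultimately show ?thesis using Gadd[OF *(3,6)] unfolding H_def by blast
      qed
      have h4: "(complex_of_real r \<odot> x, r * s) \<in> H" if xH: "(x, s) \<in> H" for r x s
      proof -
        obtain x' and s' c :: real where *: "x = x' \<oplus> complex_of_real c \<odot> v" "s = s' + c * a" "(x', s') \<in> G"
          using xH unfolding H_def by blast
        have "complex_of_real r \<odot> x = complex_of_real r \<odot> x' \<oplus> complex_of_real (r * c) \<odot> v"
          using * Gc[OF *(3)] v by (simp add: smult_add_right smult_smult)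
        moreover have "r * s = r * s' + (r * c) * a" using * by (simp add: algebra_simps)
        ultimately show ?thesis using Gsc[OF *(3), of r] unfolding H_def by blast
      qed
      have h5: "s \<ge> 0" if xs: "(x, s) \<in> H" "x \<in> K" for x s
      proof -
        obtain x' and s' c :: real where *: "x = x' \<oplus> complex_of_real c \<odot> v" "s = s' + c * a" "(x', s') \<in> G"
          using xs unfolding H_def by blast
        note x' = Gc[OF *(3)]
        consider "c = 0" | "c > 0" | "c < 0" by linarith
        then show ?thesis
        proof cases
          case 1
          then show ?thesis using * x' v xs(2) Gpos[OF *(3)] by simp
        next
          case 2
          have "complex_of_real (1 / c) \<odot> x \<in> K" by (rule K(3)[OF _ xs(2)]) (use 2 in simp)
          also have "complex_of_real (1 / c) \<odot> x = v \<ominus> complex_of_real (- 1 / c) \<odot> x'"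
            using *(1) x' v 2 by (simp add: smult_add_right smult_smult diff_conv_smult a_ac)
          finally have "(- 1 / c) * s' \<in> L" using Gsc[OF *(3), of "- 1 / c"] unfolding L_def by blast
          from aL[OF this] show ?thesis using 2 *(2) by (simp add: field_simps)
        next
          case 3
          have "complex_of_real (- 1 / c) \<odot> x \<in> K" by (rule K(3)[OF _ xs(2)]) (use 3 in simp)
          also have "complex_of_real (- 1 / c) \<odot> x = complex_of_real (- 1 / c) \<odot> x' \<ominus> v"
            using *(1) x' v 3 by (simp add: smult_add_right smult_smult diff_conv_smult a_ac)
          finally have "(- 1 / c) * s' \<in> U" using Gsc[OF *(3), of "- 1 / c"] unfolding U_def by blast
          from aU[OF this] show ?thesis using 3 *(2) by (simp add: field_simps)
        qed
      qed
      show ?thesis unfolding good_def using h1 h2 h3 h4 h5 by blast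
    qed
    then have "H = G" using max GH by blast
    moreover have "(v, 0 * t0 + 1 * a) \<in> H"
    proof -
      have "(complex_of_real 0 \<odot> e, 0 * t0) \<in> G" by (rule Gsc[OF eG])
      moreover have "v = complex_of_real 0 \<odot> e \<oplus> complex_of_real 1 \<odot> v" using v e(1) by simp
      ultimately show ?thesis unfolding H_def by blast
    qed
    ultimately show ?thesis by blast
  qed
  define g where "g x = (THE s. (x, s) \<in> G)" for x
  have gG: "g x = s" if "(x, s) \<in> G" for x s
    unfolding g_def using that single by blast
  show thesis
  proof (rule that[of g])
    fix x y assume "x \<in> carrier A" "y \<in> carrier A"
    then obtain s t where "(x, s) \<in> G" "(y, t) \<in> G" using dom by blast
    then show "g (x \<oplus> y) = g x + g y" using gG Gadd by metis
  next
    fix r x assume "x \<in> carrier A"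
    then obtain s where "(x, s) \<in> G" using dom by blast
    then show "g (complex_of_real r \<odot> x) = r * g x" using gG Gsc by metis
  next
    fix x assume x: "x \<in> K"
    then obtain s where "(x, s) \<in> G" using dom K(1) by blast
    then show "g x \<ge> 0" using gG Gpos x by metis
  next
    fix x s assume "(x, s) \<in> G0"
    then show "g x = s" using gG GG0 by blast
  qed
qed

text \<open>
  Reduction to the real case: \<open>Re f\<close> extends to a real functional \<open>g\<close> that is non-negative on
  \<open>K = {x. x + x* \<in> C}\<close>, and \<open>s x = g x - \<i> g (\<i> x)\<close>. For \<open>x\<close> in \<open>C\<close> both \<open>\<i> x\<close> and \<open>- \<i> x\<close> belong to \<open>K\<close>,
  since they are skew-adjoint, hence \<open>g (\<i> x) = 0\<close> and \<open>s x = g x \<ge> 0\<close>.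
\<close>

theorem krein_extension:
  assumes C: "C \<subseteq> carrier A" "\<And>x y. x \<in> C \<Longrightarrow> y \<in> C \<Longrightarrow> x \<oplus> y \<in> C" "\<zero> \<in> C"
      "\<And>r x. r \<ge> 0 \<Longrightarrow> x \<in> C \<Longrightarrow> complex_of_real r \<odot> x \<in> C" "\<And>x. x \<in> C \<Longrightarrow> adj A x = x"
    and e: "e \<in> carrier A" "adj A e = e"
      "\<And>x. x \<in> carrier A \<Longrightarrow> \<exists>r. complex_of_real r \<odot> e \<ominus> (x \<oplus> adj A x) \<in> C"
    and W: "Module.submodule W complex_field A" "e \<in> W" "\<And>x. x \<in> W \<Longrightarrow> adj A x \<in> W"
    and f: "lin_fun A W f" "f e = 1" "\<And>x. x \<in> W \<Longrightarrow> x \<in> C \<Longrightarrow> f x \<in> \<real>\<^sub>\<ge>\<^sub>0"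
  obtains s where "lin_fun A (carrier A) s" "\<And>x. x \<in> W \<Longrightarrow> s x = f x" "\<And>x. x \<in> C \<Longrightarrow> s x \<in> \<real>\<^sub>\<ge>\<^sub>0"
proof -
  have Wc: "W \<subseteq> carrier A" using vs.submoduleE(1)[OF W(1)] .
  have Wadd: "x \<oplus> y \<in> W" if "x \<in> W" "y \<in> W" for x y using vs.submoduleE(5)[OF W(1)] that by blast
  have Wsm: "c \<odot> x \<in> W" if "x \<in> W" for c x using vs.submoduleE(4)[OF W(1), of c x] that by simp
  have fadd: "f (x \<oplus> y) = f x + f y" if "x \<in> W" "y \<in> W" for x y using f(1) that unfolding lin_fun_def by blast
  have fsm: "f (c \<odot> x) = c * f x" if "x \<in> W" for c x using f(1) that unfolding lin_fun_def by blast
  have freal: "f h \<in> \<real>" if h: "h \<in> W" "adj A h = h" for h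
  proof -
    have hc: "h \<in> carrier A" using h Wc by blast
    obtain r where "complex_of_real r \<odot> e \<ominus> (h \<oplus> adj A h) \<in> C" using e(3)[OF hc] by blast
    moreover have eq: "complex_of_real r \<odot> e \<ominus> (h \<oplus> adj A h) = complex_of_real r \<odot> e \<oplus> (-1) \<odot> (h \<oplus> h)"
      using hc e(1) h by (simp add: diff_conv_smult)
    moreover have "complex_of_real r \<odot> e \<oplus> (-1) \<odot> (h \<oplus> h) \<in> W" using Wadd Wsm h W(2) by blast
    ultimately have "f (complex_of_real r \<odot> e \<oplus> (-1) \<odot> (h \<oplus> h)) \<in> \<real>\<^sub>\<ge>\<^sub>0" using f(3) by simp
    moreover have "f (complex_of_real r \<odot> e \<oplus> (-1) \<odot> (h \<oplus> h)) = complex_of_real r - 2 * f h"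
      using h W(2) by (simp add: fadd fsm Wadd Wsm f(2))
    ultimately have "complex_of_real r - 2 * f h \<in> \<real>\<^sub>\<ge>\<^sub>0" by simp
    then show ?thesis by (simp add: complex_nonneg_Reals_iff complex_is_Real_iff)
  qed
  have fadj: "f (adj A w) = cnj (f w)" if w: "w \<in> W" for w
  proof -
    have wc: "w \<in> carrier A" using w Wc by blast
    have "f (w \<oplus> adj A w) \<in> \<real>" using w W(3) wc by (intro freal Wadd) (simp_all add: adj_add a_ac)
    moreover have "f (\<i> \<odot> w \<oplus> (- \<i>) \<odot> adj A w) \<in> \<real>"
      using w W(3) wc by (intro freal Wadd Wsm) (simp_all add: adj_add adj_smult a_ac)
    ultimately show ?thesis using w W(3)
      by (simp add: fadd fsm Wsm complex_is_Real_iff complex_eq_iff)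
  qed
  define K where "K = {x \<in> carrier A. x \<oplus> adj A x \<in> C}"
  obtain g where g: "\<And>x y. x \<in> carrier A \<Longrightarrow> y \<in> carrier A \<Longrightarrow> g (x \<oplus> y) = g x + g y"
    "\<And>r x. x \<in> carrier A \<Longrightarrow> g (complex_of_real r \<odot> x) = r * g x"
    "\<And>x. x \<in> K \<Longrightarrow> g x \<ge> 0" "\<And>x s. (x, s) \<in> (\<lambda>w. (w, Re (f w))) ` W \<Longrightarrow> g x = s"
  proof (rule riesz_extension[of K e "(\<lambda>w. (w, Re (f w))) ` W" 1])
    show "K \<subseteq> carrier A" by (auto simp: K_def)
    show "x \<oplus> y \<in> K" if "x \<in> K" "y \<in> K" for x y
    proof -
      have "x \<oplus> y \<oplus> adj A (x \<oplus> y) = (x \<oplus> adj A x) \<oplus> (y \<oplus> adj A y)"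
        using that by (simp add: K_def adj_add a_ac)
      then show ?thesis using that C(2) by (simp add: K_def)
    qed
    show "complex_of_real r \<odot> x \<in> K" if "r \<ge> 0" "x \<in> K" for r x
    proof -
      have "complex_of_real r \<odot> x \<oplus> adj A (complex_of_real r \<odot> x) = complex_of_real r \<odot> (x \<oplus> adj A x)"
        using that by (simp add: K_def adj_smult smult_add_right)
      then show ?thesis using that C(4) by (simp add: K_def)
    qed
    show "\<exists>r. complex_of_real r \<odot> e \<ominus> x \<in> K" if x: "x \<in> carrier A" for x
    proof -
      obtain r where r: "complex_of_real r \<odot> e \<ominus> (x \<oplus> adj A x) \<in> C" using e(3)[OF x] by blast
      have "complex_of_real (r/2) \<odot> e \<ominus> x \<oplus> adj A (complex_of_real (r/2) \<odot> e \<ominus> x) =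
          (complex_of_real (r/2) \<odot> e \<oplus> complex_of_real (r/2) \<odot> e) \<oplus> (-1) \<odot> (x \<oplus> adj A x)"
        using x e(1,2) by (simp add: diff_conv_smult adj_add adj_smult smult_add_right a_ac)
      also have "complex_of_real (r/2) \<odot> e \<oplus> complex_of_real (r/2) \<odot> e = complex_of_real r \<odot> e"
        using e(1) by (simp flip: smult_add_left)
      finally have "complex_of_real (r/2) \<odot> e \<ominus> x \<in> K" using r x e(1) by (simp add: K_def diff_conv_smult)
      then show ?thesis by blast
    qed
    show "(\<lambda>w. (w, Re (f w))) ` W \<subseteq> carrier A \<times> UNIV" using Wc by blast
    show "(e, 1) \<in> (\<lambda>w. (w, Re (f w))) ` W" using W(2) f(2) by (auto intro!: image_eqI[of _ _ e])
    show "(x \<oplus> y, s + t) \<in> (\<lambda>w. (w, Re (f w))) ` W"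
      if "(x, s) \<in> (\<lambda>w. (w, Re (f w))) ` W" "(y, t) \<in> (\<lambda>w. (w, Re (f w))) ` W" for x y s t
      using that Wadd fadd by (auto intro!: image_eqI[of _ _ "x \<oplus> y"])
    show "(complex_of_real r \<odot> x, r * s) \<in> (\<lambda>w. (w, Re (f w))) ` W"
      if "(x, s) \<in> (\<lambda>w. (w, Re (f w))) ` W" for r x s
      using that Wsm fsm by (auto intro!: image_eqI[of _ _ "complex_of_real r \<odot> x"])
    show "s \<ge> 0" if "(x, s) \<in> (\<lambda>w. (w, Re (f w))) ` W" "x \<in> K" for x s
    proof -
      have x: "x \<in> W" "s = Re (f x)" using that by auto
      have "f (x \<oplus> adj A x) \<in> \<real>\<^sub>\<ge>\<^sub>0" using x(1) that(2) W(3) Wadd f(3) by (auto simp: K_def)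
      then show ?thesis using x W(3) by (simp add: fadd fadj complex_nonneg_Reals_iff)
    qed
  qed (use e in auto)
  define s where "s x = complex_of_real (g x) - \<i> * complex_of_real (g (\<i> \<odot> x))" for x
  show thesis
  proof (rule that[of s])
    have sadd: "s (x \<oplus> y) = s x + s y" if "x \<in> carrier A" "y \<in> carrier A" for x y
      using that by (simp add: s_def g(1) smult_add_right algebra_simps)
    moreover have "s (c \<odot> x) = c * s x" if x: "x \<in> carrier A" for c x
    proof -
      have 1: "s (complex_of_real r \<odot> x) = complex_of_real r * s x" if "x \<in> carrier A" for r x
      proof -
        have "\<i> \<odot> (complex_of_real r \<odot> x) = complex_of_real r \<odot> (\<i> \<odot> x)"
          using that by (simp add: smult_smult mult.commute)
        then show ?thesis using that by (simp add: s_def g(2) algebra_simps)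
      qed
      have 2: "s (\<i> \<odot> x) = \<i> * s x"
      proof -
        have "g (\<i> \<odot> (\<i> \<odot> x)) = - g x" using g(2)[OF x, of "-1"] x by (simp add: smult_smult)
        then show ?thesis by (simp add: s_def algebra_simps flip: mult.assoc)
      qed
      have "c \<odot> x = complex_of_real (Re c) \<odot> x \<oplus> complex_of_real (Im c) \<odot> (\<i> \<odot> x)"
        using x complex_eq[of c] by (simp add: smult_smult mult.commute flip: smult_add_left)
      then have "s (c \<odot> x) = complex_of_real (Re c) * s x + complex_of_real (Im c) * (\<i> * s x)"
        using x by (simp add: sadd 1 2)
      also have "\<dots> = (complex_of_real (Re c) + \<i> * complex_of_real (Im c)) * s x" by (simp add: algebra_simps)
      finally show ?thesis using complex_eq[of c] by simp
    qed
    ultimately show "lin_fun A (carrier A) s" unfolding lin_fun_def by blast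
  next
    fix x assume x: "x \<in> W"
    have "g x = Re (f x)" using g(4) x by blast
    moreover have "g (\<i> \<odot> x) = Re (f (\<i> \<odot> x))" using g(4) Wsm[OF x] by blast
    ultimately show "s x = f x" using fsm[OF x] by (simp add: s_def complex_eq_iff)
  next
    fix x assume x: "x \<in> C"
    then have xc: "x \<in> carrier A" using C(1) by blast
    have ax: "adj A x = x" using C(5) x .
    have "x \<in> K" using x xc C(2) by (simp add: K_def ax)
    then have "g x \<ge> 0" by (rule g(3))
    moreover have "c \<odot> x \<in> K" if "Re c = 0" for c
    proof -
      have "c \<odot> x \<oplus> adj A (c \<odot> x) = \<zero>"
        using xc that by (simp add: adj_smult ax smult_left_cancel_zero complex_eq_iff)
      then show ?thesis using xc C(3) by (simp add: K_def)
    qed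
    then have "g (\<i> \<odot> x) \<ge> 0" "g ((-\<i>) \<odot> x) \<ge> 0" by (auto intro!: g(3))
    then have "g (\<i> \<odot> x) = 0" using g(2)[of "\<i> \<odot> x" "-1"] xc by (simp add: smult_smult)
    ultimately show "s x \<in> \<real>\<^sub>\<ge>\<^sub>0" by (simp add: s_def complex_nonneg_Reals_iff)
  qed
qed

end

section \<open>States on matrix amplifications\<close>

lemma star_space_mat_alg:
  assumes "star_algebra A" shows "star_space (mat_alg k A)"
proof -
  interpret star_algebra A by fact
  have ent: "X $$ (i, j) \<in> carrier A" if "X \<in> carrier (mat_alg k A)" "i < k" "j < k" for X i j
    using that by (simp add: mat_alg_carrier_iff)
  have dim: "dim_row X = k" "dim_col X = k" if "X \<in> carrier (mat_alg k A)" for X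
    using that by (auto simp: mat_alg_carrier_iff)
  have "abelian_group (mat_alg k A)"
  proof (rule abelian_groupI)
    fix X Y Z assume XYZ: "X \<in> carrier (mat_alg k A)" "Y \<in> carrier (mat_alg k A)" "Z \<in> carrier (mat_alg k A)"
    show "X \<oplus>\<^bsub>mat_alg k A\<^esub> Y \<oplus>\<^bsub>mat_alg k A\<^esub> Z = X \<oplus>\<^bsub>mat_alg k A\<^esub> (Y \<oplus>\<^bsub>mat_alg k A\<^esub> Z)"
      using XYZ by (intro eq_matI) (auto simp: mat_alg_ops ent a_assoc)
  next
    fix X Y assume XY: "X \<in> carrier (mat_alg k A)" "Y \<in> carrier (mat_alg k A)"
    show "X \<oplus>\<^bsub>mat_alg k A\<^esub> Y \<in> carrier (mat_alg k A)"
      using XY by (auto simp: mat_alg_ops ent mat_alg_carrier_iff)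
    show "X \<oplus>\<^bsub>mat_alg k A\<^esub> Y = Y \<oplus>\<^bsub>mat_alg k A\<^esub> X"
      using XY by (intro eq_matI) (auto simp: mat_alg_ops ent a_comm)
  next
    fix X assume X: "X \<in> carrier (mat_alg k A)"
    show "\<zero>\<^bsub>mat_alg k A\<^esub> \<oplus>\<^bsub>mat_alg k A\<^esub> X = X"
      using X by (intro eq_matI) (auto simp: mat_alg_ops ent dim)
    show "\<exists>Y\<in>carrier (mat_alg k A). Y \<oplus>\<^bsub>mat_alg k A\<^esub> X = \<zero>\<^bsub>mat_alg k A\<^esub>"
      using X by (intro bexI[of _ "mat k k (\<lambda>(i, j). \<ominus>\<^bsub>A\<^esub> (X $$ (i, j)))"] eq_matI)
        (auto simp: mat_alg_ops mat_alg_carrier_iff l_neg)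
  qed (auto simp: mat_alg_ops mat_alg_carrier_iff)
  moreover have "Module.module complex_field (mat_alg k A)"
    by (rule moduleI[OF cring_complex_field \<open>abelian_group (mat_alg k A)\<close>])
      (auto intro!: eq_matI simp: mat_alg_ops mat_alg_carrier_iff smult_add_left smult_add_right smult_smult)
  ultimately show ?thesis
    by (intro star_space.intro star_space_axioms.intro)
      (auto intro!: eq_matI simp: mat_alg_ops mat_alg_carrier_iff adj_add adj_smult)
qed

context cstar_algebra
begin

text \<open>
  A linear functional on \<open>M\<^sub>k(S)\<close> is a matrix \<open>\<theta>\<close> of functionals on \<open>S\<close>. Positivity on Gram matrices
  suffices for an extension to a state of \<open>M\<^sub>k(A)\<close>, because the identity is an order unit for their cone.
\<close>

lemma mat_alg_state_extension:
  assumes S: "Module.submodule S complex_field A" "\<one> \<in> S" "\<And>x. x \<in> S \<Longrightarrow> adj A x \<in> S"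
    and \<theta>: "\<And>i j. i < k \<Longrightarrow> j < k \<Longrightarrow> lin_fun A S (\<theta> i j)"
      "\<And>X. gram A k X \<Longrightarrow> (\<And>i j. i < k \<Longrightarrow> j < k \<Longrightarrow> X i j \<in> S) \<Longrightarrow> (\<Sum>i<k. \<Sum>j<k. \<theta> i j (X i j)) \<in> \<real>\<^sub>\<ge>\<^sub>0"
      "(\<Sum>i<k. \<theta> i i \<one>) = 1"
  shows "\<exists>s\<in>states (mat_alg k A). lin_fun (mat_alg k A) (carrier (mat_alg k A)) s \<and>
     (\<forall>X\<in>carrier (mat_alg k A). (\<forall>i<k. \<forall>j<k. X $$ (i, j) \<in> S) \<longrightarrow>
       s X = (\<Sum>i<k. \<Sum>j<k. \<theta> i j (X $$ (i, j))))"
proof -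
  interpret V: star_space "mat_alg k A" by (rule star_space_mat_alg) unfold_locales
  have Sc: "S \<subseteq> carrier A" using vs.submoduleE(1)[OF S(1)] .
  have Sadd: "x \<oplus> y \<in> S" if "x \<in> S" "y \<in> S" for x y using vs.submoduleE(5)[OF S(1)] that by blast
  have Ssm: "c \<odot> x \<in> S" if "x \<in> S" for c x using vs.submoduleE(4)[OF S(1), of c x] that by simp
  have S0: "\<zero> \<in> S" using Ssm[OF S(2), of 0] by simp
  have ent: "X $$ (i, j) \<in> carrier A" if "X \<in> carrier (mat_alg k A)" "i < k" "j < k" for X i j
    using that by (simp add: mat_alg_carrier_iff)
  define C where "C = {X \<in> carrier (mat_alg k A). gram A k (\<lambda>i j. X $$ (i, j))}"
  define W where "W = {X \<in> carrier (mat_alg k A). \<forall>i<k. \<forall>j<k. X $$ (i, j) \<in> S}"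
  define f where "f X = (\<Sum>i<k. \<Sum>j<k. \<theta> i j (X $$ (i, j)))" for X
  have one: "\<one>\<^bsub>mat_alg k A\<^esub> \<in> carrier (mat_alg k A)" by (auto simp: mat_alg_ops mat_alg_carrier_iff)
  have f1: "f \<one>\<^bsub>mat_alg k A\<^esub> = 1"
  proof -
    have "f \<one>\<^bsub>mat_alg k A\<^esub> = (\<Sum>i<k. \<Sum>j<k. if i = j then \<theta> i j \<one> else 0)"
      unfolding f_def using lin_fun_zero[OF \<theta>(1) S0]
      by (intro sum.cong refl) (auto simp: mat_alg_ops)
    also have "\<dots> = (\<Sum>i<k. \<theta> i i \<one>)" by (intro sum.cong refl) simp
    finally show ?thesis using \<theta>(3) by simp
  qed
  obtain s where s: "lin_fun (mat_alg k A) (carrier (mat_alg k A)) s" "\<And>X. X \<in> W \<Longrightarrow> s X = f X"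
    "\<And>X. X \<in> C \<Longrightarrow> s X \<in> \<real>\<^sub>\<ge>\<^sub>0"
  proof (rule V.krein_extension[of C "\<one>\<^bsub>mat_alg k A\<^esub>" W f])
    show "X \<oplus>\<^bsub>mat_alg k A\<^esub> Y \<in> C" if "X \<in> C" "Y \<in> C" for X Y
      using that gram_add[of k "\<lambda>i j. X $$ (i, j)" "\<lambda>i j. Y $$ (i, j)"] unfolding C_def
      by (auto elim!: gram_cong simp: mat_alg_ops intro!: V.a_closed[unfolded mat_alg_ops])
    show "\<zero>\<^bsub>mat_alg k A\<^esub> \<in> C" unfolding C_def
      by (auto simp: mat_alg_ops mat_alg_carrier_iff intro: gram_cong[OF gram_zero])
    show "complex_of_real r \<odot>\<^bsub>mat_alg k A\<^esub> X \<in> C" if "r \<ge> 0" "X \<in> C" for r X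
      using that gram_scale[of k "\<lambda>i j. X $$ (i, j)" r] V.smult_closed'[of X "complex_of_real r"] unfolding C_def
      by (auto elim!: gram_cong simp: mat_alg_ops)
    show "adj (mat_alg k A) X = X" if "X \<in> C" for X
      using that unfolding C_def
      by (intro eq_matI) (auto simp: mat_alg_ops mat_alg_carrier_iff dest: gram_adj)
    show "adj (mat_alg k A) \<one>\<^bsub>mat_alg k A\<^esub> = \<one>\<^bsub>mat_alg k A\<^esub>"
      by (intro eq_matI) (auto simp: mat_alg_ops)
    show "\<exists>r. complex_of_real r \<odot>\<^bsub>mat_alg k A\<^esub> \<one>\<^bsub>mat_alg k A\<^esub> \<ominus>\<^bsub>mat_alg k A\<^esub> (X \<oplus>\<^bsub>mat_alg k A\<^esub> adj (mat_alg k A) X) \<in> C"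
      if X: "X \<in> carrier (mat_alg k A)" for X
    proof -
      have "dominated k (\<lambda>i j. X $$ (i, j))" by (rule dominated_all) (rule ent[OF X])
      then obtain r :: real where r: "gram A k (\<lambda>i j. (if i = j then complex_of_real r \<odot> \<one> else \<zero>) \<ominus> (X $$ (i, j) \<oplus> adj A (X $$ (j, i))))"
        unfolding dominated_def by blast
      let ?D = "complex_of_real r \<odot>\<^bsub>mat_alg k A\<^esub> \<one>\<^bsub>mat_alg k A\<^esub> \<ominus>\<^bsub>mat_alg k A\<^esub> (X \<oplus>\<^bsub>mat_alg k A\<^esub> adj (mat_alg k A) X)"
      have "?D \<in> carrier (mat_alg k A)" using X one by simp
      moreover have "?D = complex_of_real r \<odot>\<^bsub>mat_alg k A\<^esub> \<one>\<^bsub>mat_alg k A\<^esub> \<oplus>\<^bsub>mat_alg k A\<^esub> (-1) \<odot>\<^bsub>mat_alg k A\<^esub> (X \<oplus>\<^bsub>mat_alg k A\<^esub> adj (mat_alg k A) X)"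
        using X one by (simp add: V.diff_conv_smult)
      moreover have "gram A k (\<lambda>i j. (complex_of_real r \<odot>\<^bsub>mat_alg k A\<^esub> \<one>\<^bsub>mat_alg k A\<^esub> \<oplus>\<^bsub>mat_alg k A\<^esub> (-1) \<odot>\<^bsub>mat_alg k A\<^esub> (X \<oplus>\<^bsub>mat_alg k A\<^esub> adj (mat_alg k A) X)) $$ (i, j))"
        by (rule gram_cong[OF r]) (auto simp: mat_alg_ops diff_conv_smult ent[OF X])
      ultimately have "?D \<in> C" unfolding C_def by (simp only: mem_Collect_eq)
      then show ?thesis by (rule exI)
    qed
    show "Module.submodule W complex_field (mat_alg k A)"
    proof (rule V.vs.submoduleI)
      show "\<ominus>\<^bsub>mat_alg k A\<^esub> X \<in> W" if "X \<in> W" for X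
      proof -
        have "\<ominus>\<^bsub>mat_alg k A\<^esub> X = (-1) \<odot>\<^bsub>mat_alg k A\<^esub> X" using that by (simp add: W_def V.minus_conv_smult)
        moreover have "(-1) \<odot>\<^bsub>mat_alg k A\<^esub> X \<in> W" using that V.smult_closed'[of X "-1"] Ssm by (auto simp: W_def mat_alg_ops)
        ultimately show ?thesis by simp
      qed
      show "X \<oplus>\<^bsub>mat_alg k A\<^esub> Y \<in> W" if "X \<in> W" "Y \<in> W" for X Y
        using that V.a_closed[of X Y] Sadd by (auto simp: W_def mat_alg_ops)
      show "c \<odot>\<^bsub>mat_alg k A\<^esub> X \<in> W" if "c \<in> carrier complex_field" "X \<in> W" for c X
        using that V.smult_closed'[of X c] Ssm by (auto simp: W_def mat_alg_ops)
    qed (auto simp: W_def mat_alg_ops mat_alg_carrier_iff S0)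
    show "\<one>\<^bsub>mat_alg k A\<^esub> \<in> W" using one S S0 by (auto simp: W_def mat_alg_ops)
    show "adj (mat_alg k A) X \<in> W" if "X \<in> W" for X
      using that V.adj_closed[of X] S(3) by (auto simp: W_def mat_alg_ops)
    show "lin_fun (mat_alg k A) W f" unfolding lin_fun_def
    proof (intro conjI ballI allI)
      fix X Y assume XY: "X \<in> W" "Y \<in> W"
      have "f (X \<oplus>\<^bsub>mat_alg k A\<^esub> Y) = (\<Sum>i<k. \<Sum>j<k. \<theta> i j (X $$ (i, j)) + \<theta> i j (Y $$ (i, j)))"
        unfolding f_def using XY \<theta>(1) by (intro sum.cong refl) (auto simp: mat_alg_ops W_def lin_fun_def)
      then show "f (X \<oplus>\<^bsub>mat_alg k A\<^esub> Y) = f X + f Y" by (simp add: f_def sum.distrib)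
    next
      fix c X assume X: "X \<in> W"
      have "f (c \<odot>\<^bsub>mat_alg k A\<^esub> X) = (\<Sum>i<k. \<Sum>j<k. c * \<theta> i j (X $$ (i, j)))"
        unfolding f_def using X \<theta>(1) by (intro sum.cong refl) (auto simp: mat_alg_ops W_def lin_fun_def)
      then show "f (c \<odot>\<^bsub>mat_alg k A\<^esub> X) = c * f X" by (simp add: f_def sum_distrib_left)
    qed
    show "f \<one>\<^bsub>mat_alg k A\<^esub> = 1" by fact
    show "f X \<in> \<real>\<^sub>\<ge>\<^sub>0" if "X \<in> W" "X \<in> C" for X
      unfolding f_def by (rule \<theta>(2)) (use that in \<open>auto simp: W_def C_def\<close>)
  qed (use one in \<open>auto simp: C_def\<close>)
  have sW: "s X = f X" if "X \<in> carrier (mat_alg k A)" "\<forall>i<k. \<forall>j<k. X $$ (i, j) \<in> S" for X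
    using s(2) that by (simp add: W_def)
  have pc: "pos_cone (mat_alg k A) \<subseteq> C"
  proof
    fix X assume X: "X \<in> pos_cone (mat_alg k A)"
    then obtain Y where Y: "Y \<in> carrier (mat_alg k A)" "X = adj (mat_alg k A) Y \<otimes>\<^bsub>mat_alg k A\<^esub> Y"
      unfolding pos_cone_def by blast
    have "X \<in> carrier (mat_alg k A)"
      using V.adj_closed[OF Y(1)] Y(1)
      unfolding Y(2) mat_alg_mult mat_alg_carrier_iff by (auto intro!: finsum_closed)
    then show "X \<in> C" using pos_cone_mat_alg_gram[OF X] by (simp add: C_def)
  qed
  have "s \<in> states (mat_alg k A)"
    using s(1,3) pc sW[OF one] f1 S(2) S0 unfolding states_def lin_fun_def by (auto simp: mat_alg_ops)
  with s(1) sW show ?thesis unfolding f_def by blast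
qed

lemma w_cb_lower_bound:
  assumes S: "Module.submodule S complex_field A" "\<one> \<in> S" "\<And>x. x \<in> S \<Longrightarrow> adj A x \<in> S"
    and \<theta>: "\<And>i j. i < k \<Longrightarrow> j < k \<Longrightarrow> lin_fun A S (\<theta> i j)"
      "\<And>X. gram A k X \<Longrightarrow> (\<And>i j. i < k \<Longrightarrow> j < k \<Longrightarrow> X i j \<in> S) \<Longrightarrow> (\<Sum>i<k. \<Sum>j<k. \<theta> i j (X i j)) \<in> \<real>\<^sub>\<ge>\<^sub>0"
      "(\<Sum>i<k. \<theta> i i \<one>) = 1"
    and k: "k \<ge> 1" and u: "\<And>m. m < n \<Longrightarrow> u m \<in> S"
    and U: "\<And>m. m < n \<Longrightarrow> U m \<in> carrier_mat k k" "\<And>m. m < n \<Longrightarrow> op_norm (U m) \<le> 1"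
  shows "ereal (cmod (\<Sum>m<n. \<Sum>i<k. \<Sum>j<k. U m $$ (i, j) * \<theta> i j (u m))) \<le> w_cb A n u"
proof -
  interpret V: star_space "mat_alg k A" by (rule star_space_mat_alg) unfold_locales
  have Sc: "S \<subseteq> carrier A" using vs.submoduleE(1)[OF S(1)] .
  have Ssm: "c \<odot> x \<in> S" if "x \<in> S" for c x using vs.submoduleE(4)[OF S(1), of c x] that by simp
  obtain s where s: "s \<in> states (mat_alg k A)" "lin_fun (mat_alg k A) (carrier (mat_alg k A)) s"
    "\<And>X. X\<in>carrier (mat_alg k A) \<Longrightarrow> (\<forall>i<k. \<forall>j<k. X $$ (i, j) \<in> S) \<Longrightarrow> s X = (\<Sum>i<k. \<Sum>j<k. \<theta> i j (X $$ (i, j)))"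
    using mat_alg_state_extension[OF S \<theta>] by blast
  let ?x = "\<Oplus>\<^bsub>mat_alg k A\<^esub>i\<in>{..<n}. elem_tensor A (U i) (u i)"
  have tc: "elem_tensor A (U m) (u m) \<in> carrier (mat_alg k A)" and
    ts: "\<forall>i<k. \<forall>j<k. elem_tensor A (U m) (u m) $$ (i, j) \<in> S" and
    te: "\<And>i j. i < k \<Longrightarrow> j < k \<Longrightarrow> elem_tensor A (U m) (u m) $$ (i, j) = U m $$ (i, j) \<odot> u m" if "m < n" for m
    using U(1)[OF that] u[OF that] Sc Ssm by (auto simp: elem_tensor_def mat_alg_carrier_iff)
  have "s ?x = (\<Sum>m<n. s (elem_tensor A (U m) (u m)))"
    by (rule V.lin_fun_finsum[OF s(2) V.vs.carrier_is_submodule]) (use tc in auto)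
  also have "\<dots> = (\<Sum>m<n. \<Sum>i<k. \<Sum>j<k. U m $$ (i, j) * \<theta> i j (u m))"
  proof (rule sum.cong[OF refl])
    fix m assume "m \<in> {..<n}"
    then have m: "m < n" by simp
    show "s (elem_tensor A (U m) (u m)) = (\<Sum>i<k. \<Sum>j<k. U m $$ (i, j) * \<theta> i j (u m))"
      unfolding s(3)[OF tc[OF m] ts[OF m]] using \<theta>(1) u[OF m]
      by (intro sum.cong refl) (auto simp: te[OF m] lin_fun_def)
  qed
  finally have sx: "s ?x = (\<Sum>m<n. \<Sum>i<k. \<Sum>j<k. U m $$ (i, j) * \<theta> i j (u m))" .
  have "ereal (cmod (s ?x)) \<le> num_radius (mat_alg k A) ?x"
    unfolding num_radius_def by (rule SUP_upper[OF s(1)])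
  also have "\<dots> \<le> w_mat A k n u" unfolding w_mat_def
    by (rule SUP_upper2[of U]) (use U in auto)
  also have "\<dots> \<le> w_cb A n u" unfolding w_cb_def by (rule SUP_upper2[of k]) (use k in auto)
  finally show ?thesis by (simp add: sx)
qed

end

section \<open>Tracial states and finite-dimensional subalgebras\<close>

locale tracial_star_algebra = star_algebra A for A :: "('a, 'm) star_alg_scheme" (structure) +
  fixes \<tau> :: "'a \<Rightarrow> complex"
  assumes tr_add: "\<lbrakk>x \<in> carrier A; y \<in> carrier A\<rbrakk> \<Longrightarrow> \<tau> (x \<oplus> y) = \<tau> x + \<tau> y"
    and tr_smult: "x \<in> carrier A \<Longrightarrow> \<tau> (c \<odot> x) = c * \<tau> x"
    and tr_one: "\<tau> \<one> = 1"
    and tr_pos: "x \<in> carrier A \<Longrightarrow> \<tau> (adj A x \<otimes> x) \<in> \<real>\<^sub>\<ge>\<^sub>0"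
    and tr_comm: "\<lbrakk>x \<in> carrier A; y \<in> carrier A\<rbrakk> \<Longrightarrow> \<tau> (x \<otimes> y) = \<tau> (y \<otimes> x)"

lemma nonneg_Reals_sum: "(\<And>i. i \<in> I \<Longrightarrow> f i \<in> \<real>\<^sub>\<ge>\<^sub>0) \<Longrightarrow> (\<Sum>i\<in>I. f i :: complex) \<in> \<real>\<^sub>\<ge>\<^sub>0"
  by (simp add: complex_nonneg_Reals_iff sum_nonneg)

lemma sum_rotate:
  "(\<Sum>i\<in>I. \<Sum>j\<in>J. \<Sum>l\<in>L. f i j l) = (\<Sum>l\<in>L. \<Sum>i\<in>I. \<Sum>j\<in>J. f i j l)"
proof -
  have "(\<Sum>i\<in>I. \<Sum>j\<in>J. \<Sum>l\<in>L. f i j l) = (\<Sum>i\<in>I. \<Sum>l\<in>L. \<Sum>j\<in>J. f i j l)"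
    by (intro sum.cong refl sum.swap)
  also have "\<dots> = (\<Sum>l\<in>L. \<Sum>i\<in>I. \<Sum>j\<in>J. f i j l)" by (rule sum.swap)
  finally show ?thesis .
qed

lemma cnj_mult_self: "cnj z * z = (complex_of_real (cmod z))\<^sup>2" "z * cnj z = (complex_of_real (cmod z))\<^sup>2"
  using complex_norm_square[of z] by (simp_all add: mult.commute)

context tracial_star_algebra
begin

lemma tr_lin: "lin_fun A (carrier A) \<tau>"
  by (simp add: lin_fun_def tr_add tr_smult)

lemma tr_zero [simp]: "\<tau> \<zero> = 0"
  using tr_smult[of \<zero> 0] by simp

lemma tr_diff: "x \<in> carrier A \<Longrightarrow> y \<in> carrier A \<Longrightarrow> \<tau> (x \<ominus> y) = \<tau> x - \<tau> y"
  by (simp add: diff_conv_smult tr_add tr_smult)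

lemma tr_finsum: "finite I \<Longrightarrow> (\<And>i. i \<in> I \<Longrightarrow> f i \<in> carrier A) \<Longrightarrow> \<tau> (\<Oplus>i\<in>I. f i) = (\<Sum>i\<in>I. \<tau> (f i))"
  by (rule lin_fun_finsum[OF tr_lin vs.carrier_is_submodule])

lemma tr_finsum_sandwich:
  assumes "finite I" "\<And>i. i \<in> I \<Longrightarrow> f i \<in> carrier A" "a \<in> carrier A" "b \<in> carrier A"
  shows "\<tau> (a \<otimes> (\<Oplus>i\<in>I. f i) \<otimes> b) = (\<Sum>i\<in>I. \<tau> (a \<otimes> f i \<otimes> b))"
proof -
  have "a \<otimes> (\<Oplus>i\<in>I. f i) \<otimes> b = (\<Oplus>i\<in>I. a \<otimes> f i \<otimes> b)"
    using assms by (simp add: finsum_rdistr finsum_ldistr Pi_def)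
  then show ?thesis using assms by (simp add: tr_finsum)
qed

lemma tr_adj: "x \<in> carrier A \<Longrightarrow> \<tau> (adj A x) = cnj (\<tau> x)"
proof -
  assume x: "x \<in> carrier A"
  have *: "\<tau> (adj A y) + \<tau> y \<in> \<real>" if y: "y \<in> carrier A" for y
  proof -
    have "adj A (y \<oplus> \<one>) \<otimes> (y \<oplus> \<one>) = adj A y \<otimes> y \<oplus> (adj A y \<oplus> (y \<oplus> \<one>))"
      using y by (simp add: adj_add l_distr r_distr a_ac)
    then have "\<tau> (adj A (y \<oplus> \<one>) \<otimes> (y \<oplus> \<one>)) = \<tau> (adj A y \<otimes> y) + (\<tau> (adj A y) + \<tau> y) + 1"
      using y by (simp add: tr_add tr_one)
    then show ?thesis using tr_pos[of "y \<oplus> \<one>"] tr_pos[of y] y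
      by (simp add: complex_nonneg_Reals_iff complex_is_Real_iff)
  qed
  show ?thesis using *[OF x] *[of "\<i> \<odot> x"] x
    by (simp add: adj_smult tr_smult complex_is_Real_iff complex_eq_iff)
qed

text \<open>
  The vector functional of \<open>(v\<^sub>1, \<dots>, v\<^sub>k)\<close> in the direct sum of \<open>k\<close> copies of \<open>L\<^sup>2(A, \<tau>)\<close>.
\<close>

lemma gram_vector_state:
  assumes g: "gram A k X" and v: "\<And>i. i < k \<Longrightarrow> v i \<in> carrier A"
  shows "(\<Sum>i<k. \<Sum>j<k. \<tau> (adj A (v i) \<otimes> X i j \<otimes> v j)) \<in> \<real>\<^sub>\<ge>\<^sub>0"
proof -
  obtain p :: nat and Y where Y: "\<And>l i. l < p \<Longrightarrow> i < k \<Longrightarrow> Y l i \<in> carrier A"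
    "\<And>i j. i < k \<Longrightarrow> j < k \<Longrightarrow> X i j = (\<Oplus>l\<in>{..<p}. adj A (Y l i) \<otimes> Y l j)"
    using g unfolding gram_def by blast
  have "(\<Sum>i<k. \<Sum>j<k. \<tau> (adj A (v i) \<otimes> X i j \<otimes> v j)) =
      (\<Sum>i<k. \<Sum>j<k. \<Sum>l<p. \<tau> (adj A (Y l i \<otimes> v i) \<otimes> (Y l j \<otimes> v j)))"
  proof (intro sum.cong refl)
    fix i j assume "i \<in> {..<k}" "j \<in> {..<k}"
    then have ij: "i < k" "j < k" by auto
    have "\<tau> (adj A (v i) \<otimes> X i j \<otimes> v j) = (\<Sum>l<p. \<tau> (adj A (v i) \<otimes> (adj A (Y l i) \<otimes> Y l j) \<otimes> v j))"
      unfolding Y(2)[OF ij] using Y(1) v ij by (intro tr_finsum_sandwich) auto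
    also have "\<dots> = (\<Sum>l<p. \<tau> (adj A (Y l i \<otimes> v i) \<otimes> (Y l j \<otimes> v j)))"
      using Y(1) v ij by (intro sum.cong refl arg_cong[of _ _ \<tau>]) (auto simp: adj_mult m_assoc)
    finally show "\<tau> (adj A (v i) \<otimes> X i j \<otimes> v j) = \<dots>" .
  qed
  also have "\<dots> = (\<Sum>l<p. \<Sum>i<k. \<Sum>j<k. \<tau> (adj A (Y l i \<otimes> v i) \<otimes> (Y l j \<otimes> v j)))"
    by (rule sum_rotate)
  also have "\<dots> = (\<Sum>l<p. \<tau> (adj A (\<Oplus>i\<in>{..<k}. Y l i \<otimes> v i) \<otimes> (\<Oplus>j\<in>{..<k}. Y l j \<otimes> v j)))"
  proof (rule sum.cong[OF refl])
    fix l assume "l \<in> {..<p}"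
    then have l: "l < p" by simp
    define z where "z i = Y l i \<otimes> v i" for i
    have z: "z i \<in> carrier A" if "i < k" for i using Y(1)[OF l that] v[OF that] by (simp add: z_def)
    let ?s = "\<Oplus>j\<in>{..<k}. z j"
    have s: "?s \<in> carrier A" using z by (auto intro: finsum_closed)
    have "\<tau> (adj A ?s \<otimes> ?s) = \<tau> (\<one> \<otimes> (\<Oplus>i\<in>{..<k}. adj A (z i)) \<otimes> ?s)"
      using z s by (subst adj_finsum) (auto simp: Pi_def)
    also have "\<dots> = (\<Sum>i<k. \<tau> (\<one> \<otimes> adj A (z i) \<otimes> ?s))"
      using z s by (intro tr_finsum_sandwich) auto
    also have "\<dots> = (\<Sum>i<k. \<tau> (adj A (z i) \<otimes> ?s \<otimes> \<one>))"
      using z s by (intro sum.cong refl) auto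
    also have "\<dots> = (\<Sum>i<k. \<Sum>j<k. \<tau> (adj A (z i) \<otimes> z j \<otimes> \<one>))"
      using z by (intro sum.cong[OF refl] tr_finsum_sandwich) auto
    also have "\<dots> = (\<Sum>i<k. \<Sum>j<k. \<tau> (adj A (z i) \<otimes> z j))"
      using z by (intro sum.cong refl) auto
    finally show "(\<Sum>i<k. \<Sum>j<k. \<tau> (adj A (Y l i \<otimes> v i) \<otimes> (Y l j \<otimes> v j))) =
       \<tau> (adj A (\<Oplus>i\<in>{..<k}. Y l i \<otimes> v i) \<otimes> (\<Oplus>j\<in>{..<k}. Y l j \<otimes> v j))"
      unfolding z_def by simp
  qed
  finally show ?thesis using Y(1) v
    by (auto intro!: nonneg_Reals_sum tr_pos finsum_closed)
qed

lemma orthonormal_coeff: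
  assumes e: "\<And>i. i < k \<Longrightarrow> e i \<in> carrier A"
    "\<And>i j. i < k \<Longrightarrow> j < k \<Longrightarrow> \<tau> (adj A (e i) \<otimes> e j) = (if i = j then 1 else 0)" and i: "i < (k::nat)"
  shows "\<tau> (adj A (e i) \<otimes> (\<Oplus>j\<in>{..<k}. c j \<odot> e j)) = c i"
proof -
  have "\<tau> (adj A (e i) \<otimes> (\<Oplus>j\<in>{..<k}. c j \<odot> e j) \<otimes> \<one>) = (\<Sum>j<k. \<tau> (adj A (e i) \<otimes> (c j \<odot> e j) \<otimes> \<one>))"
    using i e by (intro tr_finsum_sandwich) auto
  also have "\<dots> = (\<Sum>j<k. if i = j then c j else 0)"
    using i e by (intro sum.cong refl) (auto simp: smult_mult_right tr_smult)
  also have "\<dots> = c i" using i by simp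
  finally show ?thesis using i e by (simp add: finsum_closed Pi_def)
qed

end

text \<open>
  Orthonormality and expansion refer to the inner product \<open>\<tau> (x* y)\<close>. The expansion property encodes
  both that \<open>e\<close> spans \<open>N\<close> and that \<open>\<tau>\<close> is faithful on \<open>N\<close>.
\<close>

locale fd_subalgebra = tracial_star_algebra A \<tau>
  for A :: "('a, 'm) star_alg_scheme" (structure) and \<tau> +
  fixes k :: nat and e :: "nat \<Rightarrow> 'a" and N :: "'a set"
  assumes N_sub: "N \<subseteq> carrier A" and N_one: "\<one> \<in> N"
    and N_add: "\<lbrakk>x \<in> N; y \<in> N\<rbrakk> \<Longrightarrow> x \<oplus> y \<in> N"
    and N_mult: "\<lbrakk>x \<in> N; y \<in> N\<rbrakk> \<Longrightarrow> x \<otimes> y \<in> N"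
    and N_smult: "x \<in> N \<Longrightarrow> c \<odot> x \<in> N"
    and N_adj: "x \<in> N \<Longrightarrow> adj A x \<in> N"
    and e_N: "i < k \<Longrightarrow> e i \<in> N"
    and e_orth: "\<lbrakk>i < k; j < k\<rbrakk> \<Longrightarrow> \<tau> (adj A (e i) \<otimes> e j) = (if i = j then 1 else 0)"
    and e_span: "x \<in> N \<Longrightarrow> x = (\<Oplus>i\<in>{..<k}. \<tau> (adj A (e i) \<otimes> x) \<odot> e i)"
begin

lemma N_carrier: "x \<in> N \<Longrightarrow> x \<in> carrier A" using N_sub by blast

lemma e_carrier: "i < k \<Longrightarrow> e i \<in> carrier A" using e_N N_carrier by blast

lemmas Nc = N_carrier e_carrier

lemma N_finsum: "finite I \<Longrightarrow> (\<And>i. i \<in> I \<Longrightarrow> f i \<in> N) \<Longrightarrow> (\<Oplus>i\<in>I. f i) \<in> N"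
proof (induction I rule: finite_induct)
  case empty
  then show ?case using N_smult[OF N_one, of 0] by simp
next
  case (insert x F)
  then have "(\<Oplus>i\<in>insert x F. f i) = f x \<oplus> (\<Oplus>i\<in>F. f i)"
    using N_carrier by (intro finsum_insert) auto
  then show ?case using insert N_add by simp
qed

lemma expand_left:
  assumes "z \<in> N" "a \<in> carrier A" "b \<in> carrier A"
  shows "\<tau> (a \<otimes> z \<otimes> b) = (\<Sum>i<k. \<tau> (adj A (e i) \<otimes> z) * \<tau> (a \<otimes> e i \<otimes> b))"
proof -
  have "\<tau> (a \<otimes> z \<otimes> b) = \<tau> (a \<otimes> (\<Oplus>i\<in>{..<k}. \<tau> (adj A (e i) \<otimes> z) \<odot> e i) \<otimes> b)"
    using e_span[OF assms(1)] by simp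
  also have "\<dots> = (\<Sum>i<k. \<tau> (a \<otimes> (\<tau> (adj A (e i) \<otimes> z) \<odot> e i) \<otimes> b))"
    using assms by (intro tr_finsum_sandwich) (auto simp: Nc)
  also have "\<dots> = (\<Sum>i<k. \<tau> (adj A (e i) \<otimes> z) * \<tau> (a \<otimes> e i \<otimes> b))"
    using assms by (intro sum.cong refl) (auto simp: Nc smult_mult_left smult_mult_right tr_smult)
  finally show ?thesis .
qed

lemma expand_right:
  assumes z: "z \<in> N" and a: "a \<in> carrier A" and b: "b \<in> carrier A"
  shows "\<tau> (a \<otimes> z \<otimes> b) = (\<Sum>i<k. \<tau> (z \<otimes> e i) * \<tau> (a \<otimes> adj A (e i) \<otimes> b))"
proof -
  have "\<tau> (a \<otimes> z \<otimes> b) = cnj (\<tau> (adj A b \<otimes> adj A z \<otimes> adj A a))"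
    using assms by (simp add: Nc m_assoc flip: tr_adj adj_mult)
  also have "\<dots> = (\<Sum>i<k. cnj (\<tau> (adj A (e i) \<otimes> adj A z)) * cnj (\<tau> (adj A b \<otimes> e i \<otimes> adj A a)))"
    using assms by (subst expand_left) (auto simp: N_adj)
  also have "\<dots> = (\<Sum>i<k. \<tau> (z \<otimes> e i) * \<tau> (a \<otimes> adj A (e i) \<otimes> b))"
    using assms by (intro sum.cong refl) (auto simp: Nc adj_mult m_assoc simp flip: tr_adj)
  finally show ?thesis .
qed

lemma N_eqI:
  assumes "x \<in> N" "y \<in> N" "\<And>i. i < k \<Longrightarrow> \<tau> (adj A (e i) \<otimes> x) = \<tau> (adj A (e i) \<otimes> y)"
  shows "x = y"
proof -
  have "x = (\<Oplus>i\<in>{..<k}. \<tau> (adj A (e i) \<otimes> x) \<odot> e i)" by (rule e_span) fact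
  also have "\<dots> = (\<Oplus>i\<in>{..<k}. \<tau> (adj A (e i) \<otimes> y) \<odot> e i)"
    using assms(3) by (intro finsum_cong') (auto simp: Nc)
  also have "\<dots> = y" by (rule e_span[symmetric]) fact
  finally show ?thesis .
qed

lemma coeff_comb: "i < k \<Longrightarrow> \<tau> (adj A (e i) \<otimes> (\<Oplus>j\<in>{..<k}. c j \<odot> e j)) = c i"
  by (rule orthonormal_coeff) (auto simp: Nc e_orth)

lemma comb_inner:
  assumes w: "w \<in> carrier A"
  shows "\<tau> (adj A (\<Oplus>i\<in>{..<k}. c i \<odot> e i) \<otimes> w) = (\<Sum>i<k. cnj (c i) * \<tau> (adj A (e i) \<otimes> w))"
proof -
  note [simp] = w
  have "\<tau> (adj A (\<Oplus>i\<in>{..<k}. c i \<odot> e i) \<otimes> w) = \<tau> (\<one> \<otimes> (\<Oplus>i\<in>{..<k}. cnj (c i) \<odot> adj A (e i)) \<otimes> w)"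
    by (subst adj_finsum) (auto simp: Nc Pi_def adj_smult finsum_closed intro!: arg_cong[of _ _ \<tau>] arg_cong[of _ _ "\<lambda>z. z \<otimes> w"] finsum_cong')
  also have "\<dots> = (\<Sum>i<k. \<tau> (\<one> \<otimes> (cnj (c i) \<odot> adj A (e i)) \<otimes> w))"
    by (intro tr_finsum_sandwich) (auto simp: Nc)
  finally show ?thesis by (simp add: Nc smult_mult_left tr_smult)
qed

lemma bessel:
  assumes x: "x \<in> carrier A"
  shows "(\<Sum>i<k. (cmod (\<tau> (adj A (e i) \<otimes> x)))\<^sup>2) \<le> Re (\<tau> (adj A x \<otimes> x))"
proof -
  define c where "c i = \<tau> (adj A (e i) \<otimes> x)" for i
  define y where "y = (\<Oplus>i\<in>{..<k}. c i \<odot> e i)"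
  have yN: "y \<in> N" unfolding y_def by (intro N_finsum) (auto intro: N_smult e_N)
  note [simp] = x N_carrier[OF yN]
  note yx = comb_inner[of _ c, folded y_def]
  have 1: "\<tau> (adj A y \<otimes> x) = (\<Sum>i<k. complex_of_real ((cmod (c i))\<^sup>2))"
    by (simp add: yx cnj_mult_self flip: c_def)
  have 2: "\<tau> (adj A y \<otimes> y) = (\<Sum>i<k. complex_of_real ((cmod (c i))\<^sup>2))"
    using coeff_comb[of _ c] by (simp add: yx cnj_mult_self flip: y_def)
  have 3: "\<tau> (adj A x \<otimes> y) = cnj (\<tau> (adj A y \<otimes> x))"
    by (simp add: adj_mult flip: tr_adj)
  have "adj A (x \<ominus> y) \<otimes> (x \<ominus> y) = adj A x \<otimes> x \<ominus> adj A x \<otimes> y \<ominus> adj A y \<otimes> x \<oplus> adj A y \<otimes> y"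
    by (simp add: adj_diff group_ring_simps)
  then have "\<tau> (adj A (x \<ominus> y) \<otimes> (x \<ominus> y)) = \<tau> (adj A x \<otimes> x) - \<tau> (adj A x \<otimes> y) - \<tau> (adj A y \<otimes> x) + \<tau> (adj A y \<otimes> y)"
    by (simp add: tr_diff tr_add)
  then have "\<tau> (adj A (x \<ominus> y) \<otimes> (x \<ominus> y)) = \<tau> (adj A x \<otimes> x) - (\<Sum>i<k. complex_of_real ((cmod (c i))\<^sup>2))"
    by (simp add: 1 2 3)
  then show ?thesis using tr_pos[of "x \<ominus> y"] by (simp add: complex_nonneg_Reals_iff c_def)
qed

text \<open>
  With \<open>c\<close> and \<open>d\<close> the coefficients of \<open>x\<close> and \<open>b\<close>, the left-hand side is the sum of
  \<open>2 Re (cnj d\<^sub>i c\<^sub>i) - |d\<^sub>i|\<^sup>2 \<le> |c\<^sub>i|\<^sup>2\<close>. So if \<open>b\<close> in \<open>N\<close> is close to \<open>x\<close> in the trace norm, then the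
  projection onto \<open>N\<close> preserves almost all of the trace norm of \<open>x\<close>.
\<close>

lemma best_approximation:
  assumes x: "x \<in> carrier A" and b: "b \<in> N"
  shows "Re (\<tau> (adj A x \<otimes> x)) - Re (\<tau> (adj A (x \<ominus> b) \<otimes> (x \<ominus> b))) \<le> (\<Sum>i<k. (cmod (\<tau> (adj A (e i) \<otimes> x)))\<^sup>2)"
proof -
  note [simp] = x N_carrier[OF b]
  define c where "c i = \<tau> (adj A (e i) \<otimes> x)" for i
  define d where "d i = \<tau> (adj A (e i) \<otimes> b)" for i
  have bw: "\<tau> (adj A b \<otimes> w) = (\<Sum>i<k. cnj (d i) * \<tau> (adj A (e i) \<otimes> w))" if "w \<in> carrier A" for w
    using comb_inner[OF that, of d] e_span[OF b] by (simp add: d_def)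
  have bx: "\<tau> (adj A b \<otimes> x) = (\<Sum>i<k. cnj (d i) * c i)" using bw[of x] by (simp add: c_def)
  have bb: "\<tau> (adj A b \<otimes> b) = (\<Sum>i<k. cnj (d i) * d i)" using bw[of b] by (simp add: d_def)
  have xb: "\<tau> (adj A x \<otimes> b) = cnj (\<tau> (adj A b \<otimes> x))" by (simp add: adj_mult flip: tr_adj)
  have "adj A (x \<ominus> b) \<otimes> (x \<ominus> b) = adj A x \<otimes> x \<ominus> adj A x \<otimes> b \<ominus> adj A b \<otimes> x \<oplus> adj A b \<otimes> b"
    by (simp add: adj_diff group_ring_simps)
  then have "\<tau> (adj A (x \<ominus> b) \<otimes> (x \<ominus> b)) = \<tau> (adj A x \<otimes> x) - cnj (\<tau> (adj A b \<otimes> x)) - \<tau> (adj A b \<otimes> x) + \<tau> (adj A b \<otimes> b)"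
    by (simp add: tr_diff tr_add xb)
  then have "Re (\<tau> (adj A x \<otimes> x)) - Re (\<tau> (adj A (x \<ominus> b) \<otimes> (x \<ominus> b))) = (\<Sum>i<k. 2 * Re (cnj (d i) * c i) - Re (cnj (d i) * d i))"
    unfolding bx bb by (simp add: Re_sum sum_subtractf sum.distrib sum_distrib_left sum_negf)
  also have "\<dots> \<le> (\<Sum>i<k. (cmod (c i))\<^sup>2)"
  proof (rule sum_mono)
    fix i
    have "0 \<le> (Re (c i) - Re (d i))\<^sup>2 + (Im (c i) - Im (d i))\<^sup>2" by simp
    then show "2 * Re (cnj (d i) * c i) - Re (cnj (d i) * d i) \<le> (cmod (c i))\<^sup>2"
      unfolding cmod_power2 by (simp add: power2_eq_square algebra_simps)
  qed
  finally show ?thesis by (simp add: c_def)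
qed

text \<open>
  For a full matrix algebra \<open>N\<close> with the normalised trace this is the scalar \<open>dim N\<close>. In general it is central and invertible,
  and compensates for the different weights that \<open>\<tau>\<close> puts on the simple summands of \<open>N\<close>.
\<close>

definition h :: 'a where "h = (\<Oplus>i\<in>{..<k}. e i \<otimes> adj A (e i))"

lemma h_N: "h \<in> N" unfolding h_def by (intro N_finsum) (auto intro: N_mult N_adj e_N)

lemma tr_h_sandwich:
  assumes "a \<in> carrier A" "b \<in> carrier A"
  shows "\<tau> (a \<otimes> h \<otimes> b) = (\<Sum>i<k. \<tau> (a \<otimes> e i \<otimes> adj A (e i) \<otimes> b))"
proof -
  have "\<tau> (a \<otimes> h \<otimes> b) = (\<Sum>i<k. \<tau> (a \<otimes> (e i \<otimes> adj A (e i)) \<otimes> b))"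
    unfolding h_def using assms by (intro tr_finsum_sandwich) (auto simp: Nc)
  then show ?thesis using assms by (simp add: Nc m_assoc)
qed

lemma h_adj: "adj A h = h"
  unfolding h_def by (subst adj_finsum) (auto simp: Nc Pi_def adj_mult intro!: finsum_cong')

text \<open>
  Expanding each \<open>e\<^sub>j* y\<close> in \<open>h y\<close> in terms of the \<open>e\<^sub>i*\<close> and collecting the terms with \<open>e\<^sub>j\<close> into \<open>y e\<^sub>i\<close> yields
  \<open>y h\<close>.
\<close>

lemma h_central:
  assumes y: "y \<in> N" shows "h \<otimes> y = y \<otimes> h"
proof (rule N_eqI)
  fix l assume l: "l < k"
  note [simp] = N_carrier[OF y] N_carrier[OF h_N] e_carrier[OF l]
  have "\<tau> (adj A (e l) \<otimes> (h \<otimes> y)) = (\<Sum>j<k. \<tau> (adj A (e l) \<otimes> e j \<otimes> (adj A (e j) \<otimes> y) \<otimes> \<one>))"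
    using tr_h_sandwich[of "adj A (e l)" y] by (simp add: m_assoc Nc)
  also have "\<dots> = (\<Sum>j<k. \<Sum>i<k. \<tau> (adj A (e j) \<otimes> y \<otimes> e i) * \<tau> (adj A (e l) \<otimes> e j \<otimes> adj A (e i) \<otimes> \<one>))"
    using y by (intro sum.cong[OF refl] expand_right N_mult N_adj e_N) (auto simp: Nc)
  also have "\<dots> = (\<Sum>i<k. \<Sum>j<k. \<tau> (adj A (e j) \<otimes> (y \<otimes> e i)) * \<tau> (adj A (e l) \<otimes> e j \<otimes> adj A (e i)))"
    by (subst sum.swap, intro sum.cong refl) (auto simp: Nc m_assoc)
  also have "\<dots> = (\<Sum>i<k. \<tau> (adj A (e l) \<otimes> (y \<otimes> e i) \<otimes> adj A (e i)))"
    using y by (intro sum.cong[OF refl] expand_left[symmetric] N_mult N_adj e_N) (auto simp: Nc)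
  also have "\<dots> = \<tau> (adj A (e l) \<otimes> (y \<otimes> h))"
    using tr_h_sandwich[of "adj A (e l) \<otimes> y" \<one>] by (simp add: m_assoc Nc)
  finally show "\<tau> (adj A (e l) \<otimes> (h \<otimes> y)) = \<tau> (adj A (e l) \<otimes> (y \<otimes> h))" .
qed (use y h_N N_mult in auto)

text \<open>
  If \<open>h x = 0\<close>, then \<open>0 = \<tau> (x* h x)\<close> is a sum of the non-negative numbers \<open>\<tau> ((e\<^sub>i* x)* (e\<^sub>i* x))\<close>, so every
  \<open>e\<^sub>i* x\<close> vanishes.
\<close>

lemma h_injective:
  assumes x: "x \<in> N" and hx: "h \<otimes> x = \<zero>" shows "x = \<zero>"
proof (rule N_eqI[OF x])
  note [simp] = N_carrier[OF x] N_carrier[OF h_N]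
  have "0 = \<tau> (adj A x \<otimes> h \<otimes> x)" using hx by (simp add: m_assoc)
  also have "\<dots> = (\<Sum>i<k. \<tau> (adj A x \<otimes> e i \<otimes> adj A (e i) \<otimes> x))" by (rule tr_h_sandwich) auto
  also have "\<dots> = (\<Sum>i<k. \<tau> (adj A (adj A (e i) \<otimes> x) \<otimes> (adj A (e i) \<otimes> x)))"
    by (intro sum.cong refl) (auto simp: Nc adj_mult m_assoc)
  finally have "(\<Sum>i<k. Re (\<tau> (adj A (adj A (e i) \<otimes> x) \<otimes> (adj A (e i) \<otimes> x)))) = 0"
    by (metis Re_sum zero_complex.simps(1))
  moreover have nn: "Re (\<tau> (adj A (adj A (e i) \<otimes> x) \<otimes> (adj A (e i) \<otimes> x))) \<ge> 0" if "i < k" for i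
    using tr_pos[of "adj A (e i) \<otimes> x"] that by (simp add: Nc complex_nonneg_Reals_iff)
  ultimately have z: "Re (\<tau> (adj A (adj A (e i) \<otimes> x) \<otimes> (adj A (e i) \<otimes> x))) = 0" if "i < k" for i
    using that by (subst (asm) sum_nonneg_eq_0_iff) auto
  fix i assume i: "i < k"
  have "(\<Sum>j<k. (cmod (\<tau> (adj A (e j) \<otimes> (adj A (e i) \<otimes> x))))\<^sup>2) \<le> 0"
    using bessel[of "adj A (e i) \<otimes> x"] z[OF i] i by (simp add: Nc)
  then have c0: "\<tau> (adj A (e j) \<otimes> (adj A (e i) \<otimes> x)) = 0" if "j < k" for j
    using that sum_nonneg_eq_0_iff[of "{..<k}" "\<lambda>j. (cmod (\<tau> (adj A (e j) \<otimes> (adj A (e i) \<otimes> x))))\<^sup>2"]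
    by (simp add: order_antisym sum_nonneg)
  have "adj A (e i) \<otimes> x = \<zero>"
  proof (rule N_eqI)
    show "\<zero> \<in> N" using N_smult[OF N_one, of 0] by simp
  qed (use x i c0 in \<open>auto intro: N_mult N_adj e_N simp: Nc\<close>)
  then show "\<tau> (adj A (e i) \<otimes> x) = \<tau> (adj A (e i) \<otimes> \<zero>)" using i by (simp add: Nc)
qed (use N_smult[OF N_one, of 0] in simp)

text \<open>
  The matrix of left multiplication by \<open>h\<close> on the finite-dimensional space \<open>N\<close> has no kernel, so the
  linear system \<open>h g = 1\<close> is solvable.
\<close>

lemma h_inverse: "\<exists>g\<in>N. h \<otimes> g = \<one>"
proof -
  define H where "H = mat k k (\<lambda>(i, j). \<tau> (adj A (e i) \<otimes> h \<otimes> e j))"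
  have H: "H \<in> carrier_mat k k" by (simp add: H_def)
  have comb: "(\<Oplus>j\<in>{..<k}. (v $ j) \<odot> e j) \<in> N" for v by (intro N_finsum) (auto intro: N_smult e_N)
  have Hv: "(H *\<^sub>v v) $ i = \<tau> (adj A (e i) \<otimes> (h \<otimes> (\<Oplus>j\<in>{..<k}. (v $ j) \<odot> e j)))"
    if v: "v \<in> carrier_vec k" and i: "i < k" for v i
  proof -
    have "\<tau> (adj A (e i) \<otimes> h \<otimes> (\<Oplus>j\<in>{..<k}. (v $ j) \<odot> e j) \<otimes> \<one>) =
       (\<Sum>j<k. \<tau> (adj A (e i) \<otimes> h \<otimes> ((v $ j) \<odot> e j) \<otimes> \<one>))"
      using i by (intro tr_finsum_sandwich) (auto simp: Nc N_carrier[OF h_N])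
    also have "\<dots> = (\<Sum>j<k. \<tau> (adj A (e i) \<otimes> h \<otimes> e j) * v $ j)"
      using i by (intro sum.cong refl) (auto simp: Nc N_carrier[OF h_N] smult_mult_right tr_smult)
    also have "\<dots> = (H *\<^sub>v v) $ i"
      using v i by (simp add: H_def scalar_prod_def lessThan_atLeast0)
    finally show ?thesis using i by (simp add: Nc m_assoc N_carrier[OF h_N] N_carrier[OF comb])
  qed
  have "det H \<noteq> 0"
  proof
    assume "det H = 0"
    then obtain v where v: "v \<in> carrier_vec k" "v \<noteq> 0\<^sub>v k" "H *\<^sub>v v = 0\<^sub>v k"
      using det_0_iff_vec_prod_zero_field[OF H] by blast
    define x where "x = (\<Oplus>j\<in>{..<k}. (v $ j) \<odot> e j)"
    have xN: "x \<in> N" unfolding x_def by (rule comb)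
    have "h \<otimes> x = \<zero>"
    proof (rule N_eqI)
      show "h \<otimes> x \<in> N" using xN h_N N_mult by blast
      show "\<zero> \<in> N" using N_smult[OF N_one, of 0] by simp
      show "\<tau> (adj A (e i) \<otimes> (h \<otimes> x)) = \<tau> (adj A (e i) \<otimes> \<zero>)" if "i < k" for i
        using Hv[OF v(1) that] v(3) that by (simp add: x_def Nc)
    qed
    then have x0: "x = \<zero>" using h_injective xN by blast
    have "v $ i = 0" if "i < k" for i
      using coeff_comb[OF that, of "\<lambda>j. v $ j"] x0 that by (simp add: Nc flip: x_def)
    then have "v = 0\<^sub>v k" using v(1) by (intro eq_vecI) auto
    then show False using v(2) by blast
  qed
  from det_non_zero_imp_unit[OF H this] obtain G where G: "G \<in> carrier_mat k k" "H * G = 1\<^sub>m k"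
    unfolding Units_def ring_mat_def by auto
  define b where "b = vec k (\<lambda>i. \<tau> (adj A (e i) \<otimes> \<one>))"
  define c where "c = G *\<^sub>v b"
  have c: "c \<in> carrier_vec k" using G by (simp add: c_def b_def)
  have Hc: "H *\<^sub>v c = b" unfolding c_def using H G by (subst assoc_mult_mat_vec[symmetric]) (auto simp: b_def)
  define g where "g = (\<Oplus>j\<in>{..<k}. (c $ j) \<odot> e j)"
  have gN: "g \<in> N" unfolding g_def by (rule comb)
  have "h \<otimes> g = \<one>"
    by (rule N_eqI[OF N_mult[OF h_N gN] N_one], subst Hv[OF c, folded g_def, symmetric]) (simp_all add: Hc b_def)
  then show ?thesis using gN by blast
qed

text \<open>
  The sum on the right is the trace-preserving conditional expectation of \<open>x\<close> onto \<open>N\<close>.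
\<close>

lemma tr_expectation:
  assumes x: "x \<in> carrier A" and n: "n \<in> N"
  shows "\<tau> (n \<otimes> x) = \<tau> (n \<otimes> (\<Oplus>i\<in>{..<k}. \<tau> (adj A (e i) \<otimes> x) \<odot> e i))"
proof -
  let ?y = "\<Oplus>i\<in>{..<k}. \<tau> (adj A (e i) \<otimes> x) \<odot> e i"
  have y: "?y \<in> carrier A" by (intro finsum_closed) (auto simp: Nc)
  have "\<tau> (\<one> \<otimes> n \<otimes> x) = \<tau> (\<one> \<otimes> n \<otimes> ?y)"
    unfolding expand_right[OF n one_closed x] expand_right[OF n one_closed y]
    by (intro sum.cong refl) (auto simp: Nc coeff_comb)
  then show ?thesis using x y n by (simp add: Nc)
qed

lemma k_pos: "k \<ge> 1"
proof (rule ccontr)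
  assume "\<not> k \<ge> 1"
  then have k0: "k = 0" by simp
  have "\<one> = \<zero>" using e_span[OF N_one] unfolding k0 by simp
  then show False using tr_one tr_zero by simp
qed

text \<open>
  Put \<open>\<theta>\<^sub>i\<^sub>j x = \<tau> (e\<^sub>i* x e\<^sub>j g)\<close> with \<open>g = h\<^sup>-\<^sup>1\<close>. For \<open>N = M\<^sub>m\<close>, where \<open>k = m\<^sup>2\<close> and \<open>L\<^sup>2(N)\<close>
  is the tensor square of the \<open>m\<close>-dimensional Hilbert space, this is the maximally entangled state on the first
  tensor factor combined with the normalised trace on the second.
  \<^item> Positivity: \<open>\<tau> (z g) = \<Sum>\<^sub>l \<tau> ((g e\<^sub>l)* z (g e\<^sub>l))\<close>, so \<open>\<theta>\<close> is a sum of vector functionals.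
  \<^item> Normalisation: \<open>\<Sum>\<^sub>i \<tau> (e\<^sub>i* z e\<^sub>i g) = \<tau> (z g h) = \<tau> z\<close>.
  \<^item> Pairing with the conjugate of the compression of \<open>x\<close>: with \<open>y\<close> the conditional expectation of \<open>x\<close>,
  summation over \<open>j\<close> yields \<open>\<Sum>\<^sub>i \<tau> (e\<^sub>i* y y* e\<^sub>i g) = \<tau> (y y*)\<close>, which by the trace property is the squared length
  of the projection of \<open>x\<close>.
\<close>

theorem tracial_witness:
  obtains \<theta> :: "nat \<Rightarrow> nat \<Rightarrow> 'a \<Rightarrow> complex" where
    "\<And>i j. i < k \<Longrightarrow> j < k \<Longrightarrow> lin_fun A (carrier A) (\<theta> i j)"
    "\<And>X. gram A k X \<Longrightarrow> (\<Sum>i<k. \<Sum>j<k. \<theta> i j (X i j)) \<in> \<real>\<^sub>\<ge>\<^sub>0"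
    "(\<Sum>i<k. \<theta> i i \<one>) = 1"
    "\<And>x. x \<in> carrier A \<Longrightarrow> (\<Sum>i<k. \<Sum>j<k. cnj (\<tau> (adj A (e i) \<otimes> x \<otimes> e j)) * \<theta> i j x) =
       (\<Sum>i<k. complex_of_real ((cmod (\<tau> (adj A (e i) \<otimes> x)))\<^sup>2))"
proof -
  obtain g where gN: "g \<in> N" and hg: "h \<otimes> g = \<one>" using h_inverse by blast
  note [simp] = N_carrier[OF gN] N_carrier[OF h_N]
  have gh: "g \<otimes> h = \<one>" using h_central[OF gN] hg by simp
  have gadj: "adj A g = g"
  proof -
    have "adj A g \<otimes> h = \<one>" using hg h_adj adj_mult[of h g] by simp
    then have "adj A g \<otimes> h \<otimes> g = g" by simp
    then show ?thesis using hg by (simp add: m_assoc)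
  qed
  have gcent: "g \<otimes> y = y \<otimes> g" if y: "y \<in> N" for y
  proof -
    have [simp]: "y \<in> carrier A" using y N_carrier by blast
    have "g \<otimes> y = g \<otimes> y \<otimes> (h \<otimes> g)" using hg by simp
    also have "\<dots> = g \<otimes> (y \<otimes> h) \<otimes> g" by (simp add: m_assoc)
    also have "\<dots> = g \<otimes> (h \<otimes> y) \<otimes> g" using h_central[OF y] by simp
    also have "\<dots> = g \<otimes> h \<otimes> (y \<otimes> g)" by (simp add: m_assoc)
    finally show ?thesis using gh by simp
  qed
  have tr_g: "\<tau> (z \<otimes> g) = (\<Sum>l<k. \<tau> (adj A (g \<otimes> e l) \<otimes> z \<otimes> (g \<otimes> e l)))" if [simp]: "z \<in> carrier A" for z
  proof -
    have "z \<otimes> g = z \<otimes> g \<otimes> h \<otimes> g" using gh hg by (simp add: m_assoc)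
    then have "\<tau> (z \<otimes> g) = \<tau> (z \<otimes> g \<otimes> h \<otimes> g)" by simp
    also have "\<dots> = (\<Sum>l<k. \<tau> (z \<otimes> g \<otimes> e l \<otimes> adj A (e l) \<otimes> g))" by (rule tr_h_sandwich) auto
    also have "\<dots> = (\<Sum>l<k. \<tau> (adj A (g \<otimes> e l) \<otimes> z \<otimes> (g \<otimes> e l)))"
    proof (intro sum.cong refl)
      fix l assume "l \<in> {..<k}"
      then have [simp]: "e l \<in> carrier A" using e_carrier by simp
      have "\<tau> ((z \<otimes> (g \<otimes> e l)) \<otimes> (adj A (e l) \<otimes> g)) = \<tau> ((adj A (e l) \<otimes> g) \<otimes> (z \<otimes> (g \<otimes> e l)))"
        by (rule tr_comm) auto
      then show "\<tau> (z \<otimes> g \<otimes> e l \<otimes> adj A (e l) \<otimes> g) = \<tau> (adj A (g \<otimes> e l) \<otimes> z \<otimes> (g \<otimes> e l))"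
        by (simp add: m_assoc adj_mult gadj)
    qed
    finally show ?thesis .
  qed
  define \<theta> where "\<theta> i j x = \<tau> (adj A (e i) \<otimes> x \<otimes> e j \<otimes> g)" for i j x
  show thesis
  proof (rule that[of \<theta>])
    show "lin_fun A (carrier A) (\<theta> i j)" if "i < k" "j < k" for i j
      unfolding lin_fun_def \<theta>_def using that
      by (auto simp: Nc l_distr r_distr tr_add smult_mult_left smult_mult_right tr_smult)
    show "(\<Sum>i<k. \<Sum>j<k. \<theta> i j (X i j)) \<in> \<real>\<^sub>\<ge>\<^sub>0" if X: "gram A k X" for X
    proof -
      have "(\<Sum>i<k. \<Sum>j<k. \<theta> i j (X i j)) =
         (\<Sum>i<k. \<Sum>j<k. \<Sum>l<k. \<tau> (adj A (e i \<otimes> (g \<otimes> e l)) \<otimes> X i j \<otimes> (e j \<otimes> (g \<otimes> e l))))"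
      proof (intro sum.cong refl)
        fix i j assume "i \<in> {..<k}" "j \<in> {..<k}"
        then have [simp]: "e i \<in> carrier A" "e j \<in> carrier A" "X i j \<in> carrier A"
          using e_carrier gram_closed[OF X] by auto
        have "\<theta> i j (X i j) = (\<Sum>l<k. \<tau> (adj A (g \<otimes> e l) \<otimes> (adj A (e i) \<otimes> X i j \<otimes> e j) \<otimes> (g \<otimes> e l)))"
          unfolding \<theta>_def by (subst tr_g) auto
        also have "\<dots> = (\<Sum>l<k. \<tau> (adj A (e i \<otimes> (g \<otimes> e l)) \<otimes> X i j \<otimes> (e j \<otimes> (g \<otimes> e l))))"
          by (intro sum.cong refl) (auto simp: Nc adj_mult m_assoc)
        finally show "\<theta> i j (X i j) = \<dots>" .
      qed
      also have "\<dots> = (\<Sum>l<k. \<Sum>i<k. \<Sum>j<k. \<tau> (adj A (e i \<otimes> (g \<otimes> e l)) \<otimes> X i j \<otimes> (e j \<otimes> (g \<otimes> e l))))"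
        by (rule sum_rotate)
      also have "\<dots> \<in> \<real>\<^sub>\<ge>\<^sub>0"
        by (intro nonneg_Reals_sum gram_vector_state[OF X]) (auto simp: Nc)
      finally show ?thesis .
    qed
    have theta_one: "(\<Sum>i<k. \<tau> (adj A (e i) \<otimes> z \<otimes> e i \<otimes> g)) = \<tau> z" if [simp]: "z \<in> carrier A" for z
    proof -
      have "(\<Sum>i<k. \<tau> (adj A (e i) \<otimes> z \<otimes> e i \<otimes> g)) = (\<Sum>i<k. \<tau> (z \<otimes> g \<otimes> e i \<otimes> adj A (e i) \<otimes> \<one>))"
      proof (intro sum.cong refl)
        fix i assume "i \<in> {..<k}"
        then have [simp]: "e i \<in> carrier A" and eN: "e i \<in> N" using e_carrier e_N by auto
        have "\<tau> (adj A (e i) \<otimes> (z \<otimes> (e i \<otimes> g))) = \<tau> (z \<otimes> (e i \<otimes> g) \<otimes> adj A (e i))"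
          by (rule tr_comm) auto
        then show "\<tau> (adj A (e i) \<otimes> z \<otimes> e i \<otimes> g) = \<tau> (z \<otimes> g \<otimes> e i \<otimes> adj A (e i) \<otimes> \<one>)"
          by (simp add: gcent[OF eN, symmetric] m_assoc)
      qed
      also have "\<dots> = \<tau> (z \<otimes> g \<otimes> h \<otimes> \<one>)" by (rule tr_h_sandwich[symmetric]) auto
      finally show ?thesis using gh by (simp add: m_assoc)
    qed
    show "(\<Sum>i<k. \<theta> i i \<one>) = 1" unfolding \<theta>_def using theta_one[of \<one>] tr_one by simp
    fix x assume x: "x \<in> carrier A"
    define y where "y = (\<Oplus>i\<in>{..<k}. \<tau> (adj A (e i) \<otimes> x) \<odot> e i)"
    have yN: "y \<in> N" unfolding y_def by (intro N_finsum) (auto intro: N_smult e_N)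
    note [simp] = x N_carrier[OF yN]
    have swap: "\<tau> (adj A (e i) \<otimes> x \<otimes> n) = \<tau> (adj A (e i) \<otimes> y \<otimes> n)" if n: "n \<in> N" and i: "i < k" for n i
    proof -
      have [simp]: "n \<in> carrier A" "e i \<in> carrier A" using n i Nc by auto
      have *: "\<tau> (adj A (e i) \<otimes> w \<otimes> n) = \<tau> (n \<otimes> adj A (e i) \<otimes> w)" if [simp]: "w \<in> carrier A" for w
        using tr_comm[of "adj A (e i) \<otimes> w" n] by (simp add: m_assoc)
      show ?thesis unfolding *[OF x] *[OF N_carrier[OF yN]]
        using tr_expectation[OF x, of "n \<otimes> adj A (e i)"] n i by (simp add: N_mult N_adj e_N y_def)
    qed
    have "(\<Sum>i<k. \<Sum>j<k. cnj (\<tau> (adj A (e i) \<otimes> x \<otimes> e j)) * \<theta> i j x) =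
       (\<Sum>i<k. \<Sum>j<k. \<tau> (adj A (e j) \<otimes> (adj A y \<otimes> e i)) * \<tau> (adj A (e i) \<otimes> y \<otimes> e j \<otimes> g))"
    proof (intro sum.cong refl)
      fix i j assume "i \<in> {..<k}" "j \<in> {..<k}"
      then have ij: "i < k" "j < k" by auto
      have "cnj (\<tau> (adj A (e i) \<otimes> y \<otimes> e j)) = \<tau> (adj A (e j) \<otimes> (adj A y \<otimes> e i))"
        using ij by (simp add: Nc adj_mult m_assoc flip: tr_adj)
      then have "cnj (\<tau> (adj A (e i) \<otimes> x \<otimes> e j)) = \<tau> (adj A (e j) \<otimes> (adj A y \<otimes> e i))"
        using swap[OF e_N[OF ij(2)] ij(1)] by simp
      moreover have "\<theta> i j x = \<tau> (adj A (e i) \<otimes> y \<otimes> e j \<otimes> g)"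
        using swap[of "e j \<otimes> g" i] ij by (simp add: \<theta>_def m_assoc Nc N_mult e_N gN)
      ultimately show "cnj (\<tau> (adj A (e i) \<otimes> x \<otimes> e j)) * \<theta> i j x =
         \<tau> (adj A (e j) \<otimes> (adj A y \<otimes> e i)) * \<tau> (adj A (e i) \<otimes> y \<otimes> e j \<otimes> g)" by simp
    qed
    also have "\<dots> = (\<Sum>i<k. \<tau> (adj A (e i) \<otimes> y \<otimes> (adj A y \<otimes> e i) \<otimes> g))"
      by (intro sum.cong[OF refl] expand_left[symmetric]) (auto intro: N_mult N_adj yN e_N simp: Nc)
    also have "\<dots> = (\<Sum>i<k. \<tau> (adj A (e i) \<otimes> (y \<otimes> adj A y) \<otimes> e i \<otimes> g))"
      by (intro sum.cong refl) (auto simp: Nc m_assoc)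
    also have "\<dots> = \<tau> (adj A y \<otimes> y)" using theta_one[of "y \<otimes> adj A y"] tr_comm[of y "adj A y"] by simp
    also have "\<dots> = \<tau> (\<one> \<otimes> adj A y \<otimes> y)" by simp
    also have "\<dots> = (\<Sum>i<k. \<tau> (adj A y \<otimes> e i) * \<tau> (\<one> \<otimes> adj A (e i) \<otimes> y))"
      by (rule expand_right) (auto intro: N_adj yN)
    also have "\<dots> = (\<Sum>i<k. complex_of_real ((cmod (\<tau> (adj A (e i) \<otimes> x)))\<^sup>2))"
    proof (intro sum.cong refl)
      fix i assume "i \<in> {..<k}"
      then have i: "i < k" by simp
      have "\<tau> (adj A (e i) \<otimes> y) = \<tau> (adj A (e i) \<otimes> x)" unfolding y_def using i by (rule coeff_comb)
      moreover have "\<tau> (adj A y \<otimes> e i) = cnj (\<tau> (adj A (e i) \<otimes> y))"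
        using i by (simp add: Nc adj_mult flip: tr_adj)
      ultimately show "\<tau> (adj A y \<otimes> e i) * \<tau> (\<one> \<otimes> adj A (e i) \<otimes> y) = complex_of_real ((cmod (\<tau> (adj A (e i) \<otimes> x)))\<^sup>2)"
        using i by (simp add: Nc cnj_mult_self)
    qed
    finally show "(\<Sum>i<k. \<Sum>j<k. cnj (\<tau> (adj A (e i) \<otimes> x \<otimes> e j)) * \<theta> i j x) =
      (\<Sum>i<k. complex_of_real ((cmod (\<tau> (adj A (e i) \<otimes> x)))\<^sup>2))" .
  qed
qed

text \<open>
  The matrix is the complex conjugate of the compression to \<open>N\<close> of left multiplication by \<open>x\<close> on
  \<open>L\<^sup>2(A, \<tau>)\<close>, and compressions do not increase the norm by Bessel's inequality.
\<close>

lemma compression_op_norm: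
  assumes x: "x \<in> carrier A"
    and le: "\<And>b. b \<in> carrier A \<Longrightarrow> Re (\<tau> (adj A (x \<otimes> b) \<otimes> (x \<otimes> b))) \<le> Re (\<tau> (adj A b \<otimes> b))"
  shows "op_norm (mat k k (\<lambda>(i, j). cnj (\<tau> (adj A (e i) \<otimes> x \<otimes> e j)))) \<le> 1"
proof -
  let ?U = "mat k k (\<lambda>(i, j). cnj (\<tau> (adj A (e i) \<otimes> x \<otimes> e j)))"
  have "euclid_norm (?U *\<^sub>v v) \<le> 1" if v: "v \<in> carrier_vec k" "euclid_norm v \<le> 1" for v
  proof -
    define b where "b = (\<Oplus>j\<in>{..<k}. cnj (v $ j) \<odot> e j)"
    have bN: "b \<in> N" unfolding b_def by (intro N_finsum) (auto intro: N_smult e_N)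
    note [simp] = x N_carrier[OF bN]
    have Uv: "(?U *\<^sub>v v) $ i = cnj (\<tau> (adj A (e i) \<otimes> (x \<otimes> b)))" if i: "i < k" for i
    proof -
      have "\<tau> (adj A (e i) \<otimes> x \<otimes> b \<otimes> \<one>) = (\<Sum>j<k. \<tau> (adj A (e i) \<otimes> x \<otimes> (cnj (v $ j) \<odot> e j) \<otimes> \<one>))"
        unfolding b_def using i by (intro tr_finsum_sandwich) (auto simp: Nc)
      also have "\<dots> = (\<Sum>j<k. cnj (v $ j) * \<tau> (adj A (e i) \<otimes> x \<otimes> e j))"
        using i by (intro sum.cong refl) (auto simp: Nc smult_mult_right tr_smult)
      finally have "\<tau> (adj A (e i) \<otimes> (x \<otimes> b)) = (\<Sum>j<k. cnj (v $ j) * \<tau> (adj A (e i) \<otimes> x \<otimes> e j))"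
        using i by (simp add: Nc m_assoc)
      then show ?thesis using i v(1) by (simp add: scalar_prod_def lessThan_atLeast0 mult.commute)
    qed
    have bb: "Re (\<tau> (adj A b \<otimes> b)) = (\<Sum>i<k. (cmod (v $ i))\<^sup>2)"
    proof -
      have "\<tau> (\<one> \<otimes> adj A b \<otimes> b) = (\<Sum>i<k. \<tau> (adj A b \<otimes> e i) * \<tau> (\<one> \<otimes> adj A (e i) \<otimes> b))"
        by (rule expand_right) (auto intro: N_adj bN)
      also have "\<dots> = (\<Sum>i<k. complex_of_real ((cmod (v $ i))\<^sup>2))"
      proof (intro sum.cong refl)
        fix i assume "i \<in> {..<k}"
        then have i: "i < k" by simp
        have "\<tau> (adj A (e i) \<otimes> b) = cnj (v $ i)" unfolding b_def using i by (rule coeff_comb)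
        moreover have "\<tau> (adj A b \<otimes> e i) = cnj (\<tau> (adj A (e i) \<otimes> b))"
          using i by (simp add: Nc adj_mult flip: tr_adj)
        ultimately show "\<tau> (adj A b \<otimes> e i) * \<tau> (\<one> \<otimes> adj A (e i) \<otimes> b) = complex_of_real ((cmod (v $ i))\<^sup>2)"
          using i by (simp add: Nc cnj_mult_self)
      qed
      finally show ?thesis by (simp flip: of_real_sum)
    qed
    have "(\<Sum>i<k. (cmod ((?U *\<^sub>v v) $ i))\<^sup>2) = (\<Sum>i<k. (cmod (\<tau> (adj A (e i) \<otimes> (x \<otimes> b))))\<^sup>2)"
      by (intro sum.cong refl) (simp add: Uv del: index_mult_mat_vec)
    also have "\<dots> \<le> Re (\<tau> (adj A (x \<otimes> b) \<otimes> (x \<otimes> b)))" by (rule bessel) simp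
    also have "\<dots> \<le> (\<Sum>i<k. (cmod (v $ i))\<^sup>2)" using le[of b] bb by simp
    also have "\<dots> \<le> 1" using v by (simp add: euclid_norm_def)
    finally show ?thesis by (simp add: euclid_norm_def)
  qed
  moreover have "0\<^sub>v k \<in> {v \<in> carrier_vec k. euclid_norm v \<le> 1}" by (simp add: euclid_norm_def)
  ultimately show ?thesis unfolding op_norm_def
    by (intro cSUP_least) (force, simp)
qed

end

context tracial_star_algebra
begin

lemma gram_schmidt:
  assumes N_add: "\<And>x y. x \<in> N \<Longrightarrow> y \<in> N \<Longrightarrow> x \<oplus> y \<in> N"
    and N_smult: "\<And>x c. x \<in> N \<Longrightarrow> c \<odot> x \<in> N" and N_zero: "\<zero> \<in> N" and N_sub: "N \<subseteq> carrier A"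
    and faithful: "\<And>x. x \<in> N \<Longrightarrow> \<tau> (adj A x \<otimes> x) = 0 \<Longrightarrow> x = \<zero>"
    and F: "finite F" "F \<subseteq> N"
  shows "\<exists>(k::nat) e. (\<forall>i<k. e i \<in> N) \<and>
    (\<forall>i<k. \<forall>j<k. \<tau> (adj A (e i) \<otimes> e j) = (if i = j then 1 else 0)) \<and>
    (\<forall>x\<in>F. x = (\<Oplus>i\<in>{..<k}. \<tau> (adj A (e i) \<otimes> x) \<odot> e i))"
  using F
proof (induction F rule: finite_induct)
  case empty
  show ?case by (rule exI[of _ 0]) simp
next
  case (insert x F)
  then obtain k :: nat and e where *: "(\<forall>i<k. e i \<in> N) \<and>
    (\<forall>i<k. \<forall>j<k. \<tau> (adj A (e i) \<otimes> e j) = (if i = j then 1 else 0)) \<and>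
    (\<forall>x\<in>F. x = (\<Oplus>i\<in>{..<k}. \<tau> (adj A (e i) \<otimes> x) \<odot> e i))"
    by auto
  then have eN: "\<And>i. i < k \<Longrightarrow> e i \<in> N"
    and orth: "\<And>i j. i < k \<Longrightarrow> j < k \<Longrightarrow> \<tau> (adj A (e i) \<otimes> e j) = (if i = j then 1 else 0)"
    and span: "\<And>x. x \<in> F \<Longrightarrow> x = (\<Oplus>i\<in>{..<k}. \<tau> (adj A (e i) \<otimes> x) \<odot> e i)"
    by simp_all
  have ec: "e i \<in> carrier A" if "i < k" for i using eN[OF that] N_sub by blast
  have fin: "(\<Oplus>i\<in>{..<l}. c i \<odot> e i) \<in> N" if "l \<le> k" for c l
    using that
  proof (induction l)
    case (Suc l)
    then show ?case using N_add N_smult eN ec by (subst finsum_lessThan_Suc) auto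
  qed (use N_zero in auto)
  define p where "p = (\<Oplus>i\<in>{..<k}. \<tau> (adj A (e i) \<otimes> x) \<odot> e i)"
  define y where "y = x \<ominus> p"
  have pN: "p \<in> N" unfolding p_def by (rule fin) simp
  have xN: "x \<in> N" using insert by simp
  have [simp]: "x \<in> carrier A" "p \<in> carrier A" using xN pN N_sub by auto
  have yN: "y \<in> N" unfolding y_def using xN pN N_add N_smult by (simp add: diff_conv_smult)
  have [simp]: "y \<in> carrier A" using yN N_sub by blast
  show ?case
  proof (cases "y = \<zero>")
    case True
    then have "x = p" by (simp add: y_def)
    with eN orth span show ?thesis unfolding p_def
      by (intro exI[of _ k] exI[of _ e]) auto
  next
    case False
    have ey: "\<tau> (adj A (e i) \<otimes> y) = 0" if "i < k" for i
      using that ec orthonormal_coeff[OF ec orth that, of "\<lambda>i. \<tau> (adj A (e i) \<otimes> x)"]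
      by (simp add: y_def mult_diff tr_diff flip: p_def)
    have ye: "\<tau> (adj A y \<otimes> e i) = 0" if "i < k" for i
    proof -
      have "\<tau> (adj A y \<otimes> e i) = cnj (\<tau> (adj A (e i) \<otimes> y))" using that ec by (simp add: adj_mult flip: tr_adj)
      then show ?thesis using ey[OF that] by simp
    qed
    have comb: "\<tau> (adj A y \<otimes> (\<Oplus>i\<in>{..<k}. c i \<odot> e i)) = 0" for c
    proof -
      have "\<tau> (adj A y \<otimes> (\<Oplus>i\<in>{..<k}. c i \<odot> e i) \<otimes> \<one>) = (\<Sum>i<k. \<tau> (adj A y \<otimes> (c i \<odot> e i) \<otimes> \<one>))"
        using ec by (intro tr_finsum_sandwich) auto
      also have "\<dots> = 0" using ec by (intro sum.neutral) (auto simp: smult_mult_right tr_smult ye)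
      finally show ?thesis using ec by (simp add: finsum_closed Pi_def)
    qed
    obtain t where t: "\<tau> (adj A y \<otimes> y) = complex_of_real t" "t \<ge> 0"
      using tr_pos[of y] by (auto elim: nonneg_Reals_cases)
    have "t \<noteq> 0" using faithful[OF yN] False t(1) by auto
    then have t0: "t > 0" using t(2) by simp
    have rr: "complex_of_real (sqrt t) * complex_of_real (sqrt t) = complex_of_real t"
      using t(2) by (metis of_real_mult real_sqrt_mult_self abs_of_nonneg)
    define r where "r = complex_of_real (1 / sqrt t)"
    have r: "cnj r = r" "r * (r * complex_of_real t) = 1" "r * complex_of_real (sqrt t) = 1"
      using t0 rr by (auto simp: r_def field_simps)
    define e' where "e' i = (if i < k then e i else r \<odot> y)" for i
    have e'N: "e' i \<in> N" for i using eN N_smult[OF yN] by (simp add: e'_def)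
    have e'c: "e' i \<in> carrier A" for i using e'N N_sub by blast
    have orth': "\<tau> (adj A (e' i) \<otimes> e' j) = (if i = j then 1 else 0)" if "i < Suc k" "j < Suc k" for i j
      using that ec orth ey ye r t(1)
      by (auto simp: e'_def adj_smult smult_mult_left smult_mult_right smult_smult tr_smult less_Suc_eq mult.assoc)
    have sum': "(\<Oplus>i\<in>{..<Suc k}. \<tau> (adj A (e' i) \<otimes> z) \<odot> e' i) =
       (\<Oplus>i\<in>{..<k}. \<tau> (adj A (e i) \<otimes> z) \<odot> e i) \<oplus> (r * \<tau> (adj A y \<otimes> z) * r) \<odot> y" if z: "z \<in> carrier A" for z
    proof -
      have "(\<Oplus>i\<in>{..<Suc k}. \<tau> (adj A (e' i) \<otimes> z) \<odot> e' i) =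
        (\<Oplus>i\<in>{..<k}. \<tau> (adj A (e' i) \<otimes> z) \<odot> e' i) \<oplus> \<tau> (adj A (e' k) \<otimes> z) \<odot> e' k"
        using e'c by (intro finsum_lessThan_Suc) auto
      also have "(\<Oplus>i\<in>{..<k}. \<tau> (adj A (e' i) \<otimes> z) \<odot> e' i) = (\<Oplus>i\<in>{..<k}. \<tau> (adj A (e i) \<otimes> z) \<odot> e i)"
        using ec by (intro finsum_cong') (auto simp: e'_def)
      also have "\<tau> (adj A (e' k) \<otimes> z) \<odot> e' k = (r * \<tau> (adj A y \<otimes> z) * r) \<odot> y"
        using z by (simp add: e'_def adj_smult smult_mult_left tr_smult smult_smult r)
      finally show ?thesis .
    qed
    have "z = (\<Oplus>i\<in>{..<Suc k}. \<tau> (adj A (e' i) \<otimes> z) \<odot> e' i)" if z: "z \<in> insert x F" for z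
    proof (cases "z = x")
      case True
      have "\<tau> (adj A y \<otimes> x) = \<tau> (adj A y \<otimes> y)"
        using comb[of "\<lambda>i. \<tau> (adj A (e i) \<otimes> x)"] by (simp add: y_def mult_diff tr_diff flip: p_def)
      then have "r * \<tau> (adj A y \<otimes> x) * r = 1" using r t(1) by (simp add: ac_simps)
      then have "(\<Oplus>i\<in>{..<Suc k}. \<tau> (adj A (e' i) \<otimes> x) \<odot> e' i) = p \<oplus> y"
        using sum'[of x] by (simp add: p_def)
      also have "\<dots> = x" by (simp add: y_def group_simps)
      finally show ?thesis using True by simp
    next
      case False
      then have zF: "z \<in> F" using z by simp
      have "\<tau> (adj A y \<otimes> z) = 0" by (subst span[OF zF]) (rule comb)
      moreover have "z \<in> carrier A" using zF insert.prems N_sub by auto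
      ultimately show ?thesis using sum'[of z] span[OF zF] by (simp add: finsum_closed Pi_def ec)
    qed
    then show ?thesis using e'N orth' by (intro exI[of _ "Suc k"] exI[of _ e']) auto
  qed
qed

lemma fd_subalgebra_exists:
  assumes N: "star_subalgebra A N" and fd: "finite_dim A N"
    and faithful: "\<And>x. x \<in> N \<Longrightarrow> \<tau> (adj A x \<otimes> x) = 0 \<Longrightarrow> x = \<zero>"
  shows "\<exists>k e. fd_subalgebra A \<tau> k e N"
proof -
  have sr: "subring N A" and sm: "Module.submodule N complex_field A" and Na: "\<And>x. x \<in> N \<Longrightarrow> adj A x \<in> N"
    using N unfolding star_subalgebra_def by auto
  have Nc: "N \<subseteq> carrier A" using vs.submoduleE(1)[OF sm] .
  have Nadd: "x \<oplus> y \<in> N" if "x \<in> N" "y \<in> N" for x y using vs.submoduleE(5)[OF sm] that by blast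
  have Nsm: "c \<odot> x \<in> N" if "x \<in> N" for c x using vs.submoduleE(4)[OF sm, of c x] that by simp
  have None: "\<one> \<in> N" and Nmult: "\<And>x y. x \<in> N \<Longrightarrow> y \<in> N \<Longrightarrow> x \<otimes> y \<in> N"
    using sr unfolding subring_def by (auto intro: submonoid.one_closed submonoid.m_closed)
  have N0: "\<zero> \<in> N" using Nsm[OF None, of 0] by simp
  obtain F where F: "finite F" "F \<subseteq> N" "N \<subseteq> lin_span A F" using fd unfolding finite_dim_def by blast
  obtain k :: nat and e where eN: "\<And>i. i < k \<Longrightarrow> e i \<in> N"
    and orth: "\<And>i j. i < k \<Longrightarrow> j < k \<Longrightarrow> \<tau> (adj A (e i) \<otimes> e j) = (if i = j then 1 else 0)"
    and span: "\<And>x. x \<in> F \<Longrightarrow> x = (\<Oplus>i\<in>{..<k}. \<tau> (adj A (e i) \<otimes> x) \<odot> e i)"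
    using gram_schmidt[OF Nadd Nsm N0 Nc faithful F(1,2)] by blast
  have ec: "e i \<in> carrier A" if "i < k" for i using eN[OF that] Nc by blast
  define W where "W = {x \<in> carrier A. x = (\<Oplus>i\<in>{..<k}. \<tau> (adj A (e i) \<otimes> x) \<odot> e i)}"
  have Wadd: "x \<oplus> y \<in> W" if x: "x \<in> W" and y: "y \<in> W" for x y
  proof -
    have [simp]: "x \<in> carrier A" "y \<in> carrier A" using x y by (auto simp: W_def)
    have "(\<Oplus>i\<in>{..<k}. \<tau> (adj A (e i) \<otimes> (x \<oplus> y)) \<odot> e i) =
        (\<Oplus>i\<in>{..<k}. \<tau> (adj A (e i) \<otimes> x) \<odot> e i \<oplus> \<tau> (adj A (e i) \<otimes> y) \<odot> e i)"
      using ec by (intro finsum_cong') (auto simp: r_distr tr_add smult_add_left)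
    also have "\<dots> = x \<oplus> y" using ec x y by (subst finsum_addf) (auto simp: W_def)
    finally show ?thesis by (simp add: W_def)
  qed
  have Wsm: "c \<odot> x \<in> W" if x: "x \<in> W" for c x
  proof -
    have [simp]: "x \<in> carrier A" using x by (auto simp: W_def)
    have "(\<Oplus>i\<in>{..<k}. \<tau> (adj A (e i) \<otimes> (c \<odot> x)) \<odot> e i) = (\<Oplus>i\<in>{..<k}. c \<odot> (\<tau> (adj A (e i) \<otimes> x) \<odot> e i))"
      using ec by (intro finsum_cong') (auto simp: smult_mult_right tr_smult smult_smult)
    also have "\<dots> = c \<odot> (\<Oplus>i\<in>{..<k}. \<tau> (adj A (e i) \<otimes> x) \<odot> e i)"
      using ec by (intro smult_finsum[symmetric]) auto
    also have "\<dots> = c \<odot> x" using x by (simp add: W_def)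
    finally show ?thesis by (simp add: W_def)
  qed
  have W0: "\<zero> \<in> W" using ec unfolding W_def
    by (auto intro!: finsum_zero[THEN sym, THEN trans] finsum_cong')
  have "Module.submodule W complex_field A"
  proof (rule vs.submoduleI)
    show "\<ominus> x \<in> W" if "x \<in> W" for x
      using Wsm[OF that, of "-1"] that by (simp add: minus_conv_smult W_def)
  qed (use Wadd Wsm W0 in \<open>auto simp: W_def\<close>)
  moreover have "F \<subseteq> W" using span F(2) Nc unfolding W_def by blast
  ultimately have "lin_span A F \<subseteq> W" unfolding lin_span_def by blast
  then have "N \<subseteq> W" using F(3) by blast
  then have "fd_subalgebra A \<tau> k e N"
    using Nc None Nadd Nmult Nsm Na eN orth by unfold_locales (auto simp: W_def)
  then show ?thesis by blast
qed

end

section \<open>Homomorphisms, quotients and transport of structure\<close>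

text \<open>
  Complete positivity formulated with Gram matrices, in which form it is stable under composition with
  *-homomorphisms.
\<close>

definition gram_positive ::
    "('a, 'm) star_alg_scheme \<Rightarrow> 'a set \<Rightarrow> ('b, 'n) star_alg_scheme \<Rightarrow> ('a \<Rightarrow> 'b) \<Rightarrow> bool" where
  "gram_positive A S B \<psi> \<longleftrightarrow> \<psi> \<in> S \<rightarrow> carrier B \<and> linear_on A S B \<psi> \<and> \<psi> \<one>\<^bsub>A\<^esub> = \<one>\<^bsub>B\<^esub> \<and>
     (\<forall>k\<ge>1. \<forall>X. gram A k X \<longrightarrow> (\<forall>i<k. \<forall>j<k. X i j \<in> S) \<longrightarrow> gram B k (\<lambda>i j. \<psi> (X i j)))"

lemma ucp_gram_positive:
  assumes "star_algebra A" "star_algebra B" "ucp A S B \<psi>" "\<zero>\<^bsub>A\<^esub> \<in> S"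
  shows "gram_positive A S B \<psi>"
  using assms(3) ucp_gram[OF assms(1-3) _ _ assms(4)] unfolding gram_positive_def ucp_def by blast

lemma star_homD:
  assumes "star_hom A B f"
  shows "x \<in> carrier A \<Longrightarrow> f x \<in> carrier B"
    "x \<in> carrier A \<Longrightarrow> y \<in> carrier A \<Longrightarrow> f (x \<oplus>\<^bsub>A\<^esub> y) = f x \<oplus>\<^bsub>B\<^esub> f y"
    "x \<in> carrier A \<Longrightarrow> y \<in> carrier A \<Longrightarrow> f (x \<otimes>\<^bsub>A\<^esub> y) = f x \<otimes>\<^bsub>B\<^esub> f y"
    "f \<one>\<^bsub>A\<^esub> = \<one>\<^bsub>B\<^esub>"
    "x \<in> carrier A \<Longrightarrow> f (c \<odot>\<^bsub>A\<^esub> x) = c \<odot>\<^bsub>B\<^esub> f x"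
    "x \<in> carrier A \<Longrightarrow> f (adj A x) = adj B (f x)"
  using assms unfolding star_hom_def Ring.ring_hom_def by auto

lemma star_hom_zero:
  assumes "star_algebra A" "star_algebra B" "star_hom A B f"
  shows "f \<zero>\<^bsub>A\<^esub> = \<zero>\<^bsub>B\<^esub>"
proof -
  interpret A: star_algebra A by fact
  interpret B: star_algebra B by fact
  show ?thesis using star_homD(5)[OF assms(3), of "\<zero>\<^bsub>A\<^esub>" 0] star_homD(1)[OF assms(3), of "\<zero>\<^bsub>A\<^esub>"] by simp
qed

lemma star_hom_finsum:
  assumes A: "star_algebra A" and B: "star_algebra B" and f: "star_hom A B f"
    and I: "finite I" "\<And>i. i \<in> I \<Longrightarrow> g i \<in> carrier A"
  shows "f (\<Oplus>\<^bsub>A\<^esub>i\<in>I. g i) = (\<Oplus>\<^bsub>B\<^esub>i\<in>I. f (g i))"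
proof -
  interpret A: star_algebra A by fact
  interpret B: star_algebra B by fact
  show ?thesis using I
  proof (induction I rule: finite_induct)
    case empty
    then show ?case using star_hom_zero[OF A B f] by simp
  next
    case (insert x F)
    then show ?case using star_homD(1,2)[OF f]
      by (subst A.finsum_insert; (subst B.finsum_insert)?) (auto simp: Pi_def A.finsum_closed)
  qed
qed

lemma star_hom_gram:
  assumes A: "star_algebra A" and B: "star_algebra B" and f: "star_hom A B f" and X: "gram A k X"
  shows "gram B k (\<lambda>i j. f (X i j))"
proof -
  interpret A: star_algebra A by fact
  interpret B: star_algebra B by fact
  obtain p :: nat and Y where Y: "\<And>l i. l < p \<Longrightarrow> i < k \<Longrightarrow> Y l i \<in> carrier A"
    "\<And>i j. i < k \<Longrightarrow> j < k \<Longrightarrow> X i j = (\<Oplus>\<^bsub>A\<^esub>l\<in>{..<p}. adj A (Y l i) \<otimes>\<^bsub>A\<^esub> Y l j)"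
    using X unfolding gram_def by blast
  have "f (X i j) = (\<Oplus>\<^bsub>B\<^esub>l\<in>{..<p}. adj B (f (Y l i)) \<otimes>\<^bsub>B\<^esub> f (Y l j))" if ij: "i < k" "j < k" for i j
  proof -
    have "f (X i j) = (\<Oplus>\<^bsub>B\<^esub>l\<in>{..<p}. f (adj A (Y l i) \<otimes>\<^bsub>A\<^esub> Y l j))"
      unfolding Y(2)[OF ij] using Y(1) ij by (intro star_hom_finsum[OF A B f]) auto
    also have "\<dots> = (\<Oplus>\<^bsub>B\<^esub>l\<in>{..<p}. adj B (f (Y l i)) \<otimes>\<^bsub>B\<^esub> f (Y l j))"
      using Y(1) ij star_homD[OF f] by (intro B.finsum_cong') auto
    finally show ?thesis .
  qed
  then show ?thesis using Y(1) star_homD(1)[OF f] unfolding gram_def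
    by (intro exI[of _ p] exI[of _ "\<lambda>l i. f (Y l i)"]) auto
qed

lemma gram_positive_comp:
  assumes B: "star_algebra B" and C: "star_algebra C" and \<psi>: "gram_positive A S B \<psi>" and f: "star_hom B C f"
  shows "gram_positive A S C (\<lambda>x. f (\<psi> x))"
  using \<psi> star_homD[OF f] star_hom_gram[OF B C f] unfolding gram_positive_def linear_on_def
  by (auto simp: Pi_def)

lemma star_hom_mat_pos_cone:
  assumes A: "star_algebra A" and B: "star_algebra B" and f: "star_hom A B f"
    and X: "X \<in> pos_cone (mat_alg k A)"
  shows "map_mat f X \<in> pos_cone (mat_alg k B)"
proof -
  interpret A: star_algebra A by fact
  interpret B: star_algebra B by fact
  obtain Y where Y: "Y \<in> carrier (mat_alg k A)" "X = adj (mat_alg k A) Y \<otimes>\<^bsub>mat_alg k A\<^esub> Y"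
    using X unfolding pos_cone_def by blast
  have Yd: "dim_row Y = k" "dim_col Y = k" and Yc: "\<And>i j. i < k \<Longrightarrow> j < k \<Longrightarrow> Y $$ (i, j) \<in> carrier A"
    using Y(1) by (auto simp: mat_alg_carrier_iff)
  have fY: "map_mat f Y \<in> carrier (mat_alg k B)"
    using Y(1) star_homD(1)[OF f] by (auto simp: mat_alg_carrier_iff)
  have "f (X $$ (i, j)) = (adj (mat_alg k B) (map_mat f Y) \<otimes>\<^bsub>mat_alg k B\<^esub> map_mat f Y) $$ (i, j)"
    if ij: "i < k" "j < k" for i j
  proof -
    have "f (X $$ (i, j)) = f (\<Oplus>\<^bsub>A\<^esub>l\<in>{..<k}. adj (mat_alg k A) Y $$ (i, l) \<otimes>\<^bsub>A\<^esub> Y $$ (l, j))"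
      using ij by (simp add: Y(2) mat_alg_mult)
    also have "\<dots> = (\<Oplus>\<^bsub>B\<^esub>l\<in>{..<k}. f (adj (mat_alg k A) Y $$ (i, l) \<otimes>\<^bsub>A\<^esub> Y $$ (l, j)))"
      using ij Yc by (intro star_hom_finsum[OF A B f]) (auto simp: mat_alg_ops)
    also have "\<dots> = (\<Oplus>\<^bsub>B\<^esub>l\<in>{..<k}. adj (mat_alg k B) (map_mat f Y) $$ (i, l) \<otimes>\<^bsub>B\<^esub> map_mat f Y $$ (l, j))"
      using ij Yc Yd star_homD[OF f] by (intro B.finsum_cong') (auto simp: mat_alg_ops)
    also have "\<dots> = (adj (mat_alg k B) (map_mat f Y) \<otimes>\<^bsub>mat_alg k B\<^esub> map_mat f Y) $$ (i, j)"
      using ij by (simp add: mat_alg_mult)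
    finally show ?thesis .
  qed
  then have "map_mat f X = adj (mat_alg k B) (map_mat f Y) \<otimes>\<^bsub>mat_alg k B\<^esub> map_mat f Y"
    by (intro eq_matI) (simp_all add: Y(2) mat_alg_mult)
  then show ?thesis using fY unfolding pos_cone_def by blast
qed

lemma star_hom_ucp:
  assumes A: "star_algebra A" and B: "star_algebra B" and f: "star_hom A B f" and S: "S \<subseteq> carrier A"
  shows "ucp A S B f"
  unfolding ucp_def linear_on_def
  using star_homD[OF f] star_hom_mat_pos_cone[OF A B f] S by (auto simp: subset_iff)

lemma star_algebra_image:
  assumes B: "star_algebra B" and car: "carrier C = q ` carrier B"
    and m: "\<And>x y. x \<in> carrier B \<Longrightarrow> y \<in> carrier B \<Longrightarrow> q x \<otimes>\<^bsub>C\<^esub> q y = q (x \<otimes>\<^bsub>B\<^esub> y)"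
    and a: "\<And>x y. x \<in> carrier B \<Longrightarrow> y \<in> carrier B \<Longrightarrow> q x \<oplus>\<^bsub>C\<^esub> q y = q (x \<oplus>\<^bsub>B\<^esub> y)"
    and s: "\<And>c x. x \<in> carrier B \<Longrightarrow> c \<odot>\<^bsub>C\<^esub> q x = q (c \<odot>\<^bsub>B\<^esub> x)"
    and z: "\<zero>\<^bsub>C\<^esub> = q \<zero>\<^bsub>B\<^esub>" and o: "\<one>\<^bsub>C\<^esub> = q \<one>\<^bsub>B\<^esub>"
    and ad: "\<And>x. x \<in> carrier B \<Longrightarrow> adj C (q x) = q (adj B x)"
  shows "star_algebra C" "star_hom B C q"
proof -
  interpret B: star_algebra B by fact
  have ag: "abelian_group C"
  proof (rule abelian_groupI)
    fix x assume "x \<in> carrier C"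
    then obtain b where b: "b \<in> carrier B" "x = q b" using car by blast
    then show "\<exists>y\<in>carrier C. y \<oplus>\<^bsub>C\<^esub> x = \<zero>\<^bsub>C\<^esub>"
      by (intro bexI[of _ "q (\<ominus>\<^bsub>B\<^esub> b)"]) (auto simp: car a z B.l_neg)
  qed (auto simp: car a z B.a_ac)
  have rg: "ring C"
  proof (rule ringI[OF ag])
    show "Group.monoid C" by (rule monoidI) (auto simp: car m o B.m_assoc)
  qed (auto simp: car m a B.l_distr B.r_distr)
  have md: "Module.module complex_field C"
    by (rule moduleI[OF cring_complex_field ag])
      (auto simp: car s a B.smult_add_left B.smult_add_right B.smult_smult)
  show "star_algebra C"
    by (intro star_algebra.intro star_space.intro star_space_axioms.intro star_algebra_axioms.intro ag rg md)
      (auto simp: car s a ad m B.adj_add B.adj_smult B.adj_mult B.smult_mult_left B.smult_mult_right)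
  show "star_hom B C q" unfolding star_hom_def Ring.ring_hom_def by (auto simp: car m a s o ad)
qed

lemma cstar_algebra_image:
  assumes B: "cstar_algebra B" and car: "carrier C = q ` carrier B"
    and m: "\<And>x y. x \<in> carrier B \<Longrightarrow> y \<in> carrier B \<Longrightarrow> q x \<otimes>\<^bsub>C\<^esub> q y = q (x \<otimes>\<^bsub>B\<^esub> y)"
    and a: "\<And>x y. x \<in> carrier B \<Longrightarrow> y \<in> carrier B \<Longrightarrow> q x \<oplus>\<^bsub>C\<^esub> q y = q (x \<oplus>\<^bsub>B\<^esub> y)"
    and s: "\<And>c x. x \<in> carrier B \<Longrightarrow> c \<odot>\<^bsub>C\<^esub> q x = q (c \<odot>\<^bsub>B\<^esub> x)"
    and z: "\<zero>\<^bsub>C\<^esub> = q \<zero>\<^bsub>B\<^esub>" and o: "\<one>\<^bsub>C\<^esub> = q \<one>\<^bsub>B\<^esub>"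
    and ad: "\<And>x. x \<in> carrier B \<Longrightarrow> adj C (q x) = q (adj B x)"
    and inj: "inj_on q (carrier B)" and no: "\<And>x. x \<in> carrier B \<Longrightarrow> cnorm C (q x) = cnorm B x"
  shows "cstar_algebra C"
proof -
  interpret B: cstar_algebra B by fact
  interpret C: star_algebra C by (rule star_algebra_image(1)[OF B.star_algebra_axioms car m a s z o ad])
  have d: "q x \<ominus>\<^bsub>C\<^esub> q y = q (x \<ominus>\<^bsub>B\<^esub> y)" if "x \<in> carrier B" "y \<in> carrier B" for x y
    using that by (simp add: C.diff_conv_smult B.diff_conv_smult car s a)
  show ?thesis
  proof unfold_locales
    fix f assume f: "\<forall>i::nat. f i \<in> carrier C"
      and cau: "\<forall>e>0. \<exists>N. \<forall>i\<ge>N. \<forall>j\<ge>N. cnorm C (f i \<ominus>\<^bsub>C\<^esub> f j) < e"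
    have "\<forall>i. \<exists>b. b \<in> carrier B \<and> f i = q b" using f car by auto
    then obtain b where b: "\<And>i. b i \<in> carrier B" "\<And>i. f i = q (b i)" by metis
    have "\<forall>e>0. \<exists>N. \<forall>i\<ge>N. \<forall>j\<ge>N. cnorm B (b i \<ominus>\<^bsub>B\<^esub> b j) < e"
      using cau b by (simp add: d no)
    then obtain x where x: "x \<in> carrier B" "(\<lambda>i. cnorm B (b i \<ominus>\<^bsub>B\<^esub> x)) \<longlonglongrightarrow> 0"
      using B.complete[of b] b(1) by blast
    then show "\<exists>x\<in>carrier C. (\<lambda>i. cnorm C (f i \<ominus>\<^bsub>C\<^esub> x)) \<longlonglongrightarrow> 0"
      by (intro bexI[of _ "q x"]) (auto simp: car b d no)
  next
    fix x assume "x \<in> carrier C"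
    then obtain b where b: "b \<in> carrier B" "x = q b" using car by blast
    then show "cnorm C x = 0 \<longleftrightarrow> x = \<zero>\<^bsub>C\<^esub>"
      using inj by (auto simp: no z B.cnorm_eq_0_iff inj_on_def)
  qed (auto simp: car no a s m ad B.cnorm_nonneg B.cnorm_triangle B.cnorm_smult B.cnorm_mult B.cnorm_cstar)
qed

text \<open>
  The operations of \<open>cstar_quot\<close> are unions over the representatives of a coset; an additive map that
  preserves the ideal sends all representatives into the same coset.
\<close>

lemma UN_coset:
  assumes J: "ideal J B" and b: "b \<in> carrier B"
    and F: "\<And>x. x \<in> carrier B \<Longrightarrow> F x \<in> carrier B" "\<And>x. x \<in> J \<Longrightarrow> F x \<in> J"
      "\<And>x y. x \<in> carrier B \<Longrightarrow> y \<in> carrier B \<Longrightarrow> F (x \<oplus>\<^bsub>B\<^esub> y) = F x \<oplus>\<^bsub>B\<^esub> F y"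
  shows "(\<Union>x\<in>J +>\<^bsub>B\<^esub> b. J +>\<^bsub>B\<^esub> F x) = J +>\<^bsub>B\<^esub> F b"
proof -
  interpret ideal J B by fact
  have "J +>\<^bsub>B\<^esub> F x = J +>\<^bsub>B\<^esub> F b" if x: "x \<in> J +>\<^bsub>B\<^esub> b" for x
  proof -
    obtain j where j: "j \<in> J" "x = j \<oplus>\<^bsub>B\<^esub> b" using x by (auto simp: a_r_coset_def')
    then have "F x = F j \<oplus>\<^bsub>B\<^esub> F b" using F(3) b a_Hcarr by simp
    then have "F x \<in> J +>\<^bsub>B\<^esub> F b" using F(2)[OF j(1)] by (auto simp: a_r_coset_def')
    then show ?thesis using a_repr_independence F(1)[OF b] a_subgroup by metis
  qed
  moreover have "b \<in> J +>\<^bsub>B\<^esub> b" using b by (rule a_rcos_self)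
  ultimately show ?thesis by blast
qed

lemma quotient_star_algebra:
  assumes B: "star_algebra B" and J: "ideal J B" and Ja: "\<And>x. x \<in> J \<Longrightarrow> adj B x \<in> J"
  shows "star_algebra (cstar_quot B J)" "star_hom B (cstar_quot B J) (\<lambda>b. J +>\<^bsub>B\<^esub> b)"
    "carrier (cstar_quot B J) = (\<lambda>b. J +>\<^bsub>B\<^esub> b) ` carrier B"
proof -
  interpret B: star_algebra B by fact
  interpret I: ideal J B by fact
  have Js: "c \<odot>\<^bsub>B\<^esub> x \<in> J" if "x \<in> J" for c x
  proof -
    have xc: "x \<in> carrier B" using that by (rule I.a_Hcarr)
    have "(c \<odot>\<^bsub>B\<^esub> \<one>\<^bsub>B\<^esub>) \<otimes>\<^bsub>B\<^esub> x \<in> J" using that by (intro I.I_l_closed) auto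
    then show ?thesis using xc by (simp add: B.smult_mult_left)
  qed
  have car: "carrier (cstar_quot B J) = (\<lambda>b. J +>\<^bsub>B\<^esub> b) ` carrier B"
    by (auto simp: cstar_quot_def FactRing_def A_RCOSETS_def')
  have m: "(J +>\<^bsub>B\<^esub> x) \<otimes>\<^bsub>cstar_quot B J\<^esub> (J +>\<^bsub>B\<^esub> y) = J +>\<^bsub>B\<^esub> (x \<otimes>\<^bsub>B\<^esub> y)"
    if "x \<in> carrier B" "y \<in> carrier B" for x y
    using that by (simp add: cstar_quot_def FactRing_def I.rcoset_mult_add)
  have a: "(J +>\<^bsub>B\<^esub> x) \<oplus>\<^bsub>cstar_quot B J\<^esub> (J +>\<^bsub>B\<^esub> y) = J +>\<^bsub>B\<^esub> (x \<oplus>\<^bsub>B\<^esub> y)"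
    if "x \<in> carrier B" "y \<in> carrier B" for x y
    using that by (simp add: cstar_quot_def FactRing_def I.a_rcos_sum)
  have s: "c \<odot>\<^bsub>cstar_quot B J\<^esub> (J +>\<^bsub>B\<^esub> x) = J +>\<^bsub>B\<^esub> (c \<odot>\<^bsub>B\<^esub> x)" if "x \<in> carrier B" for c x
    using UN_coset[OF J that, of "\<lambda>x. c \<odot>\<^bsub>B\<^esub> x"] Js by (simp add: cstar_quot_def B.smult_add_right)
  have ad: "adj (cstar_quot B J) (J +>\<^bsub>B\<^esub> x) = J +>\<^bsub>B\<^esub> adj B x" if "x \<in> carrier B" for x
    using UN_coset[OF J that, of "adj B"] Ja by (simp add: cstar_quot_def B.adj_add)
  have z: "\<zero>\<^bsub>cstar_quot B J\<^esub> = J +>\<^bsub>B\<^esub> \<zero>\<^bsub>B\<^esub>"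
    by (simp add: cstar_quot_def FactRing_def B.a_coset_add_zero[OF I.a_subset])
  have o: "\<one>\<^bsub>cstar_quot B J\<^esub> = J +>\<^bsub>B\<^esub> \<one>\<^bsub>B\<^esub>" by (simp add: cstar_quot_def FactRing_def)
  note * = star_algebra_image[OF B car m a s z o ad]
  show "star_algebra (cstar_quot B J)" "star_hom B (cstar_quot B J) (\<lambda>b. J +>\<^bsub>B\<^esub> b)"
    "carrier (cstar_quot B J) = (\<lambda>b. J +>\<^bsub>B\<^esub> b) ` carrier B"
    by (rule *(1), assumption+) (rule *(2), assumption+, rule car)
qed

text \<open>
  An isomorphic copy of \<open>B\<close> inside another type, along a map that is injective on the carrier.
\<close>

definition transport :: "('b \<Rightarrow> 'c) \<Rightarrow> 'b cstar \<Rightarrow> 'c cstar" where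
  "transport g B = (let r = inv_into (carrier B) g in
    \<lparr>carrier = g ` carrier B, monoid.mult = (\<lambda>x y. g (r x \<otimes>\<^bsub>B\<^esub> r y)), one = g \<one>\<^bsub>B\<^esub>,
     zero = g \<zero>\<^bsub>B\<^esub>, add = (\<lambda>x y. g (r x \<oplus>\<^bsub>B\<^esub> r y)),
     module.smult = (\<lambda>c x. g (c \<odot>\<^bsub>B\<^esub> r x)), adj = (\<lambda>x. g (adj B (r x))),
     cnorm = (\<lambda>x. cnorm B (r x))\<rparr>)"

lemma transport_ops:
  assumes "inj_on g (carrier B)"
  shows "carrier (transport g B) = g ` carrier B"
    "x \<in> carrier B \<Longrightarrow> y \<in> carrier B \<Longrightarrow> g x \<otimes>\<^bsub>transport g B\<^esub> g y = g (x \<otimes>\<^bsub>B\<^esub> y)"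
    "x \<in> carrier B \<Longrightarrow> y \<in> carrier B \<Longrightarrow> g x \<oplus>\<^bsub>transport g B\<^esub> g y = g (x \<oplus>\<^bsub>B\<^esub> y)"
    "x \<in> carrier B \<Longrightarrow> c \<odot>\<^bsub>transport g B\<^esub> g x = g (c \<odot>\<^bsub>B\<^esub> x)"
    "\<zero>\<^bsub>transport g B\<^esub> = g \<zero>\<^bsub>B\<^esub>" "\<one>\<^bsub>transport g B\<^esub> = g \<one>\<^bsub>B\<^esub>"
    "x \<in> carrier B \<Longrightarrow> adj (transport g B) (g x) = g (adj B x)"
    "x \<in> carrier B \<Longrightarrow> cnorm (transport g B) (g x) = cnorm B x"
  using assms by (simp_all add: transport_def Let_def)

text \<open>
  The lifting property refers to algebras on subsets of the type \<open>'c\<close>. An algebra \<open>B\<close> that embeds into \<open>'c\<close> by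
  an injection \<open>g\<close> is replaced by its copy; the quotient of the copy by the image of \<open>J\<close> is the image of
  the quotient under the map \<open>X \<mapsto> g ` X\<close> on cosets, and the lift found there is carried back.
\<close>

lemma lifting_transport:
  fixes g :: "'b \<Rightarrow> 'c" and B :: "'b cstar"
  assumes LP: "lifting_property TYPE('c) A S" and A: "star_algebra A" and S: "S \<subseteq> carrier A" "\<zero>\<^bsub>A\<^esub> \<in> S"
    and B: "cstar_algebra B" and J: "closed_ideal J B" and Ja: "\<And>x. x \<in> J \<Longrightarrow> adj B x \<in> J"
    and g: "inj_on g (carrier B)" and f: "star_hom A (cstar_quot B J) f"
  shows "\<exists>\<psi>. gram_positive A S B \<psi> \<and> (\<forall>x\<in>S. J +>\<^bsub>B\<^esub> \<psi> x = f x)"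
proof -
  interpret B: cstar_algebra B by fact
  have Ji: "ideal J B" using J by (simp add: closed_ideal_def)
  interpret I: ideal J B by fact
  define B' where "B' = transport g B"
  define J' where "J' = g ` J"
  note ops = transport_ops[OF g, folded B'_def]
  have B': "cstar_algebra B'" by (rule cstar_algebra_image[OF B ops(1-7) g ops(8)])
  interpret B': cstar_algebra B' by fact
  have gh: "star_hom B B' g" by (rule star_algebra_image(2)[OF B.star_algebra_axioms ops(1-7)])
  have Jc: "J \<subseteq> carrier B" using I.a_subset .
  have ideal': "ideal J' B'"
  proof (rule idealI)
    show "ring B'" by (rule B'.ring_axioms)
    show "subgroup J' (add_monoid B')"
    proof (rule B'.add.subgroupI)
      show "J' \<subseteq> carrier B'" using Jc by (auto simp: J'_def ops)
      show "J' \<noteq> {}" using additive_subgroup.zero_closed[OF I.additive_subgroup_axioms] unfolding J'_def by blast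
      show "\<ominus>\<^bsub>B'\<^esub> a \<in> J'" if aJ: "a \<in> J'" for a
      proof -
        obtain j where j: "j \<in> J" "a = g j" using aJ by (auto simp: J'_def)
        have "\<ominus>\<^bsub>B'\<^esub> g j = g (\<ominus>\<^bsub>B\<^esub> j)" using j Jc
          by (simp add: B'.minus_conv_smult B.minus_conv_smult ops subset_iff)
        then show ?thesis using j additive_subgroup.a_inv_closed[OF I.additive_subgroup_axioms] by (auto simp: J'_def)
      qed
      show "a \<oplus>\<^bsub>B'\<^esub> b \<in> J'" if "a \<in> J'" "b \<in> J'" for a b
        using that Jc additive_subgroup.a_closed[OF I.additive_subgroup_axioms] by (auto simp: J'_def ops subset_iff)
    qed
    show "x \<otimes>\<^bsub>B'\<^esub> a \<in> J'" "a \<otimes>\<^bsub>B'\<^esub> x \<in> J'" if "a \<in> J'" "x \<in> carrier B'" for a x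
      using that Jc I.I_l_closed I.I_r_closed by (auto simp: J'_def ops subset_iff)
  qed
  have Ja': "adj B' x \<in> J'" if "x \<in> J'" for x
    using that Ja Jc by (auto simp: J'_def ops subset_iff)
  have "closed_ideal J' B'" unfolding closed_ideal_def
  proof (intro conjI allI ballI impI ideal')
    fix h :: "nat \<Rightarrow> 'c" and x assume x: "x \<in> carrier B'" and h: "(\<forall>i. h i \<in> J') \<and> (\<lambda>i. cnorm B' (h i \<ominus>\<^bsub>B'\<^esub> x)) \<longlonglongrightarrow> 0"
    obtain b where b: "b \<in> carrier B" "x = g b" using x ops by auto
    have "\<forall>i. \<exists>j. j \<in> J \<and> h i = g j" using h by (auto simp: J'_def)
    then obtain j where j: "\<And>i. j i \<in> J" "\<And>i. h i = g (j i)" by metis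
    have jc: "j i \<in> carrier B" for i using j(1) Jc by blast
    have "cnorm B' (h i \<ominus>\<^bsub>B'\<^esub> x) = cnorm B (j i \<ominus>\<^bsub>B\<^esub> b)" for i
      using b jc[of i] by (simp add: j(2) B'.diff_conv_smult B.diff_conv_smult ops)
    then have "(\<lambda>i. cnorm B (j i \<ominus>\<^bsub>B\<^esub> b)) \<longlonglongrightarrow> 0" using h by simp
    then have "b \<in> J" using J b(1) j(1) unfolding closed_ideal_def by blast
    then show "x \<in> J'" using b by (simp add: J'_def)
  qed
  have coset: "J' +>\<^bsub>B'\<^esub> g b = g ` (J +>\<^bsub>B\<^esub> b)" if "b \<in> carrier B" for b
    using that Jc by (auto simp: a_r_coset_def' J'_def ops subset_iff intro!: image_eqI)
  note q = quotient_star_algebra[OF B.star_algebra_axioms Ji Ja]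
  note q' = quotient_star_algebra[OF B'.star_algebra_axioms ideal' Ja']
  define f' where "f' x = g ` f x" for x
  have rep: "\<exists>b\<in>carrier B. f x = J +>\<^bsub>B\<^esub> b" if "x \<in> carrier A" for x
    using star_homD(1)[OF f that] q(3) by auto
  interpret A: star_algebra A by fact
  have gq: "star_hom (cstar_quot B J) (cstar_quot B' J') (\<lambda>X. g ` X)"
  proof -
    have *: "g ` (J +>\<^bsub>B\<^esub> b) = J' +>\<^bsub>B'\<^esub> g b" if "b \<in> carrier B" for b using coset[OF that] by simp
    note h1 = star_homD(2-)[OF q(2), symmetric]
    note h2 = star_homD(2-)[OF q'(2), symmetric]
    show ?thesis unfolding star_hom_def Ring.ring_hom_def
      by (auto simp: q(3) q'(3) h1 h2 * ops) (auto simp: coset)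
  qed
  have f': "star_hom A (cstar_quot B' J') f'"
    using star_homD[OF f] star_homD[OF gq] unfolding star_hom_def Ring.ring_hom_def f'_def by auto
  have "ucp A S (cstar_quot B' J') f'"
    by (rule star_hom_ucp[OF A q'(1) f' S(1)])
  then obtain \<psi>' where \<psi>': "ucp A S B' \<psi>'" "\<And>x. x \<in> S \<Longrightarrow> J' +>\<^bsub>B'\<^esub> \<psi>' x = f' x"
    using LP \<open>closed_ideal J' B'\<close> B' unfolding lifting_property_def unital_cstar_algebra_iff by blast
  define r where "r = inv_into (carrier B) g"
  have rg [simp]: "r (g b) = b" if "b \<in> carrier B" for b using that g by (simp add: r_def)
  have rh: "star_hom B' B r"
    unfolding star_hom_def Ring.ring_hom_def by (auto simp: ops)
  have "gram_positive A S B' \<psi>'" by (rule ucp_gram_positive[OF A B'.star_algebra_axioms \<psi>'(1) S(2)])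
  then have "gram_positive A S B (\<lambda>x. r (\<psi>' x))"
    by (rule gram_positive_comp[OF B'.star_algebra_axioms B.star_algebra_axioms _ rh])
  moreover have "J +>\<^bsub>B\<^esub> r (\<psi>' x) = f x" if x: "x \<in> S" for x
  proof -
    have "\<psi>' x \<in> carrier B'" using \<psi>'(1) x unfolding ucp_def by auto
    then obtain b where b: "b \<in> carrier B" "\<psi>' x = g b" using ops by auto
    have "g ` (J +>\<^bsub>B\<^esub> b) = g ` f x" using \<psi>'(2)[OF x] b coset by (simp add: f'_def)
    moreover obtain b' where b': "b' \<in> carrier B" "f x = J +>\<^bsub>B\<^esub> b'" using rep x S(1) by blast
    moreover have "J +>\<^bsub>B\<^esub> b \<subseteq> carrier B" "J +>\<^bsub>B\<^esub> b' \<subseteq> carrier B"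
      using b(1) b'(1) B.a_r_coset_subset_G[OF Jc] by auto
    ultimately have "J +>\<^bsub>B\<^esub> b = f x" using inj_on_image_eq_iff[OF g] by metis
    then show ?thesis using b by simp
  qed
  ultimately show ?thesis by blast
qed

section \<open>Tracial lower bounds for the completely bounded numerical radius\<close>

text \<open>
  The matrices of the compressions of \<open>\<psi> (u\<^sub>m)\<close> to \<open>N\<close>, conjugated, are the contractions, and \<open>\<theta>\<close> from
  \<open>tracial_witness\<close>, composed with \<open>\<psi>\<close>, extends to the state that shows the bound.
\<close>

theorem w_cb_tracial_lower_bound:
  assumes A: "cstar_algebra A" and S: "Module.submodule S complex_field A" "\<one>\<^bsub>A\<^esub> \<in> S" "\<And>x. x \<in> S \<Longrightarrow> adj A x \<in> S"
    and fd: "fd_subalgebra B \<tau> k e N" and \<psi>: "gram_positive A S B \<psi>"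
    and u: "\<And>m. m < n \<Longrightarrow> u m \<in> unitaries A" "\<And>m. m < n \<Longrightarrow> u m \<in> S"
  shows "ereal (\<Sum>m<n. \<Sum>i<k. (cmod (\<tau> (adj B (e i) \<otimes>\<^bsub>B\<^esub> \<psi> (u m))))\<^sup>2) \<le> w_cb A n u"
proof -
  interpret A: cstar_algebra A by fact
  interpret B: fd_subalgebra B \<tau> k e N by fact
  have \<psi>c: "\<psi> x \<in> carrier B" if "x \<in> S" for x using \<psi> that unfolding gram_positive_def by auto
  have \<psi>lin: "linear_on A S B \<psi>" and \<psi>1: "\<psi> \<one>\<^bsub>A\<^esub> = \<one>\<^bsub>B\<^esub>"
    and \<psi>g: "\<And>k X. k \<ge> 1 \<Longrightarrow> gram A k X \<Longrightarrow> (\<And>i j. i < k \<Longrightarrow> j < k \<Longrightarrow> X i j \<in> S) \<Longrightarrow> gram B k (\<lambda>i j. \<psi> (X i j))"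
    using \<psi> unfolding gram_positive_def by auto
  have contr: "Re (\<tau> (adj B (x \<otimes>\<^bsub>B\<^esub> b) \<otimes>\<^bsub>B\<^esub> (x \<otimes>\<^bsub>B\<^esub> b))) \<le> Re (\<tau> (adj B b \<otimes>\<^bsub>B\<^esub> b))"
    if m: "m < n" and x: "x = \<psi> (u m)" and b [simp]: "b \<in> carrier B" for m x b
  proof -
    have uc: "u m \<in> carrier A" "adj A (u m) \<otimes>\<^bsub>A\<^esub> u m = \<one>\<^bsub>A\<^esub>" using u(1)[OF m] by (auto simp: unitaries_def)
    define X where "X i j = adj A (if i = 0 then \<one>\<^bsub>A\<^esub> else u m) \<otimes>\<^bsub>A\<^esub> (if j = 0 then \<one>\<^bsub>A\<^esub> else u m)" for i j :: nat
    have XA: "gram A 2 X" unfolding X_def by (rule A.gram_single) (use uc in auto)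
    have X: "X 0 0 = \<one>\<^bsub>A\<^esub>" "X 0 1 = u m" "X 1 0 = adj A (u m)" "X 1 1 = \<one>\<^bsub>A\<^esub>"
      using uc by (auto simp: X_def)
    have XS: "X i j \<in> S" for i j
      using uc u(2)[OF m] S(2,3) by (auto simp: X_def)
    have XB: "gram B 2 (\<lambda>i j. \<psi> (X i j))" by (rule \<psi>g[OF _ XA XS]) simp
    have [simp]: "x \<in> carrier B" using \<psi>c u(2)[OF m] x by simp
    have ax: "\<psi> (adj A (u m)) = adj B x"
      using B.gram_adj[OF XB, of 0 1] by (simp add: X x del: One_nat_def)
    \<comment> \<open>The image of the Gram matrix of \<open>(1, u)\<close> is the positive matrix with rows \<open>(1, x)\<close> and \<open>(x*, 1)\<close>; the vector \<open>(- x b, b)\<close> turns its positivity into \<open>\<tau> (b* x* x b) \<le> \<tau> (b* b)\<close>.\<close>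
    define v where "v i = (if i = 0 then (-1) \<odot>\<^bsub>B\<^esub> (x \<otimes>\<^bsub>B\<^esub> b) else b)" for i :: nat
    have "(\<Sum>i<2. \<Sum>j<2. \<tau> (adj B (v i) \<otimes>\<^bsub>B\<^esub> \<psi> (X i j) \<otimes>\<^bsub>B\<^esub> v j)) \<in> \<real>\<^sub>\<ge>\<^sub>0"
      by (rule B.gram_vector_state[OF XB]) (simp add: v_def)
    also have "(\<Sum>i<2. \<Sum>j<2. \<tau> (adj B (v i) \<otimes>\<^bsub>B\<^esub> \<psi> (X i j) \<otimes>\<^bsub>B\<^esub> v j)) =
       \<tau> (adj B (v 0) \<otimes>\<^bsub>B\<^esub> \<psi> (X 0 0) \<otimes>\<^bsub>B\<^esub> v 0) + \<tau> (adj B (v 0) \<otimes>\<^bsub>B\<^esub> \<psi> (X 0 1) \<otimes>\<^bsub>B\<^esub> v 1) +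
       (\<tau> (adj B (v 1) \<otimes>\<^bsub>B\<^esub> \<psi> (X 1 0) \<otimes>\<^bsub>B\<^esub> v 0) + \<tau> (adj B (v 1) \<otimes>\<^bsub>B\<^esub> \<psi> (X 1 1) \<otimes>\<^bsub>B\<^esub> v 1))"
      by (simp add: numeral_2_eq_2)
    also have "\<dots> = \<tau> (adj B b \<otimes>\<^bsub>B\<^esub> b) - \<tau> (adj B (x \<otimes>\<^bsub>B\<^esub> b) \<otimes>\<^bsub>B\<^esub> (x \<otimes>\<^bsub>B\<^esub> b))"
      unfolding X by (simp add: v_def \<psi>1 ax x[symmetric] B.adj_smult B.smult_mult_left B.smult_mult_right B.smult_smult
        B.tr_smult B.adj_mult B.m_assoc)
    finally show ?thesis by (simp add: complex_nonneg_Reals_iff)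
  qed
  obtain \<theta> where \<theta>: "\<And>i j. i < k \<Longrightarrow> j < k \<Longrightarrow> lin_fun B (carrier B) (\<theta> i j)"
    "\<And>X. gram B k X \<Longrightarrow> (\<Sum>i<k. \<Sum>j<k. \<theta> i j (X i j)) \<in> \<real>\<^sub>\<ge>\<^sub>0"
    "(\<Sum>i<k. \<theta> i i \<one>\<^bsub>B\<^esub>) = 1"
    "\<And>x. x \<in> carrier B \<Longrightarrow> (\<Sum>i<k. \<Sum>j<k. cnj (\<tau> (adj B (e i) \<otimes>\<^bsub>B\<^esub> x \<otimes>\<^bsub>B\<^esub> e j)) * \<theta> i j x) =
       (\<Sum>i<k. complex_of_real ((cmod (\<tau> (adj B (e i) \<otimes>\<^bsub>B\<^esub> x)))\<^sup>2))"
    using B.tracial_witness by blast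
  define U where "U m = mat k k (\<lambda>(i, j). cnj (\<tau> (adj B (e i) \<otimes>\<^bsub>B\<^esub> \<psi> (u m) \<otimes>\<^bsub>B\<^esub> e j)))" for m
  have "ereal (cmod (\<Sum>m<n. \<Sum>i<k. \<Sum>j<k. U m $$ (i, j) * \<theta> i j (\<psi> (u m)))) \<le> w_cb A n u"
  proof (rule A.w_cb_lower_bound[OF S, where \<theta> = "\<lambda>i j a. \<theta> i j (\<psi> a)"])
    show "lin_fun A S (\<lambda>a. \<theta> i j (\<psi> a))" if "i < k" "j < k" for i j
      using \<theta>(1)[OF that] \<psi>lin \<psi>c unfolding lin_fun_def linear_on_def by simp
    show "(\<Sum>i<k. \<Sum>j<k. \<theta> i j (\<psi> (X i j))) \<in> \<real>\<^sub>\<ge>\<^sub>0"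
      if "gram A k X" "\<And>i j. i < k \<Longrightarrow> j < k \<Longrightarrow> X i j \<in> S" for X
      by (rule \<theta>(2)[OF \<psi>g[OF B.k_pos that]])
    show "(\<Sum>i<k. \<theta> i i (\<psi> \<one>\<^bsub>A\<^esub>)) = 1" using \<theta>(3) \<psi>1 by simp
    show "op_norm (U m) \<le> 1" if "m < n" for m
      unfolding U_def using \<psi>c u(2)[OF that] contr[OF that refl] by (intro B.compression_op_norm) auto
  qed (use B.k_pos u in \<open>auto simp: U_def\<close>)
  also have "(\<Sum>m<n. \<Sum>i<k. \<Sum>j<k. U m $$ (i, j) * \<theta> i j (\<psi> (u m))) =
      (\<Sum>m<n. \<Sum>i<k. complex_of_real ((cmod (\<tau> (adj B (e i) \<otimes>\<^bsub>B\<^esub> \<psi> (u m))))\<^sup>2))"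
  proof (rule sum.cong[OF refl])
    fix m assume "m \<in> {..<n}"
    then have "\<psi> (u m) \<in> carrier B" using \<psi>c u(2) by simp
    from \<theta>(4)[OF this] show "(\<Sum>i<k. \<Sum>j<k. U m $$ (i, j) * \<theta> i j (\<psi> (u m))) =
      (\<Sum>i<k. complex_of_real ((cmod (\<tau> (adj B (e i) \<otimes>\<^bsub>B\<^esub> \<psi> (u m))))\<^sup>2))"
      by (simp add: U_def)
  qed
  also have "\<dots> = complex_of_real (\<Sum>m<n. \<Sum>i<k. (cmod (\<tau> (adj B (e i) \<otimes>\<^bsub>B\<^esub> \<psi> (u m))))\<^sup>2)"
    by simp
  also have "cmod \<dots> = (\<Sum>m<n. \<Sum>i<k. (cmod (\<tau> (adj B (e i) \<otimes>\<^bsub>B\<^esub> \<psi> (u m))))\<^sup>2)"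
    by (simp only: norm_of_real) (simp add: sum_nonneg)
  finally show ?thesis .
qed

section \<open>Bounded sequences and the lifting argument\<close>

lemma linf_prod_ops [simp]:
  "x \<otimes>\<^bsub>linf_prod B\<^esub> y = (\<lambda>m. x m \<otimes>\<^bsub>B m\<^esub> y m)" "x \<oplus>\<^bsub>linf_prod B\<^esub> y = (\<lambda>m. x m \<oplus>\<^bsub>B m\<^esub> y m)"
  "\<one>\<^bsub>linf_prod B\<^esub> = (\<lambda>m. \<one>\<^bsub>B m\<^esub>)" "\<zero>\<^bsub>linf_prod B\<^esub> = (\<lambda>m. \<zero>\<^bsub>B m\<^esub>)"
  "c \<odot>\<^bsub>linf_prod B\<^esub> x = (\<lambda>m. c \<odot>\<^bsub>B m\<^esub> x m)" "adj (linf_prod B) x = (\<lambda>m. adj (B m) (x m))"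
  "cnorm (linf_prod B) x = (SUP m. cnorm (B m) (x m))"
  by (simp_all add: linf_prod_def)

lemma linf_prod_carrier:
  "x \<in> carrier (linf_prod B) \<longleftrightarrow> (\<forall>m. x m \<in> carrier (B m)) \<and> (\<exists>C. \<forall>m. cnorm (B m) (x m) \<le> C)"
  by (simp add: linf_prod_def)

lemma cstar_algebra_linf_prod:
  fixes B :: "nat \<Rightarrow> 'b cstar"
  assumes B: "\<And>m. cstar_algebra (B m)"
  shows "cstar_algebra (linf_prod B)" "star_hom (linf_prod B) (B m) (\<lambda>x. x m)"
proof -
  interpret B: cstar_algebra "B m" for m by (rule B)
  let ?P = "linf_prod B"
  have ent: "x m \<in> carrier (B m)" if "x \<in> carrier ?P" for x m using that by (simp add: linf_prod_carrier)
  have bdd: "\<exists>C. \<forall>m. cnorm (B m) (x m) \<le> C" if "x \<in> carrier ?P" for x using that by (simp add: linf_prod_carrier)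
  have bddA: "bdd_above (range (\<lambda>m. cnorm (B m) (x m)))" if "x \<in> carrier ?P" for x
    using bdd[OF that] by (auto simp: bdd_above_def)
  have inI: "x \<in> carrier ?P" if "\<And>m. x m \<in> carrier (B m)" "\<And>m. cnorm (B m) (x m) \<le> C" for x C
    using that by (auto simp: linf_prod_carrier)
  have add: "x \<oplus>\<^bsub>?P\<^esub> y \<in> carrier ?P" if xy: "x \<in> carrier ?P" "y \<in> carrier ?P" for x y
  proof -
    obtain C D where C: "\<And>m. cnorm (B m) (x m) \<le> C" and D: "\<And>m. cnorm (B m) (y m) \<le> D" using bdd xy by metis
    show ?thesis
      by (rule inI[of _ "C + D"]) (use ent xy C D in \<open>auto intro!: order_trans[OF B.cnorm_triangle] add_mono\<close>)
  qed
  have mul: "x \<otimes>\<^bsub>?P\<^esub> y \<in> carrier ?P" if xy: "x \<in> carrier ?P" "y \<in> carrier ?P" for x y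
  proof -
    obtain C D where C: "\<And>m. cnorm (B m) (x m) \<le> C" and D: "\<And>m. cnorm (B m) (y m) \<le> D" using bdd xy by metis
    have "C \<ge> 0" using C[of 0] B.cnorm_nonneg[OF ent[OF xy(1)], of 0] by linarith
    then show ?thesis
      by (intro inI[of _ "C * D"])
        (use ent xy C D in \<open>auto intro!: order_trans[OF B.cnorm_mult] mult_mono B.cnorm_nonneg\<close>)
  qed
  have smu: "c \<odot>\<^bsub>?P\<^esub> x \<in> carrier ?P" if x: "x \<in> carrier ?P" for c x
  proof -
    obtain C where C: "\<And>m. cnorm (B m) (x m) \<le> C" using bdd x by metis
    show ?thesis
      by (rule inI[of _ "cmod c * C"]) (use ent x C in \<open>auto simp: B.cnorm_smult intro!: mult_left_mono\<close>)
  qed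
  have adjc: "adj ?P x \<in> carrier ?P" if x: "x \<in> carrier ?P" for x
    using x by (auto simp: linf_prod_carrier B.cnorm_adj)
  have zer: "\<zero>\<^bsub>?P\<^esub> \<in> carrier ?P" by (rule inI[of _ 0]) auto
  have one: "\<one>\<^bsub>?P\<^esub> \<in> carrier ?P"
  proof (rule inI[of _ 1])
    fix m
    have "cnorm (B m) (\<one>\<^bsub>B m\<^esub>) = (cnorm (B m) (\<one>\<^bsub>B m\<^esub>))\<^sup>2" using B.cnorm_cstar[of "\<one>\<^bsub>B m\<^esub>" m] by simp
    then have "cnorm (B m) (\<one>\<^bsub>B m\<^esub>) = 0 \<or> cnorm (B m) (\<one>\<^bsub>B m\<^esub>) = 1" by (simp add: power2_eq_square)
    then show "cnorm (B m) (\<one>\<^bsub>?P\<^esub> m) \<le> 1" by auto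
  qed auto
  have ag: "abelian_group ?P"
  proof (rule abelian_groupI)
    fix x assume x: "x \<in> carrier ?P"
    show "\<exists>y\<in>carrier ?P. y \<oplus>\<^bsub>?P\<^esub> x = \<zero>\<^bsub>?P\<^esub>"
    proof (rule bexI[of _ "(-1) \<odot>\<^bsub>?P\<^esub> x"])
      have "(-1) \<odot>\<^bsub>B m\<^esub> x m \<oplus>\<^bsub>B m\<^esub> x m = \<zero>\<^bsub>B m\<^esub>" for m
        using B.smult_minus_one_cancel[OF ent[OF x], of m] ent[OF x, of m] by (simp add: B.a_comm)
      then show "(-1) \<odot>\<^bsub>?P\<^esub> x \<oplus>\<^bsub>?P\<^esub> x = \<zero>\<^bsub>?P\<^esub>" by simp
    qed (rule smu[OF x])
  qed (use add zer in \<open>auto simp: ent B.a_assoc B.a_comm B.a_ac\<close>)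
  have rg: "ring ?P"
  proof (rule ringI[OF ag])
    show "Group.monoid ?P" by (rule monoidI) (use mul one in \<open>auto simp: ent B.m_assoc\<close>)
  qed (auto simp: ent B.l_distr B.r_distr)
  have md: "Module.module complex_field ?P"
    by (rule moduleI[OF cring_complex_field ag])
      (use smu in \<open>auto simp: ent B.smult_add_left B.smult_add_right B.smult_smult\<close>)
  interpret P: star_algebra ?P
    by (intro star_algebra.intro star_space.intro star_space_axioms.intro star_algebra_axioms.intro ag rg md)
      (use adjc in \<open>auto simp: ent B.adj_add B.adj_smult B.adj_mult B.smult_mult_left B.smult_mult_right\<close>)
  have dif: "x \<ominus>\<^bsub>?P\<^esub> y = (\<lambda>m. x m \<ominus>\<^bsub>B m\<^esub> y m)" if "x \<in> carrier ?P" "y \<in> carrier ?P" for x y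
    using that by (simp add: P.diff_conv_smult B.diff_conv_smult ent)
  have le: "cnorm (B m) (x m) \<le> cnorm ?P x" if "x \<in> carrier ?P" for x m
    using bddA[OF that] by (auto intro: cSUP_upper)
  have lub: "cnorm ?P x \<le> C" if "\<And>m. cnorm (B m) (x m) \<le> C" for x C
    using that by (auto intro: cSUP_least)
  have nn: "0 \<le> cnorm ?P x" if "x \<in> carrier ?P" for x
    using B.cnorm_nonneg[OF ent[OF that], of 0] le[OF that, of 0] by linarith
  have "cstar_algebra_axioms ?P"
  proof
    fix x assume x: "x \<in> carrier ?P"
    show "0 \<le> cnorm ?P x" by (rule nn[OF x])
    show "cnorm ?P x = 0 \<longleftrightarrow> x = \<zero>\<^bsub>?P\<^esub>"
    proof
      assume "cnorm ?P x = 0"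
      then have "x m = \<zero>\<^bsub>B m\<^esub>" for m
        using le[OF x, of m] B.cnorm_nonneg[OF ent[OF x], of m] B.cnorm_eq_0_iff[OF ent[OF x], of m] by simp
      then show "x = \<zero>\<^bsub>?P\<^esub>" by auto
    next
      assume "x = \<zero>\<^bsub>?P\<^esub>"
      then show "cnorm ?P x = 0" by simp
    qed
    show "cnorm ?P (c \<odot>\<^bsub>?P\<^esub> x) = cmod c * cnorm ?P x" for c
    proof (rule antisym)
      show "cnorm ?P (c \<odot>\<^bsub>?P\<^esub> x) \<le> cmod c * cnorm ?P x"
        using le[OF x] by (intro lub) (simp add: B.cnorm_smult[OF ent[OF x]] mult_left_mono del: linf_prod_ops(7))
      show "cmod c * cnorm ?P x \<le> cnorm ?P (c \<odot>\<^bsub>?P\<^esub> x)"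
      proof (cases "c = 0")
        case False
        have "cnorm ?P x \<le> cnorm ?P (c \<odot>\<^bsub>?P\<^esub> x) / cmod c"
        proof (rule lub)
          fix m
          have "cmod c * cnorm (B m) (x m) \<le> cnorm ?P (c \<odot>\<^bsub>?P\<^esub> x)"
            using le[OF smu[OF x], of m c] by (simp add: B.cnorm_smult[OF ent[OF x]] del: linf_prod_ops(7))
          then show "cnorm (B m) (x m) \<le> cnorm ?P (c \<odot>\<^bsub>?P\<^esub> x) / cmod c"
            using False by (simp add: field_simps del: linf_prod_ops)
        qed
        then show ?thesis using False by (simp add: field_simps del: linf_prod_ops)
      qed (use nn[OF smu[OF x]] in \<open>simp del: linf_prod_ops\<close>)
    qed
    show "cnorm ?P (adj ?P x \<otimes>\<^bsub>?P\<^esub> x) = (cnorm ?P x)\<^sup>2"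
    proof (rule antisym)
      show "cnorm ?P (adj ?P x \<otimes>\<^bsub>?P\<^esub> x) \<le> (cnorm ?P x)\<^sup>2"
        using le[OF x] B.cnorm_nonneg[OF ent[OF x]]
        by (intro lub) (simp add: B.cnorm_cstar[OF ent[OF x]] power_mono del: linf_prod_ops(7))
      have "cnorm ?P x \<le> sqrt (cnorm ?P (adj ?P x \<otimes>\<^bsub>?P\<^esub> x))"
      proof (rule lub)
        fix m
        have "(cnorm (B m) (x m))\<^sup>2 \<le> cnorm ?P (adj ?P x \<otimes>\<^bsub>?P\<^esub> x)"
          using le[OF mul[OF adjc[OF x] x], of m] by (simp add: B.cnorm_cstar[OF ent[OF x]] del: linf_prod_ops(7))
        then show "cnorm (B m) (x m) \<le> sqrt (cnorm ?P (adj ?P x \<otimes>\<^bsub>?P\<^esub> x))" by (rule real_le_rsqrt)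
      qed
      then show "(cnorm ?P x)\<^sup>2 \<le> cnorm ?P (adj ?P x \<otimes>\<^bsub>?P\<^esub> x)"
        using nn[OF x] nn[OF mul[OF adjc[OF x] x]] by (metis power_mono real_sqrt_pow2)
    qed
    fix y assume y: "y \<in> carrier ?P"
    show "cnorm ?P (x \<oplus>\<^bsub>?P\<^esub> y) \<le> cnorm ?P x + cnorm ?P y"
      using order_trans[OF B.cnorm_triangle[OF ent[OF x] ent[OF y]] add_mono[OF le[OF x] le[OF y]]]
      by (intro lub) (simp del: linf_prod_ops(7))
    show "cnorm ?P (x \<otimes>\<^bsub>?P\<^esub> y) \<le> cnorm ?P x * cnorm ?P y"
      using order_trans[OF B.cnorm_mult[OF ent[OF x] ent[OF y]] mult_mono[OF le[OF x] le[OF y] nn[OF x] B.cnorm_nonneg[OF ent[OF y]]]]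
      by (intro lub) (simp del: linf_prod_ops(7))
  next
    fix f :: "nat \<Rightarrow> nat \<Rightarrow> 'b" assume f: "\<forall>i. f i \<in> carrier ?P"
      and cau: "\<forall>e>0. \<exists>N. \<forall>i\<ge>N. \<forall>j\<ge>N. cnorm ?P (f i \<ominus>\<^bsub>?P\<^esub> f j) < e"
    have fm: "cnorm (B m) (f i m \<ominus>\<^bsub>B m\<^esub> f j m) \<le> cnorm ?P (f i \<ominus>\<^bsub>?P\<^esub> f j)" for i j m
    proof -
      have "f i \<ominus>\<^bsub>?P\<^esub> f j \<in> carrier ?P" using f by simp
      from le[OF this, of m] show ?thesis using f by (simp add: dif del: linf_prod_ops)
    qed
    have "\<exists>x\<in>carrier (B m). (\<lambda>i. cnorm (B m) (f i m \<ominus>\<^bsub>B m\<^esub> x)) \<longlonglongrightarrow> 0" for m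
    proof (rule B.complete)
      show "\<forall>e>0. \<exists>N. \<forall>i\<ge>N. \<forall>j\<ge>N. cnorm (B m) (f i m \<ominus>\<^bsub>B m\<^esub> f j m) < e"
        using cau fm by (meson order_le_less_trans)
    qed (use f ent in auto)
    then obtain x where x: "\<And>m. x m \<in> carrier (B m)" "\<And>m. (\<lambda>i. cnorm (B m) (f i m \<ominus>\<^bsub>B m\<^esub> x m)) \<longlonglongrightarrow> 0"
      by metis
    have unif: "\<exists>N. \<forall>i\<ge>N. \<forall>m. cnorm (B m) (f i m \<ominus>\<^bsub>B m\<^esub> x m) \<le> e" if e: "e > 0" for e
    proof -
      obtain N where N: "\<And>i j. i \<ge> N \<Longrightarrow> j \<ge> N \<Longrightarrow> cnorm ?P (f i \<ominus>\<^bsub>?P\<^esub> f j) < e" using cau e by blast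
      have "cnorm (B m) (f i m \<ominus>\<^bsub>B m\<^esub> x m) \<le> e" if i: "i \<ge> N" for i m
      proof (rule LIMSEQ_le_const)
        show "(\<lambda>j. e + cnorm (B m) (f j m \<ominus>\<^bsub>B m\<^esub> x m)) \<longlonglongrightarrow> e"
          using tendsto_add[OF tendsto_const x(2)[of m], of e] by simp
        have "cnorm (B m) (f i m \<ominus>\<^bsub>B m\<^esub> x m) \<le> e + cnorm (B m) (f j m \<ominus>\<^bsub>B m\<^esub> x m)" if "j \<ge> N" for j
          using B.diff_triangle[of "f i m" m "f j m" "x m"] fm[of m i j] N[OF i that] x(1) f ent by fastforce
        then show "\<exists>N. \<forall>j\<ge>N. cnorm (B m) (f i m \<ominus>\<^bsub>B m\<^esub> x m) \<le> e + cnorm (B m) (f j m \<ominus>\<^bsub>B m\<^esub> x m)" by blast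
      qed
      then show ?thesis by blast
    qed
    have xP: "x \<in> carrier ?P"
    proof -
      obtain N where N: "\<And>m. cnorm (B m) (f N m \<ominus>\<^bsub>B m\<^esub> x m) \<le> 1" using unif[of 1] by auto
      obtain C where C: "\<And>m. cnorm (B m) (f N m) \<le> C" using bdd f by metis
      have "cnorm (B m) (x m) \<le> C + 1" for m
      proof -
        have "cnorm (B m) (x m \<ominus>\<^bsub>B m\<^esub> \<zero>\<^bsub>B m\<^esub>) \<le> cnorm (B m) (x m \<ominus>\<^bsub>B m\<^esub> f N m) + cnorm (B m) (f N m \<ominus>\<^bsub>B m\<^esub> \<zero>\<^bsub>B m\<^esub>)"
          using x(1) f ent by (intro B.diff_triangle) auto
        then show ?thesis using N[of m] C[of m] B.cnorm_minus[of "x m" m "f N m"] x(1)[of m] ent[of "f N" m] f by simp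
      qed
      then show ?thesis using x(1) by (intro inI)
    qed
    have "(\<lambda>i. cnorm ?P (f i \<ominus>\<^bsub>?P\<^esub> x)) \<longlonglongrightarrow> 0"
    proof (rule LIMSEQ_I)
      fix r :: real assume r: "0 < r"
      obtain N where N: "\<And>i m. i \<ge> N \<Longrightarrow> cnorm (B m) (f i m \<ominus>\<^bsub>B m\<^esub> x m) \<le> r / 2" using unif[of "r/2"] r by auto
      have "norm (cnorm ?P (f i \<ominus>\<^bsub>?P\<^esub> x) - 0) < r" if "i \<ge> N" for i
      proof -
        have "cnorm ?P (f i \<ominus>\<^bsub>?P\<^esub> x) \<le> r / 2" using N[OF that] f xP by (intro lub) (simp add: dif)
        moreover have "0 \<le> cnorm ?P (f i \<ominus>\<^bsub>?P\<^esub> x)" using f xP by (intro nn) simp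
        ultimately show ?thesis using r by (simp del: linf_prod_ops)
      qed
      then show "\<exists>N. \<forall>i\<ge>N. norm (cnorm ?P (f i \<ominus>\<^bsub>?P\<^esub> x) - 0) < r" by blast
    qed
    then show "\<exists>x\<in>carrier ?P. (\<lambda>i. cnorm ?P (f i \<ominus>\<^bsub>?P\<^esub> x)) \<longlonglongrightarrow> 0" using xP by blast
  qed
  then show "cstar_algebra ?P" by (intro cstar_algebra.intro P.star_algebra_axioms)
  show "star_hom ?P (B m) (\<lambda>x. x m)" unfolding star_hom_def Ring.ring_hom_def by (auto simp: ent)
qed

text \<open>
  The assumption \<open>approx\<close> says that finitely many elements of \<open>B m\<close> can be projected to a common
  finite-dimensional subalgebra with arbitrarily small loss of trace norm. It connects
  \<open>w_cb_tracial_lower_bound\<close>, which only sees these projections, with the values of \<open>\<tau>\<close> at the lifted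
  unitaries, which are controlled by \<open>J\<close>.
\<close>

theorem no_unital_star_hom_into_tracial_quotient:
  fixes A :: "'a cstar" and B :: "nat \<Rightarrow> 'b cstar" and g :: "(nat \<Rightarrow> 'b) \<Rightarrow> 'c"
  defines "P \<equiv> linf_prod B"
  assumes A: "cstar_algebra A" and u: "\<forall>i<n. u i \<in> unitaries A"
    and w: "w_cb A n u < ereal (real n)"
    and LP: "lifting_property TYPE('c) A (lin_span A ({\<one>\<^bsub>A\<^esub>} \<union> u ` {..<n} \<union> (\<lambda>i. adj A (u i)) ` {..<n}))"
    and B: "\<And>m. cstar_algebra (B m)" and \<tau>: "\<And>m. tracial_star_algebra (B m) (\<tau> m)"
    and approx: "\<And>m x \<epsilon>. (\<And>i. i < n \<Longrightarrow> x i \<in> carrier (B m)) \<Longrightarrow> \<epsilon> > 0 \<Longrightarrow>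
      \<exists>k e N. fd_subalgebra (B m) (\<tau> m) k e N \<and>
        (\<forall>i<n. Re (\<tau> m (adj (B m) (x i) \<otimes>\<^bsub>B m\<^esub> x i)) - \<epsilon> \<le> (\<Sum>j<k. (cmod (\<tau> m (adj (B m) (e j) \<otimes>\<^bsub>B m\<^esub> x i)))\<^sup>2))"
    and J: "closed_ideal J P" "\<And>x. x \<in> J \<Longrightarrow> adj P x \<in> J"
    and J0: "\<And>x. x \<in> J \<Longrightarrow> ((\<lambda>m. Re (\<tau> m (adj (B m) (x m) \<otimes>\<^bsub>B m\<^esub> x m))) \<longlongrightarrow> 0) F" and F: "F \<noteq> bot"
    and g: "inj_on g (carrier P)"
  shows "\<not> (\<exists>f. star_hom A (cstar_quot P J) f)"
proof
  assume "\<exists>f. star_hom A (cstar_quot P J) f"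
  then obtain f where f: "star_hom A (cstar_quot P J) f" by blast
  interpret A: cstar_algebra A by fact
  have P: "cstar_algebra P" unfolding P_def by (rule cstar_algebra_linf_prod(1)[OF B])
  interpret P: cstar_algebra P by fact
  interpret B: tracial_star_algebra "B m" "\<tau> m" for m by (rule \<tau>)
  define G where "G = {\<one>\<^bsub>A\<^esub>} \<union> u ` {..<n} \<union> (\<lambda>i. adj A (u i)) ` {..<n}"
  define S where "S = lin_span A G"
  have uc: "u i \<in> carrier A" "adj A (u i) \<otimes>\<^bsub>A\<^esub> u i = \<one>\<^bsub>A\<^esub>" if "i < n" for i
    using u that by (auto simp: unitaries_def)
  have Gc: "G \<subseteq> carrier A" using uc by (auto simp: G_def)
  have GS: "G \<subseteq> S" unfolding S_def lin_span_def by blast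
  have Sc: "S \<subseteq> carrier A" unfolding S_def lin_span_def using A.vs.carrier_is_submodule Gc by blast
  have Smin: "S \<subseteq> W" if "Module.submodule W complex_field A" "G \<subseteq> W" for W
    unfolding S_def lin_span_def using that by blast
  have S: "Module.submodule S complex_field A"
  proof (rule A.vs.submoduleI)
    show "\<zero>\<^bsub>A\<^esub> \<in> S" unfolding S_def lin_span_def
      by (auto intro: subgroup.one_closed[OF Module.submodule.axioms(1), simplified])
    show "\<ominus>\<^bsub>A\<^esub> a \<in> S" if "a \<in> S" for a
      using that A.vs.submoduleE(3) unfolding S_def lin_span_def by blast
    show "a \<oplus>\<^bsub>A\<^esub> b \<in> S" if "a \<in> S" "b \<in> S" for a b
      using that A.vs.submoduleE(5) unfolding S_def lin_span_def by blast
    show "c \<odot>\<^bsub>A\<^esub> a \<in> S" if "c \<in> carrier complex_field" "a \<in> S" for c a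
      using that A.vs.submoduleE(4) unfolding S_def lin_span_def by blast
  qed (rule Sc)
  have S1: "\<one>\<^bsub>A\<^esub> \<in> S" using GS by (auto simp: G_def)
  have S0: "\<zero>\<^bsub>A\<^esub> \<in> S" using subgroup.one_closed[OF Module.submodule.axioms(1)[OF S]] by simp
  have Su: "u i \<in> S" if "i < n" for i using GS that by (auto simp: G_def)
  have Sadj: "adj A x \<in> S" if "x \<in> S" for x
  proof -
    define W where "W = {x \<in> carrier A. adj A x \<in> S}"
    have "Module.submodule W complex_field A"
    proof (rule A.vs.submoduleI)
      show "\<ominus>\<^bsub>A\<^esub> a \<in> W" if "a \<in> W" for a
        using that A.vs.submoduleE(4)[OF S, of "-1" "adj A a"] by (simp add: W_def A.minus_conv_smult A.adj_smult)
      show "a \<oplus>\<^bsub>A\<^esub> b \<in> W" if "a \<in> W" "b \<in> W" for a b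
        using that A.vs.submoduleE(5)[OF S] by (simp add: W_def A.adj_add)
      show "c \<odot>\<^bsub>A\<^esub> a \<in> W" if "c \<in> carrier complex_field" "a \<in> W" for c a
        using that A.vs.submoduleE(4)[OF S, of "cnj c" "adj A a"] by (simp add: W_def A.adj_smult)
    qed (use S0 in \<open>auto simp: W_def\<close>)
    moreover have "G \<subseteq> W" using Gc GS uc unfolding W_def by (auto simp: G_def)
    ultimately show ?thesis using Smin that unfolding W_def by blast
  qed
  have Ji: "ideal J P" using J(1) by (simp add: closed_ideal_def)
  note q = quotient_star_algebra[OF P.star_algebra_axioms Ji J(2)]
  obtain \<psi> where \<psi>: "gram_positive A S P \<psi>" "\<And>x. x \<in> S \<Longrightarrow> J +>\<^bsub>P\<^esub> \<psi> x = f x"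
    using lifting_transport[OF LP[folded G_def S_def] A.star_algebra_axioms Sc S0 P J g f] by blast
  have \<psi>c: "\<psi> x \<in> carrier P" if "x \<in> S" for x using \<psi>(1) that unfolding gram_positive_def by auto
  have \<psi>m: "\<psi> x m \<in> carrier (B m)" if "x \<in> S" for x m
    using \<psi>c[OF that] by (simp add: P_def linf_prod_carrier)
  define d where "d i = adj P (\<psi> (u i)) \<otimes>\<^bsub>P\<^esub> \<psi> (u i) \<ominus>\<^bsub>P\<^esub> \<one>\<^bsub>P\<^esub>" for i
  have dJ: "d i \<in> J" if i: "i < n" for i
  proof -
    let ?x = "\<psi> (u i)"
    have x: "?x \<in> carrier P" using \<psi>c Su[OF i] by simp
    have "J +>\<^bsub>P\<^esub> (adj P ?x \<otimes>\<^bsub>P\<^esub> ?x) = adj (cstar_quot P J) (J +>\<^bsub>P\<^esub> ?x) \<otimes>\<^bsub>cstar_quot P J\<^esub> (J +>\<^bsub>P\<^esub> ?x)"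
      using star_homD[OF q(2)] x by simp
    also have "\<dots> = adj (cstar_quot P J) (f (u i)) \<otimes>\<^bsub>cstar_quot P J\<^esub> f (u i)" using \<psi>(2)[OF Su[OF i]] by simp
    also have "\<dots> = f (adj A (u i) \<otimes>\<^bsub>A\<^esub> u i)" using star_homD[OF f] uc(1)[OF i] by simp
    also have "\<dots> = J +>\<^bsub>P\<^esub> \<one>\<^bsub>P\<^esub>" using star_homD(4)[OF f] star_homD(4)[OF q(2)] uc(2)[OF i] by simp
    finally show ?thesis using P.quotient_eq_iff_same_a_r_cos[OF Ji] x unfolding d_def by simp
  qed
  have dm: "d i m = adj (B m) (\<psi> (u i) m) \<otimes>\<^bsub>B m\<^esub> \<psi> (u i) m \<ominus>\<^bsub>B m\<^esub> \<one>\<^bsub>B m\<^esub>" if i: "i < n" for i m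
  proof -
    have "d i = adj P (\<psi> (u i)) \<otimes>\<^bsub>P\<^esub> \<psi> (u i) \<oplus>\<^bsub>P\<^esub> (-1) \<odot>\<^bsub>P\<^esub> \<one>\<^bsub>P\<^esub>"
      unfolding d_def using \<psi>c[OF Su[OF i]] by (intro P.diff_conv_smult) auto
    then show ?thesis using \<psi>m[OF Su[OF i], of m] by (simp add: P_def B.diff_conv_smult)
  qed
  obtain r where r: "w_cb A n u < ereal r" "ereal r < ereal (real n)" using ereal_dense2[OF w] by blast
  \<comment> \<open>Each of the \<open>n\<close> terms loses \<open>\<epsilon>\<close> twice, once at the coordinate \<open>m\<close> and once by projecting to \<open>N\<close>; the summand \<open>1\<close> keeps the denominator positive for \<open>n = 0\<close>.\<close>
  define \<epsilon> where "\<epsilon> = (real n - r) / (2 * real n + 1)"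
  have \<epsilon>: "\<epsilon> > 0" "real n * (2 * \<epsilon>) \<le> real n - r" using r(2) by (auto simp: \<epsilon>_def field_simps)
  \<comment> \<open>The Cauchy--Schwarz inequality for \<open>z\<close> and \<open>1\<close>, which transfers smallness in trace norm to the trace itself.\<close>
  have cs: "(cmod (\<tau> m z))\<^sup>2 \<le> Re (\<tau> m (adj (B m) z \<otimes>\<^bsub>B m\<^esub> z))" if [simp]: "z \<in> carrier (B m)" for m z
  proof -
    define c where "c = \<tau> m z"
    have "adj (B m) (z \<ominus>\<^bsub>B m\<^esub> c \<odot>\<^bsub>B m\<^esub> \<one>\<^bsub>B m\<^esub>) \<otimes>\<^bsub>B m\<^esub> (z \<ominus>\<^bsub>B m\<^esub> c \<odot>\<^bsub>B m\<^esub> \<one>\<^bsub>B m\<^esub>) =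
      adj (B m) z \<otimes>\<^bsub>B m\<^esub> z \<ominus>\<^bsub>B m\<^esub> c \<odot>\<^bsub>B m\<^esub> adj (B m) z \<ominus>\<^bsub>B m\<^esub> cnj c \<odot>\<^bsub>B m\<^esub> z \<oplus>\<^bsub>B m\<^esub> (cnj c * c) \<odot>\<^bsub>B m\<^esub> \<one>\<^bsub>B m\<^esub>"
      by (simp add: B.adj_diff B.adj_smult B.smult_mult_left B.smult_mult_right B.smult_smult B.smult_diff B.group_ring_simps mult.commute)
    then have "\<tau> m (adj (B m) (z \<ominus>\<^bsub>B m\<^esub> c \<odot>\<^bsub>B m\<^esub> \<one>\<^bsub>B m\<^esub>) \<otimes>\<^bsub>B m\<^esub> (z \<ominus>\<^bsub>B m\<^esub> c \<odot>\<^bsub>B m\<^esub> \<one>\<^bsub>B m\<^esub>)) =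
      \<tau> m (adj (B m) z \<otimes>\<^bsub>B m\<^esub> z) - c * cnj c - cnj c * c + cnj c * c"
      by (simp add: B.tr_diff B.tr_add B.tr_smult B.tr_one B.tr_adj flip: c_def)
    then have "\<tau> m (adj (B m) z \<otimes>\<^bsub>B m\<^esub> z) - complex_of_real ((cmod c)\<^sup>2) \<in> \<real>\<^sub>\<ge>\<^sub>0"
      using B.tr_pos[of "z \<ominus>\<^bsub>B m\<^esub> c \<odot>\<^bsub>B m\<^esub> \<one>\<^bsub>B m\<^esub>" m] by (simp add: cnj_mult_self)
    then show ?thesis by (simp add: complex_nonneg_Reals_iff c_def flip: of_real_power)
  qed
  have ev: "\<forall>\<^sub>F m in F. Re (\<tau> m (adj (B m) (d i m) \<otimes>\<^bsub>B m\<^esub> d i m)) < \<epsilon>\<^sup>2" if i: "i < n" for i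
    using order_tendstoD(2)[OF J0[OF dJ[OF i]], of "\<epsilon>\<^sup>2"] \<epsilon>(1) by simp
  have "\<forall>\<^sub>F m in F. \<forall>i\<in>{..<n}. Re (\<tau> m (adj (B m) (d i m) \<otimes>\<^bsub>B m\<^esub> d i m)) < \<epsilon>\<^sup>2"
    by (rule eventually_ball_finite) (use ev in auto)
  then obtain m where m: "\<And>i. i < n \<Longrightarrow> Re (\<tau> m (adj (B m) (d i m) \<otimes>\<^bsub>B m\<^esub> d i m)) < \<epsilon>\<^sup>2"
    using eventually_happens[of _ F] F by blast
  have big: "Re (\<tau> m (adj (B m) (\<psi> (u i) m) \<otimes>\<^bsub>B m\<^esub> \<psi> (u i) m)) \<ge> 1 - \<epsilon>" if i: "i < n" for i
  proof -
    have dc: "d i m \<in> carrier (B m)" using \<psi>m[OF Su[OF i]] by (simp add: dm[OF i])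
    have "(cmod (\<tau> m (d i m)))\<^sup>2 < \<epsilon>\<^sup>2" using cs[OF dc] m[OF i] by linarith
    then have "cmod (\<tau> m (d i m)) < \<epsilon>" using \<epsilon>(1) by (simp add: power_less_imp_less_base)
    moreover have "\<tau> m (d i m) = \<tau> m (adj (B m) (\<psi> (u i) m) \<otimes>\<^bsub>B m\<^esub> \<psi> (u i) m) - 1"
      using \<psi>m[OF Su[OF i]] by (simp add: dm[OF i] B.tr_diff B.tr_one)
    ultimately have "cmod (\<tau> m (adj (B m) (\<psi> (u i) m) \<otimes>\<^bsub>B m\<^esub> \<psi> (u i) m) - 1) < \<epsilon>" by simp
    then show ?thesis using abs_Re_le_cmod[of "\<tau> m (adj (B m) (\<psi> (u i) m) \<otimes>\<^bsub>B m\<^esub> \<psi> (u i) m) - 1"] by simp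
  qed
  obtain k e N where fd: "fd_subalgebra (B m) (\<tau> m) k e N" and
    ap: "\<And>i. i < n \<Longrightarrow> Re (\<tau> m (adj (B m) (\<psi> (u i) m) \<otimes>\<^bsub>B m\<^esub> \<psi> (u i) m)) - \<epsilon> \<le> (\<Sum>j<k. (cmod (\<tau> m (adj (B m) (e j) \<otimes>\<^bsub>B m\<^esub> \<psi> (u i) m)))\<^sup>2)"
    using approx[of "\<lambda>i. \<psi> (u i) m" m \<epsilon>] \<epsilon>(1) \<psi>m Su by blast
  have gp: "gram_positive A S (B m) (\<lambda>x. \<psi> x m)"
    by (rule gram_positive_comp[OF P.star_algebra_axioms B.star_algebra_axioms \<psi>(1)])
      (unfold P_def, rule cstar_algebra_linf_prod(2)[OF B])
  have "ereal (\<Sum>i<n. \<Sum>j<k. (cmod (\<tau> m (adj (B m) (e j) \<otimes>\<^bsub>B m\<^esub> \<psi> (u i) m)))\<^sup>2) \<le> w_cb A n u"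
    using w_cb_tracial_lower_bound[OF A S S1 Sadj fd gp] u Su by simp
  moreover have "r \<le> (\<Sum>i<n. \<Sum>j<k. (cmod (\<tau> m (adj (B m) (e j) \<otimes>\<^bsub>B m\<^esub> \<psi> (u i) m)))\<^sup>2)"
  proof -
    have "r \<le> (\<Sum>i<n. 1 - 2 * \<epsilon>)" using \<epsilon>(2) by (simp add: algebra_simps)
    also have "\<dots> \<le> (\<Sum>i<n. \<Sum>j<k. (cmod (\<tau> m (adj (B m) (e j) \<otimes>\<^bsub>B m\<^esub> \<psi> (u i) m)))\<^sup>2)"
      using ap big by (intro sum_mono) fastforce
    finally show ?thesis .
  qed
  ultimately have "ereal r \<le> w_cb A n u" by (meson ereal_less_eq(3) order_trans)
  then show False using r(1) by simp
qed

section \<open>The Hilbert space of square-summable sequences\<close>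

lemma ell2I:
  assumes "\<And>K. (\<Sum>i<K. (cmod (x i))\<^sup>2) \<le> C"
  shows "x \<in> ell2" "(ell2_norm x)\<^sup>2 \<le> C"
proof -
  show x: "x \<in> ell2" unfolding ell2_def
    by (intro CollectI summableI_nonneg_bounded[of _ C]) (use assms in auto)
  have "(\<Sum>i. (cmod (x i))\<^sup>2) \<le> C"
    using x assms unfolding ell2_def by (intro suminf_le_const) auto
  moreover have "(\<Sum>i. (cmod (x i))\<^sup>2) \<ge> 0" using x unfolding ell2_def by (intro suminf_nonneg) auto
  ultimately show "(ell2_norm x)\<^sup>2 \<le> C" by (simp add: ell2_norm_def)
qed

lemma ell2_norm_sq: "x \<in> ell2 \<Longrightarrow> (ell2_norm x)\<^sup>2 = (\<Sum>i. (cmod (x i))\<^sup>2)"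
  unfolding ell2_norm_def ell2_def by (intro real_sqrt_pow2 suminf_nonneg) auto

lemma ell2_norm_nonneg [simp]: "x \<in> ell2 \<Longrightarrow> ell2_norm x \<ge> 0"
  unfolding ell2_norm_def ell2_def by (intro real_sqrt_ge_zero suminf_nonneg) auto

lemma ell2_sum_le:
  assumes "x \<in> ell2" "finite I" shows "(\<Sum>i\<in>I. (cmod (x i))\<^sup>2) \<le> (ell2_norm x)\<^sup>2"
  unfolding ell2_norm_sq[OF assms(1)] using assms by (intro sum_le_suminf) (auto simp: ell2_def)

lemma ell2_coord_le: "x \<in> ell2 \<Longrightarrow> cmod (x i) \<le> ell2_norm x"
  by (rule power2_le_imp_le) (use ell2_sum_le[of x "{i}"] in auto)

lemma cmod_add_sq: "(cmod (a + b))\<^sup>2 \<le> 2 * (cmod a)\<^sup>2 + 2 * (cmod b)\<^sup>2"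
proof -
  have "(cmod (a + b))\<^sup>2 \<le> (cmod a + cmod b)\<^sup>2" by (intro power_mono norm_triangle_ineq) simp
  also have "\<dots> \<le> 2 * (cmod a)\<^sup>2 + 2 * (cmod b)\<^sup>2"
    using zero_le_power2[of "cmod a - cmod b"] by (simp add: power2_eq_square algebra_simps)
  finally show ?thesis .
qed

lemma ell2_add [simp, intro]: "x \<in> ell2 \<Longrightarrow> y \<in> ell2 \<Longrightarrow> (\<lambda>i. x i + y i) \<in> ell2"
proof -
  assume xy: "x \<in> ell2" "y \<in> ell2"
  have "summable (\<lambda>i. 2 * (cmod (x i))\<^sup>2 + 2 * (cmod (y i))\<^sup>2)"
    using xy unfolding ell2_def by (intro summable_add summable_mult) auto
  then show ?thesis unfolding ell2_def
    by (intro CollectI, elim summable_comparison_test[rotated]) (use cmod_add_sq in auto)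
qed

lemma ell2_scale [simp, intro]: "x \<in> ell2 \<Longrightarrow> (\<lambda>i. c * x i) \<in> ell2"
  unfolding ell2_def by (auto simp: norm_mult power_mult_distrib intro: summable_mult)

lemma ell2_zero [simp, intro]: "(\<lambda>i. 0) \<in> ell2" by (simp add: ell2_def)

lemma ell2_uminus [simp, intro]: "x \<in> ell2 \<Longrightarrow> (\<lambda>i. - x i) \<in> ell2"
  by (simp add: ell2_def)

lemma ell2_diff [simp, intro]: "x \<in> ell2 \<Longrightarrow> y \<in> ell2 \<Longrightarrow> (\<lambda>i. x i - y i) \<in> ell2"
  using ell2_add[of x "\<lambda>i. - y i"] by simp

lemma ell2_inner_summable: "x \<in> ell2 \<Longrightarrow> y \<in> ell2 \<Longrightarrow> summable (\<lambda>i. cnj (x i) * y i)"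
proof -
  assume xy: "x \<in> ell2" "y \<in> ell2"
  have s: "summable (\<lambda>i. (cmod (x i))\<^sup>2 + (cmod (y i))\<^sup>2)"
    using xy unfolding ell2_def by (intro summable_add) auto
  have "norm (cnj (x i) * y i) \<le> (cmod (x i))\<^sup>2 + (cmod (y i))\<^sup>2" for i
  proof -
    have "0 \<le> cmod (x i) * cmod (y i)" by simp
    with sum_squares_bound[of "cmod (x i)" "cmod (y i)"] show ?thesis unfolding norm_mult complex_mod_cnj by linarith
  qed
  then show ?thesis by (intro summable_comparison_test[OF _ s]) auto
qed

lemma ell2_inner_add_right:
  "x \<in> ell2 \<Longrightarrow> y \<in> ell2 \<Longrightarrow> z \<in> ell2 \<Longrightarrow> ell2_inner x (\<lambda>i. y i + z i) = ell2_inner x y + ell2_inner x z"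
  unfolding ell2_inner_def using suminf_add[OF ell2_inner_summable ell2_inner_summable, of x y x z]
  by (simp only: distrib_left)

lemma ell2_inner_scale_right:
  "x \<in> ell2 \<Longrightarrow> y \<in> ell2 \<Longrightarrow> ell2_inner x (\<lambda>i. c * y i) = c * ell2_inner x y"
  unfolding ell2_inner_def using suminf_mult[OF ell2_inner_summable, of x y c]
  by (simp only: mult.left_commute[of _ c])

lemma ell2_inner_commute: "x \<in> ell2 \<Longrightarrow> y \<in> ell2 \<Longrightarrow> ell2_inner y x = cnj (ell2_inner x y)"
proof -
  assume xy: "x \<in> ell2" "y \<in> ell2"
  have "(\<lambda>i. cnj (cnj (x i) * y i)) sums cnj (ell2_inner x y)"
    unfolding sums_cnj ell2_inner_def using ell2_inner_summable[OF xy] by (rule summable_sums)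
  note * = sums_unique[OF this]
  have "cnj (cnj (x i) * y i) = cnj (y i) * x i" for i by simp
  with * show ?thesis unfolding ell2_inner_def[of y x] by (simp only:)
qed

lemma ell2_inner_add_left:
  assumes x: "x \<in> ell2" and y: "y \<in> ell2" and z: "z \<in> ell2"
  shows "ell2_inner (\<lambda>i. x i + y i) z = ell2_inner x z + ell2_inner y z"
  unfolding ell2_inner_commute[OF z ell2_add[OF x y]] ell2_inner_commute[OF z x] ell2_inner_commute[OF z y]
    ell2_inner_add_right[OF z x y] by (rule complex_cnj_add)

lemma ell2_inner_scale_left:
  assumes x: "x \<in> ell2" and y: "y \<in> ell2"
  shows "ell2_inner (\<lambda>i. c * x i) y = cnj c * ell2_inner x y"
  unfolding ell2_inner_commute[OF y ell2_scale[OF x]] ell2_inner_commute[OF y x]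
    ell2_inner_scale_right[OF y x] by (rule complex_cnj_mult)

lemma ell2_inner_diff_right:
  assumes x: "x \<in> ell2" and y: "y \<in> ell2" and z: "z \<in> ell2"
  shows "ell2_inner x (\<lambda>i. y i - z i) = ell2_inner x y - ell2_inner x z"
proof -
  have "y i - z i = y i + (-1) * z i" for i by simp
  then show ?thesis
    using ell2_inner_add_right[OF x y ell2_scale[OF z, of "-1"]] ell2_inner_scale_right[OF x z, of "-1"]
    by (simp only:) simp
qed

lemma ell2_inner_self: "x \<in> ell2 \<Longrightarrow> ell2_inner x x = complex_of_real ((ell2_norm x)\<^sup>2)"
proof -
  assume x: "x \<in> ell2"
  then have s: "summable (\<lambda>i. (cmod (x i))\<^sup>2)" by (simp add: ell2_def)
  have "ell2_inner x x = (\<Sum>i. complex_of_real ((cmod (x i))\<^sup>2))"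
    unfolding ell2_inner_def by (intro suminf_cong) (simp add: cnj_mult_self(1))
  also have "\<dots> = complex_of_real (\<Sum>i. (cmod (x i))\<^sup>2)" using s by (rule suminf_of_real[symmetric])
  finally show ?thesis unfolding ell2_norm_sq[OF x] .
qed

lemma ell2_norm_add_scale_sq:
  assumes [simp]: "x \<in> ell2" "y \<in> ell2"
  shows "(ell2_norm (\<lambda>i. x i + c * y i))\<^sup>2 = (ell2_norm x)\<^sup>2 + 2 * Re (c * ell2_inner x y) + (cmod c)\<^sup>2 * (ell2_norm y)\<^sup>2"
proof -
  let ?z = "\<lambda>i. x i + c * y i"
  have "complex_of_real ((ell2_norm ?z)\<^sup>2) = ell2_inner ?z ?z" by (simp add: ell2_inner_self)
  also have "\<dots> = ell2_inner x x + c * ell2_inner x y + (cnj c * ell2_inner y x + cnj c * (c * ell2_inner y y))"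
    by (simp add: ell2_inner_add_left ell2_inner_add_right ell2_inner_scale_left ell2_inner_scale_right algebra_simps)
  finally have e: "complex_of_real ((ell2_norm ?z)\<^sup>2) =
    ell2_inner x x + c * ell2_inner x y + (cnj c * ell2_inner y x + cnj c * (c * ell2_inner y y))" .
  have 1: "cnj c * ell2_inner y x = cnj (c * ell2_inner x y)"
    using ell2_inner_commute[of x y] by simp
  have 2: "cnj c * (c * ell2_inner y y) = complex_of_real ((cmod c)\<^sup>2 * (ell2_norm y)\<^sup>2)"
    unfolding ell2_inner_self[OF assms(2)] mult.assoc[symmetric] cnj_mult_self by simp
  from arg_cong[OF e, of Re] show ?thesis
    unfolding 1 2 ell2_inner_self[OF assms(1)] Re_complex_of_real plus_complex.sel(1) cnj.sel(1) by linarith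
qed

lemma ell2_cauchy_schwarz:
  assumes [simp]: "x \<in> ell2" "y \<in> ell2"
  shows "cmod (ell2_inner x y) \<le> ell2_norm x * ell2_norm y"
proof -
  define s where "s = ell2_inner x y"
  have *: "0 \<le> (ell2_norm x)\<^sup>2 - 2 * t * (cmod s)\<^sup>2 + t\<^sup>2 * (cmod s)\<^sup>2 * (ell2_norm y)\<^sup>2" for t
  proof -
    have e: "complex_of_real (- t) * cnj s * s = complex_of_real (- t * (cmod s)\<^sup>2)"
      using cnj_mult_self(1)[of s] by (simp add: mult.assoc)
    have "0 \<le> (ell2_norm (\<lambda>i. x i + (complex_of_real (- t) * cnj s) * y i))\<^sup>2" by simp
    also have "\<dots> = (ell2_norm x)\<^sup>2 + 2 * Re (complex_of_real (- t) * cnj s * s) + (cmod (complex_of_real (- t) * cnj s))\<^sup>2 * (ell2_norm y)\<^sup>2"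
      unfolding s_def by (rule ell2_norm_add_scale_sq) simp_all
    also have "\<dots> = (ell2_norm x)\<^sup>2 - 2 * t * (cmod s)\<^sup>2 + t\<^sup>2 * (cmod s)\<^sup>2 * (ell2_norm y)\<^sup>2"
      unfolding e by (simp add: norm_mult power_mult_distrib)
    finally show ?thesis .
  qed
  show ?thesis
  proof (cases "ell2_norm y = 0")
    case True
    have "s = 0"
    proof (rule ccontr)
      assume "s \<noteq> 0"
      then have "2 * (((ell2_norm x)\<^sup>2 + 1) / (cmod s)\<^sup>2) * (cmod s)\<^sup>2 = 2 * ((ell2_norm x)\<^sup>2 + 1)" by simp
      then have "0 \<le> (ell2_norm x)\<^sup>2 - 2 * ((ell2_norm x)\<^sup>2 + 1)"
        using *[of "((ell2_norm x)\<^sup>2 + 1) / (cmod s)\<^sup>2"] True by simp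
      moreover have "\<not> 0 \<le> a - 2 * (a + 1)" if "a \<ge> 0" for a :: real using that by simp
      ultimately show False using zero_le_power2[of "ell2_norm x"] by blast
    qed
    then show ?thesis by (simp add: s_def)
  next
    case False
    have "0 \<le> (ell2_norm x)\<^sup>2 - (cmod s)\<^sup>2 / (ell2_norm y)\<^sup>2"
      using *[of "1 / (ell2_norm y)\<^sup>2"] False by (simp add: power2_eq_square field_simps)
    then have "(cmod s)\<^sup>2 \<le> (ell2_norm x * ell2_norm y)\<^sup>2"
      using False by (simp add: field_simps power_mult_distrib)
    then show ?thesis unfolding s_def by (rule power2_le_imp_le) simp
  qed
qed

lemma ell2_norm_scale: "x \<in> ell2 \<Longrightarrow> ell2_norm (\<lambda>i. c * x i) = cmod c * ell2_norm x"
proof -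
  assume x: "x \<in> ell2"
  then have "summable (\<lambda>i. (cmod (x i))\<^sup>2)" by (simp add: ell2_def)
  then show ?thesis
    by (simp add: ell2_norm_def norm_mult power_mult_distrib suminf_mult real_sqrt_mult)
qed

lemma ell2_norm_triangle: "x \<in> ell2 \<Longrightarrow> y \<in> ell2 \<Longrightarrow> ell2_norm (\<lambda>i. x i + y i) \<le> ell2_norm x + ell2_norm y"
proof -
  assume xy [simp]: "x \<in> ell2" "y \<in> ell2"
  have "(ell2_norm (\<lambda>i. x i + y i))\<^sup>2 = (ell2_norm x)\<^sup>2 + 2 * Re (ell2_inner x y) + (ell2_norm y)\<^sup>2"
    using ell2_norm_add_scale_sq[of x y 1] by simp
  also have "Re (ell2_inner x y) \<le> ell2_norm x * ell2_norm y"
    using ell2_cauchy_schwarz[of x y] complex_Re_le_cmod[of "ell2_inner x y"] by simp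
  finally have "(ell2_norm (\<lambda>i. x i + y i))\<^sup>2 \<le> (ell2_norm x + ell2_norm y)\<^sup>2"
    by (simp add: power2_sum)
  then show ?thesis by (rule power2_le_imp_le) simp
qed

lemma ell2_norm_zero [simp]: "ell2_norm (\<lambda>i. 0) = 0" by (simp add: ell2_norm_def)

lemma ell2_norm_eq_0_iff: "x \<in> ell2 \<Longrightarrow> ell2_norm x = 0 \<longleftrightarrow> x = (\<lambda>i. 0)"
proof
  assume "x \<in> ell2" "ell2_norm x = 0"
  then have "cmod (x i) \<le> 0" for i using ell2_coord_le[of x i] by simp
  then show "x = (\<lambda>i. 0)" by auto
next
  assume "x = (\<lambda>i. 0)"
  then show "ell2_norm x = 0" by (simp only: ell2_norm_zero)
qed

lemma ell2_norm_minus: "ell2_norm (\<lambda>i. x i - y i) = ell2_norm (\<lambda>i. y i - x i)"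
proof -
  have "cmod (x i - y i) = cmod (y i - x i)" for i by (rule norm_minus_commute)
  then show ?thesis unfolding ell2_norm_def by (simp only:)
qed

lemma ell2_diff_triangle:
  assumes "x \<in> ell2" "y \<in> ell2" "z \<in> ell2"
  shows "ell2_norm (\<lambda>i. x i - z i) \<le> ell2_norm (\<lambda>i. x i - y i) + ell2_norm (\<lambda>i. y i - z i)"
proof -
  have eq: "(x i - y i) + (y i - z i) = x i - z i" for i by simp
  show ?thesis using ell2_norm_triangle[OF ell2_diff[OF assms(1,2)] ell2_diff[OF assms(2,3)]] unfolding eq .
qed

lemma ell2_complete:
  assumes f: "\<And>n. f n \<in> ell2"
    and cau: "\<And>e. e > 0 \<Longrightarrow> \<exists>N. \<forall>i\<ge>N. \<forall>j\<ge>N. ell2_norm (\<lambda>k. f i k - f j k) < e"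
  shows "\<exists>x\<in>ell2. (\<lambda>n. ell2_norm (\<lambda>k. f n k - x k)) \<longlonglongrightarrow> 0"
proof -
  have "Cauchy (\<lambda>n. f n k)" for k
  proof (rule CauchyI)
    fix e :: real assume "0 < e"
    then obtain N where N: "\<And>i j. i \<ge> N \<Longrightarrow> j \<ge> N \<Longrightarrow> ell2_norm (\<lambda>k. f i k - f j k) < e" using cau[of e] by blast
    show "\<exists>M. \<forall>m\<ge>M. \<forall>n\<ge>M. norm (f m k - f n k) < e"
    proof (intro exI[of _ N] allI impI)
      fix m n assume "m \<ge> N" "n \<ge> N"
      then show "norm (f m k - f n k) < e"
        using ell2_coord_le[OF ell2_diff[OF f[of m] f[of n]], of k] N[of m n] by linarith
    qed
  qed
  then have "\<exists>l. (\<lambda>n. f n k) \<longlonglongrightarrow> l" for k using Cauchy_convergent_iff convergent_def by blast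
  then obtain x where x: "\<And>k. (\<lambda>n. f n k) \<longlonglongrightarrow> x k" by metis
  have unif: "\<exists>N. \<forall>i\<ge>N. (\<lambda>k. f i k - x k) \<in> ell2 \<and> ell2_norm (\<lambda>k. f i k - x k) \<le> e" if e: "e > 0" for e
  proof -
    obtain N where N: "\<And>i j. i \<ge> N \<Longrightarrow> j \<ge> N \<Longrightarrow> ell2_norm (\<lambda>k. f i k - f j k) < e" using cau[OF e] by blast
    have b: "(\<Sum>k<K. (cmod (f i k - x k))\<^sup>2) \<le> e\<^sup>2" if i: "i \<ge> N" for i K
    proof (rule LIMSEQ_le_const2)
      show "(\<lambda>j. \<Sum>k<K. (cmod (f i k - f j k))\<^sup>2) \<longlonglongrightarrow> (\<Sum>k<K. (cmod (f i k - x k))\<^sup>2)"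
        by (intro tendsto_sum tendsto_power tendsto_norm tendsto_diff tendsto_const x)
      have "(\<Sum>k<K. (cmod (f i k - f j k))\<^sup>2) \<le> e\<^sup>2" if j: "j \<ge> N" for j
      proof -
        have "(\<Sum>k<K. (cmod (f i k - f j k))\<^sup>2) \<le> (ell2_norm (\<lambda>k. f i k - f j k))\<^sup>2"
          using ell2_sum_le[of "\<lambda>k. f i k - f j k" "{..<K}"] f by simp
        also have "\<dots> \<le> e\<^sup>2" using N[OF i j] f by (intro power_mono) auto
        finally show ?thesis .
      qed
      then show "\<exists>N. \<forall>j\<ge>N. (\<Sum>k<K. (cmod (f i k - f j k))\<^sup>2) \<le> e\<^sup>2" by blast
    qed
    have "(\<lambda>k. f i k - x k) \<in> ell2 \<and> ell2_norm (\<lambda>k. f i k - x k) \<le> e" if i: "i \<ge> N" for i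
      using ell2I[of "\<lambda>k. f i k - x k" "e\<^sup>2", OF b[OF i]] e by (auto intro: power2_le_imp_le)
    then show ?thesis by blast
  qed
  obtain N where "(\<lambda>k. f N k - x k) \<in> ell2" using unif[of 1] by auto
  then have "(\<lambda>k. f N k - (f N k - x k)) \<in> ell2" by (rule ell2_diff[OF f])
  then have xe: "x \<in> ell2" by simp
  have "(\<lambda>n. ell2_norm (\<lambda>k. f n k - x k)) \<longlonglongrightarrow> 0"
  proof (rule LIMSEQ_I)
    fix r :: real assume "0 < r"
    then obtain N where "\<And>i. i \<ge> N \<Longrightarrow> ell2_norm (\<lambda>k. f i k - x k) \<le> r / 2" using unif[of "r/2"] by auto
    then have "norm (ell2_norm (\<lambda>k. f i k - x k) - 0) < r" if "i \<ge> N" for i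
      using that \<open>0 < r\<close> ell2_norm_nonneg[OF ell2_diff[OF f[of i] xe]] by force
    then show "\<exists>N. \<forall>i\<ge>N. norm (ell2_norm (\<lambda>k. f i k - x k) - 0) < r" by blast
  qed
  with xe show ?thesis by blast
qed

definition basis_vec :: "nat \<Rightarrow> nat \<Rightarrow> complex" where
  "basis_vec k = (\<lambda>i. if i = k then 1 else 0)"

definition truncate :: "nat \<Rightarrow> (nat \<Rightarrow> complex) \<Rightarrow> nat \<Rightarrow> complex" where
  "truncate K x = (\<lambda>i. if i < K then x i else 0)"

lemma basis_vec_ell2 [simp]: "basis_vec k \<in> ell2"
proof (rule ell2I(1)[of _ 1])
  show "(\<Sum>i<K. (cmod (basis_vec k i))\<^sup>2) \<le> 1" for K
  proof -
    have "(\<Sum>i<K. (cmod (basis_vec k i))\<^sup>2) = (\<Sum>i<K. if i = k then 1 else 0)"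
      by (intro sum.cong refl) (simp add: basis_vec_def)
    then show ?thesis by simp
  qed
qed

lemma truncate_ell2 [simp]: "truncate K x \<in> ell2"
  unfolding ell2_def truncate_def
  by (intro CollectI summable_finite[of "{..<K}"]) auto

lemma truncate_norm_sq: "(ell2_norm (truncate K x))\<^sup>2 = (\<Sum>i<K. (cmod (x i))\<^sup>2)"
proof -
  have "(\<Sum>i. (cmod (truncate K x i))\<^sup>2) = (\<Sum>i<K. (cmod (truncate K x i))\<^sup>2)"
    by (rule suminf_finite) (auto simp: truncate_def)
  also have "\<dots> = (\<Sum>i<K. (cmod (x i))\<^sup>2)" by (intro sum.cong refl) (simp add: truncate_def)
  finally show ?thesis by (simp add: ell2_norm_sq)
qed

lemma truncate_Suc: "truncate (Suc K) x = (\<lambda>i. truncate K x i + x K * basis_vec K i)"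
  by (auto simp: truncate_def basis_vec_def less_Suc_eq)

lemma truncate_0: "truncate 0 x = (\<lambda>i. 0)" by (simp add: truncate_def)

lemma truncate_tendsto:
  assumes x: "x \<in> ell2" shows "(\<lambda>K. ell2_norm (\<lambda>i. x i - truncate K x i)) \<longlonglongrightarrow> 0"
proof -
  have s: "summable (\<lambda>i. (cmod (x i))\<^sup>2)" using x by (simp add: ell2_def)
  have "(ell2_norm (\<lambda>i. x i - truncate K x i))\<^sup>2 = (\<Sum>i. (cmod (x i))\<^sup>2) - (\<Sum>i<K. (cmod (x i))\<^sup>2)" for K
  proof -
    have "(ell2_norm (\<lambda>i. x i - truncate K x i))\<^sup>2 = (\<Sum>i. (cmod (x i))\<^sup>2 - (cmod (truncate K x i))\<^sup>2)"
      unfolding ell2_norm_sq[OF ell2_diff[OF x truncate_ell2]]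
      by (intro suminf_cong) (simp add: truncate_def)
    also have "\<dots> = (\<Sum>i. (cmod (x i))\<^sup>2) - (\<Sum>i. (cmod (truncate K x i))\<^sup>2)"
      by (intro suminf_diff[symmetric] s) (use truncate_ell2[of K x] in \<open>simp add: ell2_def\<close>)
    also have "(\<Sum>i. (cmod (truncate K x i))\<^sup>2) = (\<Sum>i<K. (cmod (x i))\<^sup>2)"
      using truncate_norm_sq[of K x] by (simp add: ell2_norm_sq)
    finally show ?thesis .
  qed
  moreover have "(\<lambda>K. (\<Sum>i. (cmod (x i))\<^sup>2) - (\<Sum>i<K. (cmod (x i))\<^sup>2)) \<longlonglongrightarrow> (\<Sum>i. (cmod (x i))\<^sup>2) - (\<Sum>i. (cmod (x i))\<^sup>2)"
    by (intro tendsto_diff tendsto_const summable_LIMSEQ s)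
  ultimately have "(\<lambda>K. (ell2_norm (\<lambda>i. x i - truncate K x i))\<^sup>2) \<longlonglongrightarrow> 0" by simp
  from tendsto_real_sqrt[OF this] show ?thesis
    unfolding real_sqrt_abs abs_of_nonneg[OF ell2_norm_nonneg[OF ell2_diff[OF x truncate_ell2]]] real_sqrt_zero .
qed

lemma ell2_inner_basis_vec: "ell2_inner (basis_vec k) x = x k"
proof -
  have "(\<Sum>i. cnj (basis_vec k i) * x i) = (\<Sum>i\<in>{k}. cnj (basis_vec k i) * x i)"
    by (rule suminf_finite) (auto simp: basis_vec_def)
  then show ?thesis by (simp add: ell2_inner_def basis_vec_def)
qed

section \<open>Bounded operators\<close>

lemma bo_closed: "T \<in> bounded_ops \<Longrightarrow> x \<in> ell2 \<Longrightarrow> T x \<in> ell2"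
  unfolding bounded_ops_def by auto

lemma bo_add: "T \<in> bounded_ops \<Longrightarrow> x \<in> ell2 \<Longrightarrow> y \<in> ell2 \<Longrightarrow> T (\<lambda>i. x i + y i) = (\<lambda>i. T x i + T y i)"
  unfolding bounded_ops_def by blast

lemma bo_scale: "T \<in> bounded_ops \<Longrightarrow> x \<in> ell2 \<Longrightarrow> T (\<lambda>i. c * x i) = (\<lambda>i. c * T x i)"
  unfolding bounded_ops_def by blast

lemma bo_diff:
  assumes T: "T \<in> bounded_ops" and x: "x \<in> ell2" and y: "y \<in> ell2"
  shows "T (\<lambda>i. x i - y i) = (\<lambda>i. T x i - T y i)"
proof -
  have "x i - y i = x i + (-1) * y i" for i by simp
  then show ?thesis using bo_add[OF T x ell2_scale[OF y, of "-1"]] bo_scale[OF T y, of "-1"] by (simp only:) simp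
qed

lemma bo_zero: "T \<in> bounded_ops \<Longrightarrow> T (\<lambda>i. 0) = (\<lambda>i. 0)"
  using bo_scale[of T "\<lambda>i. 0" 0] by simp

lemma bo_bound:
  assumes "T \<in> bounded_ops" obtains C where "C \<ge> 0" "\<And>x. x \<in> ell2 \<Longrightarrow> ell2_norm (T x) \<le> C * ell2_norm x"
proof -
  obtain C where C: "\<And>x. x \<in> ell2 \<Longrightarrow> ell2_norm (T x) \<le> C * ell2_norm x"
    using assms unfolding bounded_ops_def by blast
  have "ell2_norm (T x) \<le> max C 0 * ell2_norm x" if "x \<in> ell2" for x
    using C[OF that] mult_right_mono[of C "max C 0" "ell2_norm x"] ell2_norm_nonneg[OF that] by linarith
  then show thesis using that[of "max C 0"] by simp
qed

lemma bo_eqI: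
  assumes "T \<in> bounded_ops" "S \<in> bounded_ops" "\<And>x. x \<in> ell2 \<Longrightarrow> T x = S x" shows "T = S"
  by (rule PiE_ext[of _ ell2 "\<lambda>_. ell2"]) (use assms in \<open>auto simp: bounded_ops_def\<close>)

lemma bo_restrictI:
  assumes "\<And>x. x \<in> ell2 \<Longrightarrow> f x \<in> ell2"
    "\<And>x y. x \<in> ell2 \<Longrightarrow> y \<in> ell2 \<Longrightarrow> f (\<lambda>i. x i + y i) = (\<lambda>i. f x i + f y i)"
    "\<And>c x. x \<in> ell2 \<Longrightarrow> f (\<lambda>i. c * x i) = (\<lambda>i. c * f x i)"
    "\<And>x. x \<in> ell2 \<Longrightarrow> ell2_norm (f x) \<le> C * ell2_norm x"
  shows "(\<lambda>x\<in>ell2. f x) \<in> bounded_ops"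
  unfolding bounded_ops_def using assms by (auto intro!: exI[of _ C])

lemma cnorm_B_ell2: "cnorm B_ell2 T = (SUP x\<in>{x \<in> ell2. ell2_norm x \<le> 1}. ell2_norm (T x))"
  by (simp add: B_ell2_def)

lemma op_bdd:
  assumes T: "T \<in> bounded_ops" shows "bdd_above ((\<lambda>x. ell2_norm (T x)) ` {x \<in> ell2. ell2_norm x \<le> 1})"
proof -
  obtain C where C: "C \<ge> 0" "\<And>x. x \<in> ell2 \<Longrightarrow> ell2_norm (T x) \<le> C * ell2_norm x" using bo_bound[OF T] by blast
  have "ell2_norm (T x) \<le> C" if x: "x \<in> ell2" "ell2_norm x \<le> 1" for x
    using C(2)[OF x(1)] mult_left_mono[OF x(2) C(1)] by simp
  then show ?thesis by (intro bdd_aboveI2[of _ _ C]) auto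
qed

lemma op_unit_le: "T \<in> bounded_ops \<Longrightarrow> x \<in> ell2 \<Longrightarrow> ell2_norm x \<le> 1 \<Longrightarrow> ell2_norm (T x) \<le> cnorm B_ell2 T"
  unfolding cnorm_B_ell2 by (rule cSUP_upper[OF _ op_bdd]) auto

lemma op_nonneg: "T \<in> bounded_ops \<Longrightarrow> 0 \<le> cnorm B_ell2 T"
  using op_unit_le[of T "\<lambda>i. 0"] bo_zero[of T] by simp

lemma op_le: assumes T: "T \<in> bounded_ops" and x: "x \<in> ell2" shows "ell2_norm (T x) \<le> cnorm B_ell2 T * ell2_norm x"
proof (cases "ell2_norm x = 0")
  case True
  obtain C where C: "C \<ge> 0" "\<And>x. x \<in> ell2 \<Longrightarrow> ell2_norm (T x) \<le> C * ell2_norm x" using bo_bound[OF T] by blast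
  show ?thesis using C(2)[OF x] True by simp
next
  case False
  then have pos: "ell2_norm x > 0" using ell2_norm_nonneg[OF x] by linarith
  define c where "c = complex_of_real (1 / ell2_norm x)"
  have cn: "cmod c = 1 / ell2_norm x" unfolding c_def norm_of_real using pos by simp
  have "ell2_norm (\<lambda>i. c * x i) \<le> 1" unfolding ell2_norm_scale[OF x] cn using pos by simp
  then have "ell2_norm (T (\<lambda>i. c * x i)) \<le> cnorm B_ell2 T" using op_unit_le[OF T ell2_scale[OF x]] by blast
  then have "(1 / ell2_norm x) * ell2_norm (T x) \<le> cnorm B_ell2 T"
    unfolding bo_scale[OF T x] ell2_norm_scale[OF bo_closed[OF T x]] cn .
  then show ?thesis using pos by (simp add: field_simps)
qed

lemma op_lub:
  assumes "\<And>x. x \<in> ell2 \<Longrightarrow> ell2_norm (T x) \<le> C * ell2_norm x" "C \<ge> 0" shows "cnorm B_ell2 T \<le> C"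
  unfolding cnorm_B_ell2
proof (rule cSUP_least)
  show "{x \<in> ell2. ell2_norm x \<le> 1} \<noteq> {}" using ell2_zero ell2_norm_zero by force
  fix x assume "x \<in> {x \<in> ell2. ell2_norm x \<le> 1}"
  then show "ell2_norm (T x) \<le> C" using assms(1)[of x] mult_left_mono[of "ell2_norm x" 1 C] assms(2) by simp
qed

lemma inner_bo_truncate:
  assumes T: "T \<in> bounded_ops" and x: "x \<in> ell2"
  shows "ell2_inner x (T (truncate K y)) = (\<Sum>k<K. y k * ell2_inner x (T (basis_vec k)))"
proof (induction K)
  case 0
  have "ell2_inner x (\<lambda>i. 0) = 0" by (simp add: ell2_inner_def)
  then show ?case unfolding truncate_0 bo_zero[OF T] by simp
next
  case (Suc K)
  note Tt = bo_closed[OF T truncate_ell2] and Tb = bo_closed[OF T basis_vec_ell2]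
  show ?case
    unfolding truncate_Suc bo_add[OF T truncate_ell2 ell2_scale[OF basis_vec_ell2]] bo_scale[OF T basis_vec_ell2]
      ell2_inner_add_right[OF x Tt ell2_scale[OF Tb]] ell2_inner_scale_right[OF x Tb] Suc by simp
qed

lemma id_bounded: "(\<lambda>x\<in>ell2. x) \<in> bounded_ops"
  by (rule bo_restrictI[of _ 1]) auto

lemma inner_truncate: "x \<in> ell2 \<Longrightarrow> ell2_inner x (truncate K y) = (\<Sum>k<K. y k * cnj (x k))"
  using inner_bo_truncate[OF id_bounded, of x K y] ell2_inner_commute[OF basis_vec_ell2, of x]
  by (simp add: ell2_inner_basis_vec)

lemma ell2_eqI:
  assumes "u \<in> ell2" "v \<in> ell2" "\<And>y. y \<in> ell2 \<Longrightarrow> ell2_inner u y = ell2_inner v y" shows "u = v"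
proof
  fix k
  have "cnj (ell2_inner (basis_vec k) u) = cnj (ell2_inner (basis_vec k) v)"
    using assms(3)[of "basis_vec k"] ell2_inner_commute[OF basis_vec_ell2 assms(1)] ell2_inner_commute[OF basis_vec_ell2 assms(2)]
    by simp
  then show "u k = v k" by (simp add: ell2_inner_basis_vec)
qed

lemma truncate_limit:
  assumes x: "x \<in> ell2" and D: "\<And>K. d \<le> C * ell2_norm (\<lambda>i. x i - truncate K x i)" shows "d \<le> (0::real)"
proof -
  have "(\<lambda>K. C * ell2_norm (\<lambda>i. x i - truncate K x i)) \<longlonglongrightarrow> C * 0"
    by (intro tendsto_mult tendsto_const truncate_tendsto x)
  then have "d \<le> C * 0" by (rule LIMSEQ_le_const) (use D in auto)
  then show ?thesis by simp
qed

lemma bo_eq_basisI: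
  assumes T: "T \<in> bounded_ops" and S: "S \<in> bounded_ops" and eq: "\<And>k. T (basis_vec k) = S (basis_vec k)"
  shows "T = S"
proof (rule bo_eqI[OF T S])
  fix x assume x: "x \<in> ell2"
  have tr: "T (truncate K x) = S (truncate K x)" for K
  proof
    fix j
    show "T (truncate K x) j = S (truncate K x) j"
      using inner_bo_truncate[OF T basis_vec_ell2, of j K x] inner_bo_truncate[OF S basis_vec_ell2, of j K x]
      unfolding ell2_inner_basis_vec eq by simp
  qed
  note d = ell2_diff[OF bo_closed[OF T x] bo_closed[OF S x]]
  have "ell2_norm (\<lambda>i. T x i - S x i) \<le> (cnorm B_ell2 T + cnorm B_ell2 S) * ell2_norm (\<lambda>i. x i - truncate K x i)" for K
  proof -
    note xt = ell2_diff[OF x truncate_ell2[of K x]]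
    have "ell2_norm (\<lambda>i. T x i - S x i) \<le> ell2_norm (\<lambda>i. T x i - T (truncate K x) i) + ell2_norm (\<lambda>i. T (truncate K x) i - S x i)"
      by (rule ell2_diff_triangle[OF bo_closed[OF T x] bo_closed[OF T truncate_ell2] bo_closed[OF S x]])
    also have "ell2_norm (\<lambda>i. T x i - T (truncate K x) i) \<le> cnorm B_ell2 T * ell2_norm (\<lambda>i. x i - truncate K x i)"
      using op_le[OF T xt] unfolding bo_diff[OF T x truncate_ell2] .
    also have "ell2_norm (\<lambda>i. T (truncate K x) i - S x i) \<le> cnorm B_ell2 S * ell2_norm (\<lambda>i. x i - truncate K x i)"
      using op_le[OF S xt] unfolding bo_diff[OF S x truncate_ell2] tr ell2_norm_minus[of "S x"] .
    finally show ?thesis by (simp add: algebra_simps)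
  qed
  from truncate_limit[OF x this] have "ell2_norm (\<lambda>i. T x i - S x i) = 0"
    using ell2_norm_nonneg[OF d] by linarith
  then have z: "(\<lambda>i. T x i - S x i) = (\<lambda>i. 0)" using ell2_norm_eq_0_iff[OF d] by blast
  show "T x = S x"
  proof
    fix i show "T x i = S x i" using fun_cong[OF z, of i] by simp
  qed
qed

subsection \<open>Adjoints\<close>

text \<open>
  The \<open>i\<close>-th coordinate of \<open>T* x\<close> is the inner product of the \<open>i\<close>-th basis vector with \<open>T* x\<close>.
\<close>

definition adj_op :: "ell2_op \<Rightarrow> ell2_op" where
  "adj_op T = (\<lambda>x\<in>ell2. \<lambda>i. ell2_inner (T (basis_vec i)) x)"

text \<open>
  If \<open>a\<close> is a truncation of \<open>T* x\<close>, then the inner product of \<open>x\<close> and \<open>T a\<close> is the square of the norm of \<open>a\<close>, which is therefore at most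
  \<open>\<parallel>T\<parallel> \<parallel>a\<parallel> \<parallel>x\<parallel>\<close>. Dividing by \<open>\<parallel>a\<parallel>\<close> gives a bound independent of the truncation.
\<close>

lemma adj_op_bound:
  assumes T: "T \<in> bounded_ops" and x: "x \<in> ell2"
  shows "adj_op T x \<in> ell2" "ell2_norm (adj_op T x) \<le> cnorm B_ell2 T * ell2_norm x"
proof -
  define a where "a i = ell2_inner (T (basis_vec i)) x" for i
  have ax: "adj_op T x = a" using x by (auto simp: adj_op_def a_def)
  let ?C = "cnorm B_ell2 T * ell2_norm x"
  have C0: "?C \<ge> 0" using op_nonneg[OF T] x by simp
  have "(\<Sum>i<K. (cmod (a i))\<^sup>2) \<le> ?C\<^sup>2" for K
  proof -
    define s where "s = ell2_norm (truncate K a)"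
    have s2: "s\<^sup>2 = (\<Sum>i<K. (cmod (a i))\<^sup>2)" unfolding s_def by (rule truncate_norm_sq)
    have s0: "s \<ge> 0" unfolding s_def by simp
    have "ell2_inner x (T (truncate K a)) = (\<Sum>i<K. a i * cnj (a i))"
      unfolding inner_bo_truncate[OF T x] a_def
      unfolding ell2_inner_commute[OF bo_closed[OF T basis_vec_ell2] x] ..
    also have "\<dots> = complex_of_real (s\<^sup>2)" unfolding s2 by (simp add: cnj_mult_self)
    finally have "cmod (ell2_inner x (T (truncate K a))) = s\<^sup>2" by (simp only: norm_of_real abs_power2 power2_abs)
    then have "s\<^sup>2 \<le> ell2_norm x * ell2_norm (T (truncate K a))"
      using ell2_cauchy_schwarz[OF x bo_closed[OF T truncate_ell2], of K a] by simp
    also have "\<dots> \<le> ell2_norm x * (cnorm B_ell2 T * s)"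
      unfolding s_def using op_le[OF T truncate_ell2] x by (intro mult_left_mono) auto
    finally have "s * s \<le> ?C * s" by (simp add: power2_eq_square mult_ac)
    then have "s \<le> ?C" using s0 C0 by (cases "s = 0") (auto simp: mult_le_cancel_right)
    then show ?thesis using s0 unfolding s2[symmetric] by (rule power_mono)
  qed
  note * = ell2I[OF this]
  show "adj_op T x \<in> ell2" using *(1) ax by simp
  show "ell2_norm (adj_op T x) \<le> ?C" using power2_le_imp_le[OF *(2) C0] ax by simp
qed

lemma adj_op_closed: assumes T: "T \<in> bounded_ops" shows "adj_op T \<in> bounded_ops"
  unfolding adj_op_def
proof (rule bo_restrictI)
  fix x y c assume x: "x \<in> ell2" and y: "y \<in> ell2"
  show "(\<lambda>i. ell2_inner (T (basis_vec i)) (\<lambda>i. x i + y i)) =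
      (\<lambda>i. ell2_inner (T (basis_vec i)) x + ell2_inner (T (basis_vec i)) y)"
    unfolding ell2_inner_add_right[OF bo_closed[OF T basis_vec_ell2] x y] ..
next
  fix x c assume x: "x \<in> ell2"
  show "(\<lambda>i. ell2_inner (T (basis_vec i)) x) \<in> ell2"
    using adj_op_bound(1)[OF T x] x by (simp add: adj_op_def)
  show "(\<lambda>i. ell2_inner (T (basis_vec i)) (\<lambda>i. c * x i)) = (\<lambda>i. c * ell2_inner (T (basis_vec i)) x)"
    unfolding ell2_inner_scale_right[OF bo_closed[OF T basis_vec_ell2] x] ..
  show "ell2_norm (\<lambda>i. ell2_inner (T (basis_vec i)) x) \<le> cnorm B_ell2 T * ell2_norm x"
    using adj_op_bound(2)[OF T x] x by (simp add: adj_op_def)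
qed

lemma adj_op_inner:
  assumes T: "T \<in> bounded_ops" and x: "x \<in> ell2" and y: "y \<in> ell2"
  shows "ell2_inner (adj_op T x) y = ell2_inner x (T y)"
proof -
  let ?a = "adj_op T x"
  note a = adj_op_bound(1)[OF T x]
  define d where "d = cmod (ell2_inner ?a y - ell2_inner x (T y))"
  have "d \<le> (ell2_norm ?a + ell2_norm x * cnorm B_ell2 T) * ell2_norm (\<lambda>i. y i - truncate K y i)" for K
  proof -
    let ?t = "truncate K y"
    note yt = ell2_diff[OF y truncate_ell2[of K y]]
    have "ell2_inner ?a ?t = ell2_inner x (T ?t)"
      unfolding inner_bo_truncate[OF T x] inner_truncate[OF a]
    proof (intro sum.cong refl arg_cong2[of _ _ _ _ "(*)"])
      fix k show "cnj (?a k) = ell2_inner x (T (basis_vec k))"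
        using ell2_inner_commute[OF bo_closed[OF T basis_vec_ell2] x, of k] x by (simp add: adj_op_def)
    qed
    then have "ell2_inner ?a y - ell2_inner x (T y) = ell2_inner ?a (\<lambda>i. y i - ?t i) - ell2_inner x (T (\<lambda>i. y i - ?t i))"
      unfolding bo_diff[OF T y truncate_ell2] ell2_inner_diff_right[OF a y truncate_ell2]
        ell2_inner_diff_right[OF x bo_closed[OF T y] bo_closed[OF T truncate_ell2]] by simp
    then have "d \<le> cmod (ell2_inner ?a (\<lambda>i. y i - ?t i)) + cmod (ell2_inner x (T (\<lambda>i. y i - ?t i)))"
      unfolding d_def using norm_triangle_ineq4 by metis
    also have "\<dots> \<le> ell2_norm ?a * ell2_norm (\<lambda>i. y i - ?t i) + ell2_norm x * ell2_norm (T (\<lambda>i. y i - ?t i))"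
      by (rule add_mono[OF ell2_cauchy_schwarz[OF a yt] ell2_cauchy_schwarz[OF x bo_closed[OF T yt]]])
    also have "\<dots> \<le> ell2_norm ?a * ell2_norm (\<lambda>i. y i - ?t i) + ell2_norm x * (cnorm B_ell2 T * ell2_norm (\<lambda>i. y i - ?t i))"
      using op_le[OF T yt] x by (intro add_left_mono mult_left_mono) auto
    finally show ?thesis by (simp add: algebra_simps)
  qed
  from truncate_limit[OF y this] show ?thesis unfolding d_def by simp
qed

lemma adj_B_ell2: assumes T: "T \<in> bounded_ops" shows "adj B_ell2 T = adj_op T"
proof -
  have "(THE T'. T' \<in> bounded_ops \<and> (\<forall>x\<in>ell2. \<forall>y\<in>ell2. ell2_inner (T' x) y = ell2_inner x (T y))) = adj_op T"
  proof (rule the_equality)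
    show "adj_op T \<in> bounded_ops \<and> (\<forall>x\<in>ell2. \<forall>y\<in>ell2. ell2_inner (adj_op T x) y = ell2_inner x (T y))"
      using adj_op_closed[OF T] adj_op_inner[OF T] by blast
    fix T' assume T': "T' \<in> bounded_ops \<and> (\<forall>x\<in>ell2. \<forall>y\<in>ell2. ell2_inner (T' x) y = ell2_inner x (T y))"
    show "T' = adj_op T"
    proof (rule bo_eqI)
      fix x assume x: "x \<in> ell2"
      show "T' x = adj_op T x"
        by (rule ell2_eqI) (use T' x adj_op_bound(1)[OF T x] adj_op_inner[OF T x] bo_closed[of T' x] in auto)
    qed (use T' adj_op_closed[OF T] in auto)
  qed
  then show ?thesis by (simp add: B_ell2_def)
qed

lemma B_ell2_ops:
  "carrier B_ell2 = bounded_ops" "\<one>\<^bsub>B_ell2\<^esub> = (\<lambda>x\<in>ell2. x)" "\<zero>\<^bsub>B_ell2\<^esub> = (\<lambda>x\<in>ell2. (\<lambda>i. 0))"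
  "S \<otimes>\<^bsub>B_ell2\<^esub> T = (\<lambda>x\<in>ell2. S (T x))" "S \<oplus>\<^bsub>B_ell2\<^esub> T = (\<lambda>x\<in>ell2. (\<lambda>i. S x i + T x i))"
  "c \<odot>\<^bsub>B_ell2\<^esub> T = (\<lambda>x\<in>ell2. (\<lambda>i. c * T x i))"
  by (simp_all add: B_ell2_def compose_def)

lemma B_ell2_mult_closed:
  assumes S: "S \<in> bounded_ops" and T: "T \<in> bounded_ops"
  shows "(\<lambda>x\<in>ell2. S (T x)) \<in> bounded_ops" "cnorm B_ell2 (\<lambda>x\<in>ell2. S (T x)) \<le> cnorm B_ell2 S * cnorm B_ell2 T"
proof -
  have le: "ell2_norm (S (T x)) \<le> (cnorm B_ell2 S * cnorm B_ell2 T) * ell2_norm x" if x: "x \<in> ell2" for x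
    using order_trans[OF op_le[OF S bo_closed[OF T x]] mult_left_mono[OF op_le[OF T x] op_nonneg[OF S]]]
    by (simp add: mult_ac)
  show "(\<lambda>x\<in>ell2. S (T x)) \<in> bounded_ops"
    by (rule bo_restrictI[OF _ _ _ le]) (simp_all add: bo_closed S T bo_add[OF T] bo_add[OF S] bo_scale[OF T] bo_scale[OF S])
  show "cnorm B_ell2 (\<lambda>x\<in>ell2. S (T x)) \<le> cnorm B_ell2 S * cnorm B_ell2 T"
    by (rule op_lub) (use le op_nonneg[OF S] op_nonneg[OF T] in auto)
qed

lemma B_ell2_add_closed:
  assumes S: "S \<in> bounded_ops" and T: "T \<in> bounded_ops"
  shows "(\<lambda>x\<in>ell2. (\<lambda>i. S x i + T x i)) \<in> bounded_ops"
    "cnorm B_ell2 (\<lambda>x\<in>ell2. (\<lambda>i. S x i + T x i)) \<le> cnorm B_ell2 S + cnorm B_ell2 T"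
proof -
  have le: "ell2_norm (\<lambda>i. S x i + T x i) \<le> (cnorm B_ell2 S + cnorm B_ell2 T) * ell2_norm x" if x: "x \<in> ell2" for x
    using order_trans[OF ell2_norm_triangle[OF bo_closed[OF S x] bo_closed[OF T x]] add_mono[OF op_le[OF S x] op_le[OF T x]]]
    by (simp add: algebra_simps)
  show "(\<lambda>x\<in>ell2. (\<lambda>i. S x i + T x i)) \<in> bounded_ops"
    by (rule bo_restrictI[OF _ _ _ le]) (simp_all add: bo_closed S T bo_add[OF T] bo_add[OF S] bo_scale[OF T] bo_scale[OF S] algebra_simps)
  show "cnorm B_ell2 (\<lambda>x\<in>ell2. (\<lambda>i. S x i + T x i)) \<le> cnorm B_ell2 S + cnorm B_ell2 T"
    by (rule op_lub) (use le op_nonneg[OF S] op_nonneg[OF T] in auto)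
qed

lemma B_ell2_scale_closed:
  assumes T: "T \<in> bounded_ops"
  shows "(\<lambda>x\<in>ell2. (\<lambda>i. c * T x i)) \<in> bounded_ops"
    "cnorm B_ell2 (\<lambda>x\<in>ell2. (\<lambda>i. c * T x i)) \<le> cmod c * cnorm B_ell2 T"
proof -
  have le: "ell2_norm (\<lambda>i. c * T x i) \<le> (cmod c * cnorm B_ell2 T) * ell2_norm x" if x: "x \<in> ell2" for x
    unfolding ell2_norm_scale[OF bo_closed[OF T x]] using mult_left_mono[OF op_le[OF T x], of "cmod c"]
    by (simp add: algebra_simps)
  show "(\<lambda>x\<in>ell2. (\<lambda>i. c * T x i)) \<in> bounded_ops"
    by (rule bo_restrictI[OF _ _ _ le]) (simp_all add: bo_closed T bo_add[OF T] bo_scale[OF T] algebra_simps)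
  show "cnorm B_ell2 (\<lambda>x\<in>ell2. (\<lambda>i. c * T x i)) \<le> cmod c * cnorm B_ell2 T"
    by (rule op_lub) (use le op_nonneg[OF T] in auto)
qed

lemma star_algebra_B_ell2: "star_algebra B_ell2"
proof -
  have ag: "abelian_group B_ell2"
  proof (rule abelian_groupI)
    fix S T U assume "S \<in> carrier B_ell2" "T \<in> carrier B_ell2" "U \<in> carrier B_ell2"
    then show "S \<oplus>\<^bsub>B_ell2\<^esub> T \<oplus>\<^bsub>B_ell2\<^esub> U = S \<oplus>\<^bsub>B_ell2\<^esub> (T \<oplus>\<^bsub>B_ell2\<^esub> U)"
      by (auto simp: B_ell2_ops algebra_simps)
  next
    fix S T assume "S \<in> carrier B_ell2" "T \<in> carrier B_ell2"
    then show "S \<oplus>\<^bsub>B_ell2\<^esub> T \<in> carrier B_ell2" "S \<oplus>\<^bsub>B_ell2\<^esub> T = T \<oplus>\<^bsub>B_ell2\<^esub> S"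
      by (auto simp: B_ell2_ops B_ell2_add_closed algebra_simps)
  next
    show "\<zero>\<^bsub>B_ell2\<^esub> \<in> carrier B_ell2" unfolding B_ell2_ops by (rule bo_restrictI[of _ 0]) auto
    fix T assume T: "T \<in> carrier B_ell2"
    then have T': "T \<in> bounded_ops" by (simp add: B_ell2_ops)
    show "\<zero>\<^bsub>B_ell2\<^esub> \<oplus>\<^bsub>B_ell2\<^esub> T = T"
      unfolding B_ell2_ops by (rule bo_eqI[OF B_ell2_add_closed(1) T'], rule bo_restrictI[of _ 0]) (use T' in auto)
    show "\<exists>S\<in>carrier B_ell2. S \<oplus>\<^bsub>B_ell2\<^esub> T = \<zero>\<^bsub>B_ell2\<^esub>"
      by (rule bexI[of _ "\<lambda>x\<in>ell2. (\<lambda>i. (-1) * T x i)"]) (auto simp: B_ell2_ops B_ell2_scale_closed[OF T', of "-1", simplified])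
  qed
  have rg: "ring B_ell2"
  proof (rule ringI[OF ag])
    show "Group.monoid B_ell2"
    proof (rule monoidI)
      fix T assume "T \<in> carrier B_ell2"
      then have T': "T \<in> bounded_ops" by (simp add: B_ell2_ops)
      show "\<one>\<^bsub>B_ell2\<^esub> \<otimes>\<^bsub>B_ell2\<^esub> T = T"
        unfolding B_ell2_ops by (rule bo_eqI[OF B_ell2_mult_closed(1)[OF id_bounded T'] T']) (simp add: bo_closed[OF T'])
      show "T \<otimes>\<^bsub>B_ell2\<^esub> \<one>\<^bsub>B_ell2\<^esub> = T"
        unfolding B_ell2_ops by (rule bo_eqI[OF B_ell2_mult_closed(1)[OF T' id_bounded] T']) simp
    qed (auto simp: B_ell2_ops B_ell2_mult_closed id_bounded bo_closed)
  qed (auto simp: B_ell2_ops bo_closed bo_add)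
  have md: "Module.module complex_field B_ell2"
  proof (rule moduleI[OF cring_complex_field ag])
    fix T assume "T \<in> carrier B_ell2"
    then have T': "T \<in> bounded_ops" by (simp add: B_ell2_ops)
    show "\<one>\<^bsub>complex_field\<^esub> \<odot>\<^bsub>B_ell2\<^esub> T = T"
      unfolding B_ell2_ops by (rule bo_eqI[OF B_ell2_scale_closed(1) T']) (auto simp: T')
  qed (auto simp: B_ell2_ops B_ell2_scale_closed algebra_simps)
  have adj_eqI: "adj B_ell2 T = S"
    if T: "T \<in> bounded_ops" and S: "S \<in> bounded_ops"
      and eq: "\<And>x y. x \<in> ell2 \<Longrightarrow> y \<in> ell2 \<Longrightarrow> ell2_inner (S x) y = ell2_inner x (T y)" for S T
  proof -
    have "adj_op T = S"
    proof (rule bo_eqI[OF adj_op_closed[OF T] S])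
      fix x assume x: "x \<in> ell2"
      show "adj_op T x = S x"
        by (rule ell2_eqI[OF bo_closed[OF adj_op_closed[OF T] x] bo_closed[OF S x]]) (simp add: adj_op_inner[OF T x] eq[OF x])
    qed
    then show ?thesis using adj_B_ell2[OF T] by simp
  qed
  have sym: "ell2_inner (T x) y = ell2_inner x (adj_op T y)" if T: "T \<in> bounded_ops" and x: "x \<in> ell2" and y: "y \<in> ell2" for T x y
    using adj_op_inner[OF T y x] ell2_inner_commute[OF y bo_closed[OF T x]]
      ell2_inner_commute[OF bo_closed[OF adj_op_closed[OF T] y] x] by simp
  show ?thesis
  proof (intro star_algebra.intro star_space.intro star_space_axioms.intro star_algebra_axioms.intro ag rg md)
    fix T assume "T \<in> carrier B_ell2"
    then have T: "T \<in> bounded_ops" by (simp add: B_ell2_ops)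
    note T' = adj_op_closed[OF T]
    show "adj B_ell2 T \<in> carrier B_ell2" using T' by (simp add: adj_B_ell2[OF T] B_ell2_ops)
    show "adj B_ell2 (adj B_ell2 T) = T"
      unfolding adj_B_ell2[OF T] by (rule adj_eqI[OF T' T]) (rule sym[OF T])
    show "adj B_ell2 (c \<odot>\<^bsub>B_ell2\<^esub> T) = cnj c \<odot>\<^bsub>B_ell2\<^esub> adj B_ell2 T" for c
      unfolding adj_B_ell2[OF T] B_ell2_ops
    proof (rule adj_eqI[OF B_ell2_scale_closed(1)[OF T] B_ell2_scale_closed(1)[OF T']])
      fix x y assume x: "x \<in> ell2" and y: "y \<in> ell2"
      show "ell2_inner ((\<lambda>x\<in>ell2. \<lambda>i. cnj c * adj_op T x i) x) y = ell2_inner x ((\<lambda>x\<in>ell2. \<lambda>i. c * T x i) y)"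
        using x y ell2_inner_scale_left[OF bo_closed[OF T' x] y, of "cnj c"] ell2_inner_scale_right[OF x bo_closed[OF T y], of c]
          adj_op_inner[OF T x y] by simp
    qed
    fix S assume "S \<in> carrier B_ell2"
    then have S: "S \<in> bounded_ops" by (simp add: B_ell2_ops)
    note S' = adj_op_closed[OF S]
    show "adj B_ell2 (T \<oplus>\<^bsub>B_ell2\<^esub> S) = adj B_ell2 T \<oplus>\<^bsub>B_ell2\<^esub> adj B_ell2 S"
      unfolding adj_B_ell2[OF T] adj_B_ell2[OF S] B_ell2_ops
    proof (rule adj_eqI[OF B_ell2_add_closed(1)[OF T S] B_ell2_add_closed(1)[OF T' S']])
      fix x y assume x: "x \<in> ell2" and y: "y \<in> ell2"
      show "ell2_inner ((\<lambda>x\<in>ell2. \<lambda>i. adj_op T x i + adj_op S x i) x) y = ell2_inner x ((\<lambda>x\<in>ell2. \<lambda>i. T x i + S x i) y)"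
        using x y ell2_inner_add_left[OF bo_closed[OF T' x] bo_closed[OF S' x] y] ell2_inner_add_right[OF x bo_closed[OF T y] bo_closed[OF S y]]
          adj_op_inner[OF T x y] adj_op_inner[OF S x y] by simp
    qed
    show "adj B_ell2 (T \<otimes>\<^bsub>B_ell2\<^esub> S) = adj B_ell2 S \<otimes>\<^bsub>B_ell2\<^esub> adj B_ell2 T"
      unfolding adj_B_ell2[OF T] adj_B_ell2[OF S] B_ell2_ops
    proof (rule adj_eqI[OF B_ell2_mult_closed(1)[OF T S] B_ell2_mult_closed(1)[OF S' T']])
      fix x y assume x: "x \<in> ell2" and y: "y \<in> ell2"
      show "ell2_inner ((\<lambda>x\<in>ell2. adj_op S (adj_op T x)) x) y = ell2_inner x ((\<lambda>x\<in>ell2. T (S x)) y)"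
        using x y adj_op_inner[OF S bo_closed[OF T' x] y] adj_op_inner[OF T x bo_closed[OF S y]] by simp
    qed
    show "(c \<odot>\<^bsub>B_ell2\<^esub> T) \<otimes>\<^bsub>B_ell2\<^esub> S = c \<odot>\<^bsub>B_ell2\<^esub> (T \<otimes>\<^bsub>B_ell2\<^esub> S)" for c
      using T S by (auto simp: B_ell2_ops bo_closed)
    show "T \<otimes>\<^bsub>B_ell2\<^esub> (c \<odot>\<^bsub>B_ell2\<^esub> S) = c \<odot>\<^bsub>B_ell2\<^esub> (T \<otimes>\<^bsub>B_ell2\<^esub> S)" for c
      using T S by (auto simp: B_ell2_ops bo_closed bo_scale)
  qed
qed

lemma cstar_algebra_B_ell2: "cstar_algebra B_ell2"
proof -
  interpret B: star_algebra B_ell2 by (rule star_algebra_B_ell2)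
  have dif: "(S \<ominus>\<^bsub>B_ell2\<^esub> T) x = (\<lambda>i. S x i - T x i)" if "S \<in> bounded_ops" "T \<in> bounded_ops" "x \<in> ell2" for S T x
    using that by (simp add: B.diff_conv_smult[unfolded B_ell2_ops(1)] B_ell2_ops(5,6))
  have difc: "S \<ominus>\<^bsub>B_ell2\<^esub> T \<in> bounded_ops" if "S \<in> bounded_ops" "T \<in> bounded_ops" for S T
    using that B.minus_closed[of S T] by (simp add: B_ell2_ops(1))
  have "cstar_algebra_axioms B_ell2"
  proof
    fix T assume "T \<in> carrier B_ell2"
    then have T: "T \<in> bounded_ops" by (simp add: B_ell2_ops)
    show "0 \<le> cnorm B_ell2 T" by (rule op_nonneg[OF T])
    show "cnorm B_ell2 T = 0 \<longleftrightarrow> T = \<zero>\<^bsub>B_ell2\<^esub>"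
    proof
      assume 0: "cnorm B_ell2 T = 0"
      show "T = \<zero>\<^bsub>B_ell2\<^esub>"
      proof (rule bo_eqI[OF T])
        show "\<zero>\<^bsub>B_ell2\<^esub> \<in> bounded_ops" using B.zero_closed by (simp add: B_ell2_ops(1))
        fix x assume x: "x \<in> ell2"
        have "ell2_norm (T x) = 0" using op_le[OF T x] 0 ell2_norm_nonneg[OF bo_closed[OF T x]] by simp
        then show "T x = \<zero>\<^bsub>B_ell2\<^esub> x" using ell2_norm_eq_0_iff[OF bo_closed[OF T x]] x by (simp add: B_ell2_ops)
      qed
    next
      assume "T = \<zero>\<^bsub>B_ell2\<^esub>"
      then have "cnorm B_ell2 T \<le> 0" by (intro op_lub) (simp_all add: B_ell2_ops)
      then show "cnorm B_ell2 T = 0" using op_nonneg[OF T] by simp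
    qed
    show "cnorm B_ell2 (c \<odot>\<^bsub>B_ell2\<^esub> T) = cmod c * cnorm B_ell2 T" for c
    proof (cases "c = 0")
      case True
      have "cnorm B_ell2 (c \<odot>\<^bsub>B_ell2\<^esub> T) \<le> 0"
        using B_ell2_scale_closed(2)[OF T, of c] True by (simp add: B_ell2_ops)
      moreover have "cnorm B_ell2 (c \<odot>\<^bsub>B_ell2\<^esub> T) \<ge> 0"
        unfolding B_ell2_ops by (rule op_nonneg[OF B_ell2_scale_closed(1)[OF T]])
      ultimately show ?thesis using True by simp
    next
      case False
      let ?S = "c \<odot>\<^bsub>B_ell2\<^esub> T"
      have S: "?S \<in> bounded_ops" unfolding B_ell2_ops by (rule B_ell2_scale_closed(1)[OF T])
      have "(1 / c) \<odot>\<^bsub>B_ell2\<^esub> ?S = T" using False T by (simp add: B.smult_smult B_ell2_ops(1))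
      then have "cnorm B_ell2 T \<le> cmod (1 / c) * cnorm B_ell2 ?S"
        using B_ell2_scale_closed(2)[OF S, of "1 / c"] by (simp add: B_ell2_ops(6))
      then have "cmod c * cnorm B_ell2 T \<le> cnorm B_ell2 ?S" using False by (simp add: norm_divide field_simps)
      moreover have "cnorm B_ell2 ?S \<le> cmod c * cnorm B_ell2 T"
        using B_ell2_scale_closed(2)[OF T, of c] by (simp add: B_ell2_ops(6))
      ultimately show ?thesis by simp
    qed
    show "cnorm B_ell2 (adj B_ell2 T \<otimes>\<^bsub>B_ell2\<^esub> T) = (cnorm B_ell2 T)\<^sup>2"
    proof (rule antisym)
      note T' = adj_op_closed[OF T]
      have TT: "adj B_ell2 T \<otimes>\<^bsub>B_ell2\<^esub> T = (\<lambda>x\<in>ell2. adj_op T (T x))" by (simp add: B_ell2_ops adj_B_ell2[OF T])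
      note TTb = B_ell2_mult_closed[OF T' T]
      have "cnorm B_ell2 (adj_op T) \<le> cnorm B_ell2 T"
        by (rule op_lub[OF adj_op_bound(2)[OF T] op_nonneg[OF T]])
      then have "cnorm B_ell2 (adj_op T) * cnorm B_ell2 T \<le> cnorm B_ell2 T * cnorm B_ell2 T"
        using op_nonneg[OF T] by (rule mult_right_mono)
      with TTb(2) show "cnorm B_ell2 (adj B_ell2 T \<otimes>\<^bsub>B_ell2\<^esub> T) \<le> (cnorm B_ell2 T)\<^sup>2"
        unfolding TT power2_eq_square by linarith
      let ?c = "cnorm B_ell2 (\<lambda>x\<in>ell2. adj_op T (T x))"
      have c0: "?c \<ge> 0" by (rule op_nonneg[OF TTb(1)])
      have "cnorm B_ell2 T \<le> sqrt ?c"
      proof (rule op_lub)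
        fix x assume x: "x \<in> ell2"
        note Tx = bo_closed[OF T x] and TTx = bo_closed[OF T' bo_closed[OF T x]]
        have "complex_of_real ((ell2_norm (T x))\<^sup>2) = ell2_inner (adj_op T (T x)) x"
          unfolding adj_op_inner[OF T Tx x] ell2_inner_self[OF Tx] ..
        then have "cmod (complex_of_real ((ell2_norm (T x))\<^sup>2)) = cmod (ell2_inner (adj_op T (T x)) x)" by (simp only:)
        then have "(ell2_norm (T x))\<^sup>2 = cmod (ell2_inner (adj_op T (T x)) x)" by (simp only: norm_of_real abs_power2)
        also have "\<dots> \<le> ell2_norm (adj_op T (T x)) * ell2_norm x" by (rule ell2_cauchy_schwarz[OF TTx x])
        also have "\<dots> \<le> (?c * ell2_norm x) * ell2_norm x"
          using op_le[OF TTb(1) x] x by (intro mult_right_mono) auto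
        also have "\<dots> = (sqrt ?c * ell2_norm x)\<^sup>2" using c0 by (simp add: power_mult_distrib power2_eq_square)
        finally show "ell2_norm (T x) \<le> sqrt ?c * ell2_norm x"
          by (rule power2_le_imp_le) (use c0 x in auto)
      qed (use c0 in simp)
      then have "(cnorm B_ell2 T)\<^sup>2 \<le> (sqrt ?c)\<^sup>2" using op_nonneg[OF T] by (rule power_mono)
      then show "(cnorm B_ell2 T)\<^sup>2 \<le> cnorm B_ell2 (adj B_ell2 T \<otimes>\<^bsub>B_ell2\<^esub> T)" unfolding TT using c0 by simp
    qed
    fix S assume "S \<in> carrier B_ell2"
    then have S: "S \<in> bounded_ops" by (simp add: B_ell2_ops)
    show "cnorm B_ell2 (T \<oplus>\<^bsub>B_ell2\<^esub> S) \<le> cnorm B_ell2 T + cnorm B_ell2 S"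
      unfolding B_ell2_ops by (rule B_ell2_add_closed(2)[OF T S])
    show "cnorm B_ell2 (T \<otimes>\<^bsub>B_ell2\<^esub> S) \<le> cnorm B_ell2 T * cnorm B_ell2 S"
      unfolding B_ell2_ops by (rule B_ell2_mult_closed(2)[OF T S])
  next
    fix f :: "nat \<Rightarrow> ell2_op" assume "\<forall>i. f i \<in> carrier B_ell2"
      and cau: "\<forall>e>0. \<exists>N. \<forall>i\<ge>N. \<forall>j\<ge>N. cnorm B_ell2 (f i \<ominus>\<^bsub>B_ell2\<^esub> f j) < e"
    then have f: "\<And>i. f i \<in> bounded_ops" by (simp add: B_ell2_ops)
    have fd: "ell2_norm (\<lambda>k. f i x k - f j x k) \<le> cnorm B_ell2 (f i \<ominus>\<^bsub>B_ell2\<^esub> f j) * ell2_norm x" if x: "x \<in> ell2" for x i j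
      using op_le[OF difc[OF f f] x, of i j] unfolding dif[OF f f x] .
    have "\<exists>y\<in>ell2. (\<lambda>i. ell2_norm (\<lambda>k. f i x k - y k)) \<longlonglongrightarrow> 0" if x: "x \<in> ell2" for x
    proof (rule ell2_complete[OF bo_closed[OF f x]])
      fix e :: real assume e: "e > 0"
      define e' where "e' = e / (ell2_norm x + 1)"
      have e'0: "e' > 0" unfolding e'_def using e ell2_norm_nonneg[OF x] by (intro divide_pos_pos) auto
      have "e' * (ell2_norm x + 1) = e" unfolding e'_def using ell2_norm_nonneg[OF x] by (simp del: ell2_norm_nonneg)
      then have e': "e' > 0" "e' * ell2_norm x < e" using e'0 by (simp_all add: distrib_left)
      obtain N where N: "\<And>i j. i \<ge> N \<Longrightarrow> j \<ge> N \<Longrightarrow> cnorm B_ell2 (f i \<ominus>\<^bsub>B_ell2\<^esub> f j) < e'" using cau e'(1) by blast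
      have "ell2_norm (\<lambda>k. f i x k - f j x k) < e" if ij: "i \<ge> N" "j \<ge> N" for i j
        using fd[OF x, of i j] mult_right_mono[OF less_imp_le[OF N[OF ij]] ell2_norm_nonneg[OF x]] e'(2) by linarith
      then show "\<exists>N. \<forall>i\<ge>N. \<forall>j\<ge>N. ell2_norm (\<lambda>k. f i x k - f j x k) < e" by blast
    qed
    then obtain F where F: "\<And>x. x \<in> ell2 \<Longrightarrow> F x \<in> ell2" "\<And>x. x \<in> ell2 \<Longrightarrow> (\<lambda>i. ell2_norm (\<lambda>k. f i x k - F x k)) \<longlonglongrightarrow> 0"
      by metis
    have Fk: "(\<lambda>i. f i x k) \<longlonglongrightarrow> F x k" if x: "x \<in> ell2" for x k
    proof -
      have "(\<lambda>i. norm (f i x k - F x k)) \<longlonglongrightarrow> 0"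
        by (rule tendsto_sandwich[OF _ _ tendsto_const F(2)[OF x]])
          (use ell2_coord_le[OF ell2_diff[OF bo_closed[OF f x] F(1)[OF x]]] in auto)
      then have "(\<lambda>i. f i x k - F x k) \<longlonglongrightarrow> 0" by (rule tendsto_norm_zero_cancel)
      then show ?thesis by (rule LIM_zero_cancel)
    qed
    have unif: "\<exists>N. \<forall>i\<ge>N. \<forall>x\<in>ell2. ell2_norm (\<lambda>k. f i x k - F x k) \<le> e * ell2_norm x" if e: "e > 0" for e
    proof -
      obtain N where N: "\<And>i j. i \<ge> N \<Longrightarrow> j \<ge> N \<Longrightarrow> cnorm B_ell2 (f i \<ominus>\<^bsub>B_ell2\<^esub> f j) < e" using cau e by blast
      have "ell2_norm (\<lambda>k. f i x k - F x k) \<le> e * ell2_norm x" if i: "i \<ge> N" and x: "x \<in> ell2" for i x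
      proof (rule LIMSEQ_le_const)
        show "(\<lambda>j. e * ell2_norm x + ell2_norm (\<lambda>k. f j x k - F x k)) \<longlonglongrightarrow> e * ell2_norm x"
          using tendsto_add[OF tendsto_const F(2)[OF x]] by simp
        have "ell2_norm (\<lambda>k. f i x k - F x k) \<le> e * ell2_norm x + ell2_norm (\<lambda>k. f j x k - F x k)" if j: "j \<ge> N" for j
          using ell2_diff_triangle[OF bo_closed[OF f x] bo_closed[OF f x] F(1)[OF x], of i j] fd[OF x, of i j]
            mult_right_mono[OF less_imp_le[OF N[OF i j]] ell2_norm_nonneg[OF x]] by linarith
        then show "\<exists>N. \<forall>j\<ge>N. ell2_norm (\<lambda>k. f i x k - F x k) \<le> e * ell2_norm x + ell2_norm (\<lambda>k. f j x k - F x k)" by blast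
      qed
      then show ?thesis by blast
    qed
    define T where "T = (\<lambda>x\<in>ell2. F x)"
    obtain N where N: "\<And>x. x \<in> ell2 \<Longrightarrow> ell2_norm (\<lambda>k. f N x k - F x k) \<le> 1 * ell2_norm x" using unif[of 1] by auto
    have T: "T \<in> bounded_ops" unfolding T_def
    proof (rule bo_restrictI)
      fix x y assume x: "x \<in> ell2" and y: "y \<in> ell2"
      show "F (\<lambda>i. x i + y i) = (\<lambda>i. F x i + F y i)"
      proof
        fix k
        have "(\<lambda>i. f i (\<lambda>i. x i + y i) k) \<longlonglongrightarrow> F x k + F y k"
          unfolding bo_add[OF f x y] by (intro tendsto_add Fk x y)
        then show "F (\<lambda>i. x i + y i) k = F x k + F y k" using Fk[OF ell2_add[OF x y]] LIMSEQ_unique by blast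
      qed
    next
      fix x c assume x: "x \<in> ell2"
      show "F x \<in> ell2" by (rule F(1)[OF x])
      show "F (\<lambda>i. c * x i) = (\<lambda>i. c * F x i)"
      proof
        fix k
        have "(\<lambda>i. f i (\<lambda>i. c * x i) k) \<longlonglongrightarrow> c * F x k"
          unfolding bo_scale[OF f x] by (intro tendsto_mult tendsto_const Fk x)
        then show "F (\<lambda>i. c * x i) k = c * F x k" using Fk[OF ell2_scale[OF x]] LIMSEQ_unique by blast
      qed
      have "ell2_norm (F x) \<le> ell2_norm (\<lambda>k. F x k - f N x k) + ell2_norm (\<lambda>k. f N x k - 0)"
        using ell2_diff_triangle[OF F(1)[OF x] bo_closed[OF f x] ell2_zero, of N] by simp
      then show "ell2_norm (F x) \<le> (1 + cnorm B_ell2 (f N)) * ell2_norm x"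
        using N[OF x] op_le[OF f x, of N] ell2_norm_minus[of "F x"] by (simp add: algebra_simps)
    qed
    have "(\<lambda>i. cnorm B_ell2 (f i \<ominus>\<^bsub>B_ell2\<^esub> T)) \<longlonglongrightarrow> 0"
    proof (rule LIMSEQ_I)
      fix r :: real assume r: "0 < r"
      obtain N where N: "\<And>i x. i \<ge> N \<Longrightarrow> x \<in> ell2 \<Longrightarrow> ell2_norm (\<lambda>k. f i x k - F x k) \<le> (r/2) * ell2_norm x"
        using unif[of "r/2"] r by auto
      have "norm (cnorm B_ell2 (f i \<ominus>\<^bsub>B_ell2\<^esub> T) - 0) < r" if i: "i \<ge> N" for i
      proof -
        have "cnorm B_ell2 (f i \<ominus>\<^bsub>B_ell2\<^esub> T) \<le> r / 2"
        proof (rule op_lub)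
          fix x assume x: "x \<in> ell2"
          show "ell2_norm ((f i \<ominus>\<^bsub>B_ell2\<^esub> T) x) \<le> r / 2 * ell2_norm x"
            unfolding dif[OF f T x] using N[OF i x] x by (simp add: T_def)
        qed (use r in simp)
        then show ?thesis using r op_nonneg[OF difc[OF f T], of i] by simp
      qed
      then show "\<exists>N. \<forall>i\<ge>N. norm (cnorm B_ell2 (f i \<ominus>\<^bsub>B_ell2\<^esub> T) - 0) < r" by blast
    qed
    then show "\<exists>x\<in>carrier B_ell2. (\<lambda>i. cnorm B_ell2 (f i \<ominus>\<^bsub>B_ell2\<^esub> x)) \<longlonglongrightarrow> 0"
      using T by (intro bexI[of _ T]) (auto simp: B_ell2_ops(1))
  qed
  then show ?thesis by (intro cstar_algebra.intro B.star_algebra_axioms)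
qed

section \<open>Subalgebras and von Neumann algebras\<close>

lemma cstar_subalgebra:
  fixes B :: "'b cstar"
  assumes B: "cstar_algebra B" and M: "M \<subseteq> carrier B" "\<one>\<^bsub>B\<^esub> \<in> M"
    "\<And>x y. x \<in> M \<Longrightarrow> y \<in> M \<Longrightarrow> x \<oplus>\<^bsub>B\<^esub> y \<in> M" "\<And>x y. x \<in> M \<Longrightarrow> y \<in> M \<Longrightarrow> x \<otimes>\<^bsub>B\<^esub> y \<in> M"
    "\<And>c x. x \<in> M \<Longrightarrow> c \<odot>\<^bsub>B\<^esub> x \<in> M" "\<And>x. x \<in> M \<Longrightarrow> adj B x \<in> M"
    and cl: "\<And>f x. (\<And>i::nat. f i \<in> M) \<Longrightarrow> x \<in> carrier B \<Longrightarrow> (\<lambda>i. cnorm B (f i \<ominus>\<^bsub>B\<^esub> x)) \<longlonglongrightarrow> 0 \<Longrightarrow> x \<in> M"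
  shows "cstar_algebra (B\<lparr>carrier := M\<rparr>)"
proof -
  interpret B: cstar_algebra B by fact
  let ?M = "B\<lparr>carrier := M\<rparr>"
  have c [simp]: "x \<in> carrier B" if "x \<in> M" for x using that M(1) by blast
  have z: "\<zero>\<^bsub>B\<^esub> \<in> M" using M(5)[OF M(2), of 0] by simp
  have ag: "abelian_group ?M"
  proof (rule abelian_groupI)
    fix x assume "x \<in> carrier ?M"
    then show "\<exists>y\<in>carrier ?M. y \<oplus>\<^bsub>?M\<^esub> x = \<zero>\<^bsub>?M\<^esub>"
      using M(5)[of x "-1"] by (intro bexI[of _ "(-1) \<odot>\<^bsub>B\<^esub> x"]) (auto simp: B.a_comm[of "(-1) \<odot>\<^bsub>B\<^esub> x"] B.smult_minus_one_cancel)
  qed (use M z in \<open>auto simp: B.a_ac\<close>)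
  have rg: "ring ?M"
  proof (rule ringI[OF ag])
    show "Group.monoid ?M" by (rule monoidI) (use M in \<open>auto simp: B.m_assoc\<close>)
  qed (auto simp: B.l_distr B.r_distr)
  have md: "Module.module complex_field ?M"
    by (rule moduleI[OF cring_complex_field ag]) (use M in \<open>auto simp: B.smult_add_left B.smult_add_right B.smult_smult\<close>)
  interpret M: star_algebra ?M
    by (intro star_algebra.intro star_space.intro star_space_axioms.intro star_algebra_axioms.intro ag rg md)
      (use M in \<open>auto simp: B.adj_add B.adj_smult B.adj_mult B.smult_mult_left B.smult_mult_right\<close>)
  have dif: "x \<ominus>\<^bsub>?M\<^esub> y = x \<ominus>\<^bsub>B\<^esub> y" if "x \<in> M" "y \<in> M" for x y
    using that M.diff_conv_smult[of x y] by (simp add: B.diff_conv_smult)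
  have "cstar_algebra_axioms ?M"
  proof
    fix f :: "nat \<Rightarrow> 'b" assume f: "\<forall>i. f i \<in> carrier ?M"
      and cau: "\<forall>e>0. \<exists>N. \<forall>i\<ge>N. \<forall>j\<ge>N. cnorm ?M (f i \<ominus>\<^bsub>?M\<^esub> f j) < e"
    have fM: "f i \<in> M" for i using f by simp
    have "\<forall>e>0. \<exists>N. \<forall>i\<ge>N. \<forall>j\<ge>N. cnorm B (f i \<ominus>\<^bsub>B\<^esub> f j) < e" using cau by (simp add: dif fM)
    then obtain x where x: "x \<in> carrier B" "(\<lambda>i. cnorm B (f i \<ominus>\<^bsub>B\<^esub> x)) \<longlonglongrightarrow> 0"
      using B.complete[of f] c[OF fM] by blast
    have xM: "x \<in> M" by (rule cl[OF fM x])
    then show "\<exists>x\<in>carrier ?M. (\<lambda>i. cnorm ?M (f i \<ominus>\<^bsub>?M\<^esub> x)) \<longlonglongrightarrow> 0"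
      using x(2) by (intro bexI[of _ x]) (simp_all add: dif fM)
  qed (auto simp: B.cnorm_nonneg B.cnorm_eq_0_iff B.cnorm_triangle B.cnorm_smult B.cnorm_mult B.cnorm_cstar)
  then show ?thesis by (intro cstar_algebra.intro M.star_algebra_axioms)
qed

lemma commutant_closure:
  assumes X: "X \<subseteq> bounded_ops"
  shows "\<one>\<^bsub>B_ell2\<^esub> \<in> commutant X"
    "S \<in> commutant X \<Longrightarrow> T \<in> commutant X \<Longrightarrow> S \<oplus>\<^bsub>B_ell2\<^esub> T \<in> commutant X"
    "S \<in> commutant X \<Longrightarrow> T \<in> commutant X \<Longrightarrow> S \<otimes>\<^bsub>B_ell2\<^esub> T \<in> commutant X"
    "S \<in> commutant X \<Longrightarrow> c \<odot>\<^bsub>B_ell2\<^esub> S \<in> commutant X"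
    "(\<And>i::nat. f i \<in> commutant X) \<Longrightarrow> T \<in> bounded_ops \<Longrightarrow> (\<lambda>i. cnorm B_ell2 (f i \<ominus>\<^bsub>B_ell2\<^esub> T)) \<longlonglongrightarrow> 0 \<Longrightarrow> T \<in> commutant X"
proof -
  interpret B: cstar_algebra B_ell2 by (rule cstar_algebra_B_ell2)
  have Xc: "x \<in> carrier B_ell2" if "x \<in> X" for x using that X by (auto simp: B_ell2_ops(1))
  have com: "commutant X = {T \<in> carrier B_ell2. \<forall>S\<in>X. T \<otimes>\<^bsub>B_ell2\<^esub> S = S \<otimes>\<^bsub>B_ell2\<^esub> T}"
    by (simp add: commutant_def B_ell2_ops(1))
  show "\<one>\<^bsub>B_ell2\<^esub> \<in> commutant X" by (simp add: com Xc)
  show "S \<oplus>\<^bsub>B_ell2\<^esub> T \<in> commutant X" if "S \<in> commutant X" "T \<in> commutant X"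
    using that by (simp add: com Xc B.l_distr B.r_distr)
  show "c \<odot>\<^bsub>B_ell2\<^esub> S \<in> commutant X" if "S \<in> commutant X"
    using that by (simp add: com Xc B.smult_mult_left B.smult_mult_right)
  show "S \<otimes>\<^bsub>B_ell2\<^esub> T \<in> commutant X" if ST: "S \<in> commutant X" "T \<in> commutant X"
  proof -
    have "S \<otimes>\<^bsub>B_ell2\<^esub> T \<otimes>\<^bsub>B_ell2\<^esub> U = U \<otimes>\<^bsub>B_ell2\<^esub> (S \<otimes>\<^bsub>B_ell2\<^esub> T)" if U: "U \<in> X" for U
    proof -
      have c: "S \<in> carrier B_ell2" "T \<in> carrier B_ell2" "U \<in> carrier B_ell2" using ST U Xc by (auto simp: com)
      have "S \<otimes>\<^bsub>B_ell2\<^esub> T \<otimes>\<^bsub>B_ell2\<^esub> U = S \<otimes>\<^bsub>B_ell2\<^esub> (U \<otimes>\<^bsub>B_ell2\<^esub> T)" using ST U c by (simp add: com B.m_assoc)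
      also have "\<dots> = (S \<otimes>\<^bsub>B_ell2\<^esub> U) \<otimes>\<^bsub>B_ell2\<^esub> T" using c by (simp add: B.m_assoc)
      also have "\<dots> = (U \<otimes>\<^bsub>B_ell2\<^esub> S) \<otimes>\<^bsub>B_ell2\<^esub> T" using ST U by (simp add: com)
      finally show ?thesis using c by (simp add: B.m_assoc)
    qed
    then show ?thesis using ST by (simp add: com)
  qed
  show "T \<in> commutant X" if f: "\<And>i::nat. f i \<in> commutant X" and Tb: "T \<in> bounded_ops"
    and lim: "(\<lambda>i. cnorm B_ell2 (f i \<ominus>\<^bsub>B_ell2\<^esub> T)) \<longlonglongrightarrow> 0"
  proof -
    have T [simp]: "T \<in> carrier B_ell2" using Tb by (simp add: B_ell2_ops(1))
    have fc [simp]: "f i \<in> carrier B_ell2" for i using f[of i] by (simp add: com)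
    have "T \<otimes>\<^bsub>B_ell2\<^esub> U = U \<otimes>\<^bsub>B_ell2\<^esub> T" if U: "U \<in> X" for U
    proof -
      note [simp] = Xc[OF U]
      let ?d = "T \<otimes>\<^bsub>B_ell2\<^esub> U \<ominus>\<^bsub>B_ell2\<^esub> U \<otimes>\<^bsub>B_ell2\<^esub> T"
      have "cnorm B_ell2 ?d \<le> 2 * cnorm B_ell2 U * cnorm B_ell2 (f i \<ominus>\<^bsub>B_ell2\<^esub> T)" for i
      proof -
        have "f i \<otimes>\<^bsub>B_ell2\<^esub> U = U \<otimes>\<^bsub>B_ell2\<^esub> f i" using f[of i] U by (simp add: com)
        then have "?d = U \<otimes>\<^bsub>B_ell2\<^esub> (f i \<ominus>\<^bsub>B_ell2\<^esub> T) \<oplus>\<^bsub>B_ell2\<^esub> (T \<ominus>\<^bsub>B_ell2\<^esub> f i) \<otimes>\<^bsub>B_ell2\<^esub> U"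
          by (simp add: B.group_ring_simps)
        then have "cnorm B_ell2 ?d \<le> cnorm B_ell2 (U \<otimes>\<^bsub>B_ell2\<^esub> (f i \<ominus>\<^bsub>B_ell2\<^esub> T)) + cnorm B_ell2 ((T \<ominus>\<^bsub>B_ell2\<^esub> f i) \<otimes>\<^bsub>B_ell2\<^esub> U)"
          using B.cnorm_triangle[of "U \<otimes>\<^bsub>B_ell2\<^esub> (f i \<ominus>\<^bsub>B_ell2\<^esub> T)" "(T \<ominus>\<^bsub>B_ell2\<^esub> f i) \<otimes>\<^bsub>B_ell2\<^esub> U"] by simp
        also have "\<dots> \<le> cnorm B_ell2 U * cnorm B_ell2 (f i \<ominus>\<^bsub>B_ell2\<^esub> T) + cnorm B_ell2 (T \<ominus>\<^bsub>B_ell2\<^esub> f i) * cnorm B_ell2 U"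
          by (intro add_mono B.cnorm_mult) auto
        finally show ?thesis by (simp add: B.cnorm_minus[of T "f i"])
      qed
      moreover have "(\<lambda>i. 2 * cnorm B_ell2 U * cnorm B_ell2 (f i \<ominus>\<^bsub>B_ell2\<^esub> T)) \<longlonglongrightarrow> 2 * cnorm B_ell2 U * 0"
        by (intro tendsto_mult tendsto_const lim)
      ultimately have "cnorm B_ell2 ?d \<le> 2 * cnorm B_ell2 U * 0" by (intro LIMSEQ_le_const) auto
      then have "?d = \<zero>\<^bsub>B_ell2\<^esub>" using B.cnorm_nonneg[of ?d] B.cnorm_eq_0_iff[of ?d] by simp
      then show ?thesis by simp
    qed
    then show ?thesis by (simp add: com)
  qed
qed

lemma cstar_algebra_vn_alg:
  assumes "von_neumann_algebra M" shows "cstar_algebra (vn_alg M)"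
proof -
  have M: "M \<subseteq> bounded_ops" "\<And>T. T \<in> M \<Longrightarrow> adj B_ell2 T \<in> M" "M = commutant (commutant M)"
    using assms unfolding von_neumann_algebra_def by auto
  have cb: "commutant M \<subseteq> bounded_ops" by (auto simp: commutant_def)
  note cc = commutant_closure[OF cb, folded M(3)]
  show ?thesis unfolding vn_alg_def
  proof (rule cstar_subalgebra[OF cstar_algebra_B_ell2 _ cc(1-4) M(2)])
    show "M \<subseteq> carrier B_ell2" using M(1) by (simp add: B_ell2_ops(1))
    show "T \<in> M" if "\<And>i::nat. f i \<in> M" "T \<in> carrier B_ell2" "(\<lambda>i. cnorm B_ell2 (f i \<ominus>\<^bsub>B_ell2\<^esub> T)) \<longlonglongrightarrow> 0" for f T
      by (rule cc(5)[OF that(1) _ that(3)]) (use that(2) in \<open>simp add: B_ell2_ops(1)\<close>)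
  qed
qed

section \<open>Orthogonal projections\<close>

lemma ell2_parallelogram:
  assumes "x \<in> ell2" "y \<in> ell2"
  shows "(ell2_norm (\<lambda>i. x i + y i))\<^sup>2 + (ell2_norm (\<lambda>i. x i - y i))\<^sup>2 = 2 * (ell2_norm x)\<^sup>2 + 2 * (ell2_norm y)\<^sup>2"
  using ell2_norm_add_scale_sq[OF assms, of 1] ell2_norm_add_scale_sq[OF assms, of "-1"] by simp

definition ell2_closed_subspace :: "(nat \<Rightarrow> complex) set \<Rightarrow> bool" where
  "ell2_closed_subspace K \<longleftrightarrow> K \<subseteq> ell2 \<and> (\<lambda>i. 0) \<in> K \<and> (\<forall>x\<in>K. \<forall>y\<in>K. (\<lambda>i. x i + y i) \<in> K) \<and>
     (\<forall>c. \<forall>x\<in>K. (\<lambda>i. c * x i) \<in> K) \<and>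
     (\<forall>f. \<forall>x\<in>ell2. (\<forall>n::nat. f n \<in> K) \<longrightarrow> (\<lambda>n. ell2_norm (\<lambda>i. f n i - x i)) \<longlonglongrightarrow> 0 \<longrightarrow> x \<in> K)"

text \<open>
  A minimising sequence is Cauchy by the parallelogram law, as the midpoints of its members lie in \<open>K\<close>.
\<close>

lemma ell2_nearest_point:
  assumes K: "ell2_closed_subspace K" and x: "x \<in> ell2"
  shows "\<exists>p\<in>K. \<forall>k\<in>K. ell2_norm (\<lambda>i. x i - p i) \<le> ell2_norm (\<lambda>i. x i - k i)"
proof -
  have Ke: "k \<in> ell2" if "k \<in> K" for k using K that unfolding ell2_closed_subspace_def by blast
  have K0: "(\<lambda>i. 0) \<in> K" and Kadd: "\<And>u v. u \<in> K \<Longrightarrow> v \<in> K \<Longrightarrow> (\<lambda>i. u i + v i) \<in> K"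
    and Ksc: "\<And>c u. u \<in> K \<Longrightarrow> (\<lambda>i. c * u i) \<in> K"
    and Kcl: "\<And>f u. u \<in> ell2 \<Longrightarrow> (\<And>n::nat. f n \<in> K) \<Longrightarrow> (\<lambda>n. ell2_norm (\<lambda>i. f n i - u i)) \<longlonglongrightarrow> 0 \<Longrightarrow> u \<in> K"
    using K unfolding ell2_closed_subspace_def by blast+
  define D where "D = (\<lambda>k. (ell2_norm (\<lambda>i. x i - k i))\<^sup>2) ` K"
  define d where "d = Inf D"
  have Dne: "D \<noteq> {}" using K0 unfolding D_def by blast
  have Dbb: "bdd_below D" unfolding D_def by (intro bdd_belowI2[of _ 0]) auto
  have dle: "d \<le> (ell2_norm (\<lambda>i. x i - k i))\<^sup>2" if "k \<in> K" for k
    unfolding d_def using Dbb that by (intro cInf_lower) (auto simp: D_def)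
  have "\<exists>k\<in>K. (ell2_norm (\<lambda>i. x i - k i))\<^sup>2 < d + 1 / (real n + 1)" for n
    using cInf_lessD[OF Dne, of "d + 1 / (real n + 1)"] unfolding d_def[symmetric] by (auto simp: D_def)
  then obtain f where f: "\<And>n. f n \<in> K" "\<And>n. (ell2_norm (\<lambda>i. x i - f n i))\<^sup>2 < d + 1 / (real n + 1)" by metis
  have fm: "(ell2_norm (\<lambda>i. f m i - f n i))\<^sup>2 \<le> 2 * (1 / (real n + 1)) + 2 * (1 / (real m + 1))" for m n
  proof -
    let ?a = "\<lambda>i. x i - f n i" and ?b = "\<lambda>i. x i - f m i"
    have a: "?a \<in> ell2" "?b \<in> ell2" using x Ke[OF f(1)] by auto
    have mid: "(\<lambda>i. (1/2) * (f n i + f m i)) \<in> K" by (rule Ksc[OF Kadd[OF f(1) f(1)]])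
    have "?a i + ?b i = 2 * (x i - (1/2) * (f n i + f m i))" for i by (simp add: algebra_simps)
    then have "ell2_norm (\<lambda>i. ?a i + ?b i) = 2 * ell2_norm (\<lambda>i. x i - (1/2) * (f n i + f m i))"
      using ell2_norm_scale[OF ell2_diff[OF x Ke[OF mid]], of 2] by (simp only:) simp
    then have "(ell2_norm (\<lambda>i. ?a i + ?b i))\<^sup>2 \<ge> 4 * d" using dle[OF mid] by (simp only: power_mult_distrib) simp
    moreover have "?a i - ?b i = f m i - f n i" for i by simp
    ultimately show ?thesis using ell2_parallelogram[OF a] f(2)[of n] f(2)[of m] by (simp only:)
  qed
  have "\<exists>p\<in>ell2. (\<lambda>n. ell2_norm (\<lambda>i. f n i - p i)) \<longlonglongrightarrow> 0"
  proof (rule ell2_complete[OF Ke[OF f(1)]])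
    fix e :: real assume e: "e > 0"
    obtain N where N: "1 / (real N + 1) < e\<^sup>2 / 4"
      using reals_Archimedean[of "e\<^sup>2 / 4"] e by (auto simp: inverse_eq_divide add.commute)
    have "ell2_norm (\<lambda>k. f i k - f j k) < e" if ij: "i \<ge> N" "j \<ge> N" for i j
    proof -
      have "1 / (real i + 1) \<le> 1 / (real N + 1)" "1 / (real j + 1) \<le> 1 / (real N + 1)"
        using ij by (auto intro!: divide_left_mono)
      then have "(ell2_norm (\<lambda>k. f i k - f j k))\<^sup>2 < e\<^sup>2" using fm[of i j] N by linarith
      then show ?thesis using e by (rule power_less_imp_less_base[OF _ less_imp_le])
    qed
    then show "\<exists>N. \<forall>i\<ge>N. \<forall>j\<ge>N. ell2_norm (\<lambda>k. f i k - f j k) < e" by blast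
  qed
  then obtain p where p: "p \<in> ell2" "(\<lambda>n. ell2_norm (\<lambda>i. f n i - p i)) \<longlonglongrightarrow> 0" by blast
  have pK: "p \<in> K" by (rule Kcl[OF p(1) f(1) p(2)])
  have "ell2_norm (\<lambda>i. x i - p i) \<le> ell2_norm (\<lambda>i. x i - k i)" if k: "k \<in> K" for k
  proof (rule LIMSEQ_le_const)
    have "(\<lambda>n. 1 / (real n + 1)) \<longlonglongrightarrow> 0" using LIMSEQ_inverse_real_of_nat by (simp add: inverse_eq_divide add.commute)
    then have "(\<lambda>n. sqrt ((ell2_norm (\<lambda>i. x i - k i))\<^sup>2 + 1 / (real n + 1)) + ell2_norm (\<lambda>i. f n i - p i)) \<longlonglongrightarrow> sqrt ((ell2_norm (\<lambda>i. x i - k i))\<^sup>2 + 0) + 0"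
      by (intro tendsto_add tendsto_real_sqrt tendsto_const p)
    then show "(\<lambda>n. sqrt ((ell2_norm (\<lambda>i. x i - k i))\<^sup>2 + 1 / (real n + 1)) + ell2_norm (\<lambda>i. f n i - p i)) \<longlonglongrightarrow> ell2_norm (\<lambda>i. x i - k i)"
      using ell2_norm_nonneg[OF ell2_diff[OF x Ke[OF k]]] by simp
    have "ell2_norm (\<lambda>i. x i - p i) \<le> sqrt ((ell2_norm (\<lambda>i. x i - k i))\<^sup>2 + 1 / (real n + 1)) + ell2_norm (\<lambda>i. f n i - p i)" for n
    proof -
      have "ell2_norm (\<lambda>i. x i - f n i) \<le> sqrt ((ell2_norm (\<lambda>i. x i - k i))\<^sup>2 + 1 / (real n + 1))"
        by (rule real_le_rsqrt) (use f(2)[of n] dle[OF k] in linarith)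
      then show ?thesis using ell2_diff_triangle[OF x Ke[OF f(1)] p(1), of n] by linarith
    qed
    then show "\<exists>N. \<forall>n\<ge>N. ell2_norm (\<lambda>i. x i - p i) \<le> sqrt ((ell2_norm (\<lambda>i. x i - k i))\<^sup>2 + 1 / (real n + 1)) + ell2_norm (\<lambda>i. f n i - p i)" by blast
  qed
  with pK show ?thesis by blast
qed

lemma ell2_projection:
  assumes K: "ell2_closed_subspace K"
  obtains P where "P \<in> bounded_ops" "\<And>x. x \<in> ell2 \<Longrightarrow> P x \<in> K"
    "\<And>x k. x \<in> ell2 \<Longrightarrow> k \<in> K \<Longrightarrow> ell2_inner (\<lambda>i. x i - P x i) k = 0"
    "\<And>x p. x \<in> ell2 \<Longrightarrow> p \<in> K \<Longrightarrow> (\<And>k. k \<in> K \<Longrightarrow> ell2_inner (\<lambda>i. x i - p i) k = 0) \<Longrightarrow> P x = p"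
proof -
  have Ke: "k \<in> ell2" if "k \<in> K" for k using K that unfolding ell2_closed_subspace_def by blast
  have Kadd: "\<And>u v. u \<in> K \<Longrightarrow> v \<in> K \<Longrightarrow> (\<lambda>i. u i + v i) \<in> K"
    and Ksc: "\<And>c u. u \<in> K \<Longrightarrow> (\<lambda>i. c * u i) \<in> K"
    using K unfolding ell2_closed_subspace_def by blast+
  have Kdiff: "(\<lambda>i. u i - v i) \<in> K" if "u \<in> K" "v \<in> K" for u v
    using Kadd[OF that(1) Ksc[OF that(2), of "-1"]] by simp
  have ex: "\<exists>p\<in>K. \<forall>k\<in>K. ell2_inner (\<lambda>i. x i - p i) k = 0" if x: "x \<in> ell2" for x
  proof -
    obtain p where p: "p \<in> K" "\<And>k. k \<in> K \<Longrightarrow> ell2_norm (\<lambda>i. x i - p i) \<le> ell2_norm (\<lambda>i. x i - k i)"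
      using ell2_nearest_point[OF K x] by blast
    have "ell2_inner (\<lambda>i. x i - p i) k = 0" if k: "k \<in> K" for k
    proof -
      define y where "y = (\<lambda>i. x i - p i)"
      have y: "y \<in> ell2" unfolding y_def using x Ke[OF p(1)] by blast
      define s where "s = ell2_inner y k"
      \<comment> \<open>Moving the nearest point along \<open>k\<close> changes the squared distance by \<open>- 2 t |s|\<^sup>2 + t\<^sup>2 |s|\<^sup>2 \<parallel>k\<parallel>\<^sup>2\<close>; for this \<open>t\<close> the first term dominates unless \<open>s = 0\<close>.\<close>
      define t where "t = 1 / ((ell2_norm k)\<^sup>2 + 1)"
      define c where "c = complex_of_real (- t) * cnj s"
      have t0: "t > 0" unfolding t_def by (intro divide_pos_pos) (auto intro: add_nonneg_pos)
      have "(ell2_norm k)\<^sup>2 + 1 > 0" by (intro add_nonneg_pos) auto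
      then have "t * ((ell2_norm k)\<^sup>2 + 1) = 1" unfolding t_def by simp
      then have tk: "t * (ell2_norm k)\<^sup>2 \<le> 1" using t0 unfolding distrib_left by linarith
      have "x i - (p i - c * k i) = y i + c * k i" for i by (simp add: y_def)
      moreover have "(\<lambda>i. p i - c * k i) \<in> K" by (rule Kdiff[OF p(1) Ksc[OF k]])
      ultimately have "ell2_norm y \<le> ell2_norm (\<lambda>i. y i + c * k i)"
        using p(2)[of "\<lambda>i. p i - c * k i"] by (simp only: y_def)
      then have "(ell2_norm y)\<^sup>2 \<le> (ell2_norm (\<lambda>i. y i + c * k i))\<^sup>2"
        using ell2_norm_nonneg[OF y] by (rule power_mono)
      then have "0 \<le> 2 * Re (c * s) + (cmod c)\<^sup>2 * (ell2_norm k)\<^sup>2"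
        unfolding ell2_norm_add_scale_sq[OF y Ke[OF k]] s_def[symmetric] by linarith
      moreover have "c * s = complex_of_real (- t * (cmod s)\<^sup>2)"
        unfolding c_def using cnj_mult_self(1)[of s] by (simp add: mult.assoc)
      moreover have "(cmod c)\<^sup>2 = t * (t * (cmod s)\<^sup>2)" unfolding c_def by (simp add: norm_mult power_mult_distrib power2_eq_square)
      ultimately have "0 \<le> t * (cmod s)\<^sup>2 * (t * (ell2_norm k)\<^sup>2 - 2)"
        by (simp add: algebra_simps)
      moreover have "t * (cmod s)\<^sup>2 * (t * (ell2_norm k)\<^sup>2 - 2) \<le> t * (cmod s)\<^sup>2 * (-1)"
        using t0 tk by (intro mult_left_mono) auto
      ultimately have "t * (cmod s)\<^sup>2 \<le> 0" by linarith
      then have "(cmod s)\<^sup>2 \<le> 0" using t0 by (simp add: mult_le_0_iff)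
      then show ?thesis unfolding s_def y_def by simp
    qed
    with p(1) show ?thesis by blast
  qed
  have uniq: "p = q" if x: "x \<in> ell2" and p: "p \<in> K" "\<And>k. k \<in> K \<Longrightarrow> ell2_inner (\<lambda>i. x i - p i) k = 0"
    and q: "q \<in> K" "\<And>k. k \<in> K \<Longrightarrow> ell2_inner (\<lambda>i. x i - q i) k = 0" for x p q
  proof -
    let ?d = "\<lambda>i. q i - p i"
    have d: "?d \<in> K" by (rule Kdiff[OF q(1) p(1)])
    have de: "?d \<in> ell2" using Ke[OF d] .
    have a: "(\<lambda>i. x i - p i) \<in> ell2" "(\<lambda>i. x i - q i) \<in> ell2" using x Ke[OF p(1)] Ke[OF q(1)] by auto
    have eq: "q i - p i = (x i - p i) - (x i - q i)" for i by simp
    have "ell2_inner ?d (\<lambda>i. (x i - p i) - (x i - q i)) = ell2_inner ?d (\<lambda>i. x i - p i) - ell2_inner ?d (\<lambda>i. x i - q i)"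
      by (rule ell2_inner_diff_right[OF de a])
    also have "\<dots> = 0"
      using p(2)[OF d] q(2)[OF d] ell2_inner_commute[OF a(1) de] ell2_inner_commute[OF a(2) de] by simp
    finally have "ell2_inner ?d ?d = 0" unfolding eq[symmetric] .
    then have "ell2_norm ?d = 0" unfolding ell2_inner_self[OF de] by simp
    then have "?d = (\<lambda>i. 0)" using ell2_norm_eq_0_iff[OF de] by blast
    then have "?d i = 0" for i by (rule fun_cong)
    then show "p = q" by (intro ext) simp
  qed
  obtain F where F: "\<And>x. x \<in> ell2 \<Longrightarrow> F x \<in> K" "\<And>x k. x \<in> ell2 \<Longrightarrow> k \<in> K \<Longrightarrow> ell2_inner (\<lambda>i. x i - F x i) k = 0"
    using ex by metis
  have Fe: "F x \<in> ell2" if "x \<in> ell2" for x using Ke[OF F(1)[OF that]] .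
  define P where "P = (\<lambda>x\<in>ell2. F x)"
  have P: "P \<in> bounded_ops" unfolding P_def
  proof (rule bo_restrictI)
    fix x y assume x: "x \<in> ell2" and y: "y \<in> ell2"
    show "F (\<lambda>i. x i + y i) = (\<lambda>i. F x i + F y i)"
    proof (rule uniq[OF ell2_add[OF x y] F(1)[OF ell2_add[OF x y]] F(2)[OF ell2_add[OF x y]] Kadd[OF F(1)[OF x] F(1)[OF y]]])
      fix k assume k: "k \<in> K"
      have eq: "x i + y i - (F x i + F y i) = (x i - F x i) + (y i - F y i)" for i by simp
      show "ell2_inner (\<lambda>i. x i + y i - (F x i + F y i)) k = 0"
        unfolding eq ell2_inner_add_left[OF ell2_diff[OF x Fe[OF x]] ell2_diff[OF y Fe[OF y]] Ke[OF k]]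
        by (simp add: F(2)[OF x k] F(2)[OF y k])
    qed
  next
    fix x c assume x: "x \<in> ell2"
    show "F x \<in> ell2" by (rule Fe[OF x])
    show "F (\<lambda>i. c * x i) = (\<lambda>i. c * F x i)"
    proof (rule uniq[OF ell2_scale[OF x] F(1)[OF ell2_scale[OF x]] F(2)[OF ell2_scale[OF x]] Ksc[OF F(1)[OF x]]])
      fix k assume k: "k \<in> K"
      have eq: "c * x i - c * F x i = c * (x i - F x i)" for i by (simp add: algebra_simps)
      show "ell2_inner (\<lambda>i. c * x i - c * F x i) k = 0"
        unfolding eq ell2_inner_scale_left[OF ell2_diff[OF x Fe[OF x]] Ke[OF k]] by (simp add: F(2)[OF x k])
    qed
    have eq: "(x i - F x i) + 1 * F x i = x i" for i by simp
    have "(ell2_norm x)\<^sup>2 = (ell2_norm (\<lambda>i. x i - F x i))\<^sup>2 + (ell2_norm (F x))\<^sup>2"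
      using ell2_norm_add_scale_sq[OF ell2_diff[OF x Fe[OF x]] Fe[OF x], of 1]
      unfolding eq F(2)[OF x F(1)[OF x]] by simp
    then have "(ell2_norm (F x))\<^sup>2 \<le> (ell2_norm x)\<^sup>2" by simp
    then show "ell2_norm (F x) \<le> 1 * ell2_norm x" using power2_le_imp_le[OF _ ell2_norm_nonneg[OF x]] by simp
  qed
  show thesis
  proof (rule that[OF P])
    show "P x \<in> K" if "x \<in> ell2" for x using F(1)[OF that] that by (simp add: P_def)
    show "ell2_inner (\<lambda>i. x i - P x i) k = 0" if "x \<in> ell2" "k \<in> K" for x k using F(2)[OF that] that by (simp add: P_def)
    show "P x = p" if "x \<in> ell2" "p \<in> K" "\<And>k. k \<in> K \<Longrightarrow> ell2_inner (\<lambda>i. x i - p i) k = 0" for x p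
      using uniq[OF that(1) F(1)[OF that(1)] F(2)[OF that(1)] that(2,3)] that(1) by (simp add: P_def)
  qed
qed

section \<open>Amplification and the density theorem\<close>

text \<open>
  A pairing function identifies the Hilbert space with the direct sum of countably many copies of
  itself. The functions \<open>slot a\<close> and \<open>place b\<close> are the coordinate projections and inclusions, and \<open>glue\<close>
  assembles a vector from its components.
\<close>

definition slot :: "nat \<Rightarrow> (nat \<Rightarrow> complex) \<Rightarrow> nat \<Rightarrow> complex" where
  "slot a z = (\<lambda>i. z (prod_encode (a, i)))"

definition glue :: "(nat \<Rightarrow> nat \<Rightarrow> complex) \<Rightarrow> nat \<Rightarrow> complex" where
  "glue z = (\<lambda>n. case prod_decode n of (a, i) \<Rightarrow> z a i)"

lemma slot_glue [simp]: "slot a (glue z) = z a" by (simp add: slot_def glue_def)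

lemma glue_slot [simp]: "glue (\<lambda>a. slot a z) = z"
proof
  fix n
  obtain a i where ai: "prod_decode n = (a, i)" by (cases "prod_decode n")
  then have "prod_encode (a, i) = n" using prod_decode_inverse[of n] by simp
  with ai show "glue (\<lambda>a. slot a z) n = z n" by (simp add: slot_def glue_def)
qed

lemma slot_eqI: assumes "\<And>a. slot a u = slot a v" shows "u = v"
proof -
  have "u = glue (\<lambda>a. slot a u)" by (rule glue_slot[symmetric])
  also have "\<dots> = v" unfolding assms by (rule glue_slot)
  finally show ?thesis .
qed

lemma slot_ops: "slot a (\<lambda>i. x i + y i) = (\<lambda>i. slot a x i + slot a y i)"
  "slot a (\<lambda>i. x i - y i) = (\<lambda>i. slot a x i - slot a y i)" "slot a (\<lambda>i. c * x i) = (\<lambda>i. c * slot a x i)"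
  by (simp_all add: slot_def)

lemma glue_ell2:
  assumes z: "\<And>a. z a \<in> ell2" and C: "\<And>K. (\<Sum>a<K. (ell2_norm (z a))\<^sup>2) \<le> C"
  shows "glue z \<in> ell2" "(ell2_norm (glue z))\<^sup>2 \<le> C"
proof -
  have "(\<Sum>n<L. (cmod (glue z n))\<^sup>2) \<le> C" for L
  proof -
    obtain K where K: "prod_decode ` {..<L} \<subseteq> {..<K} \<times> {..<K}"
    proof -
      let ?F = "prod_decode ` {..<L}"
      have "prod_decode ` {..<L} \<subseteq> {..<Suc L} \<times> {..<Suc L}"
      proof
        fix q assume "q \<in> prod_decode ` {..<L}"
        then obtain n where n: "n < L" "q = prod_decode n" by blast
        then have "n = prod_encode (fst q, snd q)" by simp
        then have "fst q \<le> n" "snd q \<le> n" using le_prod_encode_1 le_prod_encode_2 by metis+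
        then show "q \<in> {..<Suc L} \<times> {..<Suc L}" using n(1) by (cases q) auto
      qed
      then show thesis by (rule that)
    qed
    have "(\<Sum>n<L. (cmod (glue z n))\<^sup>2) = (\<Sum>q\<in>prod_decode ` {..<L}. (cmod (z (fst q) (snd q)))\<^sup>2)"
      by (subst sum.reindex[OF inj_prod_decode]) (simp add: glue_def case_prod_beta)
    also have "\<dots> \<le> (\<Sum>q\<in>{..<K} \<times> {..<K}. (cmod (z (fst q) (snd q)))\<^sup>2)"
      using K by (intro sum_mono2) auto
    also have "\<dots> = (\<Sum>a<K. \<Sum>i<K. (cmod (z a i))\<^sup>2)"
      by (subst sum.cartesian_product) (simp add: case_prod_beta)
    also have "\<dots> \<le> (\<Sum>a<K. (ell2_norm (z a))\<^sup>2)" by (intro sum_mono ell2_sum_le z) auto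
    also have "\<dots> \<le> C" by (rule C)
    finally show ?thesis .
  qed
  note * = ell2I[OF this]
  show "glue z \<in> ell2" "(ell2_norm (glue z))\<^sup>2 \<le> C" by (rule *)+
qed

lemma slot_ell2:
  assumes z: "z \<in> ell2"
  shows "slot a z \<in> ell2" "(\<Sum>a<K. (ell2_norm (slot a z))\<^sup>2) \<le> (ell2_norm z)\<^sup>2"
proof -
  have fin: "(\<Sum>a\<in>I. \<Sum>i<L. (cmod (slot a z i))\<^sup>2) \<le> (ell2_norm z)\<^sup>2" if "finite I" for I L
  proof -
    have "(\<Sum>a\<in>I. \<Sum>i<L. (cmod (slot a z i))\<^sup>2) = (\<Sum>q\<in>I \<times> {..<L}. (cmod (z (prod_encode q)))\<^sup>2)"
      by (subst sum.cartesian_product) (simp add: slot_def case_prod_beta)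
    also have "\<dots> = (\<Sum>n\<in>prod_encode ` (I \<times> {..<L}). (cmod (z n))\<^sup>2)"
      by (subst sum.reindex[OF inj_prod_encode]) simp
    also have "\<dots> \<le> (ell2_norm z)\<^sup>2" using that by (intro ell2_sum_le z) auto
    finally show ?thesis .
  qed
  show s: "slot a z \<in> ell2" for a
    by (rule ell2I(1)[of _ "(ell2_norm z)\<^sup>2"]) (use fin[of "{a}"] in simp)
  show "(\<Sum>a<K. (ell2_norm (slot a z))\<^sup>2) \<le> (ell2_norm z)\<^sup>2"
  proof (rule LIMSEQ_le_const2)
    have "(\<lambda>L. \<Sum>i<L. (cmod (slot a z i))\<^sup>2) \<longlonglongrightarrow> (ell2_norm (slot a z))\<^sup>2" for a
      unfolding ell2_norm_sq[OF s] using s[of a] by (intro summable_LIMSEQ) (simp add: ell2_def)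
    then show "(\<lambda>L. \<Sum>a<K. \<Sum>i<L. (cmod (slot a z i))\<^sup>2) \<longlonglongrightarrow> (\<Sum>a<K. (ell2_norm (slot a z))\<^sup>2)"
      by (intro tendsto_sum)
    show "\<exists>N. \<forall>L\<ge>N. (\<Sum>a<K. \<Sum>i<L. (cmod (slot a z i))\<^sup>2) \<le> (ell2_norm z)\<^sup>2" using fin[of "{..<K}"] by auto
  qed
qed

definition place :: "nat \<Rightarrow> (nat \<Rightarrow> complex) \<Rightarrow> nat \<Rightarrow> complex" where
  "place b x = glue (\<lambda>a. if a = b then x else (\<lambda>i. 0))"

lemma slot_place: "slot a (place b x) = (if a = b then x else (\<lambda>i. 0))"
  by (simp add: place_def)

lemma place_ell2:
  assumes x: "x \<in> ell2" shows "place b x \<in> ell2" "(ell2_norm (place b x))\<^sup>2 \<le> (ell2_norm x)\<^sup>2"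
proof -
  have 1: "(if a = b then x else (\<lambda>i. 0)) \<in> ell2" for a using x by simp
  have 2: "(\<Sum>a<K. (ell2_norm (if a = b then x else (\<lambda>i. 0)))\<^sup>2) \<le> (ell2_norm x)\<^sup>2" for K
  proof -
    have "(\<Sum>a<K. (ell2_norm (if a = b then x else (\<lambda>i. 0)))\<^sup>2) = (\<Sum>a<K. if a = b then (ell2_norm x)\<^sup>2 else 0)"
      by (intro sum.cong refl) simp
    then show ?thesis by simp
  qed
  show "place b x \<in> ell2" "(ell2_norm (place b x))\<^sup>2 \<le> (ell2_norm x)\<^sup>2"
    unfolding place_def by (rule glue_ell2[OF 1 2])+
qed

lemma basis_vec_place: "basis_vec (prod_encode (b, j)) = place b (basis_vec j)"
proof (rule slot_eqI)
  fix a
  show "slot a (basis_vec (prod_encode (b, j))) = slot a (place b (basis_vec j))"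
    unfolding slot_place by (auto simp: slot_def basis_vec_def)
qed

lemma inner_place:
  "ell2_inner (place b y) x = ell2_inner y (slot b x)"
proof -
  have "(\<Sum>i. cnj (place b y (prod_encode (b, i))) * x (prod_encode (b, i))) = (\<Sum>n. cnj (place b y n) * x n)"
  proof (rule suminf_mono_reindex[where g = "\<lambda>i. prod_encode (b, i)" and f = "\<lambda>n. cnj (place b y n) * x n"])
    show "strict_mono (\<lambda>i. prod_encode (b, i))"
      unfolding strict_mono_Suc_iff by (simp add: prod_encode_def)
    fix n assume n: "n \<notin> range (\<lambda>i. prod_encode (b, i))"
    obtain a i where ai: "prod_decode n = (a, i)" by (cases "prod_decode n")
    then have "n = prod_encode (a, i)" by (metis prod_decode_inverse)
    then have "a \<noteq> b" using n by blast
    then show "cnj (place b y n) * x n = 0" by (simp add: place_def glue_def ai)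
  qed
  moreover have "place b y (prod_encode (b, i)) = y i" for i by (simp add: place_def glue_def)
  ultimately show ?thesis by (simp add: ell2_inner_def slot_def)
qed

text \<open>
  The operator that acts as \<open>T\<close> in each summand.
\<close>

definition amp :: "ell2_op \<Rightarrow> ell2_op" where
  "amp T = (\<lambda>z\<in>ell2. glue (\<lambda>a. T (slot a z)))"

lemma amp_apply:
  assumes T: "T \<in> bounded_ops" and z: "z \<in> ell2"
  shows "slot a (amp T z) = T (slot a z)" "amp T z \<in> ell2" "ell2_norm (amp T z) \<le> cnorm B_ell2 T * ell2_norm z"
proof -
  show "slot a (amp T z) = T (slot a z)" using z by (simp add: amp_def)
  have 1: "T (slot a z) \<in> ell2" for a by (rule bo_closed[OF T slot_ell2(1)[OF z]])
  have 2: "(\<Sum>a<K. (ell2_norm (T (slot a z)))\<^sup>2) \<le> (cnorm B_ell2 T * ell2_norm z)\<^sup>2" for K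
  proof -
    have "(\<Sum>a<K. (ell2_norm (T (slot a z)))\<^sup>2) \<le> (\<Sum>a<K. (cnorm B_ell2 T)\<^sup>2 * (ell2_norm (slot a z))\<^sup>2)"
      unfolding power_mult_distrib[symmetric]
      by (intro sum_mono power_mono op_le[OF T slot_ell2(1)[OF z]] ell2_norm_nonneg[OF 1])
    also have "\<dots> = (cnorm B_ell2 T)\<^sup>2 * (\<Sum>a<K. (ell2_norm (slot a z))\<^sup>2)" by (rule sum_distrib_left[symmetric])
    also have "\<dots> \<le> (cnorm B_ell2 T)\<^sup>2 * (ell2_norm z)\<^sup>2" by (intro mult_left_mono slot_ell2(2)[OF z]) simp
    finally show ?thesis by (simp add: power_mult_distrib)
  qed
  have eq: "amp T z = glue (\<lambda>a. T (slot a z))" using z by (simp add: amp_def)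
  show "amp T z \<in> ell2" unfolding eq by (rule glue_ell2(1)[OF 1 2])
  show "ell2_norm (amp T z) \<le> cnorm B_ell2 T * ell2_norm z" unfolding eq
    by (rule power2_le_imp_le[OF glue_ell2(2)[OF 1 2]]) (intro mult_nonneg_nonneg op_nonneg[OF T] ell2_norm_nonneg[OF z])
qed

lemma amp_bounded: assumes T: "T \<in> bounded_ops" shows "amp T \<in> bounded_ops"
proof -
  have "(\<lambda>z\<in>ell2. amp T z) \<in> bounded_ops"
  proof (rule bo_restrictI)
    fix x y assume x: "x \<in> ell2" and y: "y \<in> ell2"
    show "amp T (\<lambda>i. x i + y i) = (\<lambda>i. amp T x i + amp T y i)"
      by (rule slot_eqI) (simp only: slot_ops amp_apply(1)[OF T x] amp_apply(1)[OF T y] amp_apply(1)[OF T ell2_add[OF x y]]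
        bo_add[OF T slot_ell2(1)[OF x] slot_ell2(1)[OF y]])
  next
    fix x c assume x: "x \<in> ell2"
    show "amp T (\<lambda>i. c * x i) = (\<lambda>i. c * amp T x i)"
      by (rule slot_eqI) (simp only: slot_ops amp_apply(1)[OF T x] amp_apply(1)[OF T ell2_scale[OF x]] bo_scale[OF T slot_ell2(1)[OF x]])
    show "amp T x \<in> ell2" by (rule amp_apply(2)[OF T x])
    show "ell2_norm (amp T x) \<le> cnorm B_ell2 T * ell2_norm x" by (rule amp_apply(3)[OF T x])
  qed
  moreover have "(\<lambda>z\<in>ell2. amp T z) = amp T" unfolding amp_def by (rule restrict_restrict[THEN trans]) simp
  ultimately show ?thesis by simp
qed

lemma amp_place: assumes T: "T \<in> bounded_ops" and x: "x \<in> ell2" shows "amp T (place b x) = place b (T x)"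
  by (rule slot_eqI) (simp add: amp_apply(1)[OF T place_ell2(1)[OF x]] slot_place bo_zero[OF T])

lemma amp_adj: assumes T: "T \<in> bounded_ops" and x: "x \<in> ell2" shows "adj_op (amp T) x = amp (adj_op T) x"
proof (rule slot_eqI)
  fix b
  have "slot b (adj_op (amp T) x) j = slot b (amp (adj_op T) x) j" for j
  proof -
    have "slot b (adj_op (amp T) x) j = ell2_inner (amp T (basis_vec (prod_encode (b, j)))) x"
      using x by (simp add: adj_op_def slot_def)
    also have "\<dots> = ell2_inner (T (basis_vec j)) (slot b x)"
      unfolding basis_vec_place amp_place[OF T basis_vec_ell2] inner_place ..
    also have "\<dots> = slot b (amp (adj_op T) x) j"
      unfolding amp_apply(1)[OF adj_op_closed[OF T] x] using slot_ell2(1)[OF x, of b] by (simp add: adj_op_def)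
    finally show ?thesis .
  qed
  then show "slot b (adj_op (amp T) x) = slot b (amp (adj_op T) x)" by blast
qed

text \<open>
  Von Neumann's argument. In the amplified Hilbert space let \<open>Z\<close> be the vector with components \<open>\<xi> a\<close>, and let \<open>P\<close> be
  the projection onto the closure \<open>K\<close> of \<open>D Z\<close>. As \<open>D\<close> is a *-algebra, \<open>P\<close> commutes with all \<open>amp d\<close>; so the
  operator entries of \<open>P\<close> lie in the commutant of \<open>D\<close>, they commute with \<open>x\<close>, and \<open>P\<close> commutes with
  \<open>amp x\<close>. Since \<open>Z\<close> lies in \<open>K\<close>, so does \<open>amp x Z\<close>.
\<close>

theorem bicommutant_density:
  fixes \<xi> :: "nat \<Rightarrow> nat \<Rightarrow> complex"
  assumes D: "D \<subseteq> bounded_ops" "\<one>\<^bsub>B_ell2\<^esub> \<in> D"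
    "\<And>S T. S \<in> D \<Longrightarrow> T \<in> D \<Longrightarrow> S \<oplus>\<^bsub>B_ell2\<^esub> T \<in> D" "\<And>S T. S \<in> D \<Longrightarrow> T \<in> D \<Longrightarrow> S \<otimes>\<^bsub>B_ell2\<^esub> T \<in> D"
    "\<And>c T. T \<in> D \<Longrightarrow> c \<odot>\<^bsub>B_ell2\<^esub> T \<in> D" "\<And>T. T \<in> D \<Longrightarrow> adj B_ell2 T \<in> D"
    and x: "x \<in> commutant (commutant D)"
    and \<xi>: "\<And>a. \<xi> a \<in> ell2" "\<And>K. (\<Sum>a<K. (ell2_norm (\<xi> a))\<^sup>2) \<le> C" and e: "e > 0"
  shows "\<exists>b\<in>D. \<forall>K. (\<Sum>a<K. (ell2_norm (\<lambda>i. x (\<xi> a) i - b (\<xi> a) i))\<^sup>2) \<le> e"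
proof -
  have Db: "T \<in> bounded_ops" if "T \<in> D" for T using D(1) that by blast
  have xb: "x \<in> bounded_ops" using x by (simp add: commutant_def)
  define Z where "Z = glue \<xi>"
  have Z: "Z \<in> ell2" unfolding Z_def by (rule glue_ell2(1)[OF \<xi>])
  note aZ = amp_apply(2)[OF _ Z]
  define K where "K = {z \<in> ell2. \<forall>e>0. \<exists>b\<in>D. ell2_norm (\<lambda>i. z i - amp b Z i) < e}"
  have Ke: "z \<in> ell2" if "z \<in> K" for z using that by (simp add: K_def)
  have Kap: "\<exists>b\<in>D. ell2_norm (\<lambda>i. z i - amp b Z i) < e" if "z \<in> K" "e > 0" for z e using that by (simp add: K_def)
  have ampadd: "amp (S \<oplus>\<^bsub>B_ell2\<^esub> T) Z = (\<lambda>i. amp S Z i + amp T Z i)" if S: "S \<in> D" and T: "T \<in> D" for S T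
    by (rule slot_eqI, simp only: slot_ops amp_apply(1)[OF Db[OF S] Z] amp_apply(1)[OF Db[OF T] Z]
      amp_apply(1)[OF Db[OF D(3)[OF S T]] Z]) (simp add: B_ell2_ops slot_ell2(1)[OF Z])
  have ampsc: "amp (c \<odot>\<^bsub>B_ell2\<^esub> T) Z = (\<lambda>i. c * amp T Z i)" if T: "T \<in> D" for c T
    by (rule slot_eqI, simp only: slot_ops amp_apply(1)[OF Db[OF T] Z] amp_apply(1)[OF Db[OF D(5)[OF T]] Z])
      (simp add: B_ell2_ops slot_ell2(1)[OF Z])
  have ampmul: "amp (S \<otimes>\<^bsub>B_ell2\<^esub> T) Z = amp S (amp T Z)" if S: "S \<in> D" and T: "T \<in> D" for S T
    by (rule slot_eqI, simp only: amp_apply(1)[OF Db[OF S] aZ[OF Db[OF T]]] amp_apply(1)[OF Db[OF T] Z]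
      amp_apply(1)[OF Db[OF D(4)[OF S T]] Z]) (simp add: B_ell2_ops slot_ell2(1)[OF Z])
  have sub: "ell2_closed_subspace K" unfolding ell2_closed_subspace_def
  proof (intro conjI ballI allI impI)
    show "K \<subseteq> ell2" using Ke by blast
    have z0: "amp (0 \<odot>\<^bsub>B_ell2\<^esub> \<one>\<^bsub>B_ell2\<^esub>) Z = (\<lambda>i. 0)" using ampsc[OF D(2), of 0] by simp
    show "(\<lambda>i. 0) \<in> K" unfolding K_def using z0 D(5)[OF D(2), of 0]
      by (auto intro!: bexI[of _ "0 \<odot>\<^bsub>B_ell2\<^esub> \<one>\<^bsub>B_ell2\<^esub>"])
    fix u v assume u: "u \<in> K" and v: "v \<in> K"
    have "\<exists>b\<in>D. ell2_norm (\<lambda>i. (u i + v i) - amp b Z i) < e" if e: "e > 0" for e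
    proof -
      obtain b c where b: "b \<in> D" "ell2_norm (\<lambda>i. u i - amp b Z i) < e/2" and c: "c \<in> D" "ell2_norm (\<lambda>i. v i - amp c Z i) < e/2"
        using Kap[OF u, of "e/2"] Kap[OF v, of "e/2"] e by auto
      have eq: "(u i + v i) - (amp b Z i + amp c Z i) = (u i - amp b Z i) + (v i - amp c Z i)" for i by simp
      have "ell2_norm (\<lambda>i. (u i + v i) - amp (b \<oplus>\<^bsub>B_ell2\<^esub> c) Z i) < e"
        unfolding ampadd[OF b(1) c(1)] eq
        using ell2_norm_triangle[OF ell2_diff[OF Ke[OF u] aZ[OF Db[OF b(1)]]] ell2_diff[OF Ke[OF v] aZ[OF Db[OF c(1)]]]] b(2) c(2) by linarith
      then show ?thesis using D(3)[OF b(1) c(1)] by blast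
    qed
    then show "(\<lambda>i. u i + v i) \<in> K" using Ke[OF u] Ke[OF v] by (simp add: K_def)
  next
    fix c u assume u: "u \<in> K"
    have "\<exists>b\<in>D. ell2_norm (\<lambda>i. c * u i - amp b Z i) < e" if e: "e > 0" for e
    proof -
      have c0: "cmod c + 1 > 0" using norm_ge_zero[of c] by linarith
      then obtain b where b: "b \<in> D" "ell2_norm (\<lambda>i. u i - amp b Z i) < e / (cmod c + 1)"
        using Kap[OF u, of "e / (cmod c + 1)"] e by auto
      note d = ell2_diff[OF Ke[OF u] aZ[OF Db[OF b(1)]]]
      have eq: "c * u i - c * amp b Z i = c * (u i - amp b Z i)" for i by (simp add: algebra_simps)
      have "cmod c * ell2_norm (\<lambda>i. u i - amp b Z i) \<le> (cmod c + 1) * ell2_norm (\<lambda>i. u i - amp b Z i)"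
        using ell2_norm_nonneg[OF d] by (intro mult_right_mono) auto
      also have "\<dots> < e" using b(2) c0 by (simp add: field_simps)
      finally have "ell2_norm (\<lambda>i. c * u i - amp (c \<odot>\<^bsub>B_ell2\<^esub> b) Z i) < e"
        unfolding ampsc[OF b(1)] eq ell2_norm_scale[OF d] .
      then show ?thesis using D(5)[OF b(1)] by blast
    qed
    then show "(\<lambda>i. c * u i) \<in> K" using Ke[OF u] by (simp add: K_def)
  next
    fix f :: "nat \<Rightarrow> nat \<Rightarrow> complex" and u assume u: "u \<in> ell2" and f: "\<forall>n. f n \<in> K" and lim: "(\<lambda>n. ell2_norm (\<lambda>i. f n i - u i)) \<longlonglongrightarrow> 0"
    have "\<exists>b\<in>D. ell2_norm (\<lambda>i. u i - amp b Z i) < e" if e: "e > 0" for e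
    proof -
      have fK: "f n \<in> K" for n using f by blast
      obtain n where n: "ell2_norm (\<lambda>i. f n i - u i) < e/2"
        using order_tendstoD(2)[OF lim, of "e/2"] e by (auto simp: eventually_sequentially)
      obtain b where b: "b \<in> D" "ell2_norm (\<lambda>i. f n i - amp b Z i) < e/2" using Kap[OF fK[of n], of "e/2"] e by auto
      have "ell2_norm (\<lambda>i. u i - amp b Z i) < e"
        using ell2_diff_triangle[OF u Ke[OF fK[of n]] aZ[OF Db[OF b(1)]]] n b(2) ell2_norm_minus[of u "f n"] by linarith
      then show ?thesis using b(1) by blast
    qed
    then show "u \<in> K" using u by (simp add: K_def)
  qed
  have inv: "amp d z \<in> K" if d: "d \<in> D" and z: "z \<in> K" for d z
  proof -
    have "\<exists>b\<in>D. ell2_norm (\<lambda>i. amp d z i - amp b Z i) < e" if e: "e > 0" for e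
    proof -
      have c0: "cnorm B_ell2 d + 1 > 0" using op_nonneg[OF Db[OF d]] by linarith
      then obtain b where b: "b \<in> D" "ell2_norm (\<lambda>i. z i - amp b Z i) < e / (cnorm B_ell2 d + 1)"
        using Kap[OF z, of "e / (cnorm B_ell2 d + 1)"] e by auto
      note dd = ell2_diff[OF Ke[OF z] aZ[OF Db[OF b(1)]]]
      have "ell2_norm (\<lambda>i. amp d z i - amp (d \<otimes>\<^bsub>B_ell2\<^esub> b) Z i) = ell2_norm (amp d (\<lambda>i. z i - amp b Z i))"
        unfolding ampmul[OF d b(1)] bo_diff[OF amp_bounded[OF Db[OF d]] Ke[OF z] aZ[OF Db[OF b(1)]]] ..
      also have "\<dots> \<le> cnorm B_ell2 d * ell2_norm (\<lambda>i. z i - amp b Z i)" by (rule amp_apply(3)[OF Db[OF d] dd])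
      also have "\<dots> \<le> (cnorm B_ell2 d + 1) * ell2_norm (\<lambda>i. z i - amp b Z i)"
        using ell2_norm_nonneg[OF dd] by (intro mult_right_mono) auto
      also have "\<dots> < e" using b(2) c0 by (simp add: field_simps)
      finally show ?thesis using D(4)[OF d b(1)] by blast
    qed
    then show ?thesis using amp_apply(2)[OF Db[OF d] Ke[OF z]] by (simp add: K_def)
  qed
  obtain P where P: "P \<in> bounded_ops" "\<And>x. x \<in> ell2 \<Longrightarrow> P x \<in> K"
    "\<And>x k. x \<in> ell2 \<Longrightarrow> k \<in> K \<Longrightarrow> ell2_inner (\<lambda>i. x i - P x i) k = 0"
    "\<And>x p. x \<in> ell2 \<Longrightarrow> p \<in> K \<Longrightarrow> (\<And>k. k \<in> K \<Longrightarrow> ell2_inner (\<lambda>i. x i - p i) k = 0) \<Longrightarrow> P x = p"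
    by (rule ell2_projection[OF sub]) blast
  note Pe = bo_closed[OF P(1)]
  have Pcomm: "P (amp d z) = amp d (P z)" if d: "d \<in> D" and z: "z \<in> ell2" for d z
  proof (rule P(4)[OF amp_apply(2)[OF Db[OF d] z] inv[OF d P(2)[OF z]]])
    fix k assume k: "k \<in> K"
    note da = amp_bounded[OF Db[OF d]]
    have "ell2_inner k (amp d (\<lambda>i. z i - P z i)) = ell2_inner (adj_op (amp d) k) (\<lambda>i. z i - P z i)"
      by (rule adj_op_inner[OF da Ke[OF k] ell2_diff[OF z Pe[OF z]], symmetric])
    also have "\<dots> = ell2_inner (amp (adj B_ell2 d) k) (\<lambda>i. z i - P z i)"
      unfolding amp_adj[OF Db[OF d] Ke[OF k]] adj_B_ell2[OF Db[OF d]] ..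
    also have "\<dots> = cnj (ell2_inner (\<lambda>i. z i - P z i) (amp (adj B_ell2 d) k))"
      by (rule ell2_inner_commute[OF ell2_diff[OF z Pe[OF z]] Ke[OF inv[OF D(6)[OF d] k]]])
    also have "\<dots> = 0" using P(3)[OF z inv[OF D(6)[OF d] k]] by simp
    finally have "ell2_inner (amp d (\<lambda>i. z i - P z i)) k = 0"
      using ell2_inner_commute[OF Ke[OF k] bo_closed[OF da ell2_diff[OF z Pe[OF z]]]] by simp
    then show "ell2_inner (\<lambda>i. amp d z i - amp d (P z) i) k = 0"
      unfolding bo_diff[OF da z Pe[OF z]] .
  qed
  \<comment> \<open>The operator entries of \<open>P\<close> commute with \<open>D\<close> because \<open>P\<close> commutes with the diagonal operators \<open>amp d\<close>.\<close>
  have Pab: "x (slot a (P (place b y))) = slot a (P (place b (x y)))" if y: "y \<in> ell2" for a b y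
  proof -
    define Q where "Q = (\<lambda>y\<in>ell2. slot a (P (place b y)))"
    have pl: "place b u \<in> ell2" if "u \<in> ell2" for u by (rule place_ell2(1)[OF that])
    have pladd: "place b (\<lambda>i. u i + v i) = (\<lambda>i. place b u i + place b v i)" for u v
      by (rule slot_eqI) (auto simp: slot_ops slot_place)
    have plsc: "place b (\<lambda>i. c * u i) = (\<lambda>i. c * place b u i)" for c u
      by (rule slot_eqI) (auto simp: slot_ops slot_place)
    have Q: "Q \<in> bounded_ops" unfolding Q_def
    proof (rule bo_restrictI)
      fix u v assume u: "u \<in> ell2" and v: "v \<in> ell2"
      show "slot a (P (place b (\<lambda>i. u i + v i))) = (\<lambda>i. slot a (P (place b u)) i + slot a (P (place b v)) i)"
        unfolding pladd bo_add[OF P(1) pl[OF u] pl[OF v]] slot_ops ..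
    next
      fix u c assume u: "u \<in> ell2"
      show "slot a (P (place b u)) \<in> ell2" by (rule slot_ell2(1)[OF Pe[OF pl[OF u]]])
      show "slot a (P (place b (\<lambda>i. c * u i))) = (\<lambda>i. c * slot a (P (place b u)) i)"
        unfolding plsc bo_scale[OF P(1) pl[OF u]] slot_ops ..
      have "(ell2_norm (slot a (P (place b u))))\<^sup>2 \<le> (\<Sum>a<Suc a. (ell2_norm (slot a (P (place b u))))\<^sup>2)"
        by (rule member_le_sum) auto
      also have "\<dots> \<le> (ell2_norm (P (place b u)))\<^sup>2" by (rule slot_ell2(2)[OF Pe[OF pl[OF u]]])
      finally have 1: "ell2_norm (slot a (P (place b u))) \<le> ell2_norm (P (place b u))"
        by (rule power2_le_imp_le[OF _ ell2_norm_nonneg[OF Pe[OF pl[OF u]]]])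
      have 2: "ell2_norm (place b u) \<le> ell2_norm u"
        by (rule power2_le_imp_le[OF place_ell2(2)[OF u] ell2_norm_nonneg[OF u]])
      show "ell2_norm (slot a (P (place b u))) \<le> cnorm B_ell2 P * ell2_norm u"
        using 1 op_le[OF P(1) pl[OF u]] mult_left_mono[OF 2 op_nonneg[OF P(1)]] by linarith
    qed
    have "Q \<otimes>\<^bsub>B_ell2\<^esub> d = d \<otimes>\<^bsub>B_ell2\<^esub> Q" if d: "d \<in> D" for d
    proof -
      have "Q (d u) = d (Q u)" if u: "u \<in> ell2" for u
      proof -
        note du = bo_closed[OF Db[OF d] u]
        have "Q (d u) = slot a (P (place b (d u)))" using du by (simp add: Q_def)
        also have "\<dots> = slot a (amp d (P (place b u)))"
          unfolding amp_place[OF Db[OF d] u, symmetric] Pcomm[OF d pl[OF u]] ..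
        also have "\<dots> = d (Q u)" unfolding amp_apply(1)[OF Db[OF d] Pe[OF pl[OF u]]] using u by (simp add: Q_def)
        finally show ?thesis .
      qed
      then show ?thesis by (auto simp: B_ell2_ops)
    qed
    then have "Q \<in> commutant D" using Q by (simp add: commutant_def)
    then have "x \<otimes>\<^bsub>B_ell2\<^esub> Q = Q \<otimes>\<^bsub>B_ell2\<^esub> x" using x by (simp add: commutant_def)
    then have "(x \<otimes>\<^bsub>B_ell2\<^esub> Q) y = (Q \<otimes>\<^bsub>B_ell2\<^esub> x) y" by simp
    then show ?thesis using y bo_closed[OF xb y] by (simp add: B_ell2_ops Q_def)
  qed
  have ax: "amp x \<in> bounded_ops" by (rule amp_bounded[OF xb])
  have "(\<lambda>z\<in>ell2. P (amp x z)) = (\<lambda>z\<in>ell2. amp x (P z))"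
  proof (rule bo_eq_basisI[OF B_ell2_mult_closed(1)[OF P(1) ax] B_ell2_mult_closed(1)[OF ax P(1)]])
    fix n
    obtain b j where bj: "n = prod_encode (b, j)" by (metis prod_decode_inverse surj_pair)
    have "P (amp x (basis_vec n)) = amp x (P (basis_vec n))"
    proof (rule slot_eqI)
      fix a
      show "slot a (P (amp x (basis_vec n))) = slot a (amp x (P (basis_vec n)))"
        unfolding bj basis_vec_place amp_place[OF xb basis_vec_ell2]
          amp_apply(1)[OF xb Pe[OF place_ell2(1)[OF basis_vec_ell2]]] Pab[OF basis_vec_ell2] ..
    qed
    then show "(\<lambda>z\<in>ell2. P (amp x z)) (basis_vec n) = (\<lambda>z\<in>ell2. amp x (P z)) (basis_vec n)" by simp
  qed
  from fun_cong[OF this, of Z] have PZ: "P (amp x Z) = amp x (P Z)" using Z by simp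
  have one: "amp \<one>\<^bsub>B_ell2\<^esub> Z = Z"
    by (rule slot_eqI, simp only: amp_apply(1)[OF Db[OF D(2)] Z]) (simp add: B_ell2_ops slot_ell2(1)[OF Z])
  have ZK: "Z \<in> K" unfolding K_def using Z D(2) one by (auto intro!: bexI[of _ "\<one>\<^bsub>B_ell2\<^esub>"])
  have "P Z = Z" by (rule P(4)[OF Z ZK]) (simp add: ell2_inner_def)
  then have "amp x Z \<in> K" using PZ P(2)[OF aZ[OF xb]] by simp
  then obtain b where b: "b \<in> D" "ell2_norm (\<lambda>i. amp x Z i - amp b Z i) < sqrt e" using Kap[of "amp x Z" "sqrt e"] e by auto
  let ?w = "\<lambda>i. amp x Z i - amp b Z i"
  have w: "?w \<in> ell2" by (rule ell2_diff[OF aZ[OF xb] aZ[OF Db[OF b(1)]]])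
  have ws: "slot a ?w = (\<lambda>i. x (\<xi> a) i - b (\<xi> a) i)" for a
    unfolding slot_ops amp_apply(1)[OF xb Z] amp_apply(1)[OF Db[OF b(1)] Z] by (simp add: Z_def)
  have "(ell2_norm ?w)\<^sup>2 \<le> (sqrt e)\<^sup>2" using b(2) ell2_norm_nonneg[OF w] by (intro power_mono) auto
  then have "(\<Sum>a<K. (ell2_norm (\<lambda>i. x (\<xi> a) i - b (\<xi> a) i))\<^sup>2) \<le> e" for K
    using slot_ell2(2)[OF w, of K] e unfolding ws by simp
  with b(1) show ?thesis by blast
qed

section \<open>Matrix algebras\<close>

lemma complex_mat_alg_ops [simp]:
  "carrier (complex_mat_alg m) = carrier_mat m m" "U \<otimes>\<^bsub>complex_mat_alg m\<^esub> V = U * V"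
  "\<one>\<^bsub>complex_mat_alg m\<^esub> = 1\<^sub>m m" "\<zero>\<^bsub>complex_mat_alg m\<^esub> = 0\<^sub>m m m" "U \<oplus>\<^bsub>complex_mat_alg m\<^esub> V = U + V"
  "c \<odot>\<^bsub>complex_mat_alg m\<^esub> U = c \<cdot>\<^sub>m U" "adj (complex_mat_alg m) U = mat_adjoint U" "cnorm (complex_mat_alg m) U = op_norm U"
  by (simp_all add: complex_mat_alg_def)

lemma mat_adjoint_index:
  fixes U :: "complex mat"
  assumes "U \<in> carrier_mat m m"
  shows "mat_adjoint U \<in> carrier_mat m m" "i < m \<Longrightarrow> j < m \<Longrightarrow> mat_adjoint U $$ (i, j) = cnj (U $$ (j, i))"
  using assms unfolding mat_adjoint_def by (auto simp: mat_of_rows_def)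

lemma mat_mult_index: "U \<in> carrier_mat m m \<Longrightarrow> V \<in> carrier_mat m m \<Longrightarrow> i < m \<Longrightarrow> j < m \<Longrightarrow>
    (U * V) $$ (i, j) = (\<Sum>k<m. U $$ (i, k) * V $$ (k, j))"
  by (simp add: scalar_prod_def lessThan_atLeast0)

lemma star_algebra_complex_mat: "star_algebra (complex_mat_alg m)"
proof -
  have ag: "abelian_group (complex_mat_alg m)"
  proof (rule abelian_groupI)
    fix U assume U: "U \<in> carrier (complex_mat_alg m)"
    then show "\<exists>V\<in>carrier (complex_mat_alg m). V \<oplus>\<^bsub>complex_mat_alg m\<^esub> U = \<zero>\<^bsub>complex_mat_alg m\<^esub>"
      by (intro bexI[of _ "- U"]) auto
  qed (auto intro: comm_add_mat)
  have rg: "ring (complex_mat_alg m)"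
  proof (rule ringI[OF ag])
    show "Group.monoid (complex_mat_alg m)" by (rule monoidI) auto
  qed (auto simp: add_mult_distrib_mat mult_add_distrib_mat)
  have md: "Module.module complex_field (complex_mat_alg m)"
    by (rule moduleI[OF cring_complex_field ag]) (auto intro!: eq_matI simp: algebra_simps)
  show ?thesis
  proof (intro star_algebra.intro star_space.intro star_space_axioms.intro star_algebra_axioms.intro ag rg md)
    fix U V :: "complex mat" assume "U \<in> carrier (complex_mat_alg m)" and "V \<in> carrier (complex_mat_alg m)"
    then have U: "U \<in> carrier_mat m m" and V: "V \<in> carrier_mat m m" by auto
    note a = mat_adjoint_index[OF U] mat_adjoint_index[OF V]
    have UV: "U * V \<in> carrier_mat m m" "U + V \<in> carrier_mat m m" using U V by auto
    show "adj (complex_mat_alg m) (U \<oplus>\<^bsub>complex_mat_alg m\<^esub> V) = adj (complex_mat_alg m) U \<oplus>\<^bsub>complex_mat_alg m\<^esub> adj (complex_mat_alg m) V"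
      using mat_adjoint_index[OF UV(2)] a U V by (intro eq_matI) auto
    show "adj (complex_mat_alg m) (U \<otimes>\<^bsub>complex_mat_alg m\<^esub> V) = adj (complex_mat_alg m) V \<otimes>\<^bsub>complex_mat_alg m\<^esub> adj (complex_mat_alg m) U"
    proof (rule eq_matI)
      fix i j assume "i < dim_row (adj (complex_mat_alg m) V \<otimes>\<^bsub>complex_mat_alg m\<^esub> adj (complex_mat_alg m) U)"
        "j < dim_col (adj (complex_mat_alg m) V \<otimes>\<^bsub>complex_mat_alg m\<^esub> adj (complex_mat_alg m) U)"
      then have ij: "i < m" "j < m" using a by auto
      have "mat_adjoint (U * V) $$ (i, j) = (\<Sum>k<m. cnj (U $$ (j, k)) * cnj (V $$ (k, i)))"
        using mat_adjoint_index(2)[OF UV(1) ij] mat_mult_index[OF U V ij(2,1)] by (simp del: index_mult_mat)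
      also have "\<dots> = (\<Sum>k<m. mat_adjoint V $$ (i, k) * mat_adjoint U $$ (k, j))"
        using ij a by (intro sum.cong refl) (simp add: mult.commute)
      also have "\<dots> = (mat_adjoint V * mat_adjoint U) $$ (i, j)"
        by (rule mat_mult_index[symmetric]) (use a ij in auto)
      finally show "adj (complex_mat_alg m) (U \<otimes>\<^bsub>complex_mat_alg m\<^esub> V) $$ (i, j) =
        (adj (complex_mat_alg m) V \<otimes>\<^bsub>complex_mat_alg m\<^esub> adj (complex_mat_alg m) U) $$ (i, j)" by simp
    qed (use a UV mat_adjoint_index[OF UV(1)] in auto)
    show "(c \<odot>\<^bsub>complex_mat_alg m\<^esub> U) \<otimes>\<^bsub>complex_mat_alg m\<^esub> V = c \<odot>\<^bsub>complex_mat_alg m\<^esub> (U \<otimes>\<^bsub>complex_mat_alg m\<^esub> V)" for c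
      using U V by (simp add: mult_smult_assoc_mat)
    show "U \<otimes>\<^bsub>complex_mat_alg m\<^esub> (c \<odot>\<^bsub>complex_mat_alg m\<^esub> V) = c \<odot>\<^bsub>complex_mat_alg m\<^esub> (U \<otimes>\<^bsub>complex_mat_alg m\<^esub> V)" for c
      using U V by (simp add: mult_smult_distrib)
  next
    fix U :: "complex mat" and c assume "U \<in> carrier (complex_mat_alg m)"
    then have U: "U \<in> carrier_mat m m" by auto
    note a = mat_adjoint_index[OF U]
    have cU: "c \<cdot>\<^sub>m U \<in> carrier_mat m m" using U by auto
    show "adj (complex_mat_alg m) U \<in> carrier (complex_mat_alg m)" using a by simp
    show "adj (complex_mat_alg m) (adj (complex_mat_alg m) U) = U"
      using mat_adjoint_index[OF a(1)] a U by (intro eq_matI) auto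
    show "adj (complex_mat_alg m) (c \<odot>\<^bsub>complex_mat_alg m\<^esub> U) = cnj c \<odot>\<^bsub>complex_mat_alg m\<^esub> adj (complex_mat_alg m) U"
      using mat_adjoint_index[OF cU] a U by (intro eq_matI) auto
  qed
qed

text \<open>
  The operator that acts by the matrix on the first \<open>m\<close> coordinates and vanishes on the others. It embeds
  the matrices isometrically into the bounded operators, so the C*-properties of \<open>op_norm\<close> are inherited.
\<close>

definition mat_op :: "nat \<Rightarrow> complex mat \<Rightarrow> ell2_op" where
  "mat_op m U = (\<lambda>x\<in>ell2. truncate m (\<lambda>i. \<Sum>j<m. U $$ (i, j) * x j))"

lemma truncate_sum: "(\<Sum>j<m. c j * truncate m x j) = (\<Sum>j<m. c j * x j)"
  by (intro sum.cong refl) (simp add: truncate_def)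

lemma truncate_eqI: "(\<And>i. i < m \<Longrightarrow> x i = y i) \<Longrightarrow> truncate m x = truncate m y"
  by (auto simp: truncate_def)

lemma mat_op_bounded: "mat_op m U \<in> bounded_ops"
  unfolding mat_op_def
proof (rule bo_restrictI)
  fix x y assume x: "x \<in> ell2" and y: "y \<in> ell2"
  show "truncate m (\<lambda>i. \<Sum>j<m. U $$ (i, j) * (x j + y j)) =
      (\<lambda>i. truncate m (\<lambda>i. \<Sum>j<m. U $$ (i, j) * x j) i + truncate m (\<lambda>i. \<Sum>j<m. U $$ (i, j) * y j) i)"
    by (auto simp: truncate_def distrib_left sum.distrib)
next
  fix x c assume x: "x \<in> ell2"
  show "truncate m (\<lambda>i. \<Sum>j<m. U $$ (i, j) * (c * x j)) = (\<lambda>i. c * truncate m (\<lambda>i. \<Sum>j<m. U $$ (i, j) * x j) i)"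
    by (auto simp: truncate_def sum_distrib_left mult_ac)
  define R where "R i = (\<Sum>j<m. cmod (U $$ (i, j)))" for i
  define S where "S = (\<Sum>i<m. (R i)\<^sup>2)"
  have "(ell2_norm (truncate m (\<lambda>i. \<Sum>j<m. U $$ (i, j) * x j)))\<^sup>2 \<le> (\<Sum>i<m. (R i * ell2_norm x)\<^sup>2)"
    unfolding truncate_norm_sq
  proof (intro sum_mono power_mono norm_ge_zero)
    fix i
    have "cmod (\<Sum>j<m. U $$ (i, j) * x j) \<le> (\<Sum>j<m. cmod (U $$ (i, j)) * ell2_norm x)"
      by (rule sum_norm_le) (simp add: norm_mult mult_left_mono ell2_coord_le[OF x])
    then show "cmod (\<Sum>j<m. U $$ (i, j) * x j) \<le> R i * ell2_norm x" by (simp add: R_def sum_distrib_right)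
  qed
  also have "\<dots> = S * (ell2_norm x)\<^sup>2" by (simp add: S_def power_mult_distrib sum_distrib_right)
  also have "\<dots> = (sqrt S * ell2_norm x)\<^sup>2" by (simp add: power_mult_distrib S_def sum_nonneg)
  finally show "ell2_norm (truncate m (\<lambda>i. \<Sum>j<m. U $$ (i, j) * x j)) \<le> sqrt S * ell2_norm x"
    by (rule power2_le_imp_le) (intro mult_nonneg_nonneg ell2_norm_nonneg[OF x] real_sqrt_ge_zero, simp add: S_def sum_nonneg)
qed simp

lemma mat_op_basis:
  "mat_op m U (basis_vec j) = truncate m (\<lambda>i. if j < m then U $$ (i, j) else 0)"
proof -
  have "(\<Sum>k<m. U $$ (i, k) * basis_vec j k) = (if j < m then U $$ (i, j) else 0)" for i
  proof -
    have "(\<Sum>k<m. U $$ (i, k) * basis_vec j k) = (\<Sum>k<m. if k = j then U $$ (i, k) else 0)"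
      by (intro sum.cong refl) (simp add: basis_vec_def)
    then show ?thesis by simp
  qed
  then show ?thesis by (simp add: mat_op_def)
qed

lemma mat_op_norm:
  assumes U: "U \<in> carrier_mat m m" shows "cnorm B_ell2 (mat_op m U) = op_norm U"
proof -
  have en: "euclid_norm v = ell2_norm (truncate m (\<lambda>i. v $ i))" if "v \<in> carrier_vec m" for v
  proof -
    have "ell2_norm (truncate m (\<lambda>i. v $ i)) = sqrt ((ell2_norm (truncate m (\<lambda>i. v $ i)))\<^sup>2)" by simp
    then show ?thesis using that unfolding truncate_norm_sq euclid_norm_def by simp
  qed
  have mv: "euclid_norm (U *\<^sub>v v) = ell2_norm (mat_op m U x)"
    if v: "v \<in> carrier_vec m" and x: "x \<in> ell2" and vx: "\<And>j. j < m \<Longrightarrow> v $ j = x j" for v x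
  proof -
    have "(U *\<^sub>v v) $ i = (\<Sum>j<m. U $$ (i, j) * x j)" if i: "i < m" for i
    proof -
      have "(U *\<^sub>v v) $ i = (\<Sum>j<m. row U i $ j * v $ j)"
        using U v i by (simp add: scalar_prod_def lessThan_atLeast0)
      also have "\<dots> = (\<Sum>j<m. U $$ (i, j) * x j)"
        using U i vx by (intro sum.cong refl) simp
      finally show ?thesis .
    qed
    then have "truncate m (\<lambda>i. (U *\<^sub>v v) $ i) = truncate m (\<lambda>i. \<Sum>j<m. U $$ (i, j) * x j)" by (rule truncate_eqI)
    then have "truncate m (\<lambda>i. (U *\<^sub>v v) $ i) = mat_op m U x" using x by (simp add: mat_op_def)
    then show ?thesis using en[of "U *\<^sub>v v"] U v by simp
  qed
  have "(\<lambda>v. euclid_norm (U *\<^sub>v v)) ` {v \<in> carrier_vec m. euclid_norm v \<le> 1} =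
    (\<lambda>x. ell2_norm (mat_op m U x)) ` {x \<in> ell2. ell2_norm x \<le> 1}"
  proof (intro equalityI subsetI)
    fix r assume "r \<in> (\<lambda>v. euclid_norm (U *\<^sub>v v)) ` {v \<in> carrier_vec m. euclid_norm v \<le> 1}"
    then obtain v where v: "v \<in> carrier_vec m" "euclid_norm v \<le> 1" "r = euclid_norm (U *\<^sub>v v)" by blast
    have "r = ell2_norm (mat_op m U (truncate m (\<lambda>i. v $ i)))"
      unfolding v(3) by (rule mv[OF v(1) truncate_ell2]) (simp add: truncate_def)
    then show "r \<in> (\<lambda>x. ell2_norm (mat_op m U x)) ` {x \<in> ell2. ell2_norm x \<le> 1}"
      using v(2) en[OF v(1)] by (intro image_eqI[of _ _ "truncate m (\<lambda>i. v $ i)"]) auto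
  next
    fix r assume "r \<in> (\<lambda>x. ell2_norm (mat_op m U x)) ` {x \<in> ell2. ell2_norm x \<le> 1}"
    then obtain x where x: "x \<in> ell2" "ell2_norm x \<le> 1" "r = ell2_norm (mat_op m U x)" by blast
    have v: "vec m x \<in> carrier_vec m" by simp
    have "(euclid_norm (vec m x))\<^sup>2 \<le> (ell2_norm x)\<^sup>2"
      using ell2_sum_le[OF x(1), of "{..<m}"] by (simp add: euclid_norm_def sum_nonneg)
    then have "euclid_norm (vec m x) \<le> ell2_norm x" by (rule power2_le_imp_le[OF _ ell2_norm_nonneg[OF x(1)]])
    moreover have "r = euclid_norm (U *\<^sub>v vec m x)" unfolding x(3) by (rule mv[OF v x(1), symmetric]) simp
    ultimately show "r \<in> (\<lambda>v. euclid_norm (U *\<^sub>v v)) ` {v \<in> carrier_vec m. euclid_norm v \<le> 1}"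
      using x(2) by (intro image_eqI[of _ _ "vec m x"]) auto
  qed
  then show ?thesis using U by (simp add: op_norm_def cnorm_B_ell2)
qed

lemma mat_op_hom:
  assumes U: "U \<in> carrier_mat m m" and V: "V \<in> carrier_mat m m"
  shows "mat_op m (U * V) = mat_op m U \<otimes>\<^bsub>B_ell2\<^esub> mat_op m V"
    "mat_op m (U + V) = mat_op m U \<oplus>\<^bsub>B_ell2\<^esub> mat_op m V"
    "mat_op m (c \<cdot>\<^sub>m U) = c \<odot>\<^bsub>B_ell2\<^esub> mat_op m U"
    "mat_op m (mat_adjoint U) = adj B_ell2 (mat_op m U)"
proof -
  have m1: "mat_op m (U * V) x = mat_op m U (mat_op m V x)" if x: "x \<in> ell2" for x
  proof -
    have "(\<Sum>k<m. (U * V) $$ (i, k) * x k) = (\<Sum>j<m. U $$ (i, j) * (\<Sum>k<m. V $$ (j, k) * x k))" if i: "i < m" for i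
    proof -
      have "(\<Sum>k<m. (U * V) $$ (i, k) * x k) = (\<Sum>k<m. \<Sum>j<m. U $$ (i, j) * V $$ (j, k) * x k)"
        using mat_mult_index[OF U V i] by (intro sum.cong refl) (simp add: sum_distrib_right del: index_mult_mat)
      also have "\<dots> = (\<Sum>j<m. \<Sum>k<m. U $$ (i, j) * V $$ (j, k) * x k)" by (rule sum.swap)
      finally show ?thesis by (simp add: sum_distrib_left mult.assoc)
    qed
    then have "truncate m (\<lambda>i. \<Sum>k<m. (U * V) $$ (i, k) * x k) =
        truncate m (\<lambda>i. \<Sum>j<m. U $$ (i, j) * (\<Sum>k<m. V $$ (j, k) * x k))" by (rule truncate_eqI)
    then show ?thesis using x by (simp add: mat_op_def truncate_sum del: index_mult_mat)
  qed
  show "mat_op m (U * V) = mat_op m U \<otimes>\<^bsub>B_ell2\<^esub> mat_op m V" unfolding B_ell2_ops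
    by (rule bo_eqI[OF mat_op_bounded B_ell2_mult_closed(1)[OF mat_op_bounded mat_op_bounded]]) (simp add: m1)
  have m2: "mat_op m (U + V) x = (\<lambda>i. mat_op m U x i + mat_op m V x i)" if x: "x \<in> ell2" for x
    using x U V by (auto simp: mat_op_def truncate_def distrib_right sum.distrib)
  show "mat_op m (U + V) = mat_op m U \<oplus>\<^bsub>B_ell2\<^esub> mat_op m V" unfolding B_ell2_ops
    by (rule bo_eqI[OF mat_op_bounded B_ell2_add_closed(1)[OF mat_op_bounded mat_op_bounded]]) (simp add: m2)
  have m3: "mat_op m (c \<cdot>\<^sub>m U) x = (\<lambda>i. c * mat_op m U x i)" if x: "x \<in> ell2" for x
    using x U by (auto simp: mat_op_def truncate_def sum_distrib_left mult.assoc)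
  show "mat_op m (c \<cdot>\<^sub>m U) = c \<odot>\<^bsub>B_ell2\<^esub> mat_op m U" unfolding B_ell2_ops
    by (rule bo_eqI[OF mat_op_bounded B_ell2_scale_closed(1)[OF mat_op_bounded]]) (simp add: m3)
  show "mat_op m (mat_adjoint U) = adj B_ell2 (mat_op m U)" unfolding adj_B_ell2[OF mat_op_bounded]
  proof (rule bo_eqI[OF mat_op_bounded adj_op_closed[OF mat_op_bounded]])
    fix x assume x: "x \<in> ell2"
    show "mat_op m (mat_adjoint U) x = adj_op (mat_op m U) x"
    proof
      fix i
      have "adj_op (mat_op m U) x i = ell2_inner (truncate m (\<lambda>k. if i < m then U $$ (k, i) else 0)) x"
        using x by (simp add: adj_op_def mat_op_basis)
      also have "\<dots> = cnj (ell2_inner x (truncate m (\<lambda>k. if i < m then U $$ (k, i) else 0)))"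
        by (rule ell2_inner_commute[OF x truncate_ell2])
      also have "\<dots> = (\<Sum>k<m. cnj (if i < m then U $$ (k, i) else 0) * x k)"
        unfolding inner_truncate[OF x] by simp
      also have "\<dots> = mat_op m (mat_adjoint U) x i"
      proof (cases "i < m")
        case True
        have "(\<Sum>k<m. cnj (U $$ (k, i)) * x k) = (\<Sum>k<m. mat_adjoint U $$ (i, k) * x k)"
          by (intro sum.cong refl) (simp add: mat_adjoint_index(2)[OF U True])
        with True x show ?thesis by (simp add: mat_op_def truncate_def)
      qed (use x in \<open>simp add: mat_op_def truncate_def\<close>)
      finally show "mat_op m (mat_adjoint U) x i = adj_op (mat_op m U) x i" by simp
    qed
  qed
qed

lemma mat_op_entry: "a < m \<Longrightarrow> b < m \<Longrightarrow> mat_op m U (basis_vec b) a = U $$ (a, b)"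
  by (simp add: mat_op_basis truncate_def)

lemma cstar_algebra_complex_mat: "cstar_algebra (complex_mat_alg m)"
proof -
  interpret C: star_algebra "complex_mat_alg m" by (rule star_algebra_complex_mat)
  interpret B: cstar_algebra B_ell2 by (rule cstar_algebra_B_ell2)
  let ?h = "mat_op m"
  have hc: "?h U \<in> carrier B_ell2" for U using mat_op_bounded by (simp add: B_ell2_ops(1))
  have dif: "?h (U \<ominus>\<^bsub>complex_mat_alg m\<^esub> V) = ?h U \<ominus>\<^bsub>B_ell2\<^esub> ?h V" if "U \<in> carrier_mat m m" "V \<in> carrier_mat m m" for U V
    using that C.diff_conv_smult[of U V] mat_op_hom(2)[of U m "(-1) \<cdot>\<^sub>m V"] mat_op_hom(3)[of V m V "-1"]
    by (simp add: B.diff_conv_smult hc)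
  have difc: "U \<ominus>\<^bsub>complex_mat_alg m\<^esub> V \<in> carrier_mat m m" if "U \<in> carrier_mat m m" "V \<in> carrier_mat m m" for U V
    using C.minus_closed[of U V] that by simp
  have nn: "op_norm U = cnorm B_ell2 (?h U)" if "U \<in> carrier_mat m m" for U using mat_op_norm[OF that] by simp
  have "cstar_algebra_axioms (complex_mat_alg m)"
  proof
    fix U assume "U \<in> carrier (complex_mat_alg m)"
    then have U: "U \<in> carrier_mat m m" by simp
    note Ua = mat_adjoint_index(1)[OF U]
    show "0 \<le> cnorm (complex_mat_alg m) U" using B.cnorm_nonneg[OF hc] by (simp add: nn[OF U])
    show "cnorm (complex_mat_alg m) U = 0 \<longleftrightarrow> U = \<zero>\<^bsub>complex_mat_alg m\<^esub>"
    proof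
      assume "cnorm (complex_mat_alg m) U = 0"
      then have "?h U = \<zero>\<^bsub>B_ell2\<^esub>" using B.cnorm_eq_0_iff[OF hc] by (simp add: nn[OF U])
      then have "?h U (basis_vec b) a = 0" for a b by (simp add: B_ell2_ops)
      then show "U = \<zero>\<^bsub>complex_mat_alg m\<^esub>" using U mat_op_entry[of _ m _ U] by (intro eq_matI) auto
    next
      assume "U = \<zero>\<^bsub>complex_mat_alg m\<^esub>"
      then have "0 \<cdot>\<^sub>m U = U" by (intro eq_matI) auto
      then have "?h U = 0 \<odot>\<^bsub>B_ell2\<^esub> ?h U" using mat_op_hom(3)[OF U U, of 0] by simp
      then have "?h U = \<zero>\<^bsub>B_ell2\<^esub>" using hc by simp
      then show "cnorm (complex_mat_alg m) U = 0" by (simp add: nn[OF U])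
    qed
    show "cnorm (complex_mat_alg m) (c \<odot>\<^bsub>complex_mat_alg m\<^esub> U) = cmod c * cnorm (complex_mat_alg m) U" for c
      using B.cnorm_smult[OF hc] U by (simp add: nn mat_op_hom(3)[OF U U])
    show "cnorm (complex_mat_alg m) (adj (complex_mat_alg m) U \<otimes>\<^bsub>complex_mat_alg m\<^esub> U) = (cnorm (complex_mat_alg m) U)\<^sup>2"
      using B.cnorm_cstar[OF hc] U Ua by (simp add: nn mat_op_hom(1)[OF Ua U] mat_op_hom(4)[OF U U])
    fix V assume "V \<in> carrier (complex_mat_alg m)"
    then have V: "V \<in> carrier_mat m m" by simp
    show "cnorm (complex_mat_alg m) (U \<oplus>\<^bsub>complex_mat_alg m\<^esub> V) \<le> cnorm (complex_mat_alg m) U + cnorm (complex_mat_alg m) V"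
      using B.cnorm_triangle[OF hc hc] U V by (simp add: nn mat_op_hom(2)[OF U V])
    show "cnorm (complex_mat_alg m) (U \<otimes>\<^bsub>complex_mat_alg m\<^esub> V) \<le> cnorm (complex_mat_alg m) U * cnorm (complex_mat_alg m) V"
      using B.cnorm_mult[OF hc hc] U V by (simp add: nn mat_op_hom(1)[OF U V])
  next
    fix f :: "nat \<Rightarrow> complex mat" assume "\<forall>i. f i \<in> carrier (complex_mat_alg m)"
      and cau: "\<forall>e>0. \<exists>N. \<forall>i\<ge>N. \<forall>j\<ge>N. cnorm (complex_mat_alg m) (f i \<ominus>\<^bsub>complex_mat_alg m\<^esub> f j) < e"
    then have f: "\<And>i. f i \<in> carrier_mat m m" by simp
    have "\<forall>e>0. \<exists>N. \<forall>i\<ge>N. \<forall>j\<ge>N. cnorm B_ell2 (?h (f i) \<ominus>\<^bsub>B_ell2\<^esub> ?h (f j)) < e"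
      using cau unfolding complex_mat_alg_ops(8) nn[OF difc[OF f f]] dif[OF f f] .
    then obtain T where T: "T \<in> carrier B_ell2" "(\<lambda>i. cnorm B_ell2 (?h (f i) \<ominus>\<^bsub>B_ell2\<^esub> T)) \<longlonglongrightarrow> 0"
      using B.complete[of "\<lambda>i. ?h (f i)"] hc by blast
    have Tb: "T \<in> bounded_ops" using T(1) by (simp add: B_ell2_ops(1))
    \<comment> \<open>The entries of the limit operator are the limits of the entries, so it comes from a matrix.\<close>
    have ent: "(\<lambda>i. ?h (f i) (basis_vec b) a) \<longlonglongrightarrow> T (basis_vec b) a" for a b
    proof -
      have "norm (?h (f i) (basis_vec b) a - T (basis_vec b) a) \<le> cnorm B_ell2 (?h (f i) \<ominus>\<^bsub>B_ell2\<^esub> T) * ell2_norm (basis_vec b)" for i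
      proof -
        have D: "?h (f i) \<ominus>\<^bsub>B_ell2\<^esub> T \<in> bounded_ops" using B.minus_closed[OF hc T(1)] by (simp add: B_ell2_ops(1))
        have "(?h (f i) \<ominus>\<^bsub>B_ell2\<^esub> T) (basis_vec b) a = ?h (f i) (basis_vec b) a - T (basis_vec b) a"
          unfolding B.diff_conv_smult[OF hc T(1)] by (simp add: B_ell2_ops)
        then show ?thesis using ell2_coord_le[OF bo_closed[OF D basis_vec_ell2], of b a] op_le[OF D basis_vec_ell2, of b] by simp
      qed
      then have "\<forall>\<^sub>F i in sequentially. norm (?h (f i) (basis_vec b) a - T (basis_vec b) a) \<le>
          norm (cnorm B_ell2 (?h (f i) \<ominus>\<^bsub>B_ell2\<^esub> T)) * ell2_norm (basis_vec b)"
        using B.cnorm_nonneg[OF B.minus_closed[OF hc T(1)]] by (intro always_eventually allI) simp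
      then have "(\<lambda>i. ?h (f i) (basis_vec b) a - T (basis_vec b) a) \<longlonglongrightarrow> 0"
        by (rule tendsto_0_le[OF T(2)])
      then show ?thesis by (rule LIM_zero_cancel)
    qed
    define U where "U = mat m m (\<lambda>(a, b). T (basis_vec b) a)"
    have U: "U \<in> carrier_mat m m" by (simp add: U_def)
    have "?h U = T"
    proof (rule bo_eq_basisI[OF mat_op_bounded Tb])
      fix b show "?h U (basis_vec b) = T (basis_vec b)"
      proof
        fix a
        show "?h U (basis_vec b) a = T (basis_vec b) a"
        proof (cases "a < m \<and> b < m")
          case True
          then show ?thesis using mat_op_entry[of a m b U] by (simp add: U_def)
        next
          case False
          then have 0: "?h V (basis_vec b) a = 0" for V by (auto simp: mat_op_basis truncate_def)
          have "T (basis_vec b) a = 0" using ent[of b a] unfolding 0 by (simp add: LIMSEQ_const_iff)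
          then show ?thesis by (simp add: 0)
        qed
      qed
    qed
    then have "(\<lambda>i. cnorm (complex_mat_alg m) (f i \<ominus>\<^bsub>complex_mat_alg m\<^esub> U)) \<longlonglongrightarrow> 0"
      using T(2) unfolding complex_mat_alg_ops(8) nn[OF difc[OF f U]] dif[OF f U] by simp
    then show "\<exists>x\<in>carrier (complex_mat_alg m). (\<lambda>i. cnorm (complex_mat_alg m) (f i \<ominus>\<^bsub>complex_mat_alg m\<^esub> x)) \<longlonglongrightarrow> 0"
      using U by (intro bexI[of _ U]) auto
  qed
  then show ?thesis by (intro cstar_algebra.intro C.star_algebra_axioms)
qed

definition ntrace :: "nat \<Rightarrow> complex mat \<Rightarrow> complex" where
  "ntrace m U = (\<Sum>i<m. U $$ (i, i)) / of_nat m"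

lemma ntrace_adj_mult:
  assumes U: "U \<in> carrier_mat m m"
  shows "ntrace m (mat_adjoint U * U) = complex_of_real ((\<Sum>i<m. \<Sum>k<m. (cmod (U $$ (k, i)))\<^sup>2) / real m)"
proof -
  have "(mat_adjoint U * U) $$ (i, i) = complex_of_real (\<Sum>k<m. (cmod (U $$ (k, i)))\<^sup>2)" if i: "i < m" for i
    using mat_mult_index[OF mat_adjoint_index(1)[OF U] U i i] mat_adjoint_index(2)[OF U i]
    by (simp add: cnj_mult_self del: index_mult_mat)
  then show ?thesis by (simp add: ntrace_def del: index_mult_mat)
qed

lemma tracial_complex_mat:
  assumes m: "m \<ge> 1" shows "tracial_star_algebra (complex_mat_alg m) (ntrace m)"
proof (intro tracial_star_algebra.intro tracial_star_algebra_axioms.intro star_algebra_complex_mat)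
  fix U V assume "U \<in> carrier (complex_mat_alg m)" "V \<in> carrier (complex_mat_alg m)"
  then have U: "U \<in> carrier_mat m m" and V: "V \<in> carrier_mat m m" by auto
  show "ntrace m (U \<oplus>\<^bsub>complex_mat_alg m\<^esub> V) = ntrace m U + ntrace m V"
    using U V by (simp add: ntrace_def sum.distrib add_divide_distrib)
  have "(\<Sum>i<m. (U * V) $$ (i, i)) = (\<Sum>i<m. \<Sum>k<m. U $$ (i, k) * V $$ (k, i))"
    by (intro sum.cong refl mat_mult_index[OF U V]) auto
  also have "\<dots> = (\<Sum>k<m. \<Sum>i<m. V $$ (k, i) * U $$ (i, k))" by (subst sum.swap) (simp add: mult.commute)
  also have "\<dots> = (\<Sum>k<m. (V * U) $$ (k, k))"
    by (intro sum.cong refl mat_mult_index[OF V U, symmetric]) auto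
  finally show "ntrace m (U \<otimes>\<^bsub>complex_mat_alg m\<^esub> V) = ntrace m (V \<otimes>\<^bsub>complex_mat_alg m\<^esub> U)" by (simp add: ntrace_def)
next
  fix U c assume "U \<in> carrier (complex_mat_alg m)"
  then have U: "U \<in> carrier_mat m m" by auto
  show "ntrace m (c \<odot>\<^bsub>complex_mat_alg m\<^esub> U) = c * ntrace m U"
    using U by (simp add: ntrace_def sum_distrib_left)
  show "ntrace m (adj (complex_mat_alg m) U \<otimes>\<^bsub>complex_mat_alg m\<^esub> U) \<in> \<real>\<^sub>\<ge>\<^sub>0"
    using ntrace_adj_mult[OF U] by (simp add: complex_nonneg_Reals_iff sum_nonneg del: of_real_divide of_real_sum)
next
  show "ntrace m \<one>\<^bsub>complex_mat_alg m\<^esub> = 1" using m by (simp add: ntrace_def)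
qed

lemma fd_subalgebra_complex_mat:
  assumes m: "m \<ge> 1" shows "\<exists>k e. fd_subalgebra (complex_mat_alg m) (ntrace m) k e (carrier_mat m m)"
proof -
  interpret tracial_star_algebra "complex_mat_alg m" "ntrace m" by (rule tracial_complex_mat[OF m])
  let ?E = "\<lambda>(a, b). mat m m (\<lambda>(i, j). if i = a \<and> j = b then 1 else (0::complex))"
  let ?I = "{..<m} \<times> {..<m}"
  show ?thesis
  proof (rule fd_subalgebra_exists)
    show "star_subalgebra (complex_mat_alg m) (carrier_mat m m)"
      unfolding star_subalgebra_def using carrier_is_subring vs.carrier_is_submodule adj_closed by simp
    have "U \<in> W" if U: "U \<in> carrier_mat m m" and W: "Module.submodule W complex_field (complex_mat_alg m)" "?E ` ?I \<subseteq> W" for U W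
    proof -
      let ?s = "\<Oplus>\<^bsub>complex_mat_alg m\<^esub>p\<in>?I. U $$ p \<odot>\<^bsub>complex_mat_alg m\<^esub> ?E p"
      have sm: "U $$ p \<odot>\<^bsub>complex_mat_alg m\<^esub> ?E p \<in> W" if "p \<in> ?I" for p
        using vs.submoduleE(4)[OF W(1), of "U $$ p" "?E p"] W(2) that by auto
      have sW: "?s \<in> W" by (rule finsum_in_submodule[OF W(1) _ sm]) auto
      have Wc: "W \<subseteq> carrier_mat m m" using vs.submoduleE(1)[OF W(1)] by simp
      have "?s $$ (a, b) = U $$ (a, b)" if ab: "a < m" "b < m" for a b
      proof -
        have lf: "lin_fun (complex_mat_alg m) (carrier (complex_mat_alg m)) (\<lambda>X. X $$ (a, b))"
          using ab by (simp add: lin_fun_def)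
        have "?s $$ (a, b) = (\<Sum>p\<in>?I. (U $$ p \<odot>\<^bsub>complex_mat_alg m\<^esub> ?E p) $$ (a, b))"
          by (rule lin_fun_finsum[OF lf vs.carrier_is_submodule]) auto
        also have "\<dots> = (\<Sum>p\<in>?I. if p = (a, b) then U $$ p else 0)"
          using ab by (intro sum.cong refl) (auto split: if_splits)
        also have "\<dots> = U $$ (a, b)" using ab by simp
        finally show ?thesis .
      qed
      then have "?s = U" using U sW Wc by (intro eq_matI) auto
      then show ?thesis using sW by simp
    qed
    then have "carrier_mat m m \<subseteq> lin_span (complex_mat_alg m) (?E ` ?I)" unfolding lin_span_def by blast
    then show "finite_dim (complex_mat_alg m) (carrier_mat m m)"
      unfolding finite_dim_def by (intro exI[of _ "?E ` ?I"]) auto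
    fix U assume U: "U \<in> carrier_mat m m" and 0: "ntrace m (adj (complex_mat_alg m) U \<otimes>\<^bsub>complex_mat_alg m\<^esub> U) = 0"
    have "(\<Sum>i<m. \<Sum>k<m. (cmod (U $$ (k, i)))\<^sup>2) = 0"
      using 0 m unfolding complex_mat_alg_ops ntrace_adj_mult[OF U] of_real_eq_0_iff by simp
    then have "U $$ (k, i) = 0" if "k < m" "i < m" for k i
      using that by (simp add: sum_nonneg_eq_0_iff sum_nonneg)
    then show "U = \<zero>\<^bsub>complex_mat_alg m\<^esub>" using U by (intro eq_matI) auto
  qed
qed

section \<open>Ideals of null sequences\<close>

locale tracial_cstar_algebra = cstar_algebra A + tracial_star_algebra A \<tau>
  for A :: "('a, 'm) cstar_scheme" (structure) and \<tau>
begin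

text \<open>
  The square of the norm of \<open>L\<^sup>2(A, \<tau>)\<close>.
\<close>

definition tr_norm_sq :: "'a \<Rightarrow> real" where "tr_norm_sq x = Re (\<tau> (adj A x \<otimes> x))"

lemma tr_norm_sq_nonneg: "x \<in> carrier A \<Longrightarrow> 0 \<le> tr_norm_sq x"
  using tr_pos[of x] by (simp add: tr_norm_sq_def complex_nonneg_Reals_iff)

lemma tr_norm_sq_tr: "x \<in> carrier A \<Longrightarrow> \<tau> (adj A x \<otimes> x) = complex_of_real (tr_norm_sq x)"
  using tr_pos[of x] by (simp add: tr_norm_sq_def complex_nonneg_Reals_iff complex_eq_iff)

lemma tr_norm_sq_add:
  assumes [simp]: "x \<in> carrier A" "y \<in> carrier A" shows "tr_norm_sq (x \<oplus> y) \<le> 2 * tr_norm_sq x + 2 * tr_norm_sq y"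
proof -
  have "adj A (x \<oplus> y) \<otimes> (x \<oplus> y) = adj A x \<otimes> x \<oplus> adj A x \<otimes> y \<oplus> (adj A y \<otimes> x \<oplus> adj A y \<otimes> y)"
    "adj A (x \<ominus> y) \<otimes> (x \<ominus> y) = adj A x \<otimes> x \<ominus> adj A x \<otimes> y \<ominus> adj A y \<otimes> x \<oplus> adj A y \<otimes> y"
    by (simp_all add: adj_add adj_diff group_ring_simps)
  then have "tr_norm_sq (x \<oplus> y) + tr_norm_sq (x \<ominus> y) = 2 * tr_norm_sq x + 2 * tr_norm_sq y"
    by (simp add: tr_norm_sq_def tr_diff tr_add)
  then show ?thesis using tr_norm_sq_nonneg[of "x \<ominus> y"] by simp
qed

lemma tr_norm_sq_adj: "x \<in> carrier A \<Longrightarrow> tr_norm_sq (adj A x) = tr_norm_sq x"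
  by (simp add: tr_norm_sq_def tr_comm[of x])

text \<open>
  Write \<open>2 t - a* a = c* c\<close>; then \<open>2 t \<tau> (x* x) - \<tau> (x* a* a x) = \<tau> ((c x)* (c x)) \<ge> 0\<close>.
\<close>

lemma tr_norm_sq_mult_left:
  assumes [simp]: "a \<in> carrier A" "x \<in> carrier A" and t: "t > 0" "(cnorm A a)\<^sup>2 \<le> t"
  shows "tr_norm_sq (a \<otimes> x) \<le> 2 * t * tr_norm_sq x"
proof -
  obtain c where [simp]: "c \<in> carrier A" and c: "adj A c \<otimes> c = complex_of_real (2 * t) \<odot> \<one> \<ominus> adj A a \<otimes> a"
    using norm_bound_square[OF _ t] by auto
  have "adj A (c \<otimes> x) \<otimes> (c \<otimes> x) = adj A x \<otimes> (adj A c \<otimes> c) \<otimes> x" by (simp add: adj_mult m_assoc)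
  also have "\<dots> = complex_of_real (2 * t) \<odot> (adj A x \<otimes> x) \<ominus> adj A (a \<otimes> x) \<otimes> (a \<otimes> x)"
    unfolding c by (simp add: mult_diff diff_mult smult_mult_left smult_mult_right adj_mult m_assoc)
  finally have "tr_norm_sq (c \<otimes> x) = 2 * t * tr_norm_sq x - tr_norm_sq (a \<otimes> x)"
    by (simp add: tr_norm_sq_def tr_diff tr_smult)
  then show ?thesis using tr_norm_sq_nonneg[of "c \<otimes> x"] by simp
qed

lemma tr_norm_sq_mult_right:
  assumes [simp]: "a \<in> carrier A" "x \<in> carrier A" and t: "t > 0" "(cnorm A a)\<^sup>2 \<le> t"
  shows "tr_norm_sq (x \<otimes> a) \<le> 2 * t * tr_norm_sq x"
proof -
  have "tr_norm_sq (adj A a \<otimes> adj A x) \<le> 2 * t * tr_norm_sq (adj A x)"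
    by (rule tr_norm_sq_mult_left) (use t in \<open>simp_all add: cnorm_adj\<close>)
  then show ?thesis using tr_norm_sq_adj[of x] tr_norm_sq_adj[of "x \<otimes> a"] by (simp add: adj_mult)
qed

lemma tr_norm_sq_bound:
  assumes [simp]: "a \<in> carrier A" and t: "t > 0" "(cnorm A a)\<^sup>2 \<le> t" shows "tr_norm_sq a \<le> 2 * t"
  using tr_norm_sq_mult_left[OF _ one_closed t] by (simp add: tr_norm_sq_def[of "\<one>"] tr_one)

end

text \<open>
  The two ideals of the theorem are instances: \<open>N m\<close> is the square of the operator norm for the sequences
  that converge to zero in norm, and the square of the trace norm for the ideal that defines the ultrapower.
  For closedness, an element at distance at most \<open>sqrt t\<close> from the ideal satisfies
  \<open>N m (x m) \<le> 2 N m (f m) + 4 t\<close> with \<open>f\<close> in the ideal.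
\<close>

lemma closed_ideal_null_sequences:
  fixes B :: "nat \<Rightarrow> 'b cstar" and N :: "nat \<Rightarrow> 'b \<Rightarrow> real" and F :: "nat filter"
  assumes B: "\<And>m. cstar_algebra (B m)"
    and nonneg: "\<And>m x. x \<in> carrier (B m) \<Longrightarrow> 0 \<le> N m x"
    and add: "\<And>m x y. x \<in> carrier (B m) \<Longrightarrow> y \<in> carrier (B m) \<Longrightarrow> N m (x \<oplus>\<^bsub>B m\<^esub> y) \<le> 2 * N m x + 2 * N m y"
    and left: "\<And>m a x t. a \<in> carrier (B m) \<Longrightarrow> x \<in> carrier (B m) \<Longrightarrow> t > 0 \<Longrightarrow> (cnorm (B m) a)\<^sup>2 \<le> t \<Longrightarrow> N m (a \<otimes>\<^bsub>B m\<^esub> x) \<le> 2 * t * N m x"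
    and right: "\<And>m a x t. a \<in> carrier (B m) \<Longrightarrow> x \<in> carrier (B m) \<Longrightarrow> t > 0 \<Longrightarrow> (cnorm (B m) a)\<^sup>2 \<le> t \<Longrightarrow> N m (x \<otimes>\<^bsub>B m\<^esub> a) \<le> 2 * t * N m x"
    and adj: "\<And>m x. x \<in> carrier (B m) \<Longrightarrow> N m (adj (B m) x) = N m x"
    and bound: "\<And>m a t. a \<in> carrier (B m) \<Longrightarrow> t > 0 \<Longrightarrow> (cnorm (B m) a)\<^sup>2 \<le> t \<Longrightarrow> N m a \<le> 2 * t"
  defines "J \<equiv> {x \<in> carrier (linf_prod B). ((\<lambda>m. N m (x m)) \<longlongrightarrow> 0) F}"
  shows "closed_ideal J (linf_prod B)" "\<And>x. x \<in> J \<Longrightarrow> adj (linf_prod B) x \<in> J"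
proof -
  let ?P = "linf_prod B"
  interpret B: cstar_algebra "B m" for m by (rule B)
  interpret P: cstar_algebra ?P by (rule cstar_algebra_linf_prod(1)[OF B])
  have ent: "x m \<in> carrier (B m)" if "x \<in> carrier ?P" for x m using that by (simp add: linf_prod_carrier)
  have dom: "y \<in> J" if y: "y \<in> carrier ?P" and x: "x \<in> J" and K: "\<And>m. N m (y m) \<le> K * N m (x m)" for x y K
  proof -
    have x': "x \<in> carrier ?P" "((\<lambda>m. N m (x m)) \<longlongrightarrow> 0) F" using x by (auto simp: J_def)
    have "norm (N m (y m)) \<le> norm (N m (x m)) * K" for m
      using K[of m] nonneg[OF ent[OF y], of m] nonneg[OF ent[OF x'(1)], of m] by (simp add: mult.commute)
    then have "((\<lambda>m. N m (y m)) \<longlongrightarrow> 0) F" by (intro tendsto_0_le[OF x'(2)] always_eventually allI)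
    then show ?thesis using y by (simp add: J_def)
  qed
  have nb: "\<exists>t>0. \<forall>m. (cnorm (B m) (a m))\<^sup>2 \<le> t" if a: "a \<in> carrier ?P" for a
  proof -
    obtain C where C: "\<And>m. cnorm (B m) (a m) \<le> C" using a by (auto simp: linf_prod_carrier)
    have "(cnorm (B m) (a m))\<^sup>2 \<le> C\<^sup>2 + 1" for m
      using power_mono[OF C B.cnorm_nonneg[OF ent[OF a]], of m 2] by simp
    then show ?thesis by (intro exI[of _ "C\<^sup>2 + 1"]) (simp add: add_nonneg_pos)
  qed
  have addJ: "x \<oplus>\<^bsub>?P\<^esub> y \<in> J" if x: "x \<in> J" and y: "y \<in> J" for x y
  proof -
    have x': "x \<in> carrier ?P" "((\<lambda>m. N m (x m)) \<longlongrightarrow> 0) F" and y': "y \<in> carrier ?P" "((\<lambda>m. N m (y m)) \<longlongrightarrow> 0) F"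
      using x y by (auto simp: J_def)
    have l: "((\<lambda>m. 2 * N m (x m) + 2 * N m (y m)) \<longlongrightarrow> 0) F"
      using tendsto_add[OF tendsto_mult_right_zero[OF x'(2), of 2] tendsto_mult_right_zero[OF y'(2), of 2]] by simp
    have "norm (N m ((x \<oplus>\<^bsub>?P\<^esub> y) m)) \<le> norm (2 * N m (x m) + 2 * N m (y m)) * 1" for m
      using add[OF ent[OF x'(1)] ent[OF y'(1)], of m] nonneg[OF B.a_closed[OF ent[OF x'(1)] ent[OF y'(1)]], of m] by simp
    then have "((\<lambda>m. N m ((x \<oplus>\<^bsub>?P\<^esub> y) m)) \<longlongrightarrow> 0) F" by (intro tendsto_0_le[OF l] always_eventually allI)
    then show ?thesis using P.a_closed[OF x'(1) y'(1)] unfolding J_def by blast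
  qed
  have leftJ: "a \<otimes>\<^bsub>?P\<^esub> x \<in> J" and rightJ: "x \<otimes>\<^bsub>?P\<^esub> a \<in> J" if x: "x \<in> J" and a: "a \<in> carrier ?P" for a x
  proof -
    have xP: "x \<in> carrier ?P" using x by (simp add: J_def)
    obtain t where t: "t > 0" "\<And>m. (cnorm (B m) (a m))\<^sup>2 \<le> t" using nb[OF a] by auto
    show "a \<otimes>\<^bsub>?P\<^esub> x \<in> J"
      by (rule dom[OF P.m_closed[OF a xP] x]) (use left[OF ent[OF a] ent[OF xP] t] in simp)
    show "x \<otimes>\<^bsub>?P\<^esub> a \<in> J"
      by (rule dom[OF P.m_closed[OF xP a] x]) (use right[OF ent[OF a] ent[OF xP] t] in simp)
  qed
  have zero: "N m \<zero>\<^bsub>B m\<^esub> = 0" for m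
  proof (rule antisym)
    show "N m \<zero>\<^bsub>B m\<^esub> \<le> 0"
    proof (rule field_le_epsilon)
      fix r :: real assume "r > 0"
      then show "N m \<zero>\<^bsub>B m\<^esub> \<le> 0 + r" using bound[of "\<zero>\<^bsub>B m\<^esub>" m "r / 2"] by simp
    qed
  qed (simp add: nonneg)
  have zeroJ: "\<zero>\<^bsub>?P\<^esub> \<in> J" using P.zero_closed by (simp add: J_def zero)
  have negJ: "\<ominus>\<^bsub>?P\<^esub> x \<in> J" if x: "x \<in> J" for x
  proof -
    have xP: "x \<in> carrier ?P" using x by (simp add: J_def)
    have "(\<ominus>\<^bsub>?P\<^esub> \<one>\<^bsub>?P\<^esub>) \<otimes>\<^bsub>?P\<^esub> x = \<ominus>\<^bsub>?P\<^esub> x"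
      using P.l_minus[OF P.one_closed xP] P.l_one[OF xP] by (simp del: linf_prod_ops)
    then show ?thesis using leftJ[OF x P.a_inv_closed[OF P.one_closed]] by (simp del: linf_prod_ops)
  qed
  have id: "ideal J ?P"
  proof (rule idealI[OF P.ring_axioms])
    show "subgroup J (add_monoid ?P)"
    proof (rule group.subgroupI[OF P.a_group])
      show "J \<subseteq> carrier (add_monoid ?P)" by (auto simp: J_def)
      show "J \<noteq> {}" using zeroJ by blast
      show "inv\<^bsub>add_monoid ?P\<^esub> x \<in> J" if "x \<in> J" for x using negJ[OF that] by (simp add: a_inv_def)
      show "x \<otimes>\<^bsub>add_monoid ?P\<^esub> y \<in> J" if "x \<in> J" "y \<in> J" for x y using addJ[OF that] by simp
    qed
  qed (rule leftJ rightJ; assumption)+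
  show "adj ?P x \<in> J" if x: "x \<in> J" for x
  proof -
    have xP: "x \<in> carrier ?P" using x by (simp add: J_def)
    show ?thesis by (rule dom[OF P.adj_closed[OF xP] x, of 1]) (simp add: adj ent[OF xP])
  qed
  show "closed_ideal J ?P" unfolding closed_ideal_def
  proof (intro conjI id allI ballI impI)
    fix f x assume x: "x \<in> carrier ?P" and fx: "(\<forall>i. f i \<in> J) \<and> (\<lambda>i. cnorm ?P (f i \<ominus>\<^bsub>?P\<^esub> x)) \<longlonglongrightarrow> 0"
    have fJ: "f i \<in> J" for i using fx by blast
    have fP: "f i \<in> carrier ?P" for i using fJ[of i] by (simp add: J_def)
    have lim: "((\<lambda>m. N m (x m)) \<longlongrightarrow> 0) F"
    proof (rule tendstoI)
      fix r :: real assume r: "r > 0"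
      define t where "t = r / 8"
      have t: "t > 0" using r by (simp add: t_def)
      have "\<forall>\<^sub>F i in sequentially. cnorm ?P (f i \<ominus>\<^bsub>?P\<^esub> x) < sqrt t"
        using fx t by (intro order_tendstoD(2)[of _ 0]) auto
      then obtain i where i: "cnorm ?P (f i \<ominus>\<^bsub>?P\<^esub> x) < sqrt t" using eventually_happens'[of sequentially] by auto
      define d where "d = x \<ominus>\<^bsub>?P\<^esub> f i"
      have dP: "d \<in> carrier ?P" unfolding d_def by (rule P.minus_closed[OF x fP])
      have dn: "cnorm ?P d < sqrt t" using i P.cnorm_minus[OF fP x] by (simp add: d_def del: linf_prod_ops)
      have "(cnorm (B m) (d m))\<^sup>2 \<le> t" for m
      proof -
        have "bdd_above (range (\<lambda>m. cnorm (B m) (d m)))" using dP by (auto simp: linf_prod_carrier bdd_above_def)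
        then have "cnorm (B m) (d m) \<le> cnorm ?P d" unfolding linf_prod_ops by (intro cSUP_upper) auto
        then have "(cnorm (B m) (d m))\<^sup>2 \<le> (sqrt t)\<^sup>2"
          using dn B.cnorm_nonneg[OF ent[OF dP], of m] by (intro power_mono) auto
        then show ?thesis using t by simp
      qed
      then have Nd: "N m (d m) \<le> 2 * t" for m by (rule bound[OF ent[OF dP] t])
      have "f i \<oplus>\<^bsub>?P\<^esub> d = x" unfolding d_def using x fP by (simp add: P.group_simps del: linf_prod_ops)
      then have xm: "x m = f i m \<oplus>\<^bsub>B m\<^esub> d m" for m by auto
      have Nx: "N m (x m) \<le> 2 * N m (f i m) + 4 * t" for m
        using add[OF ent[OF fP[of i]] ent[OF dP], of m] Nd[of m] by (simp flip: xm)
      have "((\<lambda>m. N m (f i m)) \<longlongrightarrow> 0) F" using fJ[of i] by (simp add: J_def)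
      then have "\<forall>\<^sub>F m in F. N m (f i m) < t" using t by (intro order_tendstoD(2)[of _ 0]) auto
      then show "\<forall>\<^sub>F m in F. dist (N m (x m)) 0 < r"
      proof eventually_elim
        case (elim m)
        then show ?case using Nx[of m] nonneg[OF ent[OF x], of m] r by (simp add: t_def dist_real_def)
      qed
    qed
    then show "x \<in> J" using x by (simp add: J_def)
  qed
qed

section \<open>Approximation in the hyperfinite factor\<close>

lemma vn_alg_ops [simp]:
  "carrier (vn_alg M) = M" "x \<otimes>\<^bsub>vn_alg M\<^esub> y = x \<otimes>\<^bsub>B_ell2\<^esub> y" "x \<oplus>\<^bsub>vn_alg M\<^esub> y = x \<oplus>\<^bsub>B_ell2\<^esub> y"
  "\<one>\<^bsub>vn_alg M\<^esub> = \<one>\<^bsub>B_ell2\<^esub>" "\<zero>\<^bsub>vn_alg M\<^esub> = \<zero>\<^bsub>B_ell2\<^esub>" "c \<odot>\<^bsub>vn_alg M\<^esub> x = c \<odot>\<^bsub>B_ell2\<^esub> x"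
  "adj (vn_alg M) = adj B_ell2" "cnorm (vn_alg M) = cnorm B_ell2"
  by (simp_all add: vn_alg_def)

lemma tracial_vn_alg:
  assumes M: "von_neumann_algebra M" and t: "faithful_normal_trace M \<tau>"
  shows "tracial_cstar_algebra (vn_alg M) \<tau>"
proof -
  interpret V: cstar_algebra "vn_alg M" by (rule cstar_algebra_vn_alg[OF M])
  have s: "\<tau> \<in> states (vn_alg M)" and c: "\<And>S T. S \<in> M \<Longrightarrow> T \<in> M \<Longrightarrow> \<tau> (S \<otimes>\<^bsub>B_ell2\<^esub> T) = \<tau> (T \<otimes>\<^bsub>B_ell2\<^esub> S)"
    using t unfolding faithful_normal_trace_def by auto
  have "tracial_star_algebra (vn_alg M) \<tau>"
  proof (intro tracial_star_algebra.intro tracial_star_algebra_axioms.intro V.star_algebra_axioms)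
    fix x assume x: "x \<in> carrier (vn_alg M)"
    then have "adj (vn_alg M) x \<otimes>\<^bsub>vn_alg M\<^esub> x \<in> pos_cone (vn_alg M)" unfolding pos_cone_def by blast
    then show "\<tau> (adj (vn_alg M) x \<otimes>\<^bsub>vn_alg M\<^esub> x) \<in> \<real>\<^sub>\<ge>\<^sub>0" using s unfolding states_def by blast
  qed (use s c in \<open>simp_all add: states_def\<close>)
  then show ?thesis by (intro tracial_cstar_algebra.intro V.cstar_algebra_axioms)
qed

text \<open>
  If \<open>\<tau>\<close> is given by the families \<open>\<xi>\<close> and \<open>\<eta>\<close>, then each term of \<open>\<tau> (d* d)\<close> is an inner product of \<open>d \<eta>\<^sub>i\<close> and
  \<open>d \<xi>\<^sub>i\<close>, bounded by the sum of their squared norms. So the bicommutant argument is applied to both families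
  at once, interleaved into the family \<open>\<zeta>\<close>.
\<close>

lemma trace_dense:
  assumes t: "normal_functional M \<tau>" and Mb: "M \<subseteq> bounded_ops"
    and Madj: "\<And>T. T \<in> M \<Longrightarrow> adj B_ell2 T \<in> M" and Mm: "\<And>S T. S \<in> M \<Longrightarrow> T \<in> M \<Longrightarrow> S \<otimes>\<^bsub>B_ell2\<^esub> T \<in> M"
    and Md: "\<And>S T. S \<in> M \<Longrightarrow> T \<in> M \<Longrightarrow> S \<ominus>\<^bsub>B_ell2\<^esub> T \<in> M"
    and D: "D \<subseteq> M" "\<one>\<^bsub>B_ell2\<^esub> \<in> D"
    "\<And>S T. S \<in> D \<Longrightarrow> T \<in> D \<Longrightarrow> S \<oplus>\<^bsub>B_ell2\<^esub> T \<in> D" "\<And>S T. S \<in> D \<Longrightarrow> T \<in> D \<Longrightarrow> S \<otimes>\<^bsub>B_ell2\<^esub> T \<in> D"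
    "\<And>c T. T \<in> D \<Longrightarrow> c \<odot>\<^bsub>B_ell2\<^esub> T \<in> D" "\<And>T. T \<in> D \<Longrightarrow> adj B_ell2 T \<in> D"
    and x: "x \<in> commutant (commutant D)" "x \<in> M" and \<epsilon>: "\<epsilon> > 0"
  shows "\<exists>b\<in>D. cmod (\<tau> (adj B_ell2 (x \<ominus>\<^bsub>B_ell2\<^esub> b) \<otimes>\<^bsub>B_ell2\<^esub> (x \<ominus>\<^bsub>B_ell2\<^esub> b))) \<le> \<epsilon>"
proof -
  interpret B: cstar_algebra B_ell2 by (rule cstar_algebra_B_ell2)
  obtain \<xi> \<eta> :: "nat \<Rightarrow> nat \<Rightarrow> complex" where H: "(\<forall>i. \<xi> i \<in> ell2 \<and> \<eta> i \<in> ell2) \<and>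
      summable (\<lambda>i. (ell2_norm (\<xi> i))\<^sup>2) \<and> summable (\<lambda>i. (ell2_norm (\<eta> i))\<^sup>2) \<and>
      (\<forall>T\<in>M. \<tau> T = (\<Sum>i. ell2_inner (\<eta> i) (T (\<xi> i))))"
    using t unfolding normal_functional_def by (elim exE)
  have e2: "\<xi> i \<in> ell2" "\<eta> i \<in> ell2" for i using H by blast+
  have sm: "summable (\<lambda>i. (ell2_norm (\<xi> i))\<^sup>2)" "summable (\<lambda>i. (ell2_norm (\<eta> i))\<^sup>2)" using H by blast+
  have tau: "\<tau> T = (\<Sum>i. ell2_inner (\<eta> i) (T (\<xi> i)))" if T: "T \<in> M" for T using H T by blast
  define \<zeta> where "\<zeta> a = (if even a then \<xi> (a div 2) else \<eta> (a div 2))" for a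
  have \<zeta>2: "\<zeta> a \<in> ell2" for a using e2 by (simp add: \<zeta>_def)
  have split: "(\<Sum>a<2 * K. p (\<zeta> a)) = (\<Sum>a<K. p (\<xi> a)) + (\<Sum>a<K. p (\<eta> a))" for p :: "_ \<Rightarrow> real" and K
    by (induction K) (simp_all add: \<zeta>_def)
  have \<zeta>sum: "(\<Sum>a<K. (ell2_norm (\<zeta> a))\<^sup>2) \<le> (\<Sum>i. (ell2_norm (\<xi> i))\<^sup>2) + (\<Sum>i. (ell2_norm (\<eta> i))\<^sup>2)" for K
  proof -
    have "(\<Sum>a<K. (ell2_norm (\<zeta> a))\<^sup>2) \<le> (\<Sum>a<2 * K. (ell2_norm (\<zeta> a))\<^sup>2)" by (rule sum_mono2) auto
    also have "\<dots> \<le> (\<Sum>i. (ell2_norm (\<xi> i))\<^sup>2) + (\<Sum>i. (ell2_norm (\<eta> i))\<^sup>2)"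
      unfolding split[of "\<lambda>z. (ell2_norm z)\<^sup>2"] by (intro add_mono sum_le_suminf sm) auto
    finally show ?thesis .
  qed
  have "\<exists>b\<in>D. \<forall>K. (\<Sum>a<K. (ell2_norm (\<lambda>i. x (\<zeta> a) i - b (\<zeta> a) i))\<^sup>2) \<le> \<epsilon>"
    by (rule bicommutant_density[OF subset_trans[OF D(1) Mb] _ _ _ _ _ x(1) \<zeta>2 \<zeta>sum \<epsilon>]) (fact D)+
  then obtain b where b: "b \<in> D" and bb: "\<And>K. (\<Sum>a<K. (ell2_norm (\<lambda>i. x (\<zeta> a) i - b (\<zeta> a) i))\<^sup>2) \<le> \<epsilon>"
    by blast
  define d where "d = x \<ominus>\<^bsub>B_ell2\<^esub> b"
  have bM: "b \<in> M" using b D(1) by blast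
  have xc: "x \<in> carrier B_ell2" "b \<in> carrier B_ell2" using x(2) bM Mb by (auto simp: B_ell2_ops(1))
  have dM: "d \<in> M" unfolding d_def by (rule Md[OF x(2) bM])
  have db: "d \<in> bounded_ops" using dM Mb by blast
  have da: "d z = (\<lambda>i. x z i - b z i)" if "z \<in> ell2" for z
    unfolding d_def B.diff_conv_smult[OF xc] using that by (simp add: B_ell2_ops)
  define p where "p z = (ell2_norm (d z))\<^sup>2" for z
  have "(\<Sum>a<K. p (\<zeta> a)) \<le> \<epsilon>" for K using bb[of K] by (simp add: p_def da[OF \<zeta>2])
  from this[of "2 * K" for K] have pK: "(\<Sum>a<K. p (\<xi> a) + p (\<eta> a)) \<le> \<epsilon>" for K
    unfolding split by (simp add: sum.distrib)
  define w where "w i = ell2_inner (\<eta> i) ((adj B_ell2 d \<otimes>\<^bsub>B_ell2\<^esub> d) (\<xi> i))" for i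
  have wle: "cmod (w i) \<le> p (\<xi> i) + p (\<eta> i)" for i
  proof -
    have c: "d (\<xi> i) \<in> ell2" "d (\<eta> i) \<in> ell2" using bo_closed[OF db] e2 by auto
    have "w i = ell2_inner (\<eta> i) (adj_op d (d (\<xi> i)))"
      using e2 by (simp add: w_def adj_B_ell2[OF db] B_ell2_ops)
    also have "\<dots> = cnj (ell2_inner (adj_op d (d (\<xi> i))) (\<eta> i))"
      by (rule ell2_inner_commute) (use e2 bo_closed[OF adj_op_closed[OF db] c(1)] in auto)
    also have "\<dots> = cnj (ell2_inner (d (\<xi> i)) (d (\<eta> i)))" using adj_op_inner[OF db c(1) e2(2)] by simp
    finally have "cmod (w i) = cmod (ell2_inner (d (\<xi> i)) (d (\<eta> i)))" by simp
    also have "\<dots> \<le> ell2_norm (d (\<xi> i)) * ell2_norm (d (\<eta> i))" by (rule ell2_cauchy_schwarz[OF c])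
    also have "\<dots> \<le> p (\<xi> i) + p (\<eta> i)"
    proof -
      have "0 \<le> (ell2_norm (d (\<xi> i)) - ell2_norm (d (\<eta> i)))\<^sup>2 + (ell2_norm (d (\<xi> i)))\<^sup>2 + (ell2_norm (d (\<eta> i)))\<^sup>2" by simp
      then show ?thesis unfolding p_def by (simp add: power2_eq_square algebra_simps)
    qed
    finally show ?thesis .
  qed
  have wK: "(\<Sum>i<K. cmod (w i)) \<le> \<epsilon>" for K by (rule order_trans[OF sum_mono[OF wle] pK])
  have ws: "summable (\<lambda>i. cmod (w i))" by (rule summableI_nonneg_bounded[OF _ wK]) simp
  have "cmod (suminf w) \<le> (\<Sum>i. cmod (w i))" by (rule summable_norm[OF ws])
  also have "\<dots> \<le> \<epsilon>" by (rule suminf_le_const[OF ws wK])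
  finally have "cmod (\<tau> (adj B_ell2 d \<otimes>\<^bsub>B_ell2\<^esub> d)) \<le> \<epsilon>"
    unfolding tau[OF Mm[OF Madj[OF dM] dM]] w_def .
  then show ?thesis using b unfolding d_def by blast
qed

lemma submodule_vn_alg:
  assumes M: "von_neumann_algebra M" and W: "Module.submodule W complex_field (vn_alg M)"
  shows "Module.submodule W complex_field B_ell2"
proof -
  interpret V: cstar_algebra "vn_alg M" by (rule cstar_algebra_vn_alg[OF M])
  interpret B: cstar_algebra B_ell2 by (rule cstar_algebra_B_ell2)
  have Mb: "M \<subseteq> carrier B_ell2" using M by (simp add: von_neumann_algebra_def B_ell2_ops(1))
  note V = V.vs.submoduleE[OF W]
  have Wb: "W \<subseteq> carrier B_ell2" using V(1) Mb by auto
  show ?thesis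
  proof (rule B.vs.submoduleI[OF Wb])
    have z: "\<zero>\<^bsub>vn_alg M\<^esub> \<in> W" using subgroup.one_closed[OF Module.submodule.axioms(1)[OF W]] by simp
    then show "\<zero>\<^bsub>B_ell2\<^esub> \<in> W" by simp
    show "\<ominus>\<^bsub>B_ell2\<^esub> a \<in> W" if a: "a \<in> W" for a
      using V(4)[OF _ a, of "-1"] B.minus_conv_smult[of a] a Wb by auto
    show "a \<oplus>\<^bsub>B_ell2\<^esub> b \<in> W" if "a \<in> W" "b \<in> W" for a b using V(5)[OF that] by simp
    show "c \<odot>\<^bsub>B_ell2\<^esub> a \<in> W" if "c \<in> carrier complex_field" "a \<in> W" for c a using V(4)[OF that] by simp
  qed
qed

lemma star_subalgebra_vn_alg:
  assumes M: "von_neumann_algebra M" and N: "star_subalgebra B_ell2 N" "finite_dim B_ell2 N" "N \<subseteq> M"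
  shows "star_subalgebra (vn_alg M) N" "finite_dim (vn_alg M) N"
proof -
  interpret V: cstar_algebra "vn_alg M" by (rule cstar_algebra_vn_alg[OF M])
  interpret B: cstar_algebra B_ell2 by (rule cstar_algebra_B_ell2)
  have sr: "subring N B_ell2" and sm: "Module.submodule N complex_field B_ell2" and ad: "\<And>x. x \<in> N \<Longrightarrow> adj B_ell2 x \<in> N"
    using N(1) unfolding star_subalgebra_def by auto
  note s = B.vs.submoduleE[OF sm] and r = subringE[OF sr]
  have neg: "\<ominus>\<^bsub>vn_alg M\<^esub> a \<in> N" if a: "a \<in> N" for a
    using s(4)[OF _ a, of "-1"] V.minus_conv_smult[of a] a N(3) by auto
  have "subring N (vn_alg M)"
    by (rule V.subringI) (use N(3) r neg in auto)
  moreover have "Module.submodule N complex_field (vn_alg M)"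
    by (rule V.vs.submoduleI) (use N(3) r s neg in auto)
  ultimately show "star_subalgebra (vn_alg M) N" using ad by (simp add: star_subalgebra_def)
  obtain G where "finite G" "G \<subseteq> N" "N \<subseteq> lin_span B_ell2 G" using N(2) unfolding finite_dim_def by blast
  moreover have "lin_span B_ell2 G \<subseteq> lin_span (vn_alg M) G"
    unfolding lin_span_def using submodule_vn_alg[OF M] by blast
  ultimately show "finite_dim (vn_alg M) N" unfolding finite_dim_def by blast
qed

lemma double_commutant_mono: "X \<subseteq> bounded_ops \<Longrightarrow> X \<subseteq> commutant (commutant X)"
  unfolding commutant_def by auto

text \<open>
  Each \<open>x i\<close> is approximated in trace norm from some member of the increasing sequence of
  finite-dimensional algebras; the largest of these members serves for all \<open>i < n\<close>.
\<close>

lemma hyperfinite_approximation: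
  fixes n :: nat
  assumes R: "hyperfinite_II1_factor M \<tau>" and x: "\<And>i. i < n \<Longrightarrow> x i \<in> M" and \<epsilon>: "\<epsilon> > 0"
  shows "\<exists>k e N. fd_subalgebra (vn_alg M) \<tau> k e N \<and>
    (\<forall>i<n. Re (\<tau> (adj (vn_alg M) (x i) \<otimes>\<^bsub>vn_alg M\<^esub> x i)) - \<epsilon> \<le> (\<Sum>j<k. (cmod (\<tau> (adj (vn_alg M) (e j) \<otimes>\<^bsub>vn_alg M\<^esub> x i)))\<^sup>2))"
proof -
  have vn: "von_neumann_algebra M" and tr: "faithful_normal_trace M \<tau>"
    using R unfolding hyperfinite_II1_factor_def is_factor_def by auto
  obtain N :: "nat \<Rightarrow> ell2_op set" where inc: "incseq N" and N: "\<And>i. star_subalgebra B_ell2 (N i)" "\<And>i. finite_dim B_ell2 (N i)"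
    and MN: "M = commutant (commutant (\<Union>i. N i))"
    using R unfolding hyperfinite_II1_factor_def by metis
  interpret V: tracial_cstar_algebra "vn_alg M" \<tau> by (rule tracial_vn_alg[OF vn tr])
  interpret B: cstar_algebra B_ell2 by (rule cstar_algebra_B_ell2)
  have normal: "normal_functional M \<tau>" and faithful: "\<And>T. T \<in> M \<Longrightarrow> \<tau> (adj B_ell2 T \<otimes>\<^bsub>B_ell2\<^esub> T) = 0 \<Longrightarrow> T = \<zero>\<^bsub>B_ell2\<^esub>"
    using tr unfolding faithful_normal_trace_def by auto
  have Mb: "M \<subseteq> bounded_ops" and Madj: "\<And>T. T \<in> M \<Longrightarrow> adj B_ell2 T \<in> M" using vn unfolding von_neumann_algebra_def by auto
  have Mc: "T \<in> carrier B_ell2" if "T \<in> M" for T using that Mb by (auto simp: B_ell2_ops(1))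
  have dif: "S \<ominus>\<^bsub>vn_alg M\<^esub> T = S \<ominus>\<^bsub>B_ell2\<^esub> T" if "S \<in> M" "T \<in> M" for S T
    using V.diff_conv_smult[of S T] B.diff_conv_smult[OF Mc Mc, of S T] that by simp
  have Md: "S \<ominus>\<^bsub>B_ell2\<^esub> T \<in> M" if "S \<in> M" "T \<in> M" for S T
    using V.minus_closed[of S T] that dif[OF that] by simp
  have Mm: "S \<otimes>\<^bsub>B_ell2\<^esub> T \<in> M" if "S \<in> M" "T \<in> M" for S T using V.m_closed[of S T] that by simp
  let ?D = "\<Union>i. N i"
  have r: "subring (N i) B_ell2" "Module.submodule (N i) complex_field B_ell2" "\<And>T. T \<in> N i \<Longrightarrow> adj B_ell2 T \<in> N i" for i
    using N(1)[of i] unfolding star_subalgebra_def by auto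
  have ND: "N i \<subseteq> carrier B_ell2" for i by (rule subringE(1)[OF r(1)])
  then have Db: "?D \<subseteq> bounded_ops" by (auto simp: B_ell2_ops(1))
  have DM: "?D \<subseteq> M" unfolding MN by (rule double_commutant_mono[OF Db])
  have up: "\<exists>j. S \<in> N j \<and> T \<in> N j" if ST: "S \<in> ?D" "T \<in> ?D" for S T
  proof -
    obtain i j where "S \<in> N i" "T \<in> N j" using ST by blast
    then show ?thesis using incseqD[OF inc, of i "max i j"] incseqD[OF inc, of j "max i j"]
      by (intro exI[of _ "max i j"]) auto
  qed
  have "\<exists>b\<in>?D. cmod (\<tau> (adj B_ell2 (T \<ominus>\<^bsub>B_ell2\<^esub> b) \<otimes>\<^bsub>B_ell2\<^esub> (T \<ominus>\<^bsub>B_ell2\<^esub> b))) \<le> \<epsilon>" if T: "T \<in> M" for T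
  proof (rule trace_dense[OF normal Mb Madj Mm Md DM])
    show "\<one>\<^bsub>B_ell2\<^esub> \<in> ?D" using subringE(3)[OF r(1)] by blast
    show "S \<oplus>\<^bsub>B_ell2\<^esub> S' \<in> ?D" if "S \<in> ?D" "S' \<in> ?D" for S S' using up[OF that] subringE(7)[OF r(1)] by blast
    show "S \<otimes>\<^bsub>B_ell2\<^esub> S' \<in> ?D" if "S \<in> ?D" "S' \<in> ?D" for S S' using up[OF that] subringE(6)[OF r(1)] by blast
    show "c \<odot>\<^bsub>B_ell2\<^esub> S \<in> ?D" if "S \<in> ?D" for c S using that B.vs.submoduleE(4)[OF r(2), of c] by auto
    show "adj B_ell2 S \<in> ?D" if "S \<in> ?D" for S using that r(3) by blast
    show "T \<in> commutant (commutant ?D)" using T MN by simp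
  qed (use T \<epsilon> in auto)
  then have "\<forall>i. \<exists>j b. i < n \<longrightarrow> b \<in> N j \<and> cmod (\<tau> (adj B_ell2 (x i \<ominus>\<^bsub>B_ell2\<^esub> b) \<otimes>\<^bsub>B_ell2\<^esub> (x i \<ominus>\<^bsub>B_ell2\<^esub> b))) \<le> \<epsilon>"
    using x by blast
  then obtain j b where jb: "\<And>i. i < n \<Longrightarrow> b i \<in> N (j i)"
      "\<And>i. i < n \<Longrightarrow> cmod (\<tau> (adj B_ell2 (x i \<ominus>\<^bsub>B_ell2\<^esub> b i) \<otimes>\<^bsub>B_ell2\<^esub> (x i \<ominus>\<^bsub>B_ell2\<^esub> b i))) \<le> \<epsilon>"
    by metis
  \<comment> \<open>The element \<open>0\<close> keeps the set non-empty for \<open>n = 0\<close>.\<close>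
  define m where "m = Max (insert 0 (j ` {..<n}))"
  have jm: "j i \<le> m" if "i < n" for i unfolding m_def by (rule Max_ge) (use that in simp_all)
  have bm: "b i \<in> N m" if "i < n" for i using incseqD[OF inc jm[OF that]] jb(1)[OF that] by blast
  have NM: "N m \<subseteq> M" using DM by blast
  obtain k e where "fd_subalgebra (vn_alg M) \<tau> k e (N m)"
    using V.fd_subalgebra_exists[OF star_subalgebra_vn_alg[OF vn N(1,2) NM]] faithful NM by auto
  then interpret F: fd_subalgebra "vn_alg M" \<tau> k e "N m" .
  have "Re (\<tau> (adj (vn_alg M) (x i) \<otimes>\<^bsub>vn_alg M\<^esub> x i)) - \<epsilon> \<le> (\<Sum>j<k. (cmod (\<tau> (adj (vn_alg M) (e j) \<otimes>\<^bsub>vn_alg M\<^esub> x i)))\<^sup>2)" if i: "i < n" for i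
  proof -
    have bM: "b i \<in> M" using bm[OF i] NM by blast
    have "Re (\<tau> (adj B_ell2 (x i \<ominus>\<^bsub>B_ell2\<^esub> b i) \<otimes>\<^bsub>B_ell2\<^esub> (x i \<ominus>\<^bsub>B_ell2\<^esub> b i))) \<le> \<epsilon>"
      using order_trans[OF complex_Re_le_cmod jb(2)[OF i]] .
    then show ?thesis using F.best_approximation[OF _ bm[OF i], of "x i"] x[OF i] by (simp add: dif[OF x[OF i] bM])
  qed
  then show ?thesis using F.fd_subalgebra_axioms by blast
qed

section \<open>Failure of embeddability\<close>

lemma embeds_star_hom: "embeds A B \<Longrightarrow> \<exists>f. star_hom A B f"
  unfolding embeds_def star_hom_def by blast

text \<open>
  A bounded operator is determined by its matrix entries, so a sequence of operators is a countable
  family of complex numbers.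
\<close>

lemma vn_sequence_encoding:
  "inj_on (\<lambda>x n. case prod_decode n of (m, q) \<Rightarrow> case prod_decode q of (j, i) \<Rightarrow> x m (basis_vec j) i) {x. \<forall>m. x m \<in> bounded_ops}"
proof (rule inj_onI)
  fix x y :: "nat \<Rightarrow> ell2_op"
  assume xy: "x \<in> {x. \<forall>m. x m \<in> bounded_ops}" "y \<in> {x. \<forall>m. x m \<in> bounded_ops}"
    and eq: "(\<lambda>n. case prod_decode n of (m, q) \<Rightarrow> case prod_decode q of (j, i) \<Rightarrow> x m (basis_vec j) i) =
      (\<lambda>n. case prod_decode n of (m, q) \<Rightarrow> case prod_decode q of (j, i) \<Rightarrow> y m (basis_vec j) i)"
  have "x m (basis_vec j) i = y m (basis_vec j) i" for m j i
    using fun_cong[OF eq, of "prod_encode (m, prod_encode (j, i))"] by simp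
  then have "x m (basis_vec j) = y m (basis_vec j)" for m j by blast
  then have "x m = y m" for m using xy by (intro bo_eq_basisI) auto
  then show "x = y" by blast
qed

lemma matrix_sequence_encoding:
  "inj_on (\<lambda>x n. case prod_decode n of (m, q) \<Rightarrow> x m $$ prod_decode q) {x :: nat \<Rightarrow> complex mat. \<forall>m. x m \<in> carrier_mat (d m) (d m)}"
proof (rule inj_onI)
  fix x y :: "nat \<Rightarrow> complex mat"
  assume xy: "x \<in> {x. \<forall>m. x m \<in> carrier_mat (d m) (d m)}" "y \<in> {x. \<forall>m. x m \<in> carrier_mat (d m) (d m)}"
    and eq: "(\<lambda>n. case prod_decode n of (m, q) \<Rightarrow> x m $$ prod_decode q) = (\<lambda>n. case prod_decode n of (m, q) \<Rightarrow> y m $$ prod_decode q)"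
  have e: "x m $$ (i, j) = y m $$ (i, j)" for m j i
    using fun_cong[OF eq, of "prod_encode (m, prod_encode (i, j))"] by simp
  have "x m = y m" for m
  proof (rule eq_matI)
    have c: "x m \<in> carrier_mat (d m) (d m)" "y m \<in> carrier_mat (d m) (d m)" using xy by auto
    show "dim_row (x m) = dim_row (y m)" "dim_col (x m) = dim_col (y m)" using c by auto
  qed (rule e)
  then show "x = y" by (rule ext)
qed

theorem theorem3p1:
  fixes A :: "'a cstar" and u :: "nat \<Rightarrow> 'a" and n :: nat
  assumes "unital_cstar_algebra A"
    and "\<forall>i<n. u i \<in> unitaries A"
    and "w_cb A n u < ereal (real n)"
    and "lifting_property TYPE(nat \<Rightarrow> complex) A
           (lin_span A ({\<one>\<^bsub>A\<^esub>} \<union> u ` {..<n} \<union> (\<lambda>i. adj A (u i)) ` {..<n}))"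
  shows "(\<forall>R \<tau> \<omega>. hyperfinite_II1_factor R \<tau> \<and> free_ultrafilter \<omega> \<longrightarrow>
            \<not> embeds A (tracial_ultrapower R \<tau> \<omega>)) \<and>
         \<not> embeds A matrix_corona"
proof (intro conjI allI impI)
  have A: "cstar_algebra A" using assms(1) by (simp add: unital_cstar_algebra_iff)
  note master = no_unital_star_hom_into_tracial_quotient[OF A assms(2-4)]
  {
    fix R \<tau> \<omega> assume H: "hyperfinite_II1_factor R \<tau> \<and> free_ultrafilter \<omega>"
    then have R: "hyperfinite_II1_factor R \<tau>" and om: "\<omega> \<noteq> bot" by (auto simp: free_ultrafilter_def)
    have vn: "von_neumann_algebra R" and tr: "faithful_normal_trace R \<tau>"
      using R unfolding hyperfinite_II1_factor_def is_factor_def by auto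
    interpret V: tracial_cstar_algebra "vn_alg R" \<tau> by (rule tracial_vn_alg[OF vn tr])
    let ?P = "linf_prod (\<lambda>_. vn_alg R)"
    have "((\<lambda>m. \<tau> (adj B_ell2 (x m) \<otimes>\<^bsub>B_ell2\<^esub> x m)) \<longlongrightarrow> 0) \<omega> \<longleftrightarrow> ((\<lambda>m. V.tr_norm_sq (x m)) \<longlongrightarrow> 0) \<omega>"
      if "x \<in> carrier ?P" for x
    proof -
      have "\<tau> (adj B_ell2 (x m) \<otimes>\<^bsub>B_ell2\<^esub> x m) = complex_of_real (V.tr_norm_sq (x m))" for m
        using V.tr_norm_sq_tr[of "x m"] that by (simp add: linf_prod_carrier)
      then show ?thesis using tendsto_of_real_iff[of "\<lambda>m. V.tr_norm_sq (x m)" 0 \<omega>, where 'a = complex] by simp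
    qed
    then have J: "trace_ideal R \<tau> \<omega> = {x \<in> carrier ?P. ((\<lambda>m. V.tr_norm_sq (x m)) \<longlongrightarrow> 0) \<omega>}"
      unfolding trace_ideal_def by blast
    have Rb: "R \<subseteq> bounded_ops" using vn by (simp add: von_neumann_algebra_def)
    have "\<not> (\<exists>f. star_hom A (cstar_quot ?P (trace_ideal R \<tau> \<omega>)) f)"
    proof (rule master[where \<tau> = "\<lambda>_. \<tau>" and F = \<omega> and g = "\<lambda>x n. case prod_decode n of (m, q) \<Rightarrow> case prod_decode q of (j, i) \<Rightarrow> x m (basis_vec j) i"])
      show "closed_ideal (trace_ideal R \<tau> \<omega>) ?P" unfolding J
        by (rule closed_ideal_null_sequences(1)) (fact V.cstar_algebra_axioms V.tr_norm_sq_nonneg V.tr_norm_sq_add V.tr_norm_sq_mult_left V.tr_norm_sq_mult_right V.tr_norm_sq_adj V.tr_norm_sq_bound)+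
      show "adj ?P x \<in> trace_ideal R \<tau> \<omega>" if "x \<in> trace_ideal R \<tau> \<omega>" for x using that unfolding J
        by (rule closed_ideal_null_sequences(2)[rotated -1]) (fact V.cstar_algebra_axioms V.tr_norm_sq_nonneg V.tr_norm_sq_add V.tr_norm_sq_mult_left V.tr_norm_sq_mult_right V.tr_norm_sq_adj V.tr_norm_sq_bound)+
      show "((\<lambda>m. Re (\<tau> (adj (vn_alg R) (x m) \<otimes>\<^bsub>vn_alg R\<^esub> x m))) \<longlongrightarrow> 0) \<omega>" if "x \<in> trace_ideal R \<tau> \<omega>" for x
        using that unfolding J V.tr_norm_sq_def by blast
      show "inj_on (\<lambda>x n. case prod_decode n of (m, q) \<Rightarrow> case prod_decode q of (j, i) \<Rightarrow> x m (basis_vec j) i) (carrier ?P)"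
        by (rule inj_on_subset[OF vn_sequence_encoding]) (use Rb in \<open>auto simp: linf_prod_carrier\<close>)
      show "\<exists>k e N. fd_subalgebra (vn_alg R) \<tau> k e N \<and>
        (\<forall>i<n. Re (\<tau> (adj (vn_alg R) (x i) \<otimes>\<^bsub>vn_alg R\<^esub> x i)) - \<epsilon> \<le> (\<Sum>j<k. (cmod (\<tau> (adj (vn_alg R) (e j) \<otimes>\<^bsub>vn_alg R\<^esub> x i)))\<^sup>2))"
        if H: "\<And>i. i < n \<Longrightarrow> x i \<in> carrier (vn_alg R)" "\<epsilon> > 0" for x \<epsilon>
        by (rule hyperfinite_approximation[OF R _ H(2)]) (use H(1) in simp)
    qed (fact V.cstar_algebra_axioms V.tracial_star_algebra_axioms om)+
    then show "\<not> embeds A (tracial_ultrapower R \<tau> \<omega>)"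
      unfolding tracial_ultrapower_def using embeds_star_hom by blast
  }
  let ?B = "\<lambda>m. complex_mat_alg (Suc m)"
  let ?P = "linf_prod ?B"
  interpret T: tracial_cstar_algebra "?B m" "ntrace (Suc m)" for m
    by (intro tracial_cstar_algebra.intro cstar_algebra_complex_mat tracial_complex_mat) simp
  have J: "c0_ideal ?B = {x \<in> carrier ?P. ((\<lambda>m. (cnorm (?B m) (x m))\<^sup>2) \<longlonglongrightarrow> 0)}"
    unfolding c0_ideal_def by (simp only: power_tendsto_0_iff zero_less_numeral)
  have sq: "(cnorm (?B m) (a \<otimes>\<^bsub>?B m\<^esub> x))\<^sup>2 \<le> 2 * t * (cnorm (?B m) x)\<^sup>2"
    "(cnorm (?B m) (x \<otimes>\<^bsub>?B m\<^esub> a))\<^sup>2 \<le> 2 * t * (cnorm (?B m) x)\<^sup>2"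
    if H: "a \<in> carrier (?B m)" "x \<in> carrier (?B m)" "t > 0" "(cnorm (?B m) a)\<^sup>2 \<le> t" for m a x t
  proof -
    have "(cnorm (?B m) a)\<^sup>2 * (cnorm (?B m) x)\<^sup>2 \<le> (2 * t) * (cnorm (?B m) x)\<^sup>2"
      by (intro mult_right_mono) (use H(3,4) in auto)
    then have le: "(cnorm (?B m) a * cnorm (?B m) x)\<^sup>2 \<le> 2 * t * (cnorm (?B m) x)\<^sup>2" by (simp add: power_mult_distrib)
    show "(cnorm (?B m) (a \<otimes>\<^bsub>?B m\<^esub> x))\<^sup>2 \<le> 2 * t * (cnorm (?B m) x)\<^sup>2"
      by (rule order_trans[OF power_mono[OF T.cnorm_mult[OF H(1,2)] T.cnorm_nonneg[OF T.m_closed[OF H(1,2)]]] le])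
    show "(cnorm (?B m) (x \<otimes>\<^bsub>?B m\<^esub> a))\<^sup>2 \<le> 2 * t * (cnorm (?B m) x)\<^sup>2"
      using order_trans[OF power_mono[OF T.cnorm_mult[OF H(2,1)] T.cnorm_nonneg[OF T.m_closed[OF H(2,1)]], of 2]] le
      by (simp only: mult.commute)
  qed
  have ad: "(cnorm (?B m) (x \<oplus>\<^bsub>?B m\<^esub> y))\<^sup>2 \<le> 2 * (cnorm (?B m) x)\<^sup>2 + 2 * (cnorm (?B m) y)\<^sup>2"
    if H: "x \<in> carrier (?B m)" "y \<in> carrier (?B m)" for m x y
  proof -
    have "(cnorm (?B m) (x \<oplus>\<^bsub>?B m\<^esub> y))\<^sup>2 \<le> (cnorm (?B m) x + cnorm (?B m) y)\<^sup>2"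
      by (rule power_mono[OF T.cnorm_triangle[OF H] T.cnorm_nonneg[OF T.a_closed[OF H]]])
    also have "\<dots> \<le> 2 * (cnorm (?B m) x)\<^sup>2 + 2 * (cnorm (?B m) y)\<^sup>2"
      using zero_le_power2[of "cnorm (?B m) x - cnorm (?B m) y"] by (simp add: power2_eq_square algebra_simps)
    finally show ?thesis .
  qed
  have aj: "(cnorm (?B m) (adj (?B m) x))\<^sup>2 = (cnorm (?B m) x)\<^sup>2" if "x \<in> carrier (?B m)" for m x
    using T.cnorm_adj[OF that] by simp
  have bd: "(cnorm (?B m) a)\<^sup>2 \<le> 2 * t" if "a \<in> carrier (?B m)" "t > 0" "(cnorm (?B m) a)\<^sup>2 \<le> t" for m a t
    using that(2,3) by linarith
  have nn: "0 \<le> (cnorm (?B m) a)\<^sup>2" if "a \<in> carrier (?B m)" for m a by simp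
  have "\<not> (\<exists>f. star_hom A (cstar_quot ?P (c0_ideal ?B)) f)"
  proof (rule master[where \<tau> = "\<lambda>m. ntrace (Suc m)" and F = sequentially and g = "\<lambda>x n. case prod_decode n of (m, q) \<Rightarrow> x m $$ prod_decode q"])
    show "closed_ideal (c0_ideal ?B) ?P" unfolding J
      by (rule closed_ideal_null_sequences(1)) (fact cstar_algebra_complex_mat nn ad sq aj bd)+
    show "adj ?P x \<in> c0_ideal ?B" if "x \<in> c0_ideal ?B" for x using that unfolding J
      by (rule closed_ideal_null_sequences(2)[rotated -1]) (fact cstar_algebra_complex_mat nn ad sq aj bd)+
    show "(\<lambda>m. Re (ntrace (Suc m) (adj (?B m) (x m) \<otimes>\<^bsub>?B m\<^esub> x m))) \<longlonglongrightarrow> 0" if x: "x \<in> c0_ideal ?B" for x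
    proof -
      have xc: "x m \<in> carrier (?B m)" for m using x unfolding c0_ideal_def linf_prod_carrier by blast
      have lim: "(\<lambda>m. (cnorm (?B m) (x m))\<^sup>2) \<longlonglongrightarrow> 0" using x unfolding J by blast
      have "T.tr_norm_sq m (x m) \<le> 2 * (cnorm (?B m) (x m))\<^sup>2" for m
      proof (rule field_le_epsilon)
        fix r :: real assume "r > 0"
        then show "T.tr_norm_sq m (x m) \<le> 2 * (cnorm (?B m) (x m))\<^sup>2 + r"
          using T.tr_norm_sq_bound[OF xc[of m], of "(cnorm (?B m) (x m))\<^sup>2 + r / 2"] by (simp add: add_nonneg_pos)
      qed
      then have "norm (T.tr_norm_sq m (x m)) \<le> norm ((cnorm (?B m) (x m))\<^sup>2) * 2" for m
        using T.tr_norm_sq_nonneg[OF xc[of m]] by (simp add: mult.commute)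
      then have "(\<lambda>m. T.tr_norm_sq m (x m)) \<longlonglongrightarrow> 0" by (intro tendsto_0_le[OF lim] always_eventually allI)
      then show ?thesis unfolding T.tr_norm_sq_def .
    qed
    show "inj_on (\<lambda>x n. case prod_decode n of (m, q) \<Rightarrow> x m $$ prod_decode q) (carrier ?P)"
      by (rule inj_on_subset[OF matrix_sequence_encoding[of Suc]]) (auto simp: linf_prod_carrier)
    show "\<exists>k e N. fd_subalgebra (?B m) (ntrace (Suc m)) k e N \<and>
      (\<forall>i<n. Re (ntrace (Suc m) (adj (?B m) (x i) \<otimes>\<^bsub>?B m\<^esub> x i)) - \<epsilon> \<le> (\<Sum>j<k. (cmod (ntrace (Suc m) (adj (?B m) (e j) \<otimes>\<^bsub>?B m\<^esub> x i)))\<^sup>2))"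
      if H: "\<And>i. i < n \<Longrightarrow> x i \<in> carrier (?B m)" "\<epsilon> > 0" for m x \<epsilon>
    proof -
      obtain k e where "fd_subalgebra (?B m) (ntrace (Suc m)) k e (carrier_mat (Suc m) (Suc m))"
        using fd_subalgebra_complex_mat[of "Suc m"] by auto
      then interpret fd: fd_subalgebra "?B m" "ntrace (Suc m)" k e "carrier_mat (Suc m) (Suc m)" .
      have "Re (ntrace (Suc m) (adj (?B m) (x i) \<otimes>\<^bsub>?B m\<^esub> x i)) - \<epsilon> \<le> (\<Sum>j<k. (cmod (ntrace (Suc m) (adj (?B m) (e j) \<otimes>\<^bsub>?B m\<^esub> x i)))\<^sup>2)" if i: "i < n" for i
      proof -
        have xi: "x i \<in> carrier_mat (Suc m) (Suc m)" using H(1)[OF i] by simp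
        have z: "x i \<ominus>\<^bsub>?B m\<^esub> x i = \<zero>\<^bsub>?B m\<^esub>" by (rule T.diff_self[OF H(1)[OF i]])
        have "ntrace (Suc m) (adj (?B m) (x i \<ominus>\<^bsub>?B m\<^esub> x i) \<otimes>\<^bsub>?B m\<^esub> (x i \<ominus>\<^bsub>?B m\<^esub> x i)) = 0"
          unfolding z T.adj_zero T.l_null[OF T.zero_closed] by (rule T.tr_zero)
        then show ?thesis using fd.best_approximation[OF H(1)[OF i] xi] H(2) by (simp del: complex_mat_alg_ops)
      qed
      then show ?thesis using fd.fd_subalgebra_axioms by (intro exI[of _ k] exI[of _ e] exI[of _ "carrier_mat (Suc m) (Suc m)"]) (intro conjI allI impI)
    qed
  qed (fact cstar_algebra_complex_mat T.tracial_star_algebra_axioms trivial_limit_sequentially)+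
  then show "\<not> embeds A matrix_corona" unfolding matrix_corona_def using embeds_star_hom by blast
qed

end
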